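(* Let $R$ be a commutative Noetherian ring, let $C$ be a semidualizing $R$-module, and let $M\in\mathcal A_C(R)$. Then $$\mathrm{qpd}_R M<\infty\iff C\text{-}\mathrm{qpd}_R(C\otimes_R M)<\infty.$$ Moreover: (1) $\mathrm{qpd}_R M=C\text{-}\mathrm{qpd}_R(C\otimes_R M)$. (2) $P_\bullet$ is a quasi-projective resolution of $M$ if and only if it is a $C$-quasi-projective resolution of $C\otimes_R M$.
   Context: A finitely generated $R$-module $C$ is semidualizing if the homothety map $R\to\operatorname{Hom}_R(C,C)$ is an isomorphism and $\operatorname{Ext}^i_R(C,C)=0$ for all $i>0$. The Auslander class $\mathcal A_C(R)$ consists of the $R$-modules $M$ such that the natural map $M\to\operatorname{Hom}_R(C,C\otimes_R M)$ is an isomorphism and $\operatorname{Tor}^R_i(C,M)=0=\operatorname{Ext}^i_R(C,C\otimes_R M)$ for all $i>0$. For a complex $X_\bullet$ of $R$-modules (homological indexing), $\sup X_\bullet=\sup\{i: X_i\neq0\}$, $\inf X_\bullet=\inf\{i: X_i\neq0\}$ and $\operatorname{hsup}X_\bullet=\sup\{i:\mathrm H_i(X_\bullet)\neq0\}$. A quasi-projective resolution of an $R$-module $L$ is a bounded below complex $P_\bullet$ of projective $R$-modules such that for all $i\ge\inf P_\bullet$ there are non-negative integers $a_i$, not all zero, with $\mathrm H_i(P_\bullet)\cong L^{\oplus a_i}$. The quasi-projective dimension $\mathrm{qpd}_R L$ is the infimum of $\sup P_\bullet-\operatorname{hsup}P_\bullet$ over all bounded quasi-projective resolutions $P_\bullet$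 of $L$ ($\infty$ if there are none), and it is $-\infty$ if $L=0$. A $C$-quasi-projective resolution of an $R$-module $L$ is a bounded complex $P_\bullet$ of projective $R$-modules such that $P_\bullet\otimes_R C$ is not acyclic and each $\mathrm H_i(P_\bullet\otimes_R C)$ is zero or a finite direct sum of copies of $L$. The $C$-quasi-projective dimension $C\text{-}\mathrm{qpd}_R L$ is the infimum of $\sup(P_\bullet\otimes_R C)-\operatorname{hsup}(P_\bullet\otimes_R C)$ over all $C$-quasi-projective resolutions $P_\bullet$ of $L$ ($\infty$ if there are none), and it is $-\infty$ if $L=0$.
   Formalization: Part (2) is stated for nonzero M and for bounded quasi-projective resolutions: an unbounded one can never be a C-quasi-projective resolution, and for M = 0 the acyclic complex R = R is a quasi-projective resolution of M but not a C-quasi-projective resolution of C⊗M. *)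

theory Defs
  imports
    "HOL-Algebra.Module"
    "HOL-Algebra.AbelCoset"
    "HOL-Algebra.Ring_Divisibility"
    "HOL-Library.Extended_Real"
begin

text \<open>
  Modules are the records of \<^theory>\<open>HOL-Algebra.Module\<close>. They extend rings, so the record fields
  for multiplication and unit of a module carry no information and are left undefined below.
\<close>

section \<open>Modules\<close>

definition mod_hom ::
  "('a, 'r) ring_scheme \<Rightarrow> ('a, 'b, 'x) module_scheme \<Rightarrow> ('a, 'c, 'y) module_scheme \<Rightarrow> ('b \<Rightarrow> 'c) set"
where
  "mod_hom R A B =
    {f \<in> carrier A \<rightarrow> carrier B.
      (\<forall>x\<in>carrier A. \<forall>y\<in>carrier A. f (x \<oplus>\<^bsub>A\<^esub> y) = f x \<oplus>\<^bsub>B\<^esub> f y) \<and>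
      (\<forall>r\<in>carrier R. \<forall>x\<in>carrier A. f (r \<odot>\<^bsub>A\<^esub> x) = r \<odot>\<^bsub>B\<^esub> f x)}"

definition mod_iso ::
  "('a, 'r) ring_scheme \<Rightarrow> ('a, 'b, 'x) module_scheme \<Rightarrow> ('a, 'c, 'y) module_scheme \<Rightarrow> ('b \<Rightarrow> 'c) set"
where
  "mod_iso R A B = {f \<in> mod_hom R A B. bij_betw f (carrier A) (carrier B)}"

definition isomorphic_mod ::
  "('a, 'r) ring_scheme \<Rightarrow> ('a, 'b, 'x) module_scheme \<Rightarrow> ('a, 'c, 'y) module_scheme \<Rightarrow> bool"
where
  "isomorphic_mod R A B \<longleftrightarrow> mod_iso R A B \<noteq> {}"

definition zero_mod :: "('a, 'b, 'x) module_scheme \<Rightarrow> bool" where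
  "zero_mod A \<longleftrightarrow> carrier A = {\<zero>\<^bsub>A\<^esub>}"

definition mod_span :: "('a, 'r) ring_scheme \<Rightarrow> ('a, 'b, 'x) module_scheme \<Rightarrow> 'b set \<Rightarrow> 'b set" where
  "mod_span R A S = \<Inter>{N. submodule N R A \<and> S \<subseteq> N}"

definition fin_gen_mod :: "('a, 'r) ring_scheme \<Rightarrow> ('a, 'b, 'x) module_scheme \<Rightarrow> bool" where
  "fin_gen_mod R A \<longleftrightarrow> (\<exists>S. finite S \<and> S \<subseteq> carrier A \<and> mod_span R A S = carrier A)"

definition regular_mod :: "('a, 'r) ring_scheme \<Rightarrow> ('a, 'a) module" where
  "regular_mod R =
    \<lparr>carrier = carrier R, mult = undefined, one = undefined,
     zero = \<zero>\<^bsub>R\<^esub>, add = (\<oplus>\<^bsub>R\<^esub>), smult = (\<otimes>\<^bsub>R\<^esub>)\<rparr>"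

definition quot_mod :: "('a, 'b, 'x) module_scheme \<Rightarrow> 'b set \<Rightarrow> ('a, 'b set) module" where
  "quot_mod A K =
    \<lparr>carrier = a_rcosets\<^bsub>A\<^esub> K, mult = undefined, one = undefined,
     zero = K, add = (<+>\<^bsub>A\<^esub>),
     smult = (\<lambda>r X. \<Union>x\<in>X. K +>\<^bsub>A\<^esub> (r \<odot>\<^bsub>A\<^esub> x))\<rparr>"

text \<open>The direct sum of \<open>n\<close> copies of \<open>A\<close>.\<close>

definition mod_power :: "('a, 'b, 'x) module_scheme \<Rightarrow> nat \<Rightarrow> ('a, nat \<Rightarrow> 'b) module" where
  "mod_power A n =
    \<lparr>carrier = {..<n} \<rightarrow>\<^sub>E carrier A, mult = undefined, one = undefined,
     zero = (\<lambda>i\<in>{..<n}. \<zero>\<^bsub>A\<^esub>),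
     add = (\<lambda>f g. \<lambda>i\<in>{..<n}. f i \<oplus>\<^bsub>A\<^esub> g i),
     smult = (\<lambda>r f. \<lambda>i\<in>{..<n}. r \<odot>\<^bsub>A\<^esub> f i)\<rparr>"

definition hom_mod ::
  "('a, 'r) ring_scheme \<Rightarrow> ('a, 'b, 'x) module_scheme \<Rightarrow> ('a, 'c, 'y) module_scheme
    \<Rightarrow> ('a, 'b \<Rightarrow> 'c) module"
where
  "hom_mod R A B =
    \<lparr>carrier = mod_hom R A B \<inter> extensional (carrier A), mult = undefined, one = undefined,
     zero = (\<lambda>x\<in>carrier A. \<zero>\<^bsub>B\<^esub>),
     add = (\<lambda>f g. \<lambda>x\<in>carrier A. f x \<oplus>\<^bsub>B\<^esub> g x),
     smult = (\<lambda>r f. \<lambda>x\<in>carrier A. r \<odot>\<^bsub>B\<^esub> f x)\<rparr>"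

text \<open>
  The lifting property. It is tested only against surjections \<open>A \<rightarrow> B\<close> with \<open>A\<close> carried by
  \<^typ>\<open>'p \<Rightarrow> 'a\<close> and \<open>B\<close> by \<^typ>\<open>'p\<close>. This loses nothing: the canonical surjection from the free
  module on the set \<open>P\<close> onto \<open>P\<close> is of this form, so \<open>P\<close> is a direct summand of a free module and
  therefore lifts along surjections of modules over arbitrary types.
\<close>

definition projective_mod :: "('a, 'r) ring_scheme \<Rightarrow> ('a, 'p) module \<Rightarrow> bool" where
  "projective_mod R P \<longleftrightarrow> module R P \<and>
    (\<forall>(A :: ('a, 'p \<Rightarrow> 'a) module) (B :: ('a, 'p) module) g f.
      module R A \<and> module R B \<and> g \<in> mod_hom R A B \<and> g ` carrier A = carrier B \<and>
      f \<in> mod_hom R P B \<longrightarrow>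
      (\<exists>h\<in>mod_hom R P A. \<forall>x\<in>carrier P. g (h x) = f x))"


section \<open>Free modules and tensor products\<close>

text \<open>The free module on \<open>X\<close>: the finitely supported functions with support in \<open>X\<close>.\<close>

definition free_mod :: "('a, 'r) ring_scheme \<Rightarrow> 'b set \<Rightarrow> ('a, 'b \<Rightarrow> 'a) module" where
  "free_mod R X =
    \<lparr>carrier = {f. range f \<subseteq> carrier R \<and> finite {x. f x \<noteq> \<zero>\<^bsub>R\<^esub>} \<and> {x. f x \<noteq> \<zero>\<^bsub>R\<^esub>} \<subseteq> X},
     mult = undefined, one = undefined,
     zero = (\<lambda>_. \<zero>\<^bsub>R\<^esub>),
     add = (\<lambda>f g x. f x \<oplus>\<^bsub>R\<^esub> g x),
     smult = (\<lambda>r f x. r \<otimes>\<^bsub>R\<^esub> f x)\<rparr>"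

definition basis_vec :: "('a, 'r) ring_scheme \<Rightarrow> 'b \<Rightarrow> 'b \<Rightarrow> 'a" where
  "basis_vec R b = (\<lambda>x. if x = b then \<one>\<^bsub>R\<^esub> else \<zero>\<^bsub>R\<^esub>)"

text \<open>The linear extension of a map \<open>g\<close> from a basis to \<open>N\<close>.\<close>

definition lin_ext ::
  "('a, 'r) ring_scheme \<Rightarrow> ('a, 'c, 'y) module_scheme \<Rightarrow> ('b \<Rightarrow> 'c) \<Rightarrow> ('b \<Rightarrow> 'a) \<Rightarrow> 'c"
where
  "lin_ext R N g f = (\<Oplus>\<^bsub>N\<^esub>x\<in>{x. f x \<noteq> \<zero>\<^bsub>R\<^esub>}. f x \<odot>\<^bsub>N\<^esub> g x)"

definition tensor_rel ::
  "('a, 'r) ring_scheme \<Rightarrow> ('a, 'b, 'x) module_scheme \<Rightarrow> ('a, 'c, 'y) module_scheme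
    \<Rightarrow> ('b \<times> 'c \<Rightarrow> 'a) set"
where
  "tensor_rel R A B =
    (let F = free_mod R (carrier A \<times> carrier B); e = (\<lambda>x y. basis_vec R (x, y)) in
      mod_span R F
       ({e (x \<oplus>\<^bsub>A\<^esub> x') y \<ominus>\<^bsub>F\<^esub> (e x y \<oplus>\<^bsub>F\<^esub> e x' y) | x x' y.
           x \<in> carrier A \<and> x' \<in> carrier A \<and> y \<in> carrier B} \<union>
        {e x (y \<oplus>\<^bsub>B\<^esub> y') \<ominus>\<^bsub>F\<^esub> (e x y \<oplus>\<^bsub>F\<^esub> e x y') | x y y'.
           x \<in> carrier A \<and> y \<in> carrier B \<and> y' \<in> carrier B} \<union>
        {e (r \<odot>\<^bsub>A\<^esub> x) y \<ominus>\<^bsub>F\<^esub> r \<odot>\<^bsub>F\<^esub> e x y | r x y.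
           r \<in> carrier R \<and> x \<in> carrier A \<and> y \<in> carrier B} \<union>
        {e x (r \<odot>\<^bsub>B\<^esub> y) \<ominus>\<^bsub>F\<^esub> r \<odot>\<^bsub>F\<^esub> e x y | r x y.
           r \<in> carrier R \<and> x \<in> carrier A \<and> y \<in> carrier B}))"

definition tensor_mod ::
  "('a, 'r) ring_scheme \<Rightarrow> ('a, 'b, 'x) module_scheme \<Rightarrow> ('a, 'c, 'y) module_scheme
    \<Rightarrow> ('a, ('b \<times> 'c \<Rightarrow> 'a) set) module"
where
  "tensor_mod R A B = quot_mod (free_mod R (carrier A \<times> carrier B)) (tensor_rel R A B)"

definition tensor_elt ::
  "('a, 'r) ring_scheme \<Rightarrow> ('a, 'b, 'x) module_scheme \<Rightarrow> ('a, 'c, 'y) module_scheme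
    \<Rightarrow> 'b \<Rightarrow> 'c \<Rightarrow> ('b \<times> 'c \<Rightarrow> 'a) set"
where
  "tensor_elt R A B x y =
    tensor_rel R A B +>\<^bsub>free_mod R (carrier A \<times> carrier B)\<^esub> basis_vec R (x, y)"

text \<open>
  The map \<open>f \<otimes> B\<close> from \<open>A \<otimes> B\<close> to \<open>A' \<otimes> B\<close>; all representatives \<open>\<phi>\<close> of a class are sent to the
  same class.
\<close>

definition tensor_map ::
  "('a, 'r) ring_scheme \<Rightarrow> ('a, 'd, 'z) module_scheme \<Rightarrow> ('a, 'c, 'y) module_scheme
    \<Rightarrow> ('b \<Rightarrow> 'd) \<Rightarrow> ('b \<times> 'c \<Rightarrow> 'a) set \<Rightarrow> ('d \<times> 'c \<Rightarrow> 'a) set"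
where
  "tensor_map R A' B f X =
    (let F = free_mod R (carrier A' \<times> carrier B) in
      \<Union>\<phi>\<in>X. tensor_rel R A' B +>\<^bsub>F\<^esub> lin_ext R F (\<lambda>(x, y). basis_vec R (f x, y)) \<phi>)"


section \<open>Complexes\<close>

text \<open>Homological indexing: \<open>diff P i\<close> maps \<open>obj P i\<close> to \<open>obj P (i - 1)\<close>.\<close>

record ('a, 'p) cplx =
  obj :: "int \<Rightarrow> ('a, 'p) module"
  diff :: "int \<Rightarrow> 'p \<Rightarrow> 'p"

definition is_cplx :: "('a, 'r) ring_scheme \<Rightarrow> ('a, 'p) cplx \<Rightarrow> bool" where
  "is_cplx R P \<longleftrightarrow>
    (\<forall>i. module R (obj P i) \<and> diff P i \<in> mod_hom R (obj P i) (obj P (i - 1)) \<and>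
      (\<forall>x\<in>carrier (obj P i). diff P (i - 1) (diff P i x) = \<zero>\<^bsub>obj P (i - 2)\<^esub>))"

definition homology :: "('a, 'p) cplx \<Rightarrow> int \<Rightarrow> ('a, 'p set) module" where
  "homology P i =
    quot_mod
      (obj P i \<lparr>carrier := {x \<in> carrier (obj P i). diff P i x = \<zero>\<^bsub>obj P (i - 1)\<^esub>}\<rparr>)
      (diff P (i + 1) ` carrier (obj P (i + 1)))"

definition acyclic_cplx :: "('a, 'p) cplx \<Rightarrow> bool" where
  "acyclic_cplx P \<longleftrightarrow> (\<forall>i. zero_mod (homology P i))"

definition bounded_below_cplx :: "('a, 'p) cplx \<Rightarrow> bool" where
  "bounded_below_cplx P \<longleftrightarrow> (\<exists>n. \<forall>i<n. zero_mod (obj P i))"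

definition bounded_cplx :: "('a, 'p) cplx \<Rightarrow> bool" where
  "bounded_cplx P \<longleftrightarrow> bounded_below_cplx P \<and> (\<exists>n. \<forall>i>n. zero_mod (obj P i))"

text \<open>Values are extended reals: the zero complex has supremum \<open>-\<infinity>\<close> and infimum \<open>\<infinity>\<close>.\<close>

definition cplx_sup :: "('a, 'p) cplx \<Rightarrow> ereal" where
  "cplx_sup P = (SUP i\<in>{i. \<not> zero_mod (obj P i)}. ereal (real_of_int i))"

definition cplx_inf :: "('a, 'p) cplx \<Rightarrow> ereal" where
  "cplx_inf P = (INF i\<in>{i. \<not> zero_mod (obj P i)}. ereal (real_of_int i))"

definition cplx_hsup :: "('a, 'p) cplx \<Rightarrow> ereal" where
  "cplx_hsup P = (SUP i\<in>{i. \<not> zero_mod (homology P i)}. ereal (real_of_int i))"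

definition tensor_cplx ::
  "('a, 'r) ring_scheme \<Rightarrow> ('a, 'p) cplx \<Rightarrow> ('a, 'c, 'y) module_scheme
    \<Rightarrow> ('a, ('p \<times> 'c \<Rightarrow> 'a) set) cplx"
where
  "tensor_cplx R P N =
    \<lparr>obj = (\<lambda>i. tensor_mod R (obj P i) N),
     diff = (\<lambda>i. tensor_map R (obj P (i - 1)) N (diff P i))\<rparr>"

text \<open>\<open>Hom\<^sub>R(P, N)\<close>, with \<open>Hom\<^sub>R(P\<^sub>n, N)\<close> placed in degree \<open>-n\<close>.\<close>

definition hom_cplx ::
  "('a, 'r) ring_scheme \<Rightarrow> ('a, 'p) cplx \<Rightarrow> ('a, 'c, 'y) module_scheme \<Rightarrow> ('a, 'p \<Rightarrow> 'c) cplx"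
where
  "hom_cplx R P N =
    \<lparr>obj = (\<lambda>i. hom_mod R (obj P (- i)) N),
     diff = (\<lambda>i f. \<lambda>x\<in>carrier (obj P (1 - i)). f (diff P (1 - i) x))\<rparr>"


section \<open>Tor and Ext\<close>

text \<open>
  Tor and Ext are computed from a canonical free resolution \<open>F\<close> of \<open>C\<close>. The basis of \<open>F\<^sub>0\<close> consists
  of a generator \<open>Gen c\<close> for each \<open>c \<in> C\<close>. The basis of \<open>F\<^bsub>n+1\<^esub>\<close> consists of a generator \<open>Rel w\<close> for
  each word \<open>w = [(a\<^sub>1, x\<^sub>1), \<dots>, (a\<^sub>k, x\<^sub>k)]\<close>, with \<open>x\<^sub>j\<close> in the basis of \<open>F\<^sub>n\<close>, for which
  \<open>a\<^sub>1 x\<^sub>1 + \<dots> + a\<^sub>k x\<^sub>k \<in> F\<^sub>n\<close> is a cycle (for \<open>n = 0\<close>: lies in the kernel of the augmentation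
  \<open>F\<^sub>0 \<rightarrow> C\<close>), and the differential sends \<open>Rel w\<close> to that cycle. The datatype holds the bases in all
  degrees in one type.
\<close>

datatype ('a, 'c) res_gen = Gen 'c | Rel "('a \<times> ('a, 'c) res_gen) list"

definition word_val :: "('a, 'r) ring_scheme \<Rightarrow> ('a \<times> 'b) list \<Rightarrow> 'b \<Rightarrow> 'a" where
  "word_val R w = (\<lambda>y. foldr (\<lambda>(a, x) s. if x = y then a \<oplus>\<^bsub>R\<^esub> s else s) w \<zero>\<^bsub>R\<^esub>)"

primrec gen_aug :: "('a, 'c) res_gen \<Rightarrow> 'c" where
  "gen_aug (Gen c) = c"
| "gen_aug (Rel w) = undefined"

primrec gen_bd :: "('a, 'r) ring_scheme \<Rightarrow> ('a, 'c) res_gen \<Rightarrow> ('a, 'c) res_gen \<Rightarrow> 'a" where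
  "gen_bd R (Gen c) = undefined"
| "gen_bd R (Rel w) = word_val R w"

primrec res_basis ::
  "('a, 'r) ring_scheme \<Rightarrow> ('a, 'c, 'y) module_scheme \<Rightarrow> nat \<Rightarrow> ('a, 'c) res_gen set"
where
  "res_basis R C 0 = Gen ` carrier C"
| "res_basis R C (Suc n) =
    {Rel w | w. set w \<subseteq> carrier R \<times> res_basis R C n \<and>
      (if n = 0 then lin_ext R C gen_aug (word_val R w) = \<zero>\<^bsub>C\<^esub>
       else lin_ext R (free_mod R UNIV) (gen_bd R) (word_val R w) = (\<lambda>_. \<zero>\<^bsub>R\<^esub>))}"

definition free_resolution ::
  "('a, 'r) ring_scheme \<Rightarrow> ('a, 'c, 'y) module_scheme \<Rightarrow> ('a, ('a, 'c) res_gen \<Rightarrow> 'a) cplx"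
where
  "free_resolution R C =
    \<lparr>obj = (\<lambda>i. free_mod R (if i < 0 then {} else res_basis R C (nat i))),
     diff = (\<lambda>i. if i \<le> 0 then (\<lambda>_ _. \<zero>\<^bsub>R\<^esub>) else lin_ext R (free_mod R UNIV) (gen_bd R))\<rparr>"

definition Tor_mod ::
  "('a, 'r) ring_scheme \<Rightarrow> nat \<Rightarrow> ('a, 'c, 'x) module_scheme \<Rightarrow> ('a, 'm, 'y) module_scheme
    \<Rightarrow> ('a, ((('a, 'c) res_gen \<Rightarrow> 'a) \<times> 'm \<Rightarrow> 'a) set set) module"
where
  "Tor_mod R n C M = homology (tensor_cplx R (free_resolution R C) M) (int n)"

definition Ext_mod ::
  "('a, 'r) ring_scheme \<Rightarrow> nat \<Rightarrow> ('a, 'c, 'x) module_scheme \<Rightarrow> ('a, 'm, 'y) module_scheme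
    \<Rightarrow> ('a, ((('a, 'c) res_gen \<Rightarrow> 'a) \<Rightarrow> 'm) set) module"
where
  "Ext_mod R n C N = homology (hom_cplx R (free_resolution R C) N) (- int n)"


section \<open>Semidualizing modules and the Auslander class\<close>

definition semidualizing :: "('a, 'r) ring_scheme \<Rightarrow> ('a, 'c) module \<Rightarrow> bool" where
  "semidualizing R C \<longleftrightarrow>
    module R C \<and> fin_gen_mod R C \<and>
    (\<lambda>r. \<lambda>c\<in>carrier C. r \<odot>\<^bsub>C\<^esub> c) \<in> mod_iso R (regular_mod R) (hom_mod R C C) \<and>
    (\<forall>i>0. zero_mod (Ext_mod R i C C))"

definition auslander_class :: "('a, 'r) ring_scheme \<Rightarrow> ('a, 'c) module \<Rightarrow> ('a, 'm) module set" where
  "auslander_class R C =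
    {M. module R M \<and>
      (\<lambda>m. \<lambda>c\<in>carrier C. tensor_elt R C M c m) \<in> mod_iso R M (hom_mod R C (tensor_mod R C M)) \<and>
      (\<forall>i>0. zero_mod (Tor_mod R i C M) \<and> zero_mod (Ext_mod R i C (tensor_mod R C M)))}"


section \<open>Quasi-projective resolutions and dimensions\<close>

definition quasi_proj_res ::
  "('a, 'r) ring_scheme \<Rightarrow> ('a, 'l) module \<Rightarrow> ('a, 'p) cplx \<Rightarrow> bool"
where
  "quasi_proj_res R L P \<longleftrightarrow>
    is_cplx R P \<and> (\<forall>i. projective_mod R (obj P i)) \<and> bounded_below_cplx P \<and>
    (\<exists>a :: int \<Rightarrow> nat.
      (\<exists>i. cplx_inf P \<le> ereal (real_of_int i) \<and> a i \<noteq> 0) \<and>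
      (\<forall>i. cplx_inf P \<le> ereal (real_of_int i) \<longrightarrow>
        isomorphic_mod R (homology P i) (mod_power L (a i))))"

definition C_quasi_proj_res ::
  "('a, 'r) ring_scheme \<Rightarrow> ('a, 'c) module \<Rightarrow> ('a, 'l) module \<Rightarrow> ('a, 'p) cplx \<Rightarrow> bool"
where
  "C_quasi_proj_res R C L P \<longleftrightarrow>
    is_cplx R P \<and> (\<forall>i. projective_mod R (obj P i)) \<and> bounded_cplx P \<and>
    \<not> acyclic_cplx (tensor_cplx R P C) \<and>
    (\<forall>i. zero_mod (homology (tensor_cplx R P C) i) \<or>
      (\<exists>n. isomorphic_mod R (homology (tensor_cplx R P C) i) (mod_power L n)))"

text \<open>
  HOL has no quantification over types, so the infimum ranges over the resolutions whose modules have
  their carriers in a type \<^typ>\<open>'p\<close>, which is a parameter of the dimension.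
\<close>

definition qpd :: "'p itself \<Rightarrow> ('a, 'r) ring_scheme \<Rightarrow> ('a, 'l) module \<Rightarrow> ereal" where
  "qpd (_ :: 'p itself) R L =
    (if zero_mod L then - \<infinity>
     else (INF P\<in>{P :: ('a, 'p) cplx. bounded_cplx P \<and> quasi_proj_res R L P}.
       cplx_sup P - cplx_hsup P))"

definition C_qpd ::
  "'p itself \<Rightarrow> ('a, 'r) ring_scheme \<Rightarrow> ('a, 'c) module \<Rightarrow> ('a, 'l) module \<Rightarrow> ereal"
where
  "C_qpd (_ :: 'p itself) R C L =
    (if zero_mod L then - \<infinity>
     else (INF P\<in>{P :: ('a, 'p) cplx. C_quasi_proj_res R C L P}.
       cplx_sup (tensor_cplx R P C) - cplx_hsup (tensor_cplx R P C)))"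

end

theory Submission
  imports Defs
begin

text \<open>
  As \<open>R\<close> is Noetherian, \<open>C\<close> has a resolution \<open>G\<close> by free modules of finite rank, given by matrices. Its
  basis can be chosen inside the basis of the canonical free resolution, and then \<open>G\<close> is a retract of the
  canonical resolution. Hence the vanishing of Tor and Ext in positive degrees makes the complexes
  \<open>X \<otimes> G\<close> and \<open>Hom(G, X)\<close> exact there; these consist of finite powers of \<open>X\<close> and of the maps
  given by the matrices and their transposes.

  A projective module is a direct summand of a sum of copies of \<open>R\<close>, so \<open>P \<otimes> C\<close> is one of a sum of
  copies of \<open>C\<close>. Finite matrices respect this, so projective modules are Tor-acyclic, \<open>P \<otimes> C\<close> is
  Ext-acyclic, and \<open>P \<cong> Hom(C, P \<otimes> C)\<close>.

  Let \<open>P\<close> now be a bounded complex of projectives. If its homology modules are powers of \<open>M\<close>, then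
  ascending induction on the degree shows that its boundaries are Tor-acyclic, so \<open>- \<otimes> C\<close> commutes
  with homology and \<open>H\<^sub>i(P \<otimes> C) \<cong> H\<^sub>i(P) \<otimes> C\<close>. If the homology modules of \<open>P \<otimes> C\<close> are powers
  of \<open>C \<otimes> M\<close>, then descending induction shows that its boundaries and cycles are Ext-acyclic, so
  \<open>Hom(C, -)\<close> commutes with homology and \<open>H\<^sub>i(P) \<cong> Hom(C, H\<^sub>i(P \<otimes> C))\<close>, where
  \<open>Hom(C, C \<otimes> M) \<cong> M\<close>. The exponents are the same in both directions.
\<close>

section \<open>Homomorphisms and linear combinations\<close>

text \<open>Every tensor product and every quotient lives over a new type, so Tor and Ext of
  boundary modules are never formed. Acyclicity of a submodule is stated inside the term that
  contains it, as solvability of linear systems with the entries of \<open>D\<close> as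
  coefficients, and homology enters only through coordinate functions on cycles. Dimension shifting
  thus becomes the correction of a solution by subtraction. Elements of X \<otimes> C and
  homomorphisms from C turn into tuples as well: cosets of tuples in X^(n 0) modulo the image of
  \<open>D 0\<close>, and tuples killed by the transpose of \<open>D 0\<close>. Two resolutions
  usually compare only up to homotopy. Distinct generators make the embedding of G into the
  canonical resolution split strictly, so no homotopy occurs. The directions of the inductions come
  from the sequences Z -> P -> B and B -> Z -> H of cycles, boundaries and homology: Tor-acyclicity
  passes to the kernel of a surjection of acyclic modules, Ext-acyclicity to extensions and to
  quotients by acyclic submodules.\<close>

lemma mod_homI:
  assumes "\<And>x. x \<in> carrier A \<Longrightarrow> f x \<in> carrier B"
    and "\<And>x y. x \<in> carrier A \<Longrightarrow> y \<in> carrier A \<Longrightarrow> f (x \<oplus>\<^bsub>A\<^esub> y) = f x \<oplus>\<^bsub>B\<^esub> f y"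
    and "\<And>r x. r \<in> carrier R \<Longrightarrow> x \<in> carrier A \<Longrightarrow> f (r \<odot>\<^bsub>A\<^esub> x) = r \<odot>\<^bsub>B\<^esub> f x"
  shows "f \<in> mod_hom R A B"
  using assms by (auto simp: mod_hom_def)

lemma
  assumes "f \<in> mod_hom R A B"
  shows mod_hom_closed: "x \<in> carrier A \<Longrightarrow> f x \<in> carrier B"
    and mod_hom_add: "x \<in> carrier A \<Longrightarrow> y \<in> carrier A \<Longrightarrow> f (x \<oplus>\<^bsub>A\<^esub> y) = f x \<oplus>\<^bsub>B\<^esub> f y"
    and mod_hom_smult: "r \<in> carrier R \<Longrightarrow> x \<in> carrier A \<Longrightarrow> f (r \<odot>\<^bsub>A\<^esub> x) = r \<odot>\<^bsub>B\<^esub> f x"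
  using assms by (auto simp: mod_hom_def)

lemmas module_a_closed = abelian_monoid.a_closed[OF abelian_group.axioms(1)[OF module.axioms(2)]]
  and module_zero_closed = abelian_monoid.zero_closed[OF abelian_group.axioms(1)[OF module.axioms(2)]]
  and module_l_zero = abelian_monoid.l_zero[OF abelian_group.axioms(1)[OF module.axioms(2)]]
  and module_finsum_cong' = abelian_monoid.finsum_cong'[OF abelian_group.axioms(1)[OF module.axioms(2)]]

lemma mod_hom_zero:
  assumes "module R A" "module R B" "f \<in> mod_hom R A B"
  shows "f \<zero>\<^bsub>A\<^esub> = \<zero>\<^bsub>B\<^esub>"
proof -
  interpret A: module R A by fact
  interpret B: module R B by fact
  have "f (\<zero>\<^bsub>R\<^esub> \<odot>\<^bsub>A\<^esub> \<zero>\<^bsub>A\<^esub>) = \<zero>\<^bsub>R\<^esub> \<odot>\<^bsub>B\<^esub> f \<zero>\<^bsub>A\<^esub>"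
    by (rule mod_hom_smult[OF assms(3)]) simp_all
  then show ?thesis using mod_hom_closed[OF assms(3)] by simp
qed

lemma mod_hom_minus:
  assumes "module R A" "module R B" "f \<in> mod_hom R A B" "x \<in> carrier A" "y \<in> carrier A"
  shows "f (x \<ominus>\<^bsub>A\<^esub> y) = f x \<ominus>\<^bsub>B\<^esub> f y"
proof -
  interpret A: module R A by fact
  interpret B: module R B by fact
  have "\<ominus>\<^bsub>A\<^esub> y = (\<ominus>\<^bsub>R\<^esub> \<one>\<^bsub>R\<^esub>) \<odot>\<^bsub>A\<^esub> y" using assms(5) by (simp add: A.smult_l_minus)
  moreover have "\<ominus>\<^bsub>B\<^esub> f y = (\<ominus>\<^bsub>R\<^esub> \<one>\<^bsub>R\<^esub>) \<odot>\<^bsub>B\<^esub> f y"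
    using assms(5) mod_hom_closed[OF assms(3)] by (simp add: B.smult_l_minus)
  ultimately show ?thesis
    using assms by (simp add: a_minus_def mod_hom_add[OF assms(3)] mod_hom_smult[OF assms(3)])
qed

lemma mod_hom_cong:
  assumes "module R A" "f \<in> mod_hom R A B" "\<And>x. x \<in> carrier A \<Longrightarrow> g x = f x"
  shows "g \<in> mod_hom R A B"
proof -
  interpret A: module R A by fact
  show ?thesis
    by (rule mod_homI) (simp_all add: assms(3) mod_hom_closed[OF assms(2)] mod_hom_add[OF assms(2)] mod_hom_smult[OF assms(2)])
qed

lemma mod_hom_comp:
  assumes "f \<in> mod_hom R A B" "g \<in> mod_hom R B E"
  shows "(\<lambda>x. g (f x)) \<in> mod_hom R A E"
  using assms by (auto simp: mod_hom_def Pi_def)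

lemma mod_hom_ident: "(\<lambda>x. x) \<in> mod_hom R A A"
  by (simp add: mod_hom_def)

lemma mod_hom_finsum:
  assumes "module R A" "module R B" "f \<in> mod_hom R A B" "finite S" "g \<in> S \<rightarrow> carrier A"
  shows "f (\<Oplus>\<^bsub>A\<^esub>i\<in>S. g i) = (\<Oplus>\<^bsub>B\<^esub>i\<in>S. f (g i))"
proof -
  interpret A: module R A by fact
  interpret B: module R B by fact
  show ?thesis using assms(4,5)
  proof (induction S rule: finite_induct)
    case empty
    then show ?case by (simp add: mod_hom_zero[OF assms(1-3)])
  next
    case (insert x F)
    then have "g \<in> F \<rightarrow> carrier A" "g x \<in> carrier A" by auto
    with insert show ?case
      using mod_hom_closed[OF assms(3)]
      by (simp add: mod_hom_add[OF assms(3)] Pi_def)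
  qed
qed

lemma (in abelian_monoid) finsum_swap:
  assumes "finite S" "finite T" "\<And>i j. i \<in> S \<Longrightarrow> j \<in> T \<Longrightarrow> g i j \<in> carrier G"
  shows "(\<Oplus>i\<in>S. \<Oplus>j\<in>T. g i j) = (\<Oplus>j\<in>T. \<Oplus>i\<in>S. g i j)"
  using assms(1,3)
proof (induction S rule: finite_induct)
  case empty
  then show ?case by (simp add: finsum_zero)
next
  case (insert x F)
  then have "(\<Oplus>i\<in>insert x F. \<Oplus>j\<in>T. g i j) = (\<Oplus>j\<in>T. g x j) \<oplus> (\<Oplus>j\<in>T. \<Oplus>i\<in>F. g i j)"
    by (simp add: Pi_def)
  also have "\<dots> = (\<Oplus>j\<in>T. g x j \<oplus> (\<Oplus>i\<in>F. g i j))"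
    using insert.prems by (subst finsum_addf) (auto simp: Pi_def)
  also have "\<dots> = (\<Oplus>j\<in>T. \<Oplus>i\<in>insert x F. g i j)"
    using insert by (intro finsum_cong') (auto simp: Pi_def)
  finally show ?case .
qed

text \<open>Coefficients and vectors are separate arguments: a row \<open>D k i\<close> of a matrix
  applies to a tuple as it stands, and a matrix acts by one \<open>lc\<close> per row.\<close>

definition lc :: "('a, 'b, 'x) module_scheme \<Rightarrow> 'i set \<Rightarrow> ('i \<Rightarrow> 'a) \<Rightarrow> ('i \<Rightarrow> 'b) \<Rightarrow> 'b" where
  "lc A S a x = (\<Oplus>\<^bsub>A\<^esub>i\<in>S. a i \<odot>\<^bsub>A\<^esub> x i)"

lemma lc_cong:
  assumes "module R A" "S = T" "\<And>i. i \<in> T \<Longrightarrow> a i = b i" "\<And>i. i \<in> T \<Longrightarrow> x i = y i"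
    and "\<And>i. i \<in> T \<Longrightarrow> b i \<in> carrier R" "\<And>i. i \<in> T \<Longrightarrow> y i \<in> carrier A"
  shows "lc A S a x = lc A T b y"
proof -
  interpret A: module R A by fact
  show ?thesis unfolding lc_def using assms by (intro A.finsum_cong') auto
qed

context module
begin

lemma lc_closed [intro]:
  assumes "\<And>i. i \<in> S \<Longrightarrow> a i \<in> carrier R" "\<And>i. i \<in> S \<Longrightarrow> x i \<in> carrier M"
  shows "lc M S a x \<in> carrier M"
  unfolding lc_def using assms by (intro finsum_closed) auto

lemma lc_insert:
  assumes "finite S" "i \<notin> S" "\<And>j. j \<in> insert i S \<Longrightarrow> a j \<in> carrier R" "\<And>j. j \<in> insert i S \<Longrightarrow> x j \<in> carrier M"
  shows "lc M (insert i S) a x = a i \<odot>\<^bsub>M\<^esub> x i \<oplus>\<^bsub>M\<^esub> lc M S a x"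
  unfolding lc_def using assms by (subst finsum_insert) (auto simp: Pi_def)

lemma lc_add:
  assumes "\<And>i. i \<in> S \<Longrightarrow> a i \<in> carrier R" "\<And>i. i \<in> S \<Longrightarrow> x i \<in> carrier M" "\<And>i. i \<in> S \<Longrightarrow> y i \<in> carrier M"
  shows "lc M S a (\<lambda>i. x i \<oplus>\<^bsub>M\<^esub> y i) = lc M S a x \<oplus>\<^bsub>M\<^esub> lc M S a y"
proof -
  have "lc M S a (\<lambda>i. x i \<oplus>\<^bsub>M\<^esub> y i) = (\<Oplus>\<^bsub>M\<^esub>i\<in>S. a i \<odot>\<^bsub>M\<^esub> x i \<oplus>\<^bsub>M\<^esub> a i \<odot>\<^bsub>M\<^esub> y i)"
    unfolding lc_def using assms by (intro finsum_cong') (auto simp: smult_r_distr)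
  then show ?thesis unfolding lc_def using assms by (simp add: finsum_addf Pi_def)
qed

lemma lc_add_left:
  assumes "\<And>i. i \<in> S \<Longrightarrow> a i \<in> carrier R" "\<And>i. i \<in> S \<Longrightarrow> b i \<in> carrier R" "\<And>i. i \<in> S \<Longrightarrow> x i \<in> carrier M"
  shows "lc M S (\<lambda>i. a i \<oplus> b i) x = lc M S a x \<oplus>\<^bsub>M\<^esub> lc M S b x"
proof -
  have "lc M S (\<lambda>i. a i \<oplus> b i) x = (\<Oplus>\<^bsub>M\<^esub>i\<in>S. a i \<odot>\<^bsub>M\<^esub> x i \<oplus>\<^bsub>M\<^esub> b i \<odot>\<^bsub>M\<^esub> x i)"
    unfolding lc_def using assms by (intro finsum_cong') (auto simp: smult_l_distr)
  then show ?thesis unfolding lc_def using assms by (simp add: finsum_addf Pi_def)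
qed

lemma lc_smult:
  assumes "finite S" "r \<in> carrier R" "\<And>i. i \<in> S \<Longrightarrow> a i \<in> carrier R" "\<And>i. i \<in> S \<Longrightarrow> x i \<in> carrier M"
  shows "lc M S a (\<lambda>i. r \<odot>\<^bsub>M\<^esub> x i) = r \<odot>\<^bsub>M\<^esub> lc M S a x"
    and "lc M S (\<lambda>i. r \<otimes> a i) x = r \<odot>\<^bsub>M\<^esub> lc M S a x"
proof -
  have 1: "r \<odot>\<^bsub>M\<^esub> lc M S a x = (\<Oplus>\<^bsub>M\<^esub>i\<in>S. r \<odot>\<^bsub>M\<^esub> (a i \<odot>\<^bsub>M\<^esub> x i))"
    unfolding lc_def using assms by (intro finsum_smult_ldistr) auto
  show "lc M S (\<lambda>i. r \<otimes> a i) x = r \<odot>\<^bsub>M\<^esub> lc M S a x"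
    unfolding 1 unfolding lc_def using assms by (intro finsum_cong') (auto simp: smult_assoc1)
  show "lc M S a (\<lambda>i. r \<odot>\<^bsub>M\<^esub> x i) = r \<odot>\<^bsub>M\<^esub> lc M S a x"
    unfolding 1 unfolding lc_def using assms
    by (intro finsum_cong') (auto simp: smult_assoc1[symmetric] R.m_comm)
qed

lemma lc_zero:
  assumes "\<And>i. i \<in> S \<Longrightarrow> a i \<in> carrier R" "\<And>i. i \<in> S \<Longrightarrow> x i = \<zero>\<^bsub>M\<^esub>"
  shows "lc M S a x = \<zero>\<^bsub>M\<^esub>"
  unfolding lc_def using assms by (intro add.finprod_one_eqI) auto

lemma lc_zero_left:
  assumes "\<And>i. i \<in> S \<Longrightarrow> x i \<in> carrier M" "\<And>i. i \<in> S \<Longrightarrow> a i = \<zero>"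
  shows "lc M S a x = \<zero>\<^bsub>M\<^esub>"
  unfolding lc_def using assms by (intro add.finprod_one_eqI) auto

lemma smult_minus_one: "x \<in> carrier M \<Longrightarrow> \<ominus>\<^bsub>M\<^esub> x = (\<ominus> \<one>) \<odot>\<^bsub>M\<^esub> x"
  by (simp add: smult_l_minus)

lemma lc_minus:
  assumes "finite S" "\<And>i. i \<in> S \<Longrightarrow> a i \<in> carrier R" "\<And>i. i \<in> S \<Longrightarrow> x i \<in> carrier M" "\<And>i. i \<in> S \<Longrightarrow> y i \<in> carrier M"
  shows "lc M S a (\<lambda>i. x i \<ominus>\<^bsub>M\<^esub> y i) = lc M S a x \<ominus>\<^bsub>M\<^esub> lc M S a y"
proof -
  have "lc M S a (\<lambda>i. x i \<ominus>\<^bsub>M\<^esub> y i) = lc M S a (\<lambda>i. x i \<oplus>\<^bsub>M\<^esub> (\<ominus> \<one>) \<odot>\<^bsub>M\<^esub> y i)"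
    using assms by (intro lc_cong[OF module_axioms]) (auto simp: a_minus_def smult_minus_one)
  also have "\<dots> = lc M S a x \<oplus>\<^bsub>M\<^esub> (\<ominus> \<one>) \<odot>\<^bsub>M\<^esub> lc M S a y"
    using assms by (subst lc_add) (auto simp: lc_smult)
  also have "\<dots> = lc M S a x \<ominus>\<^bsub>M\<^esub> lc M S a y"
    using assms by (simp add: a_minus_def smult_minus_one lc_closed)
  finally show ?thesis .
qed

lemma lc_swap:
  assumes "finite S" "finite T" "\<And>i. i \<in> S \<Longrightarrow> a i \<in> carrier R" "\<And>j. j \<in> T \<Longrightarrow> b j \<in> carrier R"
    and "\<And>i j. i \<in> S \<Longrightarrow> j \<in> T \<Longrightarrow> x i j \<in> carrier M"
  shows "lc M S a (\<lambda>i. lc M T b (\<lambda>j. x i j)) = lc M T b (\<lambda>j. lc M S a (\<lambda>i. x i j))"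
proof -
  have "lc M S a (\<lambda>i. lc M T b (\<lambda>j. x i j)) = (\<Oplus>\<^bsub>M\<^esub>i\<in>S. \<Oplus>\<^bsub>M\<^esub>j\<in>T. a i \<odot>\<^bsub>M\<^esub> (b j \<odot>\<^bsub>M\<^esub> x i j))"
    unfolding lc_def using assms
    by (intro finsum_cong') (auto simp: finsum_smult_ldistr Pi_def intro!: finsum_closed)
  also have "\<dots> = (\<Oplus>\<^bsub>M\<^esub>j\<in>T. \<Oplus>\<^bsub>M\<^esub>i\<in>S. a i \<odot>\<^bsub>M\<^esub> (b j \<odot>\<^bsub>M\<^esub> x i j))"
    using assms by (intro finsum_swap) auto
  also have "\<dots> = (\<Oplus>\<^bsub>M\<^esub>j\<in>T. \<Oplus>\<^bsub>M\<^esub>i\<in>S. b j \<odot>\<^bsub>M\<^esub> (a i \<odot>\<^bsub>M\<^esub> x i j))"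
    using assms by (intro finsum_cong' refl) (auto simp: smult_assoc1[symmetric] R.m_comm intro!: finsum_closed)
  also have "\<dots> = lc M T b (\<lambda>j. lc M S a (\<lambda>i. x i j))"
    unfolding lc_def using assms
    by (intro finsum_cong') (auto simp: finsum_smult_ldistr Pi_def intro!: finsum_closed)
  finally show ?thesis .
qed

lemma finsum_smult_rdistr:
  assumes "finite S" "a \<in> S \<rightarrow> carrier R" "x \<in> carrier M"
  shows "(\<Oplus>i\<in>S. a i) \<odot>\<^bsub>M\<^esub> x = (\<Oplus>\<^bsub>M\<^esub>i\<in>S. a i \<odot>\<^bsub>M\<^esub> x)"
  using assms by (induction S rule: finite_induct) (auto simp: Pi_def smult_l_distr)

text \<open>Associativity of the matrix product. Together with \<open>D_D\<close> it makes the
  composite of consecutive matrices vanish on tuples from any module.\<close>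

lemma lc_lc:
  assumes "finite S" "finite T" "\<And>i. i \<in> S \<Longrightarrow> a i \<in> carrier R" "\<And>i j. i \<in> S \<Longrightarrow> j \<in> T \<Longrightarrow> b i j \<in> carrier R"
    and "\<And>j. j \<in> T \<Longrightarrow> x j \<in> carrier M"
  shows "lc M S a (\<lambda>i. lc M T (b i) x) = lc M T (\<lambda>j. \<Oplus>i\<in>S. a i \<otimes> b i j) x"
proof -
  have "lc M S a (\<lambda>i. lc M T (b i) x) = (\<Oplus>\<^bsub>M\<^esub>i\<in>S. \<Oplus>\<^bsub>M\<^esub>j\<in>T. a i \<odot>\<^bsub>M\<^esub> (b i j \<odot>\<^bsub>M\<^esub> x j))"
    unfolding lc_def using assms
    by (intro finsum_cong') (auto simp: finsum_smult_ldistr Pi_def intro!: finsum_closed)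
  also have "\<dots> = (\<Oplus>\<^bsub>M\<^esub>j\<in>T. \<Oplus>\<^bsub>M\<^esub>i\<in>S. a i \<odot>\<^bsub>M\<^esub> (b i j \<odot>\<^bsub>M\<^esub> x j))"
    using assms by (intro finsum_swap) auto
  also have "\<dots> = lc M T (\<lambda>j. \<Oplus>i\<in>S. a i \<otimes> b i j) x"
    unfolding lc_def using assms
    by (intro finsum_cong' refl) (auto simp: finsum_smult_rdistr smult_assoc1 Pi_def intro!: finsum_closed add.finprod_cong')
  finally show ?thesis .
qed

lemma lc_delta:
  assumes "finite S" "i \<in> S" "\<And>j. j \<in> S \<Longrightarrow> x j \<in> carrier M"
  shows "lc M S (\<lambda>j. if j = i then \<one> else \<zero>) x = x i"
proof -
  have "lc M S (\<lambda>j. if j = i then \<one> else \<zero>) x = (\<Oplus>\<^bsub>M\<^esub>j\<in>S. if i = j then x j else \<zero>\<^bsub>M\<^esub>)"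
    unfolding lc_def using assms by (intro finsum_cong') auto
  then show ?thesis using assms by (simp add: finsum_singleton Pi_def)
qed

lemma submodule_lc:
  assumes "submodule N R M" "finite S" "\<And>i. i \<in> S \<Longrightarrow> a i \<in> carrier R" "\<And>i. i \<in> S \<Longrightarrow> x i \<in> N"
  shows "lc M S a x \<in> N"
  using assms(2-)
proof (induction S rule: finite_induct)
  case empty
  have "\<zero>\<^bsub>M\<^esub> \<in> N" using assms(1) by (metis submodule.axioms(1) subgroup.one_closed monoid.simps(2))
  then show ?case by (simp add: lc_def)
next
  case (insert i S)
  have "N \<subseteq> carrier M" using submoduleE(1)[OF assms(1)] .
  with insert show ?case
    by (subst lc_insert) (auto intro!: submoduleE(5)[OF assms(1)] submoduleE(4)[OF assms(1)])
qed

end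

lemma mod_hom_lc:
  assumes "module R A" "module R B" "f \<in> mod_hom R A B" "finite S"
    and "\<And>i. i \<in> S \<Longrightarrow> a i \<in> carrier R" "\<And>i. i \<in> S \<Longrightarrow> x i \<in> carrier A"
  shows "f (lc A S a x) = lc B S a (\<lambda>i. f (x i))"
proof -
  interpret A: module R A by fact
  interpret B: module R B by fact
  show ?thesis
    unfolding lc_def using assms(4-) mod_hom_closed[OF assms(3)]
    by (subst mod_hom_finsum[OF assms(1-3)])
       (auto simp: Pi_def mod_hom_smult[OF assms(3)] intro!: B.finsum_cong')
qed

lemma mod_hom_lc_fun:
  assumes "module R B" "finite S"
    and "\<And>i. i \<in> S \<Longrightarrow> f i \<in> mod_hom R A B" "\<And>i. i \<in> S \<Longrightarrow> a i \<in> carrier R"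
  shows "(\<lambda>x. lc B S a (\<lambda>i. f i x)) \<in> mod_hom R A B"
proof -
  interpret B: module R B by fact
  note h = mod_hom_closed[OF assms(3)] mod_hom_add[OF assms(3)] mod_hom_smult[OF assms(3)]
  show ?thesis
  proof (rule mod_homI)
    fix x assume "x \<in> carrier A"
    then show "lc B S a (\<lambda>i. f i x) \<in> carrier B" using h assms by auto
    fix y assume y: "y \<in> carrier A"
    have "lc B S a (\<lambda>i. f i (x \<oplus>\<^bsub>A\<^esub> y)) = lc B S a (\<lambda>i. f i x \<oplus>\<^bsub>B\<^esub> f i y)"
      using h assms y \<open>x \<in> carrier A\<close> by (intro lc_cong[OF assms(1)]) auto
    then show "lc B S a (\<lambda>i. f i (x \<oplus>\<^bsub>A\<^esub> y)) = lc B S a (\<lambda>i. f i x) \<oplus>\<^bsub>B\<^esub> lc B S a (\<lambda>i. f i y)"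
      using h assms y \<open>x \<in> carrier A\<close> by (simp add: B.lc_add)
  next
    fix r x assume "r \<in> carrier R" "x \<in> carrier A"
    have "lc B S a (\<lambda>i. f i (r \<odot>\<^bsub>A\<^esub> x)) = lc B S a (\<lambda>i. r \<odot>\<^bsub>B\<^esub> f i x)"
      using h assms \<open>r \<in> carrier R\<close> \<open>x \<in> carrier A\<close> by (intro lc_cong[OF assms(1)]) auto
    then show "lc B S a (\<lambda>i. f i (r \<odot>\<^bsub>A\<^esub> x)) = r \<odot>\<^bsub>B\<^esub> lc B S a (\<lambda>i. f i x)"
      using h assms \<open>r \<in> carrier R\<close> \<open>x \<in> carrier A\<close> by (simp add: B.lc_smult)
  qed
qed

section \<open>Cancellation, and modules and isomorphisms obtained from maps and relations\<close>

context module
begin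

lemma minus_zero: "x \<in> carrier M \<Longrightarrow> x \<ominus>\<^bsub>M\<^esub> \<zero>\<^bsub>M\<^esub> = x"
  by (simp add: a_minus_def)

lemma add_minus_cancel: "x \<in> carrier M \<Longrightarrow> y \<in> carrier M \<Longrightarrow> (x \<oplus>\<^bsub>M\<^esub> y) \<ominus>\<^bsub>M\<^esub> y = x"
  by (simp add: a_minus_def M.a_assoc M.r_neg)

lemma minus_add_cancel: "x \<in> carrier M \<Longrightarrow> y \<in> carrier M \<Longrightarrow> (x \<ominus>\<^bsub>M\<^esub> y) \<oplus>\<^bsub>M\<^esub> y = x"
  by (simp add: a_minus_def M.a_assoc M.l_neg)

lemma minus_eq_zero_iff:
  assumes "x \<in> carrier M" "y \<in> carrier M"
  shows "x \<ominus>\<^bsub>M\<^esub> y = \<zero>\<^bsub>M\<^esub> \<longleftrightarrow> x = y"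
proof
  assume "x \<ominus>\<^bsub>M\<^esub> y = \<zero>\<^bsub>M\<^esub>"
  then show "x = y" using minus_add_cancel[OF assms] assms by simp
next
  show "x \<ominus>\<^bsub>M\<^esub> y = \<zero>\<^bsub>M\<^esub>" if "x = y" using that assms by (simp add: a_minus_def M.r_neg)
qed

end

text \<open>The isomorphisms on homology have no formula, since a class is reached through a choice
  of representatives. A relation closed under sums and multiples is the graph of a map as soon as
  zero is related to zero only: two values of one argument differ by a value of zero. Injectivity is
  the same remark with the sides exchanged.\<close>

lemma isomorphic_mod_relI:
  assumes "module R A" "module R B"
    and cl: "\<And>x y. \<rho> x y \<Longrightarrow> x \<in> carrier A \<and> y \<in> carrier B"
    and tot: "\<And>x. x \<in> carrier A \<Longrightarrow> \<exists>y. \<rho> x y"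
    and sur: "\<And>y. y \<in> carrier B \<Longrightarrow> \<exists>x. \<rho> x y"
    and add: "\<And>x y x' y'. \<rho> x y \<Longrightarrow> \<rho> x' y' \<Longrightarrow> \<rho> (x \<oplus>\<^bsub>A\<^esub> x') (y \<oplus>\<^bsub>B\<^esub> y')"
    and smult: "\<And>r x y. r \<in> carrier R \<Longrightarrow> \<rho> x y \<Longrightarrow> \<rho> (r \<odot>\<^bsub>A\<^esub> x) (r \<odot>\<^bsub>B\<^esub> y)"
    and sv: "\<And>y. \<rho> \<zero>\<^bsub>A\<^esub> y \<Longrightarrow> y = \<zero>\<^bsub>B\<^esub>"
    and inj: "\<And>x. \<rho> x \<zero>\<^bsub>B\<^esub> \<Longrightarrow> x = \<zero>\<^bsub>A\<^esub>"
  shows "isomorphic_mod R A B"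
proof -
  interpret A: module R A by fact
  interpret B: module R B by fact
  have minus: "\<rho> (x \<ominus>\<^bsub>A\<^esub> x') (y \<ominus>\<^bsub>B\<^esub> y')" if "\<rho> x y" "\<rho> x' y'" for x x' y y'
    using add[OF that(1) smult[OF _ that(2), of "\<ominus>\<^bsub>R\<^esub> \<one>\<^bsub>R\<^esub>"]] cl[OF that(2)]
    by (simp add: a_minus_def A.smult_minus_one B.smult_minus_one)
  have uniq: "y = y'" if "\<rho> x y" "\<rho> x y'" for x y y'
  proof -
    have "\<rho> \<zero>\<^bsub>A\<^esub> (y \<ominus>\<^bsub>B\<^esub> y')"
      using minus[OF that] cl[OF that(1)] by (simp add: A.r_neg a_minus_def)
    from sv[OF this] show ?thesis using cl[OF that(1)] cl[OF that(2)] by (simp add: B.minus_eq_zero_iff)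
  qed
  have uniq': "x = x'" if "\<rho> x y" "\<rho> x' y" for x x' y
  proof -
    have "\<rho> (x \<ominus>\<^bsub>A\<^esub> x') \<zero>\<^bsub>B\<^esub>"
      using minus[OF that] cl[OF that(1)] by (simp add: B.r_neg a_minus_def)
    from inj[OF this] show ?thesis using cl[OF that(1)] cl[OF that(2)] by (simp add: A.minus_eq_zero_iff)
  qed
  from tot obtain f where f: "\<And>x. x \<in> carrier A \<Longrightarrow> \<rho> x (f x)" by metis
  have "f \<in> mod_hom R A B"
  proof (rule mod_homI)
    show "f x \<in> carrier B" if "x \<in> carrier A" for x using cl[OF f[OF that]] by simp
    show "f (x \<oplus>\<^bsub>A\<^esub> y) = f x \<oplus>\<^bsub>B\<^esub> f y" if "x \<in> carrier A" "y \<in> carrier A" for x y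
      using uniq[OF f add[OF f[OF that(1)] f[OF that(2)]]] that by simp
    show "f (r \<odot>\<^bsub>A\<^esub> x) = r \<odot>\<^bsub>B\<^esub> f x" if "r \<in> carrier R" "x \<in> carrier A" for r x
      using uniq[OF f smult[OF that(1) f[OF that(2)]]] that by simp
  qed
  moreover have "bij_betw f (carrier A) (carrier B)"
    unfolding bij_betw_def inj_on_def
  proof (intro conjI ballI impI)
    show "x = y" if "x \<in> carrier A" "y \<in> carrier A" "f x = f y" for x y
      using uniq'[OF f[OF that(1)]] f[OF that(2)] that by simp
    show "f ` carrier A = carrier B"
    proof (intro equalityI subsetI)
      show "y \<in> carrier B" if "y \<in> f ` carrier A" for y using that cl f by blast
      show "y \<in> f ` carrier A" if "y \<in> carrier B" for y
        using sur[OF that] cl f uniq by (metis image_eqI)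
    qed
  qed
  ultimately show ?thesis unfolding isomorphic_mod_def mod_iso_def by auto
qed

text \<open>\<open>B\<close> is merely a record here and inherits its axioms: each of its elements
  is some \<open>q x\<close>, and each identity is the image of one in \<open>A\<close>. Quotients
  are the case where \<open>q\<close> is the coset map.\<close>

lemma module_image:
  assumes "module R A" "q ` carrier A = carrier B" "q \<zero>\<^bsub>A\<^esub> = \<zero>\<^bsub>B\<^esub>"
    and add: "\<And>x y. x \<in> carrier A \<Longrightarrow> y \<in> carrier A \<Longrightarrow> q (x \<oplus>\<^bsub>A\<^esub> y) = q x \<oplus>\<^bsub>B\<^esub> q y"
    and smult: "\<And>r x. r \<in> carrier R \<Longrightarrow> x \<in> carrier A \<Longrightarrow> q (r \<odot>\<^bsub>A\<^esub> x) = r \<odot>\<^bsub>B\<^esub> q x"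
  shows "module R B"
proof -
  interpret A: module R A by fact
  have ex: "\<exists>x \<in> carrier A. y = q x" if "y \<in> carrier B" for y using that assms(2) by auto
  have cl: "q x \<in> carrier B" if "x \<in> carrier A" for x using that assms(2) by auto
  show ?thesis
  proof (rule moduleI)
    show "cring R" by (rule A.R.is_cring)
    show "abelian_group B"
    proof (rule abelian_groupI)
      show "x \<oplus>\<^bsub>B\<^esub> y \<in> carrier B" if "x \<in> carrier B" "y \<in> carrier B" for x y
        using ex[OF that(1)] ex[OF that(2)] cl by (auto simp: add[symmetric])
      show "\<zero>\<^bsub>B\<^esub> \<in> carrier B" using cl[of "\<zero>\<^bsub>A\<^esub>"] assms(3) by simp
      show "x \<oplus>\<^bsub>B\<^esub> y \<oplus>\<^bsub>B\<^esub> z = x \<oplus>\<^bsub>B\<^esub> (y \<oplus>\<^bsub>B\<^esub> z)" if "x \<in> carrier B" "y \<in> carrier B" "z \<in> carrier B" for x y z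
        using ex[OF that(1)] ex[OF that(2)] ex[OF that(3)] by (auto simp: add[symmetric] A.a_assoc)
      show "x \<oplus>\<^bsub>B\<^esub> y = y \<oplus>\<^bsub>B\<^esub> x" if "x \<in> carrier B" "y \<in> carrier B" for x y
        using ex[OF that(1)] ex[OF that(2)] by (auto simp: add[symmetric] A.a_comm)
      show "\<zero>\<^bsub>B\<^esub> \<oplus>\<^bsub>B\<^esub> x = x" if "x \<in> carrier B" for x
        using ex[OF that] by (auto simp: add[symmetric] assms(3)[symmetric])
      show "\<exists>y\<in>carrier B. y \<oplus>\<^bsub>B\<^esub> x = \<zero>\<^bsub>B\<^esub>" if "x \<in> carrier B" for x
      proof -
        from ex[OF that] obtain u where u: "u \<in> carrier A" "x = q u" by blast
        then have "q (\<ominus>\<^bsub>A\<^esub> u) \<oplus>\<^bsub>B\<^esub> x = \<zero>\<^bsub>B\<^esub>" by (simp add: add[symmetric] A.l_neg assms(3))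
        then show ?thesis using cl[of "\<ominus>\<^bsub>A\<^esub> u"] u by blast
      qed
    qed
    show "\<one>\<^bsub>R\<^esub> \<odot>\<^bsub>B\<^esub> x = x" if "x \<in> carrier B" for x
      using ex[OF that] by (auto simp: smult[symmetric])
  next
    fix a x assume a: "a \<in> carrier R" and "x \<in> carrier B"
    from ex[OF this(2)] obtain u where u: "u \<in> carrier A" "x = q u" by blast
    show "a \<odot>\<^bsub>B\<^esub> x \<in> carrier B" using a u cl by (simp add: smult[symmetric])
    show "(b \<otimes>\<^bsub>R\<^esub> a) \<odot>\<^bsub>B\<^esub> x = b \<odot>\<^bsub>B\<^esub> (a \<odot>\<^bsub>B\<^esub> x)" if "b \<in> carrier R" for b
      using a u that by (simp add: smult[symmetric] A.smult_assoc1)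
    show "(b \<oplus>\<^bsub>R\<^esub> a) \<odot>\<^bsub>B\<^esub> x = b \<odot>\<^bsub>B\<^esub> x \<oplus>\<^bsub>B\<^esub> a \<odot>\<^bsub>B\<^esub> x" if "b \<in> carrier R" for b
      using a u that by (simp add: add[symmetric] smult[symmetric] A.smult_l_distr)
    fix y assume "y \<in> carrier B"
    from ex[OF this] obtain v where "v \<in> carrier A" "y = q v" by blast
    then show "a \<odot>\<^bsub>B\<^esub> (x \<oplus>\<^bsub>B\<^esub> y) = a \<odot>\<^bsub>B\<^esub> x \<oplus>\<^bsub>B\<^esub> a \<odot>\<^bsub>B\<^esub> y"
      using a u by (simp add: add[symmetric] smult[symmetric] A.smult_r_distr)
  qed
qed

section \<open>Quotients, powers and free modules\<close>

lemma submodule_imp_subset: "submodule K R A \<Longrightarrow> K \<subseteq> carrier A"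
  using subgroup.subset submodule.axioms(1) by fastforce

lemma submodule_zero: "submodule K R A \<Longrightarrow> \<zero>\<^bsub>A\<^esub> \<in> K"
  using subgroup.one_closed submodule.axioms(1) by fastforce

context module
begin

context
  fixes K
  assumes K: "submodule K R M"
begin

lemma abelian_subgroup_submodule: "abelian_subgroup K M"
  using K by (intro abelian_subgroupI3 additive_subgroupI abelian_group_axioms) (simp add: submodule.axioms)

lemma coset_mem_iff:
  assumes "x \<in> carrier M"
  shows "u \<in> K +>\<^bsub>M\<^esub> x \<longleftrightarrow> u \<in> carrier M \<and> u \<ominus>\<^bsub>M\<^esub> x \<in> K"
proof
  assume "u \<in> K +>\<^bsub>M\<^esub> x"
  then obtain k where k: "k \<in> K" "u = k \<oplus>\<^bsub>M\<^esub> x" by (auto simp: a_r_coset_def')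
  then have "k \<in> carrier M" using submodule_imp_subset[OF K] by auto
  with k assms show "u \<in> carrier M \<and> u \<ominus>\<^bsub>M\<^esub> x \<in> K" by (simp add: add_minus_cancel)
next
  assume "u \<in> carrier M \<and> u \<ominus>\<^bsub>M\<^esub> x \<in> K"
  then have "u = (u \<ominus>\<^bsub>M\<^esub> x) \<oplus>\<^bsub>M\<^esub> x" "u \<ominus>\<^bsub>M\<^esub> x \<in> K" using assms by (simp_all add: minus_add_cancel)
  then show "u \<in> K +>\<^bsub>M\<^esub> x" unfolding a_r_coset_def' by blast
qed

lemma quot_eq_iff:
  assumes "x \<in> carrier M" "y \<in> carrier M"
  shows "K +>\<^bsub>M\<^esub> x = K +>\<^bsub>M\<^esub> y \<longleftrightarrow> x \<ominus>\<^bsub>M\<^esub> y \<in> K"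
proof -
  interpret abelian_subgroup K M by (rule abelian_subgroup_submodule)
  have "K +>\<^bsub>M\<^esub> x = K +>\<^bsub>M\<^esub> y \<longleftrightarrow> x \<in> K +>\<^bsub>M\<^esub> y"
    using assms a_rcos_self a_repr_independence[OF _ _ a_subgroup] by metis
  also have "\<dots> \<longleftrightarrow> x \<ominus>\<^bsub>M\<^esub> y \<in> K" using assms by (simp add: coset_mem_iff)
  finally show ?thesis .
qed

lemma quot_eq_zero_iff:
  assumes "x \<in> carrier M"
  shows "K +>\<^bsub>M\<^esub> x = K \<longleftrightarrow> x \<in> K"
proof -
  have "K +>\<^bsub>M\<^esub> \<zero>\<^bsub>M\<^esub> = K" by (rule a_coset_add_zero) (rule submodule_imp_subset[OF K])
  then show ?thesis using quot_eq_iff[of x "\<zero>\<^bsub>M\<^esub>"] assms by (simp add: minus_zero)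
qed

lemma quot_carrier: "carrier (quot_mod M K) = (\<lambda>x. K +>\<^bsub>M\<^esub> x) ` carrier M"
  by (auto simp: quot_mod_def A_RCOSETS_def')

lemma quot_zero: "\<zero>\<^bsub>quot_mod M K\<^esub> = K"
  by (simp add: quot_mod_def)

lemma quot_add:
  assumes "x \<in> carrier M" "y \<in> carrier M"
  shows "K +>\<^bsub>M\<^esub> (x \<oplus>\<^bsub>M\<^esub> y) = (K +>\<^bsub>M\<^esub> x) \<oplus>\<^bsub>quot_mod M K\<^esub> (K +>\<^bsub>M\<^esub> y)"
  using abelian_subgroup.a_rcos_sum[OF abelian_subgroup_submodule assms] by (simp add: quot_mod_def)

lemma quot_smult:
  assumes "r \<in> carrier R" "x \<in> carrier M"
  shows "K +>\<^bsub>M\<^esub> (r \<odot>\<^bsub>M\<^esub> x) = r \<odot>\<^bsub>quot_mod M K\<^esub> (K +>\<^bsub>M\<^esub> x)"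
proof -
  interpret abelian_subgroup K M by (rule abelian_subgroup_submodule)
  \<comment> \<open>Scalar multiplication on \<open>quot_mod\<close> is a union over all members of
    a coset. Members differ by elements of \<open>K\<close>, so the union consists of a single
    coset.\<close>
  have "K +>\<^bsub>M\<^esub> (r \<odot>\<^bsub>M\<^esub> u) = K +>\<^bsub>M\<^esub> (r \<odot>\<^bsub>M\<^esub> x)" if u: "u \<in> K +>\<^bsub>M\<^esub> x" for u
  proof -
    have uc: "u \<in> carrier M" using u assms a_r_coset_subset_G[OF submodule_imp_subset[OF K]] by blast
    have "u \<ominus>\<^bsub>M\<^esub> x \<in> K" using u assms by (simp add: coset_mem_iff)
    then have "r \<odot>\<^bsub>M\<^esub> (u \<ominus>\<^bsub>M\<^esub> x) \<in> K" using submoduleE(4)[OF K] assms by simp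
    moreover have "r \<odot>\<^bsub>M\<^esub> (u \<ominus>\<^bsub>M\<^esub> x) = r \<odot>\<^bsub>M\<^esub> u \<ominus>\<^bsub>M\<^esub> r \<odot>\<^bsub>M\<^esub> x"
      using assms uc by (simp add: a_minus_def smult_r_distr smult_r_minus)
    ultimately show ?thesis using quot_eq_iff assms uc by simp
  qed
  then have "(\<Union>u\<in>K +>\<^bsub>M\<^esub> x. K +>\<^bsub>M\<^esub> (r \<odot>\<^bsub>M\<^esub> u)) = K +>\<^bsub>M\<^esub> (r \<odot>\<^bsub>M\<^esub> x)"
    using a_rcos_self[OF assms(2)] by blast
  then show ?thesis by (simp add: quot_mod_def)
qed

lemma quot_module: "module R (quot_mod M K)"
proof (rule module_image[OF module_axioms, where q = "\<lambda>x. K +>\<^bsub>M\<^esub> x"])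
  show "K +>\<^bsub>M\<^esub> \<zero>\<^bsub>M\<^esub> = \<zero>\<^bsub>quot_mod M K\<^esub>"
    using submodule_imp_subset[OF K] by (simp add: quot_zero a_coset_add_zero)
qed (simp_all add: quot_carrier quot_add quot_smult)

lemma quot_hom: "(\<lambda>x. K +>\<^bsub>M\<^esub> x) \<in> mod_hom R M (quot_mod M K)"
  by (rule mod_homI) (simp_all add: quot_carrier quot_add quot_smult)

lemma hom_const_on_coset:
  assumes "module R W" "f \<in> mod_hom R M W" "\<And>x. x \<in> K \<Longrightarrow> f x = \<zero>\<^bsub>W\<^esub>"
    and "x \<in> carrier M" "u \<in> K +>\<^bsub>M\<^esub> x"
  shows "u \<in> carrier M" "f u = f x"
proof -
  interpret abelian_subgroup K M by (rule abelian_subgroup_submodule)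
  interpret W: module R W by fact
  from assms(5) obtain k where k: "k \<in> K" "u = k \<oplus>\<^bsub>M\<^esub> x" by (auto simp: a_r_coset_def')
  then have kc: "k \<in> carrier M" using submodule_imp_subset[OF K] by auto
  then show "u \<in> carrier M" using k assms(4) by simp
  show "f u = f x"
    using k kc assms(3)[OF k(1)] mod_hom_closed[OF assms(2)] assms(4)
    by (simp add: mod_hom_add[OF assms(2)])
qed

lemma quot_lift:
  assumes "module R W" "f \<in> mod_hom R M W" "\<And>x. x \<in> K \<Longrightarrow> f x = \<zero>\<^bsub>W\<^esub>"
  shows "\<exists>h\<in>mod_hom R (quot_mod M K) W. \<forall>x\<in>carrier M. h (K +>\<^bsub>M\<^esub> x) = f x"
proof -
  interpret abelian_subgroup K M by (rule abelian_subgroup_submodule)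
  define h where "h X = f (SOME u. u \<in> X)" for X
  have h: "h (K +>\<^bsub>M\<^esub> x) = f x" if "x \<in> carrier M" for x
    unfolding h_def
    by (rule hom_const_on_coset(2)[OF assms that]) (use a_rcos_self[OF that] in \<open>auto intro: someI\<close>)
  have "h \<in> mod_hom R (quot_mod M K) W"
  proof (rule mod_homI)
    show "h X \<in> carrier W" if "X \<in> carrier (quot_mod M K)" for X
      using that mod_hom_closed[OF assms(2)] by (auto simp: quot_carrier h)
    show "h (X \<oplus>\<^bsub>quot_mod M K\<^esub> Y) = h X \<oplus>\<^bsub>W\<^esub> h Y"
      if "X \<in> carrier (quot_mod M K)" "Y \<in> carrier (quot_mod M K)" for X Y
      using that mod_hom_add[OF assms(2)] by (auto simp: quot_carrier h quot_add[symmetric])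
    show "h (r \<odot>\<^bsub>quot_mod M K\<^esub> X) = r \<odot>\<^bsub>W\<^esub> h X"
      if "r \<in> carrier R" "X \<in> carrier (quot_mod M K)" for r X
      using that mod_hom_smult[OF assms(2)] by (auto simp: quot_carrier h quot_smult[symmetric])
  qed
  with h show ?thesis by blast
qed

end

section \<open>Finite powers of a module\<close>

lemma mod_power_mem_iff:
  "f \<in> carrier (mod_power M n) \<longleftrightarrow> (\<forall>i<n. f i \<in> carrier M) \<and> (\<forall>i. \<not> i < n \<longrightarrow> f i = undefined)"
  by (auto simp: mod_power_def PiE_iff extensional_def)

lemma mod_power_apply:
  "\<zero>\<^bsub>mod_power M n\<^esub> i = (if i < n then \<zero>\<^bsub>M\<^esub> else undefined)"
  "(f \<oplus>\<^bsub>mod_power M n\<^esub> g) i = (if i < n then f i \<oplus>\<^bsub>M\<^esub> g i else undefined)"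
  "(r \<odot>\<^bsub>mod_power M n\<^esub> f) i = (if i < n then r \<odot>\<^bsub>M\<^esub> f i else undefined)"
  by (auto simp: mod_power_def)

lemma mod_power_module: "module R (mod_power M n)"
proof (rule moduleI)
  show "cring R" by (rule R.is_cring)
  show "abelian_group (mod_power M n)"
  proof (rule abelian_groupI)
    fix x assume x: "x \<in> carrier (mod_power M n)"
    let ?y = "\<lambda>i. if i < n then \<ominus>\<^bsub>M\<^esub> x i else undefined"
    have "?y \<in> carrier (mod_power M n)"
      using x by (simp add: mod_power_mem_iff)
    moreover have "?y \<oplus>\<^bsub>mod_power M n\<^esub> x = \<zero>\<^bsub>mod_power M n\<^esub>"
      using x by (intro ext) (simp add: mod_power_mem_iff mod_power_apply M.l_neg)
    ultimately show "\<exists>y\<in>carrier (mod_power M n). y \<oplus>\<^bsub>mod_power M n\<^esub> x = \<zero>\<^bsub>mod_power M n\<^esub>" by blast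
    show "\<zero>\<^bsub>mod_power M n\<^esub> \<oplus>\<^bsub>mod_power M n\<^esub> x = x"
      using x by (intro ext) (simp add: mod_power_mem_iff mod_power_apply)
    fix y assume y: "y \<in> carrier (mod_power M n)"
    show "x \<oplus>\<^bsub>mod_power M n\<^esub> y = y \<oplus>\<^bsub>mod_power M n\<^esub> x"
      using x y by (intro ext) (simp add: mod_power_mem_iff mod_power_apply M.a_comm)
    show "x \<oplus>\<^bsub>mod_power M n\<^esub> y \<in> carrier (mod_power M n)"
      using x y by (simp add: mod_power_mem_iff mod_power_apply)
    fix z assume z: "z \<in> carrier (mod_power M n)"
    show "x \<oplus>\<^bsub>mod_power M n\<^esub> y \<oplus>\<^bsub>mod_power M n\<^esub> z = x \<oplus>\<^bsub>mod_power M n\<^esub> (y \<oplus>\<^bsub>mod_power M n\<^esub> z)"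
      using x y z by (intro ext) (simp add: mod_power_mem_iff mod_power_apply M.a_assoc)
  qed (simp add: mod_power_mem_iff mod_power_apply)
  show "\<one> \<odot>\<^bsub>mod_power M n\<^esub> x = x" if "x \<in> carrier (mod_power M n)" for x
    using that by (intro ext) (simp add: mod_power_mem_iff mod_power_apply)
next
  fix a x assume a: "a \<in> carrier R" and x: "x \<in> carrier (mod_power M n)"
  show "a \<odot>\<^bsub>mod_power M n\<^esub> x \<in> carrier (mod_power M n)"
    using a x by (simp add: mod_power_mem_iff mod_power_apply)

  show "a \<odot>\<^bsub>mod_power M n\<^esub> (x \<oplus>\<^bsub>mod_power M n\<^esub> y) = a \<odot>\<^bsub>mod_power M n\<^esub> x \<oplus>\<^bsub>mod_power M n\<^esub> a \<odot>\<^bsub>mod_power M n\<^esub> y"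
    if "y \<in> carrier (mod_power M n)" for y
    using a x that by (intro ext) (simp add: mod_power_mem_iff mod_power_apply smult_r_distr)
  fix b assume b: "b \<in> carrier R"
  show "(b \<oplus> a) \<odot>\<^bsub>mod_power M n\<^esub> x = b \<odot>\<^bsub>mod_power M n\<^esub> x \<oplus>\<^bsub>mod_power M n\<^esub> a \<odot>\<^bsub>mod_power M n\<^esub> x"
    using a b x by (intro ext) (simp add: mod_power_mem_iff mod_power_apply smult_l_distr)
  show "(b \<otimes> a) \<odot>\<^bsub>mod_power M n\<^esub> x = b \<odot>\<^bsub>mod_power M n\<^esub> (a \<odot>\<^bsub>mod_power M n\<^esub> x)"
    using a b x by (intro ext) (simp add: mod_power_mem_iff mod_power_apply smult_assoc1)
qed

end

section \<open>The ring as a module over itself, and free modules\<close>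

lemma regular_mod_module:
  assumes "cring R"
  shows "module R (regular_mod R)"
proof -
  interpret cring R by fact
  show ?thesis
  proof (rule moduleI)
    show "abelian_group (regular_mod R)"
      by (rule abelian_groupI) (auto simp: regular_mod_def a_ac intro: l_neg a_inv_closed)
  qed (auto simp: regular_mod_def assms m_ac l_distr r_distr)
qed

lemma free_mod_carrierD:
  assumes "f \<in> carrier (free_mod R X)"
  shows "f x \<in> carrier R" "finite {x. f x \<noteq> \<zero>\<^bsub>R\<^esub>}" "{x. f x \<noteq> \<zero>\<^bsub>R\<^esub>} \<subseteq> X"
  using assms by (auto simp: free_mod_def)

lemma free_mod_simps [simp]:
  "\<zero>\<^bsub>free_mod R X\<^esub> = (\<lambda>_. \<zero>\<^bsub>R\<^esub>)"
  "f \<oplus>\<^bsub>free_mod R X\<^esub> g = (\<lambda>x. f x \<oplus>\<^bsub>R\<^esub> g x)"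
  "r \<odot>\<^bsub>free_mod R X\<^esub> f = (\<lambda>x. r \<otimes>\<^bsub>R\<^esub> f x)"
  by (simp_all add: free_mod_def)

lemma free_mod_module:
  assumes "cring R"
  shows "module R (free_mod R X)"
proof -
  interpret cring R by fact
  note fs = rev_finite_subset[OF finite_UnI]
  show ?thesis
  proof (rule moduleI)
    show "abelian_group (free_mod R X)"
    proof (rule abelian_groupI)
      fix f assume f: "f \<in> carrier (free_mod R X)"
      have "{x. \<ominus>\<^bsub>R\<^esub> f x \<noteq> \<zero>\<^bsub>R\<^esub>} \<subseteq> {x. f x \<noteq> \<zero>\<^bsub>R\<^esub>}" by auto
      with f have "(\<lambda>x. \<ominus>\<^bsub>R\<^esub> f x) \<in> carrier (free_mod R X)"
        by (auto simp: free_mod_def intro: finite_subset)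
      moreover have "(\<lambda>x. \<ominus>\<^bsub>R\<^esub> f x) \<oplus>\<^bsub>free_mod R X\<^esub> f = \<zero>\<^bsub>free_mod R X\<^esub>"
        using free_mod_carrierD[OF f] by (simp add: free_mod_def l_neg)
      ultimately show "\<exists>g\<in>carrier (free_mod R X). g \<oplus>\<^bsub>free_mod R X\<^esub> f = \<zero>\<^bsub>free_mod R X\<^esub>" by blast
    next
      fix f g assume fg: "f \<in> carrier (free_mod R X)" "g \<in> carrier (free_mod R X)"
      have "{x. f x \<oplus>\<^bsub>R\<^esub> g x \<noteq> \<zero>\<^bsub>R\<^esub>} \<subseteq> {x. f x \<noteq> \<zero>\<^bsub>R\<^esub>} \<union> {x. g x \<noteq> \<zero>\<^bsub>R\<^esub>}" by auto
      with fg show "f \<oplus>\<^bsub>free_mod R X\<^esub> g \<in> carrier (free_mod R X)"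
        by (auto simp: free_mod_def image_subset_iff intro: fs)
    qed (auto simp: free_mod_def image_subset_iff a_ac)
  next
    fix r f assume rf: "r \<in> carrier R" "f \<in> carrier (free_mod R X)"
    have "{x. r \<otimes>\<^bsub>R\<^esub> f x \<noteq> \<zero>\<^bsub>R\<^esub>} \<subseteq> {x. f x \<noteq> \<zero>\<^bsub>R\<^esub>}" using rf by auto
    with rf show "r \<odot>\<^bsub>free_mod R X\<^esub> f \<in> carrier (free_mod R X)"
      by (auto simp: free_mod_def image_subset_iff intro: finite_subset)
  qed (auto simp: free_mod_def image_subset_iff assms m_ac l_distr r_distr)
qed

lemma basis_vec_mem:
  assumes "cring R" "b \<in> X"
  shows "basis_vec R b \<in> carrier (free_mod R X)"
proof -
  interpret cring R by fact
  have "{x. basis_vec R b x \<noteq> \<zero>\<^bsub>R\<^esub>} \<subseteq> {b}" by (auto simp: basis_vec_def)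
  then show ?thesis using assms by (auto simp: free_mod_def basis_vec_def intro: finite_subset)
qed

lemma lin_ext_eq_lc:
  assumes "module R N" "finite S" "{x. f x \<noteq> \<zero>\<^bsub>R\<^esub>} \<subseteq> S"
    and "\<And>x. x \<in> S \<Longrightarrow> f x \<in> carrier R" "\<And>x. x \<in> S \<Longrightarrow> g x \<in> carrier N"
  shows "lin_ext R N g f = lc N S f g"
proof -
  interpret N: module R N by fact
  show ?thesis unfolding lin_ext_def lc_def
    using assms by (intro N.add.finprod_mono_neutral_cong_left) auto
qed

lemma lin_ext_hom:
  assumes "module R N" "\<And>x. x \<in> X \<Longrightarrow> g x \<in> carrier N"
  shows "lin_ext R N g \<in> mod_hom R (free_mod R X) N"
proof -
  interpret N: module R N by fact
  note fc = free_mod_carrierD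
  show ?thesis
  proof (rule mod_homI)
    fix f assume f: "f \<in> carrier (free_mod R X)"
    let ?S = "{x. f x \<noteq> \<zero>\<^bsub>R\<^esub>}"
    have ef: "lin_ext R N g f = lc N ?S f g"
      using fc[OF f] assms by (intro lin_ext_eq_lc) auto
    then show "lin_ext R N g f \<in> carrier N" using fc[OF f] assms by auto
    show "lin_ext R N g (f \<oplus>\<^bsub>free_mod R X\<^esub> h) = lin_ext R N g f \<oplus>\<^bsub>N\<^esub> lin_ext R N g h"
      if h: "h \<in> carrier (free_mod R X)" for h
    proof -
      \<comment> \<open>\<open>lin_ext\<close> sums over supports, and those of the two arguments
        and of their sum differ. All three sums are taken over the union, where the additional terms
        are zero.\<close>
      let ?T = "?S \<union> {x. h x \<noteq> \<zero>\<^bsub>R\<^esub>}"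
      have T: "finite ?T" "?T \<subseteq> X" using fc[OF f] fc[OF h] by auto
      have "lin_ext R N g (f \<oplus>\<^bsub>free_mod R X\<^esub> h) = lc N ?T (\<lambda>x. f x \<oplus>\<^bsub>R\<^esub> h x) g"
        unfolding free_mod_simps using T fc[OF f] fc[OF h] assms
        by (intro lin_ext_eq_lc) auto
      also have "\<dots> = lc N ?T f g \<oplus>\<^bsub>N\<^esub> lc N ?T h g"
        using T fc[OF f] fc[OF h] assms by (intro N.lc_add_left) auto
      also have "lc N ?T f g = lin_ext R N g f"
        using T fc[OF f] assms by (intro lin_ext_eq_lc[symmetric]) auto
      also have "lc N ?T h g = lin_ext R N g h"
        using T fc[OF h] assms by (intro lin_ext_eq_lc[symmetric]) auto
      finally show ?thesis .
    qed
    show "lin_ext R N g (r \<odot>\<^bsub>free_mod R X\<^esub> f) = r \<odot>\<^bsub>N\<^esub> lin_ext R N g f"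
      if r: "r \<in> carrier R" for r
    proof -
      have "lin_ext R N g (r \<odot>\<^bsub>free_mod R X\<^esub> f) = lc N ?S (\<lambda>x. r \<otimes>\<^bsub>R\<^esub> f x) g"
        unfolding free_mod_simps using fc[OF f] r assms by (intro lin_ext_eq_lc) auto
      then show ?thesis unfolding ef using fc[OF f] r assms by (subst (asm) N.lc_smult) auto
    qed
  qed
qed

lemma lin_ext_basis:
  assumes "module R N" "g b \<in> carrier N"
  shows "lin_ext R N g (basis_vec R b) = g b"
proof -
  interpret N: module R N by fact
  have "lin_ext R N g (basis_vec R b) = lc N {b} (basis_vec R b) g"
    using assms by (intro lin_ext_eq_lc) (auto simp: basis_vec_def)
  then show ?thesis using assms by (simp add: lc_def basis_vec_def)
qed

lemma free_mod_eval_hom: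
  assumes "cring R"
  shows "(\<lambda>f. f x) \<in> mod_hom R (free_mod R X) (regular_mod R)"
  by (rule mod_homI) (auto simp: free_mod_carrierD regular_mod_def)

lemma free_mod_expand:
  assumes "cring R" "f \<in> carrier (free_mod R X)"
  shows "f = lc (free_mod R X) {x. f x \<noteq> \<zero>\<^bsub>R\<^esub>} f (basis_vec R)"
proof
  interpret cring R by fact
  interpret Rm: module R "regular_mod R" by (rule regular_mod_module) fact
  let ?S = "{x. f x \<noteq> \<zero>\<^bsub>R\<^esub>}"
  note fc = free_mod_carrierD[OF assms(2)]
  fix y
  \<comment> \<open>Evaluation at \<open>y\<close> is linear, which reduces the identity to one
    coordinate; there only the term with index \<open>y\<close> survives.\<close>
  have "lc (free_mod R X) ?S f (basis_vec R) y = lc (regular_mod R) ?S f (\<lambda>x. basis_vec R x y)"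
    using fc assms(1)
    by (intro mod_hom_lc[OF free_mod_module regular_mod_module free_mod_eval_hom])
       (auto intro!: basis_vec_mem)
  also have "\<dots> = (\<Oplus>\<^bsub>regular_mod R\<^esub>x\<in>?S. if y = x then f x else \<zero>\<^bsub>regular_mod R\<^esub>)"
    unfolding lc_def using fc
    by (intro Rm.finsum_cong') (auto simp: basis_vec_def regular_mod_def)
  also have "\<dots> = f y"
  proof (cases "y \<in> ?S")
    case True
    then show ?thesis using fc by (subst Rm.finsum_singleton) (auto simp: regular_mod_def)
  next
    case False
    have "(\<Oplus>\<^bsub>regular_mod R\<^esub>x\<in>?S. if y = x then f x else \<zero>\<^bsub>regular_mod R\<^esub>) = \<zero>\<^bsub>regular_mod R\<^esub>"
      using False by (intro Rm.add.finprod_one_eqI) auto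
    then show ?thesis using False by (simp add: regular_mod_def)
  qed
  finally show "f y = lc (free_mod R X) ?S f (basis_vec R) y" ..
qed

lemma free_mod_hom_expand:
  assumes "module R N" "h \<in> mod_hom R (free_mod R X) N" "f \<in> carrier (free_mod R X)"
  shows "h f = lc N {x. f x \<noteq> \<zero>\<^bsub>R\<^esub>} f (\<lambda>x. h (basis_vec R x))"
proof -
  interpret N: module R N by fact
  note fc = free_mod_carrierD[OF assms(3)]
  have "h f = h (lc (free_mod R X) {x. f x \<noteq> \<zero>\<^bsub>R\<^esub>} f (basis_vec R))"
    using free_mod_expand[OF N.R.is_cring assms(3)] by simp
  also have "\<dots> = lc N {x. f x \<noteq> \<zero>\<^bsub>R\<^esub>} f (\<lambda>x. h (basis_vec R x))"
    using fc N.R.is_cring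
    by (intro mod_hom_lc[OF free_mod_module assms(1,2)]) (auto intro!: basis_vec_mem)
  finally show ?thesis .
qed

lemma free_mod_hom_eqI:
  assumes "module R N" "h \<in> mod_hom R (free_mod R X) N" "h' \<in> mod_hom R (free_mod R X) N"
    and "\<And>b. b \<in> X \<Longrightarrow> h (basis_vec R b) = h' (basis_vec R b)"
    and "f \<in> carrier (free_mod R X)"
  shows "h f = h' f"
proof -
  interpret N: module R N by fact
  have "lc N {x. f x \<noteq> \<zero>\<^bsub>R\<^esub>} f (\<lambda>x. h (basis_vec R x)) = lc N {x. f x \<noteq> \<zero>\<^bsub>R\<^esub>} f (\<lambda>x. h' (basis_vec R x))"
    using free_mod_carrierD[OF assms(5)] assms(4) N.R.is_cring
    by (intro lc_cong[OF assms(1)]) (auto intro!: basis_vec_mem mod_hom_closed[OF assms(3)])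
  then show ?thesis by (simp add: free_mod_hom_expand[OF assms(1) _ assms(5)] assms(2,3))
qed

section \<open>Spans, kernels and images\<close>

lemma mod_span_submodule:
  assumes "module R A" "S \<subseteq> carrier A"
  shows "submodule (mod_span R A S) R A"
proof -
  interpret A: module R A by fact
  have c: "submodule (carrier A) R A" by (rule A.carrier_is_submodule)
  show ?thesis unfolding mod_span_def
    using assms(2) c
    by (intro A.submoduleI)
       (auto intro: submodule_zero A.submoduleE(3,4,5))
qed

lemma mod_span_superset: "S \<subseteq> mod_span R A S"
  by (auto simp: mod_span_def)

lemma mod_span_least: "submodule N R A \<Longrightarrow> S \<subseteq> N \<Longrightarrow> mod_span R A S \<subseteq> N"
  by (auto simp: mod_span_def)

lemma mod_hom_kernel_submodule:
  assumes "module R A" "module R B" "f \<in> mod_hom R A B"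
  shows "submodule {x \<in> carrier A. f x = \<zero>\<^bsub>B\<^esub>} R A"
proof -
  interpret A: module R A by fact
  interpret B: module R B by fact
  show ?thesis
    by (rule A.submoduleI)
       (auto simp: mod_hom_zero[OF assms] mod_hom_add[OF assms(3)] mod_hom_smult[OF assms(3)] A.smult_minus_one)
qed

lemma mod_hom_image_submodule:
  assumes "module R A" "module R B" "f \<in> mod_hom R A B"
  shows "submodule (f ` carrier A) R B"
proof -
  interpret A: module R A by fact
  interpret B: module R B by fact
  show ?thesis
  proof (rule B.submoduleI)
    show "\<zero>\<^bsub>B\<^esub> \<in> f ` carrier A" using mod_hom_zero[OF assms] by (metis A.zero_closed imageI)
    show "\<ominus>\<^bsub>B\<^esub> a \<in> f ` carrier A" if "a \<in> f ` carrier A" for a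
      using that mod_hom_closed[OF assms(3)]
      by (auto simp: B.smult_minus_one mod_hom_smult[OF assms(3), symmetric])
  qed (use mod_hom_closed[OF assms(3)] in
      \<open>auto simp: mod_hom_add[OF assms(3), symmetric] mod_hom_smult[OF assms(3), symmetric]\<close>)
qed

section \<open>Tensor products\<close>

definition bilinear_map ::
  "('a, 'r) ring_scheme \<Rightarrow> ('a, 'b, 'x) module_scheme \<Rightarrow> ('a, 'c, 'y) module_scheme
    \<Rightarrow> ('a, 'd, 'z) module_scheme \<Rightarrow> ('b \<Rightarrow> 'c \<Rightarrow> 'd) \<Rightarrow> bool"
where
  "bilinear_map R A B W g \<longleftrightarrow>
    (\<forall>x\<in>carrier A. g x \<in> mod_hom R B W) \<and> (\<forall>y\<in>carrier B. (\<lambda>x. g x y) \<in> mod_hom R A W)"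

lemma bilinear_mapI:
  assumes "\<And>x. x \<in> carrier A \<Longrightarrow> g x \<in> mod_hom R B W"
    and "\<And>y. y \<in> carrier B \<Longrightarrow> (\<lambda>x. g x y) \<in> mod_hom R A W"
  shows "bilinear_map R A B W g"
  using assms by (simp add: bilinear_map_def)

lemma
  assumes "bilinear_map R A B W g"
  shows bilinear_map_right: "x \<in> carrier A \<Longrightarrow> g x \<in> mod_hom R B W"
    and bilinear_map_left: "y \<in> carrier B \<Longrightarrow> (\<lambda>x. g x y) \<in> mod_hom R A W"
  using assms by (auto simp: bilinear_map_def)

locale tensor_product =
  A: module R A + B: module R B
  for R :: "('a, 'r) ring_scheme"
    and A :: "('a, 'b, 'x) module_scheme" and B :: "('a, 'c, 'y) module_scheme"
begin

abbreviation F where "F \<equiv> free_mod R (carrier A \<times> carrier B)"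
abbreviation T where "T \<equiv> tensor_mod R A B"
abbreviation rel where "rel \<equiv> tensor_rel R A B"
abbreviation elt where "elt \<equiv> tensor_elt R A B"

lemma F_module: "module R F"
  by (rule free_mod_module) (rule A.R.is_cring)

sublocale F: module R F
  by (rule F_module)

lemma e_mem: "x \<in> carrier A \<Longrightarrow> y \<in> carrier B \<Longrightarrow> basis_vec R (x, y) \<in> carrier F"
  by (intro basis_vec_mem A.R.is_cring) simp

definition gens where
  "gens = (let e = (\<lambda>x y. basis_vec R (x, y)) in
       ({e (x \<oplus>\<^bsub>A\<^esub> x') y \<ominus>\<^bsub>F\<^esub> (e x y \<oplus>\<^bsub>F\<^esub> e x' y) | x x' y.
           x \<in> carrier A \<and> x' \<in> carrier A \<and> y \<in> carrier B} \<union>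
        {e x (y \<oplus>\<^bsub>B\<^esub> y') \<ominus>\<^bsub>F\<^esub> (e x y \<oplus>\<^bsub>F\<^esub> e x y') | x y y'.
           x \<in> carrier A \<and> y \<in> carrier B \<and> y' \<in> carrier B} \<union>
        {e (r \<odot>\<^bsub>A\<^esub> x) y \<ominus>\<^bsub>F\<^esub> r \<odot>\<^bsub>F\<^esub> e x y | r x y.
           r \<in> carrier R \<and> x \<in> carrier A \<and> y \<in> carrier B} \<union>
        {e x (r \<odot>\<^bsub>B\<^esub> y) \<ominus>\<^bsub>F\<^esub> r \<odot>\<^bsub>F\<^esub> e x y | r x y.
           r \<in> carrier R \<and> x \<in> carrier A \<and> y \<in> carrier B}))"

lemma rel_eq_span: "rel = mod_span R F gens"
  by (simp add: tensor_rel_def gens_def Let_def)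

lemma gens_subset: "gens \<subseteq> carrier F"
  unfolding gens_def Let_def
  by (auto simp del: free_mod_simps intro!: F.minus_closed F.a_closed F.smult_closed e_mem)

lemma rel_submodule: "submodule rel R F"
  unfolding rel_eq_span by (rule mod_span_submodule[OF F_module gens_subset])

lemma gens_rel: "gens \<subseteq> rel"
  unfolding rel_eq_span by (rule mod_span_superset)

lemma tensor_module: "module R T"
  unfolding tensor_mod_def by (rule F.quot_module[OF rel_submodule])

sublocale T: module R T
  by (rule tensor_module)

lemma class_hom: "(\<lambda>\<phi>. rel +>\<^bsub>F\<^esub> \<phi>) \<in> mod_hom R F T"
  unfolding tensor_mod_def by (rule F.quot_hom[OF rel_submodule])

lemma class_eqI:
  assumes "\<phi> \<ominus>\<^bsub>F\<^esub> \<psi> \<in> gens" "\<phi> \<in> carrier F" "\<psi> \<in> carrier F"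
  shows "rel +>\<^bsub>F\<^esub> \<phi> = rel +>\<^bsub>F\<^esub> \<psi>"
  using assms gens_rel by (subst F.quot_eq_iff[OF rel_submodule]) auto

lemma elt_bilinear: "bilinear_map R A B T elt"
proof (rule bilinear_mapI)
  note c = mod_hom_add[OF class_hom, symmetric] mod_hom_smult[OF class_hom, symmetric]
  note m = e_mem F.a_closed F.smult_closed A.a_closed A.smult_closed B.a_closed B.smult_closed
  fix x assume x: "x \<in> carrier A"
  show "elt x \<in> mod_hom R B T"
  proof (rule mod_homI)
    fix y assume y: "y \<in> carrier B"
    show "elt x y \<in> carrier T"
      unfolding tensor_elt_def using mod_hom_closed[OF class_hom e_mem[OF x y]] .
    show "elt x (y \<oplus>\<^bsub>B\<^esub> y') = elt x y \<oplus>\<^bsub>T\<^esub> elt x y'" if "y' \<in> carrier B" for y'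
      unfolding tensor_elt_def c(1)[OF e_mem[OF x y] e_mem[OF x that]]
      using x y that by (intro class_eqI m) (auto simp: gens_def Let_def simp del: free_mod_simps)
    show "elt x (r \<odot>\<^bsub>B\<^esub> y) = r \<odot>\<^bsub>T\<^esub> elt x y" if "r \<in> carrier R" for r
      unfolding tensor_elt_def c(2)[OF that e_mem[OF x y]]
      using x y that by (intro class_eqI m) (auto simp: gens_def Let_def simp del: free_mod_simps)
  qed
next
  note c = mod_hom_add[OF class_hom, symmetric] mod_hom_smult[OF class_hom, symmetric]
  note m = e_mem F.a_closed F.smult_closed A.a_closed A.smult_closed B.a_closed B.smult_closed
  fix y assume y: "y \<in> carrier B"
  show "(\<lambda>x. elt x y) \<in> mod_hom R A T"
  proof (rule mod_homI)
    fix x assume x: "x \<in> carrier A"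
    show "elt x y \<in> carrier T"
      unfolding tensor_elt_def using mod_hom_closed[OF class_hom e_mem[OF x y]] .
    show "elt (x \<oplus>\<^bsub>A\<^esub> x') y = elt x y \<oplus>\<^bsub>T\<^esub> elt x' y" if "x' \<in> carrier A" for x'
      unfolding tensor_elt_def c(1)[OF e_mem[OF x y] e_mem[OF that y]]
      using x y that by (intro class_eqI m) (auto simp: gens_def Let_def simp del: free_mod_simps)
    show "elt (r \<odot>\<^bsub>A\<^esub> x) y = r \<odot>\<^bsub>T\<^esub> elt x y" if "r \<in> carrier R" for r
      unfolding tensor_elt_def c(2)[OF that e_mem[OF x y]]
      using x y that by (intro class_eqI m) (auto simp: gens_def Let_def simp del: free_mod_simps)
  qed
qed

lemmas elt_hom_right = bilinear_map_right[OF elt_bilinear]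
lemmas elt_hom_left = bilinear_map_left[OF elt_bilinear]

lemma elt_closed: "x \<in> carrier A \<Longrightarrow> y \<in> carrier B \<Longrightarrow> elt x y \<in> carrier T"
  using mod_hom_closed[OF elt_hom_right] .

text \<open>The kernel of the linear extension is a submodule and contains each defining relation
  because \<open>g\<close> is bilinear; hence it contains their span.\<close>

lemma lin_ext_kills_rel:
  assumes "module R W" "bilinear_map R A B W g" "\<phi> \<in> rel"
  shows "lin_ext R W (\<lambda>(x, y). g x y) \<phi> = \<zero>\<^bsub>W\<^esub>"
proof -
  interpret W: module R W by fact
  let ?f = "lin_ext R W (\<lambda>(x, y). g x y)"
  have gc: "g x y \<in> carrier W" if "x \<in> carrier A" "y \<in> carrier B" for x y
    using mod_hom_closed[OF bilinear_map_right[OF assms(2)]] that .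
  have f: "?f \<in> mod_hom R F W" using gc by (intro lin_ext_hom assms(1)) auto
  have fe: "?f (basis_vec R (x, y)) = g x y" if "x \<in> carrier A" "y \<in> carrier B" for x y
    using gc[OF that] by (subst lin_ext_basis[OF assms(1)]) auto
  have z: "?f (\<phi> \<ominus>\<^bsub>F\<^esub> \<psi>) = \<zero>\<^bsub>W\<^esub>" if "\<phi> \<in> carrier F" "\<psi> \<in> carrier F" "?f \<phi> = ?f \<psi>" for \<phi> \<psi>
    using that mod_hom_closed[OF f] by (simp add: mod_hom_minus[OF F_module assms(1) f] W.minus_eq_zero_iff)
  note c = mod_hom_add[OF f] mod_hom_smult[OF f]
  note m = e_mem F.a_closed F.smult_closed A.a_closed A.smult_closed B.a_closed B.smult_closed
  note g = mod_hom_add[OF bilinear_map_right[OF assms(2)]] mod_hom_add[OF bilinear_map_left[OF assms(2)]]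
    mod_hom_smult[OF bilinear_map_right[OF assms(2)]] mod_hom_smult[OF bilinear_map_left[OF assms(2)]]
  have "?f \<gamma> = \<zero>\<^bsub>W\<^esub>" if "\<gamma> \<in> gens" for \<gamma>
    using that unfolding gens_def Let_def
    by (auto simp: c e_mem fe g simp del: free_mod_simps intro!: z m)
  then have "gens \<subseteq> {\<phi> \<in> carrier F. ?f \<phi> = \<zero>\<^bsub>W\<^esub>}" using gens_subset by blast
  then have "rel \<subseteq> {\<phi> \<in> carrier F. ?f \<phi> = \<zero>\<^bsub>W\<^esub>}"
    unfolding rel_eq_span by (intro mod_span_least mod_hom_kernel_submodule[OF F_module assms(1) f])
  with assms(3) show ?thesis by blast
qed

lemma tensor_lift:
  assumes "module R W" "bilinear_map R A B W g"
  shows "\<exists>h\<in>mod_hom R T W. \<forall>x\<in>carrier A. \<forall>y\<in>carrier B. h (elt x y) = g x y"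
proof -
  let ?f = "lin_ext R W (\<lambda>(x, y). g x y)"
  have gc: "g x y \<in> carrier W" if "x \<in> carrier A" "y \<in> carrier B" for x y
    using mod_hom_closed[OF bilinear_map_right[OF assms(2)]] that .
  have f: "?f \<in> mod_hom R F W" using gc by (intro lin_ext_hom assms(1)) auto
  have fe: "?f (basis_vec R (x, y)) = g x y" if "x \<in> carrier A" "y \<in> carrier B" for x y
    using gc[OF that] by (subst lin_ext_basis[OF assms(1)]) auto
  obtain h where h: "h \<in> mod_hom R T W" "\<forall>\<phi>\<in>carrier F. h (rel +>\<^bsub>F\<^esub> \<phi>) = ?f \<phi>"
    using F.quot_lift[OF rel_submodule assms(1) f lin_ext_kills_rel[OF assms]]
    unfolding tensor_mod_def by auto
  then show ?thesis by (intro bexI[of _ h]) (auto simp: tensor_elt_def e_mem fe)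
qed

lemma tensor_generated:
  assumes "submodule N R T" "\<And>x y. x \<in> carrier A \<Longrightarrow> y \<in> carrier B \<Longrightarrow> elt x y \<in> N" "t \<in> carrier T"
  shows "t \<in> N"
proof -
  obtain \<phi> where \<phi>: "\<phi> \<in> carrier F" "t = rel +>\<^bsub>F\<^esub> \<phi>"
    using assms(3) unfolding tensor_mod_def F.quot_carrier[OF rel_submodule] by auto
  note fc = free_mod_carrierD[OF \<phi>(1)]
  have "t = lc T {p. \<phi> p \<noteq> \<zero>\<^bsub>R\<^esub>} \<phi> (\<lambda>p. rel +>\<^bsub>F\<^esub> basis_vec R p)"
    unfolding \<phi>(2) by (rule free_mod_hom_expand[OF tensor_module class_hom \<phi>(1)])
  also have "\<dots> \<in> N"
    using fc assms(2) by (intro T.submodule_lc[OF assms(1)]) (auto simp: tensor_elt_def)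
  finally show ?thesis .
qed

lemma tensor_hom_eqI:
  assumes "module R W" "h \<in> mod_hom R T W" "h' \<in> mod_hom R T W"
    and "\<And>x y. x \<in> carrier A \<Longrightarrow> y \<in> carrier B \<Longrightarrow> h (elt x y) = h' (elt x y)"
    and "t \<in> carrier T"
  shows "h t = h' t"
proof -
  interpret W: module R W by fact
  note h = mod_hom_closed[OF assms(2)] mod_hom_closed[OF assms(3)]
  have "submodule {t \<in> carrier T. h t = h' t} R T"
    by (rule T.submoduleI)
       (auto simp: mod_hom_zero[OF tensor_module assms(1,2)] mod_hom_zero[OF tensor_module assms(1,3)]
         mod_hom_add[OF assms(2)] mod_hom_add[OF assms(3)] mod_hom_smult[OF assms(2)]
         mod_hom_smult[OF assms(3)] T.smult_minus_one)
  from tensor_generated[OF this _ assms(5)] show ?thesis using assms(4) elt_closed by auto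
qed

end

text \<open>\<open>tensor_map\<close> is a union over all representatives. It is a single class
  because the map of free modules followed by the class map agrees with the linear extension of a
  bilinear map, so it kills the relations and is constant on cosets.\<close>

lemma tensor_map_hom:
  assumes "module R A" "module R A'" "module R B" "f \<in> mod_hom R A A'"
  shows "tensor_map R A' B f \<in> mod_hom R (tensor_mod R A B) (tensor_mod R A' B)"
    and "x \<in> carrier A \<Longrightarrow> y \<in> carrier B \<Longrightarrow>
      tensor_map R A' B f (tensor_elt R A B x y) = tensor_elt R A' B (f x) y"
proof -
  interpret T: tensor_product R A B using assms by (simp add: tensor_product_def)
  interpret T': tensor_product R A' B using assms by (simp add: tensor_product_def)
  let ?g = "\<lambda>(x, y). basis_vec R (f x, y)"
  let ?l = "lin_ext R T'.F ?g"
  have fm: "f x \<in> carrier A'" if "x \<in> carrier A" for x using mod_hom_closed[OF assms(4) that] .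
  have l: "?l \<in> mod_hom R T.F T'.F"
    using fm by (intro lin_ext_hom T'.F_module) (auto intro!: T'.e_mem)
  let ?q = "\<lambda>\<phi>. T'.rel +>\<^bsub>T'.F\<^esub> ?l \<phi>"
  have q: "?q \<in> mod_hom R T.F T'.T" by (rule mod_hom_comp[OF l T'.class_hom])
  have bil: "bilinear_map R A B T'.T (\<lambda>x y. T'.elt (f x) y)"
  proof (rule bilinear_mapI)
    show "T'.elt (f x) \<in> mod_hom R B T'.T" if "x \<in> carrier A" for x
      by (rule T'.elt_hom_right[OF fm[OF that]])
    show "(\<lambda>x. T'.elt (f x) y) \<in> mod_hom R A T'.T" if "y \<in> carrier B" for y
      by (rule mod_hom_comp[OF assms(4) T'.elt_hom_left[OF that]])
  qed
  have qe: "?q (basis_vec R (x, y)) = T'.elt (f x) y" if "x \<in> carrier A" "y \<in> carrier B" for x y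
    using T'.e_mem[OF fm[OF that(1)] that(2)]
    by (subst lin_ext_basis[OF T'.F_module]) (auto simp: tensor_elt_def)
  have l2: "lin_ext R T'.T (\<lambda>(x, y). T'.elt (f x) y) \<in> mod_hom R T.F T'.T"
    using fm by (intro lin_ext_hom T'.tensor_module) (auto intro!: T'.elt_closed)
  have kill: "?q \<phi> = \<zero>\<^bsub>T'.T\<^esub>" if "\<phi> \<in> T.rel" for \<phi>
  proof -
    have "?q \<phi> = lin_ext R T'.T (\<lambda>(x, y). T'.elt (f x) y) \<phi>"
    proof (rule free_mod_hom_eqI[OF T'.tensor_module q l2])
      show "\<phi> \<in> carrier T.F" using that submodule_imp_subset[OF T.rel_submodule] by blast
      show "?q (basis_vec R b) = lin_ext R T'.T (\<lambda>(x, y). T'.elt (f x) y) (basis_vec R b)"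
        if "b \<in> carrier A \<times> carrier B" for b
        using that fm T'.elt_closed qe
        by (subst lin_ext_basis[OF T'.tensor_module]) auto
    qed
    then show ?thesis using T.lin_ext_kills_rel[OF T'.tensor_module bil that] by simp
  qed
  have val: "tensor_map R A' B f (T.rel +>\<^bsub>T.F\<^esub> \<phi>) = ?q \<phi>" if "\<phi> \<in> carrier T.F" for \<phi>
  proof -
    have "?q \<psi> = ?q \<phi>" if "\<psi> \<in> T.rel +>\<^bsub>T.F\<^esub> \<phi>" for \<psi>
      by (rule T.F.hom_const_on_coset(2)[OF T.rel_submodule T'.tensor_module q kill \<open>\<phi> \<in> carrier T.F\<close> that])
    moreover have "\<phi> \<in> T.rel +>\<^bsub>T.F\<^esub> \<phi>"
      using that abelian_subgroup.a_rcos_self[OF T.F.abelian_subgroup_submodule[OF T.rel_submodule]] by blast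
    ultimately show ?thesis unfolding tensor_map_def Let_def by blast
  qed
  obtain h where h: "h \<in> mod_hom R T.T T'.T" "\<forall>\<phi>\<in>carrier T.F. h (T.rel +>\<^bsub>T.F\<^esub> \<phi>) = ?q \<phi>"
    using T.F.quot_lift[OF T.rel_submodule T'.tensor_module q kill] unfolding tensor_mod_def[of R A B] by auto
  have eq: "tensor_map R A' B f t = h t" if "t \<in> carrier T.T" for t
    using that val h(2) unfolding tensor_mod_def T.F.quot_carrier[OF T.rel_submodule] by auto
  show "tensor_map R A' B f \<in> mod_hom R T.T T'.T"
    by (rule mod_homI) (simp_all add: eq mod_hom_closed[OF h(1)] mod_hom_add[OF h(1)] mod_hom_smult[OF h(1)])
  show "tensor_map R A' B f (T.elt x y) = T'.elt (f x) y" if "x \<in> carrier A" "y \<in> carrier B"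
    using val[OF T.e_mem[OF that]] qe[OF that] by (simp add: tensor_elt_def)
qed

text \<open>Complexes of projectives are tensored with C on the right, whereas the Auslander class
  has C on the left.\<close>

lemma tensor_swap:
  assumes "module R A" "module R B"
  shows "\<exists>h\<in>mod_hom R (tensor_mod R A B) (tensor_mod R B A).
    \<forall>x\<in>carrier A. \<forall>y\<in>carrier B. h (tensor_elt R A B x y) = tensor_elt R B A y x"
proof -
  interpret T: tensor_product R A B using assms by (simp add: tensor_product_def)
  interpret T': tensor_product R B A using assms by (simp add: tensor_product_def)
  show ?thesis
    by (intro T.tensor_lift T'.tensor_module bilinear_mapI T'.elt_hom_left T'.elt_hom_right)
qed

section \<open>Resolutions by finitely generated free modules\<close>

lemma lc_reindex:
  assumes "module R A" "inj_on h T"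
    and "\<And>i. i \<in> T \<Longrightarrow> a (h i) \<in> carrier R" "\<And>i. i \<in> T \<Longrightarrow> x (h i) \<in> carrier A"
  shows "lc A (h ` T) a x = lc A T (\<lambda>i. a (h i)) (\<lambda>i. x (h i))"
proof -
  interpret A: module R A by fact
  show ?thesis unfolding lc_def
    using assms(2-) by (intro A.finsum_reindex) auto
qed

lemma lc_span_submodule:
  assumes "module R A" "finite S" "S \<subseteq> carrier A"
  shows "submodule {lc A S a (\<lambda>s. s) | a. \<forall>s\<in>S. a s \<in> carrier R} R A" (is "submodule ?P R A")
    and "S \<subseteq> {lc A S a (\<lambda>s. s) | a. \<forall>s\<in>S. a s \<in> carrier R}"
proof -
  interpret A: module R A by fact
  have S: "s \<in> carrier A" if "s \<in> S" for s using assms that by auto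
  have PI: "x \<in> ?P" if "x = lc A S a (\<lambda>s. s)" "\<And>s. s \<in> S \<Longrightarrow> a s \<in> carrier R" for x a
    using that by blast
  show "submodule ?P R A"
  proof (rule A.submoduleI)
    show "?P \<subseteq> carrier A" using S by auto
    show "\<zero>\<^bsub>A\<^esub> \<in> ?P"
    proof (rule PI)
      show "\<zero>\<^bsub>A\<^esub> = lc A S (\<lambda>_. \<zero>\<^bsub>R\<^esub>) (\<lambda>s. s)" using S by (simp add: A.lc_zero_left)
    qed simp
    have sm: "r \<odot>\<^bsub>A\<^esub> x \<in> ?P" if r: "r \<in> carrier R" and x: "x \<in> ?P" for r x
    proof -
      from x obtain a where a: "\<forall>s\<in>S. a s \<in> carrier R" "x = lc A S a (\<lambda>s. s)" by blast
      show ?thesis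
      proof (rule PI)
        show "r \<odot>\<^bsub>A\<^esub> x = lc A S (\<lambda>s. r \<otimes>\<^bsub>R\<^esub> a s) (\<lambda>s. s)" using a S r assms(2) by (simp add: A.lc_smult)
      qed (use a r in simp)
    qed
    show "\<ominus>\<^bsub>A\<^esub> x \<in> ?P" if "x \<in> ?P" for x
    proof -
      have "x \<in> carrier A" using that S by auto
      then show ?thesis using sm[OF _ that, of "\<ominus>\<^bsub>R\<^esub> \<one>\<^bsub>R\<^esub>"] by (simp add: A.smult_minus_one)
    qed
    show "r \<odot>\<^bsub>A\<^esub> x \<in> ?P" if "r \<in> carrier R" "x \<in> ?P" for r x
      using sm[OF that] .
    fix x y assume "x \<in> ?P" "y \<in> ?P"
    then obtain a b where ab: "\<forall>s\<in>S. a s \<in> carrier R" "x = lc A S a (\<lambda>s. s)"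
      "\<forall>s\<in>S. b s \<in> carrier R" "y = lc A S b (\<lambda>s. s)" by blast
    show "x \<oplus>\<^bsub>A\<^esub> y \<in> ?P"
    proof (rule PI)
      show "x \<oplus>\<^bsub>A\<^esub> y = lc A S (\<lambda>s. a s \<oplus>\<^bsub>R\<^esub> b s) (\<lambda>s. s)" using ab S by (simp add: A.lc_add_left)
    qed (use ab in simp)
  qed
  show "S \<subseteq> ?P"
  proof
    fix s assume s: "s \<in> S"
    show "s \<in> ?P"
    proof (rule PI)
      show "s = lc A S (\<lambda>j. if j = s then \<one>\<^bsub>R\<^esub> else \<zero>\<^bsub>R\<^esub>) (\<lambda>s. s)"
        using S assms(2) s by (subst A.lc_delta) auto
    qed simp
  qed
qed

section \<open>Finite generation of submodules over a Noetherian ring\<close>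

lemma submodule_regular_imp_ideal:
  assumes "cring R" "submodule J R (regular_mod R)"
  shows "ideal J R"
proof -
  interpret cring R by fact
  interpret M: module R "regular_mod R" by (rule regular_mod_module) fact
  note e = M.submoduleE[OF assms(2)]
  have J: "J \<subseteq> carrier R" using e(1) by (simp add: regular_mod_def)
  show ?thesis
  proof (rule idealI)
    show "ring R" by (rule ring_axioms)
    show "subgroup J (add_monoid R)"
    proof (rule add.subgroupI)
      show "\<ominus>\<^bsub>R\<^esub> a \<in> J" if "a \<in> J" for a
        using e(4)[of "\<ominus>\<^bsub>R\<^esub> \<one>\<^bsub>R\<^esub>" a] that J by (auto simp: regular_mod_def l_minus)
    qed (use e J in \<open>auto simp: regular_mod_def\<close>)
    show "x \<otimes>\<^bsub>R\<^esub> a \<in> J" if "a \<in> J" "x \<in> carrier R" for a x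
      using e(4)[OF that(2,1)] by (simp add: regular_mod_def)
    show "a \<otimes>\<^bsub>R\<^esub> x \<in> J" if "a \<in> J" "x \<in> carrier R" for a x
      using e(4)[OF that(2,1)] that J by (auto simp: regular_mod_def m_comm)
  qed
qed

lemma free_mod_mono_hom:
  assumes "X \<subseteq> Y"
  shows "(\<lambda>f. f) \<in> mod_hom R (free_mod R X) (free_mod R Y)"
  using assms by (intro mod_homI) (auto simp: free_mod_def)

text \<open>Induction on the rank. The coordinates at \<open>b\<close> of elements of
  \<open>N\<close> form an ideal, which is finitely generated, and the elements whose coordinate is
  zero form a submodule of a free module of smaller rank. Lifts of generators of the ideal and
  generators of this kernel generate \<open>N\<close> together.\<close>

lemma free_mod_submodule_fin_gen:
  assumes "cring R" "noetherian_ring R" "finite X" "submodule N R (free_mod R X)"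
  shows "\<exists>S. finite S \<and> S \<subseteq> N \<and>
    (\<forall>f\<in>N. \<exists>a. (\<forall>s\<in>S. a s \<in> carrier R) \<and> f = lc (free_mod R X) S a (\<lambda>s. s))"
  using assms(3,4)
proof (induction X arbitrary: N rule: finite_induct)
  case empty
  interpret F: module R "free_mod R {}" by (rule free_mod_module) fact
  have "f = lc (free_mod R {}) {} (\<lambda>s. undefined) (\<lambda>s. s)" if "f \<in> N" for f
    using that submodule_imp_subset[OF empty] free_mod_carrierD(3)[of f R "{}"]
    by (auto simp: lc_def F.finsum_empty)
  then show ?case by (intro exI[of _ "{}"]) auto
next
  case (insert b X)
  interpret R: cring R by fact
  interpret N: noetherian_ring R by fact
  let ?F = "free_mod R (insert b X)" and ?G = "free_mod R X"
  interpret F: module R ?F by (rule free_mod_module) fact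
  interpret G: module R ?G by (rule free_mod_module) fact
  interpret M: module R "regular_mod R" by (rule regular_mod_module) fact
  note Ne = F.submoduleE[OF insert.prems]
  have Nc: "f \<in> carrier ?F" if "f \<in> N" for f using Ne(1) that by blast
  note fc = free_mod_carrierD[OF Nc]
  have ev: "(\<lambda>f. f b) \<in> mod_hom R ?F (regular_mod R)" by (rule free_mod_eval_hom) fact
  have "(\<lambda>f. f b) \<in> mod_hom R (?F\<lparr>carrier := N\<rparr>) (regular_mod R)"
    using fc(1) by (intro mod_homI) (simp_all add: regular_mod_def)
  from mod_hom_image_submodule[OF submodule.submodule_is_module[OF insert.prems F.module_axioms] M.module_axioms this]
  have "submodule ((\<lambda>f. f b) ` N) R (regular_mod R)" by simp
  from submodule_regular_imp_ideal[OF assms(1) this]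
  have "ideal ((\<lambda>f. f b) ` N) R" .
  then obtain A where A: "A \<subseteq> carrier R" "finite A" "(\<lambda>f. f b) ` N = Idl\<^bsub>R\<^esub> A"
    using N.finetely_gen by blast
  have AN: "A \<subseteq> (\<lambda>f. f b) ` N" unfolding A(3) by (rule R.genideal_self[OF A(1)])
  have "\<forall>a\<in>A. \<exists>f. f \<in> N \<and> f b = a" using AN by blast
  from bchoice[OF this] obtain g where g: "\<And>a. a \<in> A \<Longrightarrow> g a \<in> N" "\<And>a. a \<in> A \<Longrightarrow> g a b = a" by blast
  have A': "A \<subseteq> carrier (regular_mod R)" using A by (simp add: regular_mod_def)
  note sp = lc_span_submodule[OF M.module_axioms A(2) A']
  have Idl: "Idl\<^bsub>R\<^esub> A \<subseteq> {lc (regular_mod R) A a (\<lambda>s. s) | a. \<forall>s\<in>A. a s \<in> carrier R}"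
    by (rule R.genideal_minimal[OF submodule_regular_imp_ideal[OF assms(1) sp(1)] sp(2)])
  define N' where "N' = {f \<in> N. f b = \<zero>\<^bsub>R\<^esub>}"
  have N'G: "f \<in> carrier ?G" if "f \<in> N'" for f
    using Nc[of f] that by (auto simp: N'_def free_mod_def)
  have "submodule N' R ?G"
  proof (rule G.submoduleI)
    show "N' \<subseteq> carrier ?G" using N'G by blast
    show "\<zero>\<^bsub>?G\<^esub> \<in> N'" using submodule_zero[OF insert.prems] by (simp add: N'_def)
    show "f \<oplus>\<^bsub>?G\<^esub> h \<in> N'" if "f \<in> N'" "h \<in> N'" for f h
      using Ne(5)[of f h] that by (simp add: N'_def)
    have sm: "r \<odot>\<^bsub>?G\<^esub> f \<in> N'" if "r \<in> carrier R" "f \<in> N'" for r f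
      using Ne(4)[of r f] that by (simp add: N'_def)
    then show "r \<odot>\<^bsub>?G\<^esub> f \<in> N'" if "r \<in> carrier R" "f \<in> N'" for r f using that .
    show "\<ominus>\<^bsub>?G\<^esub> f \<in> N'" if "f \<in> N'" for f
      using sm[OF _ that, of "\<ominus>\<^bsub>R\<^esub> \<one>\<^bsub>R\<^esub>"] N'G[OF that] by (simp add: G.smult_minus_one)
  qed
  from insert.IH[OF this] obtain S' where S': "finite S'" "S' \<subseteq> N'"
    "\<forall>f\<in>N'. \<exists>a. (\<forall>s\<in>S'. a s \<in> carrier R) \<and> f = lc ?G S' a (\<lambda>s. s)" by blast
  let ?S = "S' \<union> g ` A"
  have SN: "?S \<subseteq> N" using S' g by (auto simp: N'_def)
  have fS: "finite ?S" using S' A by simp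
  note spF = lc_span_submodule(1)[OF F.module_axioms fS subset_trans[OF SN Ne(1)]]
    and Ssp = lc_span_submodule(2)[OF F.module_axioms fS subset_trans[OF SN Ne(1)]]
  have "f \<in> {lc ?F ?S a (\<lambda>s. s) | a. \<forall>s\<in>?S. a s \<in> carrier R}" if f: "f \<in> N" for f
  proof -
    have "f b \<in> Idl\<^bsub>R\<^esub> A" unfolding A(3)[symmetric] using f by blast
    then obtain a where a: "\<forall>s\<in>A. a s \<in> carrier R" "f b = lc (regular_mod R) A a (\<lambda>s. s)"
      using Idl by blast
    \<comment> \<open>\<open>u\<close> realises the coordinate of \<open>f\<close> at
      \<open>b\<close> by the lifted ideal generators, so the difference of \<open>f\<close> and
      \<open>u\<close> falls into \<open>N'\<close>, where the induction hypothesis applies.\<close>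
    define u where "u = lc ?F A a g"
    have uN: "u \<in> N" unfolding u_def using a g A by (intro F.submodule_lc[OF insert.prems]) auto
    have "u b = lc (regular_mod R) A a (\<lambda>s. g s b)"
      unfolding u_def using a g Nc A(2) by (intro mod_hom_lc[OF F.module_axioms M.module_axioms ev]) auto
    also have "\<dots> = f b"
      unfolding a(2) using a A A' g by (intro lc_cong[OF M.module_axioms]) auto
    finally have ub: "u b = f b" .
    define h where "h = f \<oplus>\<^bsub>?F\<^esub> (\<ominus>\<^bsub>R\<^esub> \<one>\<^bsub>R\<^esub>) \<odot>\<^bsub>?F\<^esub> u"
    have "h \<in> N" unfolding h_def using f uN by (intro Ne(4,5)) auto
    moreover have "h b = \<zero>\<^bsub>R\<^esub>" using ub fc(1)[OF f] by (simp add: h_def R.l_minus R.r_neg)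
    ultimately have "h \<in> N'" by (simp add: N'_def)
    then obtain e where e: "\<forall>s\<in>S'. e s \<in> carrier R" "h = lc ?G S' e (\<lambda>s. s)" using S'(3) by blast
    have "h = lc ?F S' e (\<lambda>s. s)"
      using e S'(1,2) N'G mod_hom_lc[OF G.module_axioms F.module_axioms free_mod_mono_hom, where a = e and S = S' and x = "\<lambda>s. s"] by auto
    also have "\<dots> \<in> {lc ?F ?S a (\<lambda>s. s) | a. \<forall>s\<in>?S. a s \<in> carrier R}"
      using e Ssp S'(1) by (intro F.submodule_lc[OF spF]) blast+
    finally have h: "h \<in> {lc ?F ?S a (\<lambda>s. s) | a. \<forall>s\<in>?S. a s \<in> carrier R}" .
    have u: "u \<in> {lc ?F ?S a (\<lambda>s. s) | a. \<forall>s\<in>?S. a s \<in> carrier R}"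
      unfolding u_def using a Ssp A(2) by (intro F.submodule_lc[OF spF]) blast+
    have "f = h \<oplus>\<^bsub>?F\<^esub> u"
      using fc(1)[OF f] fc(1)[OF uN] by (auto simp: h_def R.l_minus R.a_assoc R.l_neg)
    then show ?thesis using F.submoduleE(5)[OF spF h u] by simp
  qed
  then have "\<forall>f\<in>N. \<exists>a. (\<forall>s\<in>?S. a s \<in> carrier R) \<and> f = lc ?F ?S a (\<lambda>s. s)" by blast
  with SN fS show ?case by (intro exI[of _ ?S]) blast
qed

text \<open>Enumerating a set keeps the generators distinct, as \<open>D_inj\<close> and
  \<open>c_inj\<close> will demand. Indices from \<open>p\<close> on are sent to zero, so that all
  values lie in \<open>N\<close> without a bound on the index.\<close>

lemma enumerate_lc_span:
  assumes "module R A" "finite S" "S \<subseteq> N" "N \<subseteq> carrier A" "\<zero>\<^bsub>A\<^esub> \<in> N"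
    and "\<And>x. x \<in> N \<Longrightarrow> \<exists>a. (\<forall>s\<in>S. a s \<in> carrier R) \<and> x = lc A S a (\<lambda>s. s)"
  shows "\<exists>(p::nat) g. (\<forall>j. g j \<in> N) \<and> inj_on g {..<p} \<and>
    (\<forall>x\<in>N. \<exists>a. (\<forall>j. a j \<in> carrier R) \<and> x = lc A {..<p} a g)"
proof -
  interpret A: module R A by fact
  obtain h where h: "bij_betw h {..<card S} S"
    using ex_bij_betw_nat_finite[OF assms(2)] by (auto simp: atLeast0LessThan)
  let ?g = "\<lambda>j. if j < card S then h j else \<zero>\<^bsub>A\<^esub>"
  have hS: "h j \<in> S" if "j < card S" for j using h that by (auto simp: bij_betw_def)
  have hA: "h j \<in> carrier A" if "j < card S" for j using hS[OF that] assms(3,4) by blast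
  have inj: "inj_on h {..<card S}" and im: "h ` {..<card S} = S" using h by (auto simp: bij_betw_def)
  have "inj_on ?g {..<card S}" using inj by (auto simp: inj_on_def)
  moreover have "\<exists>a. (\<forall>j. a j \<in> carrier R) \<and> x = lc A {..<card S} a ?g" if "x \<in> N" for x
  proof -
    from assms(6)[OF that] obtain a where a: "\<forall>s\<in>S. a s \<in> carrier R" "x = lc A S a (\<lambda>s. s)" by (elim exE conjE)
    let ?a = "\<lambda>j. if j < card S then a (h j) else \<zero>\<^bsub>R\<^esub>"
    have "x = lc A (h ` {..<card S}) a (\<lambda>s. s)" unfolding im by (rule a(2))
    also have "\<dots> = lc A {..<card S} (\<lambda>i. a (h i)) h"
      using a hS hA by (intro lc_reindex[OF assms(1) inj]) auto
    also have "\<dots> = lc A {..<card S} ?a ?g"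
      using a hS hA by (intro lc_cong[OF assms(1)]) auto
    finally show ?thesis using a hS by (intro exI[of _ ?a]) auto
  qed
  moreover have "?g j \<in> N" for j using hS assms(3,5) by auto
  ultimately show ?thesis by (intro exI[of _ "card S"] exI[of _ ?g]) blast
qed

text \<open>
  \<open>D k\<close> is the matrix of the differential \<open>R\<^bsup>n (k + 1)\<^esup> \<rightarrow> R\<^bsup>n k\<^esup>\<close>. That generators and columns
  are distinct makes the map \<open>emb\<close> below injective, which is needed to split it.
\<close>

locale finite_resolution =
  module R C for R :: "('a, 'r) ring_scheme" (structure) and C :: "('a, 'c, 'y) module_scheme" +
  fixes n :: "nat \<Rightarrow> nat" and D :: "nat \<Rightarrow> nat \<Rightarrow> nat \<Rightarrow> 'a" and c :: "nat \<Rightarrow> 'c"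
  assumes D_closed [simp]: "D k i j \<in> carrier R"
    and c_closed [simp]: "c i \<in> carrier C"
    and D_inj: "\<lbrakk>j < n (Suc k); j' < n (Suc k); \<And>i. i < n k \<Longrightarrow> D k i j = D k i j'\<rbrakk> \<Longrightarrow> j = j'"
    and c_inj: "\<lbrakk>i < n 0; i' < n 0; c i = c i'\<rbrakk> \<Longrightarrow> i = i'"
    and D_D: "\<lbrakk>i < n k; l < n (Suc (Suc k))\<rbrakk> \<Longrightarrow>
      (\<Oplus>j\<in>{..<n (Suc k)}. D k i j \<otimes> D (Suc k) j l) = \<zero>"
    and D_exact: "\<lbrakk>\<And>j. r j \<in> carrier R;
        \<And>i. i < n k \<Longrightarrow> lc (regular_mod R) {..<n (Suc k)} (D k i) r = \<zero>\<rbrakk> \<Longrightarrow>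
      \<exists>s. (\<forall>l. s l \<in> carrier R) \<and>
        (\<forall>j<n (Suc k). r j = lc (regular_mod R) {..<n (Suc (Suc k))} (D (Suc k) j) s)"
    and c_span: "x \<in> carrier C \<Longrightarrow> \<exists>r. (\<forall>i. r i \<in> carrier R) \<and> x = lc C {..<n 0} r c"
    and c_D: "j < n 1 \<Longrightarrow> lc C {..<n 0} (\<lambda>i. D 0 i j) c = \<zero>\<^bsub>C\<^esub>"
    and c_exact: "\<lbrakk>\<And>i. r i \<in> carrier R; lc C {..<n 0} r c = \<zero>\<^bsub>C\<^esub>\<rbrakk> \<Longrightarrow>
      \<exists>s. (\<forall>j. s j \<in> carrier R) \<and> (\<forall>i<n 0. r i = lc (regular_mod R) {..<n 1} (D 0 i) s)"

section \<open>Construction of a resolution by finite free modules\<close>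

lemma finsum_regular_mod: "finsum (regular_mod R) = finsum R"
  by (intro ext) (simp add: finsum_def finprod_def regular_mod_def)

lemma lc_regular_mod: "lc (regular_mod R) S a x = (\<Oplus>\<^bsub>R\<^esub>i\<in>S. a i \<otimes>\<^bsub>R\<^esub> x i)"
  by (simp add: lc_def finsum_regular_mod) (simp add: regular_mod_def)

lemma lc_regular_mod_comm:
  assumes "cring R" "\<And>i. i \<in> S \<Longrightarrow> a i \<in> carrier R" "\<And>i. i \<in> S \<Longrightarrow> x i \<in> carrier R"
  shows "lc (regular_mod R) S a x = lc (regular_mod R) S x a"
proof -
  interpret cring R by fact
  show ?thesis unfolding lc_regular_mod using assms by (intro finsum_cong') (auto simp: m_comm)
qed

lemma free_mod_lc_apply:
  assumes "cring R" "finite S" "\<And>i. i \<in> S \<Longrightarrow> a i \<in> carrier R" "\<And>i. i \<in> S \<Longrightarrow> g i \<in> carrier (free_mod R X)"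
  shows "lc (free_mod R X) S a g x = lc (regular_mod R) S a (\<lambda>i. g i x)"
  using assms by (intro mod_hom_lc[OF free_mod_module regular_mod_module free_mod_eval_hom]) auto

text \<open>Iterated syzygies: the kernel of a map out of a finite free module is finitely generated
  because R is Noetherian, and its generators are the columns of the next matrix.\<close>

lemma finite_resolution_exists:
  assumes "module R C" "noetherian_ring R" "fin_gen_mod R C"
  shows "\<exists>n D c. finite_resolution R C n D c"
proof -
  interpret C: module R C by fact
  note R = C.R.is_cring
  interpret Rm: module R "regular_mod R" by (rule regular_mod_module[OF R])
  have Rc: "carrier (regular_mod R) = carrier R" "\<zero>\<^bsub>regular_mod R\<^esub> = \<zero>\<^bsub>R\<^esub>" by (simp_all add: regular_mod_def)
  let ?U = "free_mod R (UNIV :: nat set)"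
  interpret U: module R ?U by (rule free_mod_module[OF R])
  \<comment> \<open>Combinations are moved to the free module on all of \<open>nat\<close>, so that
    stages of different rank share one ambient module.\<close>
  have step: "\<exists>(p::nat) g. (\<forall>j. g j \<in> N) \<and> inj_on g {..<p} \<and>
      (\<forall>x\<in>N. \<exists>a. (\<forall>j. a j \<in> carrier R) \<and> x = lc ?U {..<p} a g)"
    if N: "submodule N R (free_mod R {..<m})" for N and m :: nat
  proof -
    interpret F: module R "free_mod R {..<m}" by (rule free_mod_module[OF R])
    from free_mod_submodule_fin_gen[OF R assms(2) finite_lessThan N] obtain S where S: "finite S" "S \<subseteq> N"
      "\<forall>f\<in>N. \<exists>a. (\<forall>s\<in>S. a s \<in> carrier R) \<and> f = lc (free_mod R {..<m}) S a (\<lambda>s. s)" by blast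
    then obtain p :: nat and g where g: "\<forall>j. g j \<in> N" "inj_on g {..<p}"
      "\<forall>x\<in>N. \<exists>a. (\<forall>j. a j \<in> carrier R) \<and> x = lc (free_mod R {..<m}) {..<p} a g"
      using enumerate_lc_span[OF F.module_axioms S(1,2) submodule_imp_subset[OF N] submodule_zero[OF N]] by blast
    have "lc (free_mod R {..<m}) {..<p} a g = lc ?U {..<p} a g" if "\<forall>j. a j \<in> carrier R" for a
      using that g(1) submodule_imp_subset[OF N]
      by (intro mod_hom_lc[OF F.module_axioms U.module_axioms free_mod_mono_hom]) auto
    with g show ?thesis by metis
  qed
  obtain S where S: "finite S" "S \<subseteq> carrier C" "mod_span R C S = carrier C"
    using assms(3) by (auto simp: fin_gen_mod_def)
  have "carrier C \<subseteq> {lc C S a (\<lambda>s. s) | a. \<forall>s\<in>S. a s \<in> carrier R}"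
    using mod_span_least[OF lc_span_submodule[OF assms(1) S(1,2)]] S(3) by simp
  then obtain n0 :: nat and c where c: "\<forall>j. c j \<in> carrier C" "inj_on c {..<n0}"
    "\<forall>x\<in>carrier C. \<exists>a. (\<forall>j. a j \<in> carrier R) \<and> x = lc C {..<n0} a c"
    using enumerate_lc_span[OF assms(1) S(1,2) subset_refl C.zero_closed] by blast
  define syz :: "nat \<Rightarrow> (nat \<Rightarrow> nat \<Rightarrow> 'a) \<Rightarrow> (nat \<Rightarrow> 'a) set" where
    "syz p g = {a \<in> carrier (free_mod R {..<p}). lin_ext R ?U g a = \<zero>\<^bsub>?U\<^esub>}" for p g
  define N0 where "N0 = {a \<in> carrier (free_mod R {..<n0}). lin_ext R C c a = \<zero>\<^bsub>C\<^esub>}"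
  define good where "good N p g \<longleftrightarrow> (\<forall>j. g j \<in> N) \<and> inj_on g {..<p} \<and>
      (\<forall>x\<in>N. \<exists>a. (\<forall>j. a j \<in> carrier R) \<and> x = lc ?U {..<p} a g)" for N p and g :: "nat \<Rightarrow> nat \<Rightarrow> 'a"
  have N0: "submodule N0 R (free_mod R {..<n0})" unfolding N0_def
    using c by (intro mod_hom_kernel_submodule[OF free_mod_module[OF R] assms(1)] lin_ext_hom assms(1)) auto
  have Ucl: "a \<in> carrier ?U" if "a \<in> carrier (free_mod R {..<p})" for a and p :: nat
    using mod_hom_closed[OF free_mod_mono_hom[OF subset_UNIV] that] .
  \<comment> \<open>A state consists of a number of generators and the generators themselves, which
    are the columns of a matrix. The first state generates the kernel of the map from R^n0 to C,
    each later one the syzygies of its predecessor.\<close>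
  have "\<exists>st. \<forall>k. ((\<forall>j. snd (st k) j \<in> carrier ?U) \<and> (k = 0 \<longrightarrow> good N0 (fst (st k)) (snd (st k)))) \<and>
      good (syz (fst (st k)) (snd (st k))) (fst (st (Suc k))) (snd (st (Suc k)))"
  proof -
    show ?thesis
    proof (rule dependent_nat_choice)
      from step[OF N0] obtain p g where g: "good N0 p g" unfolding good_def by blast
      then have "g j \<in> carrier ?U" for j
        by (intro Ucl[of "g j" n0]) (simp add: good_def N0_def)
      with g show "\<exists>s. (\<forall>j. snd s j \<in> carrier ?U) \<and> (0 = (0::nat) \<longrightarrow> good N0 (fst s) (snd s))"
        by (intro exI[of _ "(p, g)"]) simp
    next
      fix s and k :: nat assume s: "(\<forall>j. snd s j \<in> carrier ?U) \<and> (k = 0 \<longrightarrow> good N0 (fst s) (snd s))"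
      have "submodule (syz (fst s) (snd s)) R (free_mod R {..<fst s})" unfolding syz_def
        using s by (intro mod_hom_kernel_submodule[OF free_mod_module[OF R] U.module_axioms] lin_ext_hom U.module_axioms) auto
      from step[OF this] obtain p g where "good (syz (fst s) (snd s)) p g" unfolding good_def by blast
      then show "\<exists>y. ((\<forall>j. snd y j \<in> carrier ?U) \<and> (Suc k = 0 \<longrightarrow> good N0 (fst y) (snd y))) \<and>
          good (syz (fst s) (snd s)) (fst y) (snd y)"
        using Ucl by (intro exI[of _ "(p, g)"]) (auto simp: good_def syz_def)
    qed
  qed
  then obtain st where st0: "good N0 (fst (st 0)) (snd (st 0))"
    and stU: "\<And>k j. snd (st k) j \<in> carrier ?U"
    and stS: "\<And>k. good (syz (fst (st k)) (snd (st k))) (fst (st (Suc k))) (snd (st (Suc k)))" by blast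
  \<comment> \<open>State \<open>k\<close> holds the columns of \<open>D k\<close> and their number,
    which is the rank one degree higher; hence the shift against \<open>st\<close>.\<close>
  define n where "n k = (case k of 0 \<Rightarrow> n0 | Suc k \<Rightarrow> fst (st k))" for k
  define D where "D k i j = snd (st k) j i" for k i j
  have nS: "n (Suc k) = fst (st k)" "n 0 = n0" for k by (simp_all add: n_def)
  have Dc: "D k i j \<in> carrier R" for k i j using free_mod_carrierD(1)[OF stU] by (simp add: D_def)
  have Dcol: "snd (st k) j = (\<lambda>i. D k i j)" for k j by (simp add: D_def)
  \<comment> \<open>Rows from \<open>n k\<close> on are zero, so a column is determined by the rows
    that \<open>D_inj\<close> mentions.\<close>
  have supp: "D k i j = \<zero>\<^bsub>R\<^esub>" if "\<not> i < n k" for k i j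
  proof -
    have "snd (st k) j \<in> carrier (free_mod R {..<n k})"
      using st0 stS by (cases k) (auto simp: good_def N0_def syz_def nS)
    from free_mod_carrierD(3)[OF this] show ?thesis using that by (auto simp: D_def[abs_def])
  qed
  \<comment> \<open>The exactness assumptions speak of sequences that are arbitrary from some index
    on; cutting them off puts them into the free module of rank \<open>m\<close>.\<close>
  define tr where "tr m r = (\<lambda>i. if i < m then r i else \<zero>\<^bsub>R\<^esub>)" for m :: nat and r :: "nat \<Rightarrow> 'a"
  have tr: "tr m r \<in> carrier (free_mod R {..<m})" if "\<And>i. r i \<in> carrier R" for m r
    using that by (auto simp: tr_def free_mod_def intro: finite_subset[of _ "{..<m}"])
  have gen: "\<exists>s. (\<forall>l. s l \<in> carrier R) \<and>
      (\<forall>j<m. r j = lc (regular_mod R) {..<fst (st k)} (D k j) s)"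
    if "good N (fst (st k)) (snd (st k))" "tr m r \<in> N" for N m k r
  proof -
    from that obtain a where a: "\<forall>j. a j \<in> carrier R" "tr m r = lc ?U {..<fst (st k)} a (snd (st k))"
      unfolding good_def by blast
    have "r j = lc (regular_mod R) {..<fst (st k)} (D k j) a" if "j < m" for j
    proof -
      have "r j = lc ?U {..<fst (st k)} a (snd (st k)) j" using that by (simp flip: a(2)) (simp add: tr_def)
      also have "\<dots> = lc (regular_mod R) {..<fst (st k)} a (\<lambda>i. snd (st k) i j)"
        using a stU by (intro free_mod_lc_apply[OF R]) auto
      also have "\<dots> = lc (regular_mod R) {..<fst (st k)} (D k j) a"
        using a Dc by (subst lc_regular_mod_comm[OF R]) (auto simp: D_def[abs_def])
      finally show ?thesis .
    qed
    with a show ?thesis by blast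
  qed
  have "finite_resolution R C n D c"
  proof (unfold_locales, goal_cases)
    case (3 j k j')
    have "D k i j = D k i j'" for i using supp 3(3) by (cases "i < n k") auto
    then have "snd (st k) j = snd (st k) j'" by (simp add: Dcol)
    moreover have "inj_on (snd (st k)) {..<n (Suc k)}"
      using st0 stS by (cases k) (auto simp: good_def nS)
    ultimately show ?case using 3(1,2) by (auto dest: inj_onD)
  next
    case (5 i k l)
    have "snd (st (Suc k)) l \<in> syz (fst (st k)) (snd (st k))" using stS[of k] by (simp add: good_def)
    then have z: "lin_ext R ?U (snd (st k)) (snd (st (Suc k)) l) = \<zero>\<^bsub>?U\<^esub>"
      and m: "snd (st (Suc k)) l \<in> carrier (free_mod R {..<n (Suc k)})" by (auto simp: syz_def nS)
    have "\<zero>\<^bsub>R\<^esub> = lin_ext R ?U (snd (st k)) (snd (st (Suc k)) l) i" using z by simp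
    also have "lin_ext R ?U (snd (st k)) (snd (st (Suc k)) l) = lc ?U {..<n (Suc k)} (snd (st (Suc k)) l) (snd (st k))"
      using free_mod_carrierD[OF m] stU by (intro lin_ext_eq_lc U.module_axioms) auto
    also have "\<dots> i = lc (regular_mod R) {..<n (Suc k)} (snd (st (Suc k)) l) (\<lambda>j. snd (st k) j i)"
      using free_mod_carrierD(1)[OF m] stU by (intro free_mod_lc_apply[OF R]) auto
    also have "\<dots> = lc (regular_mod R) {..<n (Suc k)} (\<lambda>j. D k i j) (\<lambda>j. D (Suc k) j l)"
      using Dc by (subst lc_regular_mod_comm[OF R]) (auto simp: D_def[abs_def])
    finally show ?case by (simp add: lc_regular_mod)
  next
    case (6 r k)
    have "tr (n (Suc k)) r \<in> syz (fst (st k)) (snd (st k))"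
    proof -
      have "lin_ext R ?U (snd (st k)) (tr (n (Suc k)) r) = lc ?U {..<n (Suc k)} r (snd (st k))"
      proof -
        have "lin_ext R ?U (snd (st k)) (tr (n (Suc k)) r) = lc ?U {..<n (Suc k)} (tr (n (Suc k)) r) (snd (st k))"
          using 6(1) stU by (intro lin_ext_eq_lc U.module_axioms) (auto simp: tr_def)
        also have "\<dots> = lc ?U {..<n (Suc k)} r (snd (st k))"
          using 6(1) stU by (intro lc_cong[OF U.module_axioms]) (auto simp: tr_def)
        finally show ?thesis .
      qed
      also have "\<dots> = (\<lambda>_. \<zero>\<^bsub>R\<^esub>)"
      proof
        fix i
        have e: "lc ?U {..<n (Suc k)} r (snd (st k)) i = lc (regular_mod R) {..<n (Suc k)} (D k i) r"
          using 6(1) stU Dc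
          by (subst free_mod_lc_apply[OF R]) (auto simp: D_def[abs_def] intro!: lc_regular_mod_comm[OF R])
        show "lc ?U {..<n (Suc k)} r (snd (st k)) i = \<zero>\<^bsub>R\<^esub>"
        proof (cases "i < n k")
          case True
          then show ?thesis unfolding e by (rule 6(2))
        next
          case False
          then show ?thesis unfolding e using 6(1) supp[OF False] by (subst Rm.lc_zero_left) (auto simp: Rc)
        qed
      qed
      finally show ?thesis using tr[OF 6(1)] by (simp add: syz_def nS)
    qed
    from gen[OF stS this] show ?case by (simp add: nS)
  next
    case (7 x)
    then show ?case using c(3) by (simp add: nS)
  next
    case (8 j)
    have m: "snd (st 0) j \<in> N0" using st0 by (simp add: good_def)
    then have m': "snd (st 0) j \<in> carrier (free_mod R {..<n 0})" by (simp add: N0_def nS)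
    have "lc C {..<n 0} (snd (st 0) j) c = lin_ext R C c (snd (st 0) j)"
      using free_mod_carrierD[OF m'] c by (intro lin_ext_eq_lc[symmetric] assms(1)) auto
    then show ?case using m by (simp add: N0_def Dcol)
  next
    case (9 r)
    have "lin_ext R C c (tr n0 r) = lc C {..<n0} (tr n0 r) c"
      using 9(1) c by (intro lin_ext_eq_lc assms(1)) (auto simp: tr_def)
    also have "\<dots> = lc C {..<n0} r c"
      using 9(1) c by (intro lc_cong[OF assms(1)]) (auto simp: tr_def)
    finally have "tr n0 r \<in> N0" using tr[OF 9(1)] 9(2) by (simp add: N0_def nS)
    from gen[OF st0 this] show ?case by (simp add: nS)
  qed (use Dc c in \<open>auto simp: nS dest: inj_onD\<close>)
  then show ?thesis by blast
qed

section \<open>Vanishing of Tor and Ext in terms of a finite resolution\<close>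

text \<open>Vectors are total functions; a matrix with \<open>n\<close> columns only reads the entries below \<open>n\<close>.\<close>

definition vec :: "('a, 'b, 'x) module_scheme \<Rightarrow> (nat \<Rightarrow> 'b) set" where
  "vec X = {x. \<forall>i. x i \<in> carrier X}"

lemma vecD: "x \<in> vec X \<Longrightarrow> x i \<in> carrier X"
  by (simp add: vec_def)

text \<open>Exactness at the middle of X^p -> X^m -> X^l for matrices \<open>V\<close> and
  \<open>U\<close>, as inclusion of the kernel in the image. The same matrices act on every module,
  so the property can be compared across modules.\<close>

definition exact_pair ::
  "('a, 'b, 'x) module_scheme \<Rightarrow> nat \<Rightarrow> nat \<Rightarrow> nat \<Rightarrow> (nat \<Rightarrow> nat \<Rightarrow> 'a) \<Rightarrow> (nat \<Rightarrow> nat \<Rightarrow> 'a) \<Rightarrow> bool"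
where
  "exact_pair X l m p U V \<longleftrightarrow>
    (\<forall>x\<in>vec X. (\<forall>i<l. lc X {..<m} (U i) x = \<zero>\<^bsub>X\<^esub>) \<longrightarrow> (\<exists>y\<in>vec X. \<forall>j<m. x j = lc X {..<p} (V j) y))"

text \<open>The maps \<open>\<sigma> b\<close> and \<open>\<mu> b\<close> exhibit \<open>X\<close> as a direct summand of a direct sum of copies of \<open>A\<close>.\<close>

definition sum_retract ::
  "('a, 'r) ring_scheme \<Rightarrow> ('a, 'b, 'x) module_scheme \<Rightarrow> ('a, 'c, 'y) module_scheme \<Rightarrow> 'i set
    \<Rightarrow> ('i \<Rightarrow> 'c \<Rightarrow> 'b) \<Rightarrow> ('i \<Rightarrow> 'b \<Rightarrow> 'c) \<Rightarrow> bool"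
where
  "sum_retract R A X I \<sigma> \<mu> \<longleftrightarrow>
    (\<forall>b\<in>I. \<sigma> b \<in> mod_hom R X A \<and> \<mu> b \<in> mod_hom R A X) \<and>
    (\<forall>x\<in>carrier X. \<exists>S. finite S \<and> S \<subseteq> I \<and> (\<forall>b\<in>I - S. \<sigma> b x = \<zero>\<^bsub>A\<^esub>) \<and>
      x = lc X S (\<lambda>_. \<one>\<^bsub>R\<^esub>) (\<lambda>b. \<mu> b (\<sigma> b x)))"

text \<open>Finitely many elements involve finitely many summands: the union of their index sets
  serves all of them, since additional terms are zero. A linear system over \<open>X\<close> can
  then be treated with one \<open>S\<close>.\<close>

lemma sum_retract_family:
  fixes x :: "nat \<Rightarrow> 'c"
  assumes "module R A" "module R X" "sum_retract R A X I \<sigma> \<mu>" "\<And>j. j < m \<Longrightarrow> x j \<in> carrier X"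
  shows "\<exists>S. finite S \<and> S \<subseteq> I \<and> (\<forall>b\<in>I - S. \<forall>j<m. \<sigma> b (x j) = \<zero>\<^bsub>A\<^esub>) \<and>
    (\<forall>j<m. x j = lc X S (\<lambda>_. \<one>\<^bsub>R\<^esub>) (\<lambda>b. \<mu> b (\<sigma> b (x j))))"
proof -
  interpret A: module R A by fact
  interpret X: module R X by fact
  have "\<forall>j\<in>{..<m}. \<exists>S. finite S \<and> S \<subseteq> I \<and> (\<forall>b\<in>I - S. \<sigma> b (x j) = \<zero>\<^bsub>A\<^esub>) \<and>
      x j = lc X S (\<lambda>_. \<one>\<^bsub>R\<^esub>) (\<lambda>b. \<mu> b (\<sigma> b (x j)))"
    using assms(3,4) by (simp add: sum_retract_def)
  from bchoice[OF this] obtain S where S: "\<And>j. j < m \<Longrightarrow> finite (S j)" "\<And>j. j < m \<Longrightarrow> S j \<subseteq> I"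
    "\<And>j b. j < m \<Longrightarrow> b \<in> I - S j \<Longrightarrow> \<sigma> b (x j) = \<zero>\<^bsub>A\<^esub>"
    "\<And>j. j < m \<Longrightarrow> x j = lc X (S j) (\<lambda>_. \<one>\<^bsub>R\<^esub>) (\<lambda>b. \<mu> b (\<sigma> b (x j)))" by blast
  let ?T = "\<Union>j<m. S j"
  have h: "\<sigma> b \<in> mod_hom R X A" "\<mu> b \<in> mod_hom R A X" if "b \<in> I" for b
    using assms(3) that by (auto simp: sum_retract_def)
  have "x j = lc X ?T (\<lambda>_. \<one>\<^bsub>R\<^esub>) (\<lambda>b. \<mu> b (\<sigma> b (x j)))" if j: "j < m" for j
  proof -
    let ?g = "\<lambda>b. \<mu> b (\<sigma> b (x j))"
    have gc: "?g b \<in> carrier X" if "b \<in> I" for b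
      using mod_hom_closed[OF h(2)[OF that]] mod_hom_closed[OF h(1)[OF that]] assms(4)[OF j] by blast
    have TI: "?T \<subseteq> I" using S(2) by blast
    have z: "?g b = \<zero>\<^bsub>X\<^esub>" if "b \<in> ?T - S j" for b
    proof -
      have "b \<in> I" using that TI by blast
      then show ?thesis
        using S(3)[OF j, of b] that mod_hom_zero[OF assms(1,2) h(2)] by simp
    qed
    have "x j = lc X (S j) (\<lambda>_. \<one>\<^bsub>R\<^esub>) ?g" by (rule S(4)[OF j])
    also have "\<dots> = lc X ?T (\<lambda>_. \<one>\<^bsub>R\<^esub>) ?g"
      unfolding lc_def
    proof (rule X.add.finprod_mono_neutral_cong_left)
      show "finite ?T" using S(1) by simp
      show "S j \<subseteq> ?T" using j by blast
      show "(\<lambda>b. \<one>\<^bsub>R\<^esub> \<odot>\<^bsub>X\<^esub> ?g b) \<in> ?T \<rightarrow> carrier X" using gc TI by auto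
    qed (use z in auto)
    finally show ?thesis .
  qed
  moreover have "finite ?T" "?T \<subseteq> I" using S(1,2) by auto
  moreover have "\<forall>b\<in>I - ?T. \<forall>j<m. \<sigma> b (x j) = \<zero>\<^bsub>A\<^esub>" using S(3) by blast
  ultimately show ?thesis by blast
qed

text \<open>Homomorphisms commute with matrices over R, so a system over \<open>X\<close> projects
  to a system over \<open>A\<close> for each index. The solutions are sent back by
  \<open>\<mu>\<close> and added up over the finite set \<open>S\<close>.\<close>

lemma exact_pair_retract:
  assumes "module R A" "module R X" "sum_retract R A X I \<sigma> \<mu>"
    and U: "\<And>i j. U i j \<in> carrier R" and V: "\<And>i j. V i j \<in> carrier R"
    and "exact_pair A l m p U V"
  shows "exact_pair X l m p U V"
  unfolding exact_pair_def
proof (intro ballI impI)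
  interpret A: module R A by fact
  interpret X: module R X by fact
  fix x assume x: "x \<in> vec X" and z: "\<forall>i<l. lc X {..<m} (U i) x = \<zero>\<^bsub>X\<^esub>"
  have h: "\<sigma> b \<in> mod_hom R X A" "\<mu> b \<in> mod_hom R A X" if "b \<in> I" for b
    using assms(3) that by (auto simp: sum_retract_def)
  obtain S where S: "finite S" "S \<subseteq> I" "\<forall>j<m. x j = lc X S (\<lambda>_. \<one>\<^bsub>R\<^esub>) (\<lambda>b. \<mu> b (\<sigma> b (x j)))"
    using sum_retract_family[OF assms(1-3), of m x] x by (auto simp: vec_def)
  have "\<exists>y. y \<in> vec A \<and> (\<forall>j<m. \<sigma> b (x j) = lc A {..<p} (V j) y)" if b: "b \<in> I" for b
  proof -
    have "(\<lambda>j. \<sigma> b (x j)) \<in> vec A" using mod_hom_closed[OF h(1)[OF b]] x by (auto simp: vec_def)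
    moreover have "lc A {..<m} (U i) (\<lambda>j. \<sigma> b (x j)) = \<zero>\<^bsub>A\<^esub>" if "i < l" for i
    proof -
      have "lc A {..<m} (U i) (\<lambda>j. \<sigma> b (x j)) = \<sigma> b (lc X {..<m} (U i) x)"
        using U vecD[OF x] by (intro mod_hom_lc[OF assms(2,1) h(1)[OF b], symmetric]) auto
      then show ?thesis using z that mod_hom_zero[OF assms(2,1) h(1)[OF b]] by simp
    qed
    ultimately show ?thesis using assms(6) unfolding exact_pair_def by blast
  qed
  then have "\<forall>b\<in>I. \<exists>y. y \<in> vec A \<and> (\<forall>j<m. \<sigma> b (x j) = lc A {..<p} (V j) y)" by blast
  from bchoice[OF this] obtain y where y: "\<And>b. b \<in> I \<Longrightarrow> y b \<in> vec A"
    "\<And>b j. b \<in> I \<Longrightarrow> j < m \<Longrightarrow> \<sigma> b (x j) = lc A {..<p} (V j) (y b)" by blast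
  have \<mu>y: "\<mu> b (y b i) \<in> carrier X" if "b \<in> S" for b i
    using mod_hom_closed[OF h(2)] vecD[OF y(1)] S(2) that by blast
  define Y where "Y i = lc X S (\<lambda>_. \<one>\<^bsub>R\<^esub>) (\<lambda>b. \<mu> b (y b i))" for i
  have "Y \<in> vec X" using \<mu>y by (auto simp: vec_def Y_def)
  moreover have "x j = lc X {..<p} (V j) Y" if j: "j < m" for j
  proof -
    have "lc X {..<p} (V j) Y = lc X S (\<lambda>_. \<one>\<^bsub>R\<^esub>) (\<lambda>b. lc X {..<p} (V j) (\<lambda>i. \<mu> b (y b i)))"
      unfolding Y_def using S(1) V \<mu>y by (intro X.lc_swap) auto
    also have "\<dots> = lc X S (\<lambda>_. \<one>\<^bsub>R\<^esub>) (\<lambda>b. \<mu> b (\<sigma> b (x j)))"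
    proof (intro lc_cong[OF assms(2)] refl)
      fix b assume b: "b \<in> S"
      then have bI: "b \<in> I" using S(2) by blast
      show "lc X {..<p} (V j) (\<lambda>i. \<mu> b (y b i)) = \<mu> b (\<sigma> b (x j))"
        unfolding y(2)[OF bI j] using V vecD[OF y(1)[OF bI]]
        by (intro mod_hom_lc[OF assms(1,2) h(2)[OF bI], symmetric]) auto
      show "\<mu> b (\<sigma> b (x j)) \<in> carrier X"
        using mod_hom_closed[OF h(2)[OF bI]] mod_hom_closed[OF h(1)[OF bI]] vecD[OF x] by blast
    qed simp
    also have "\<dots> = x j" using S(3) j by simp
    finally show ?thesis ..
  qed
  ultimately show "\<exists>y\<in>vec X. \<forall>j<m. x j = lc X {..<p} (V j) y" by blast
qed

section \<open>Words over the canonical basis\<close>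

lemma word_val_Nil: "word_val R [] = (\<lambda>_. \<zero>\<^bsub>R\<^esub>)"
  by (simp add: word_val_def)

lemma word_val_mem:
  assumes "cring R" "set w \<subseteq> carrier R \<times> B"
  shows "word_val R w \<in> carrier (free_mod R B)"
    and "a \<in> carrier R \<Longrightarrow> x \<in> B \<Longrightarrow> word_val R ((a, x) # w) =
      (a \<odot>\<^bsub>free_mod R B\<^esub> basis_vec R x) \<oplus>\<^bsub>free_mod R B\<^esub> word_val R w"
proof -
  interpret cring R by fact
  interpret F: module R "free_mod R B" by (rule free_mod_module) fact
  have step: "word_val R ((a, x) # w) = (a \<odot>\<^bsub>free_mod R B\<^esub> basis_vec R x) \<oplus>\<^bsub>free_mod R B\<^esub> word_val R w"
    if "a \<in> carrier R" "word_val R w \<in> carrier (free_mod R B)" for a x and w :: "('a \<times> 'c) list"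
    using that(1) free_mod_carrierD(1)[OF that(2)]
    by (auto simp: word_val_def basis_vec_def fun_eq_iff)
  show mem: "word_val R w \<in> carrier (free_mod R B)" using assms(2)
  proof (induction w)
    case Nil
    then show ?case using F.zero_closed by (simp add: word_val_Nil)
  next
    case (Cons p w)
    obtain a x where p: "p = (a, x)" by (cases p)
    have IH: "word_val R w \<in> carrier (free_mod R B)" "a \<in> carrier R" "x \<in> B"
      using Cons p by auto
    show ?case unfolding p step[OF IH(2,1)]
      by (intro F.a_closed F.smult_closed IH basis_vec_mem assms(1))
  qed
  show "word_val R ((a, x) # w) = (a \<odot>\<^bsub>free_mod R B\<^esub> basis_vec R x) \<oplus>\<^bsub>free_mod R B\<^esub> word_val R w"
    if "a \<in> carrier R" "x \<in> B" by (rule step[OF that(1) mem])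
qed

lemma word_val_map:
  assumes "cring R" "distinct is" "\<And>i. i \<in> set is \<Longrightarrow> a i \<in> carrier R" "\<And>i. i \<in> set is \<Longrightarrow> e i \<in> B"
  shows "word_val R (map (\<lambda>i. (a i, e i)) is) = lc (free_mod R B) (set is) a (\<lambda>i. basis_vec R (e i))"
  using assms(2-)
proof (induction "is")
  case Nil
  interpret F: module R "free_mod R B" by (rule free_mod_module) fact
  show ?case by (simp add: word_val_Nil lc_def)
next
  case (Cons i "is")
  interpret F: module R "free_mod R B" by (rule free_mod_module) fact
  have "set (map (\<lambda>i. (a i, e i)) is) \<subseteq> carrier R \<times> B" using Cons.prems by auto
  then have "word_val R (map (\<lambda>i. (a i, e i)) (i # is)) =
      (a i \<odot>\<^bsub>free_mod R B\<^esub> basis_vec R (e i)) \<oplus>\<^bsub>free_mod R B\<^esub> word_val R (map (\<lambda>i. (a i, e i)) is)"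
    using Cons.prems by (simp add: word_val_mem(2)[OF assms(1)] del: free_mod_simps)
  also have "\<dots> = lc (free_mod R B) (insert i (set is)) a (\<lambda>i. basis_vec R (e i))"
    using Cons by (subst F.lc_insert) (auto intro!: basis_vec_mem assms(1) simp del: free_mod_simps)
  finally show ?case by simp
qed

context finite_resolution
begin

text \<open>The differentials of \<open>X \<otimes> G\<close> and \<open>Hom(G, X)\<close>.\<close>

abbreviation dn where "dn X k x i \<equiv> lc X {..<n (Suc k)} (D k i) x"
abbreviation up where "up X k x j \<equiv> lc X {..<n k} (\<lambda>i. D k i j) x"
abbreviation K where "K k \<equiv> free_mod R (res_basis R C k)"
abbreviation bd where "bd \<equiv> lin_ext R (free_mod R UNIV) (gen_bd R)"
abbreviation reg where "reg \<equiv> regular_mod R"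

declare res_basis.simps(2) [simp del]

text \<open>Index \<open>k\<close> stands for degree \<open>k + 1\<close>, so this is vanishing of
  Tor with C in positive degrees, computed from G. In the version for Ext the matrices are
  transposed, which reverses the order of the ranks.\<close>

definition tor_acyclic :: "('a, 'm, 'z) module_scheme \<Rightarrow> bool" where
  "tor_acyclic X \<longleftrightarrow> (\<forall>k. exact_pair X (n k) (n (Suc k)) (n (Suc (Suc k))) (D k) (D (Suc k)))"

definition ext_acyclic :: "('a, 'm, 'z) module_scheme \<Rightarrow> bool" where
  "ext_acyclic X \<longleftrightarrow> (\<forall>k. exact_pair X (n (Suc (Suc k))) (n (Suc k)) (n k)
    (\<lambda>l j. D (Suc k) j l) (\<lambda>j i. D k i j))"

lemma tor_acyclicD:
  assumes "tor_acyclic X" "x \<in> vec X" "\<And>i. i < n k \<Longrightarrow> dn X k x i = \<zero>\<^bsub>X\<^esub>"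
  obtains y where "y \<in> vec X" "\<And>j. j < n (Suc k) \<Longrightarrow> x j = dn X (Suc k) y j"
  using assms unfolding tor_acyclic_def exact_pair_def by blast

lemma ext_acyclicD:
  assumes "ext_acyclic X" "x \<in> vec X" "\<And>l. l < n (Suc (Suc k)) \<Longrightarrow> up X (Suc k) x l = \<zero>\<^bsub>X\<^esub>"
  obtains y where "y \<in> vec X" "\<And>j. j < n (Suc k) \<Longrightarrow> x j = up X k y j"
  using assms unfolding ext_acyclic_def exact_pair_def by blast

lemma cring: "cring R"
  by (rule R.is_cring)

lemma reg_module: "module R reg"
  by (rule regular_mod_module[OF cring])

lemma reg_simps: "carrier reg = carrier R" "\<zero>\<^bsub>reg\<^esub> = \<zero>" "a \<odot>\<^bsub>reg\<^esub> b = a \<otimes> b" "a \<oplus>\<^bsub>reg\<^esub> b = a \<oplus> b"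
  by (simp_all add: regular_mod_def)

lemma dn_dn:
  assumes "module R X" "x \<in> vec X" "i < n k"
  shows "dn X k (dn X (Suc k) x) i = \<zero>\<^bsub>X\<^esub>"
proof -
  interpret X: module R X by fact
  have "dn X k (dn X (Suc k) x) i =
      lc X {..<n (Suc (Suc k))} (\<lambda>l. \<Oplus>j\<in>{..<n (Suc k)}. D k i j \<otimes> D (Suc k) j l) x"
    using vecD[OF assms(2)] by (intro X.lc_lc) auto
  also have "\<dots> = \<zero>\<^bsub>X\<^esub>"
    using vecD[OF assms(2)] D_D[OF assms(3)] by (intro X.lc_zero_left) auto
  finally show ?thesis .
qed

lemma up_up:
  assumes "module R X" "\<And>i. i < n k \<Longrightarrow> x i \<in> carrier X" "l < n (Suc (Suc k))"
  shows "up X (Suc k) (up X k x) l = \<zero>\<^bsub>X\<^esub>"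
proof -
  interpret X: module R X by fact
  have "up X (Suc k) (up X k x) l =
      lc X {..<n k} (\<lambda>i. \<Oplus>j\<in>{..<n (Suc k)}. D (Suc k) j l \<otimes> D k i j) x"
    using assms(2) by (intro X.lc_lc) auto
  also have "\<dots> = \<zero>\<^bsub>X\<^esub>"
  proof (intro X.lc_zero_left)
    fix i assume i: "i \<in> {..<n k}"
    have "(\<Oplus>j\<in>{..<n (Suc k)}. D (Suc k) j l \<otimes> D k i j) = (\<Oplus>j\<in>{..<n (Suc k)}. D k i j \<otimes> D (Suc k) j l)"
      by (intro R.finsum_cong') (auto simp: R.m_comm)
    then show "(\<Oplus>j\<in>{..<n (Suc k)}. D (Suc k) j l \<otimes> D k i j) = \<zero>" using D_D assms(3) i by simp
  qed (use assms(2) in auto)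
  finally show ?thesis .
qed

lemma tor_acyclic_reg: "tor_acyclic reg"
  unfolding tor_acyclic_def exact_pair_def
proof (intro allI ballI impI)
  fix k x assume x: "x \<in> vec reg" and z: "\<forall>i<n k. dn reg k x i = \<zero>\<^bsub>reg\<^esub>"
  have "\<exists>s. (\<forall>l. s l \<in> carrier R) \<and> (\<forall>j<n (Suc k). x j = dn reg (Suc k) s j)"
    using vecD[OF x] z by (intro D_exact) (simp_all add: reg_simps)
  then show "\<exists>y\<in>vec reg. \<forall>j<n (Suc k). x j = dn reg (Suc k) y j" by (auto simp: vec_def reg_simps)
qed

subsection \<open>The finite resolution as a retract of the canonical one\<close>

text \<open>A generator of G in degree \<open>k + 1\<close> becomes the word that spells out its
  column in the embedded generators of degree \<open>k\<close>. The boundary of a word is its value,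
  so the embedding commutes with the differentials by construction.\<close>

primrec emb :: "nat \<Rightarrow> nat \<Rightarrow> ('a, 'c) res_gen" where
  "emb 0 i = Gen (c i)"
| "emb (Suc k) j = Rel (map (\<lambda>i. (D k i j, emb k i)) [0..<n k])"

lemma gen_bd_emb_free:
  assumes "\<And>i. i < n k \<Longrightarrow> emb k i \<in> res_basis R C k"
  shows "gen_bd R (emb (Suc k) j) = lc (K k) {..<n k} (\<lambda>i. D k i j) (\<lambda>i. basis_vec R (emb k i))"
  using assms word_val_map[OF cring, of "[0..<n k]" "\<lambda>i. D k i j" "emb k" "res_basis R C k"]
  by (simp add: atLeast0LessThan)

lemma Rel_basisD:
  assumes "b \<in> res_basis R C (Suc k)"
  shows "gen_bd R b \<in> carrier (K k)"
    and "k = 0 \<Longrightarrow> lin_ext R C gen_aug (gen_bd R b) = \<zero>\<^bsub>C\<^esub>"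
    and "k \<noteq> 0 \<Longrightarrow> bd (gen_bd R b) = (\<lambda>_. \<zero>)"
  using assms word_val_mem(1)[OF cring] by (auto simp: res_basis.simps(2))

lemma bd_hom: "bd \<in> mod_hom R (K (Suc k)) (K k)"
proof -
  interpret U: module R "free_mod R (UNIV :: ('a, 'c) res_gen set)" by (rule free_mod_module[OF cring])
  interpret Kk: module R "K k" by (rule free_mod_module[OF cring])
  have g: "gen_bd R b \<in> carrier (K k)" if "b \<in> res_basis R C (Suc k)" for b
    by (rule Rel_basisD(1)[OF that])
  note i = free_mod_mono_hom[OF subset_UNIV]
  have U: "bd \<in> mod_hom R (K (Suc k)) (free_mod R UNIV)"
    using mod_hom_closed[OF i g] by (intro lin_ext_hom U.module_axioms) auto
  have l: "lin_ext R (K k) (gen_bd R) \<in> mod_hom R (K (Suc k)) (K k)"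
    using g by (intro lin_ext_hom Kk.module_axioms)
  have eq: "bd \<kappa> = lin_ext R (K k) (gen_bd R) \<kappa>" if "\<kappa> \<in> carrier (K (Suc k))" for \<kappa>
  proof (rule free_mod_hom_eqI[OF U.module_axioms U mod_hom_comp[OF l i] _ that])
    show "bd (basis_vec R b) = lin_ext R (K k) (gen_bd R) (basis_vec R b)" if "b \<in> res_basis R C (Suc k)" for b
      using g[OF that] mod_hom_closed[OF i g[OF that]]
      by (simp add: lin_ext_basis[OF U.module_axioms] lin_ext_basis[OF Kk.module_axioms])
  qed
  show ?thesis by (rule mod_hom_cong[OF free_mod_module[OF cring] l eq])
qed

lemma bd_basis: "b \<in> res_basis R C (Suc k) \<Longrightarrow> bd (basis_vec R b) = gen_bd R b"
  using Rel_basisD(1)[of b k] mod_hom_closed[OF free_mod_mono_hom[OF subset_UNIV]]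
  by (intro lin_ext_basis free_mod_module[OF cring]) blast

text \<open>A word belongs to the basis only if it spells a cycle. For a column this is
  \<open>D_D\<close>, or \<open>c_D\<close> in the lowest degree; the computation expands generators
  two degrees down, hence the complete induction.\<close>

lemma emb_basis: "i < n k \<Longrightarrow> emb k i \<in> res_basis R C k"
proof (induction k arbitrary: i rule: less_induct)
  case (less k)
  show ?case
  proof (cases k)
    case 0
    then show ?thesis by simp
  next
    case k: (Suc k')
    have IH: "emb k' j \<in> res_basis R C k'" if "j < n k'" for j using less.IH[of k' j] k that by simp
    let ?w = "map (\<lambda>j. (D k' j i, emb k' j)) [0..<n k']"
    have wv: "word_val R ?w = lc (K k') {..<n k'} (\<lambda>j. D k' j i) (\<lambda>j. basis_vec R (emb k' j))"
      using gen_bd_emb_free[OF IH, of i] by simp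
    have m: "basis_vec R (emb k' j) \<in> carrier (K k')" if "j < n k'" for j
      using IH[OF that] by (intro basis_vec_mem cring)
    have "(if k' = 0 then lin_ext R C gen_aug (word_val R ?w) = \<zero>\<^bsub>C\<^esub>
         else bd (word_val R ?w) = (\<lambda>_. \<zero>))"
    proof (cases k')
      case 0
      have h: "lin_ext R C gen_aug \<in> mod_hom R (K 0) C" by (intro lin_ext_hom module_axioms) auto
      have "lin_ext R C gen_aug (word_val R ?w) =
          lc C {..<n 0} (\<lambda>j. D 0 j i) (\<lambda>j. lin_ext R C gen_aug (basis_vec R (emb 0 j)))"
        unfolding wv unfolding 0 using m[unfolded 0]
        by (intro mod_hom_lc[OF free_mod_module[OF cring] module_axioms h]) auto
      also have "\<dots> = lc C {..<n 0} (\<lambda>j. D 0 j i) c"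
        by (intro lc_cong[OF module_axioms]) (auto simp: lin_ext_basis[OF module_axioms])
      also have "\<dots> = \<zero>\<^bsub>C\<^esub>" using less.prems k 0 by (intro c_D) simp
      finally show ?thesis using 0 by simp
    next
      case k': (Suc k'')
      have IH': "emb k'' l \<in> res_basis R C k''" if "l < n k''" for l
        using less.IH[of k'' l] k k' that by simp
      have m': "basis_vec R (emb k'' l) \<in> carrier (K k'')" if "l < n k''" for l
        using IH'[OF that] by (intro basis_vec_mem cring)
      have "bd (word_val R ?w) =
          lc (K k'') {..<n (Suc k'')} (\<lambda>j. D (Suc k'') j i) (\<lambda>j. bd (basis_vec R (emb (Suc k'') j)))"
        unfolding wv unfolding k' using m[unfolded k']
        by (intro mod_hom_lc[OF free_mod_module[OF cring] free_mod_module[OF cring] bd_hom]) auto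
      also have "\<dots> = up (K k'') (Suc k'') (up (K k'') k'' (\<lambda>l. basis_vec R (emb k'' l))) i"
        using IH[unfolded k'] Rel_basisD(1)[of _ k'']
        by (intro lc_cong[OF free_mod_module[OF cring]]) 
           (auto simp: bd_basis[of _ k''] gen_bd_emb_free[OF IH', symmetric] simp del: emb.simps)
      also have "\<dots> = \<zero>\<^bsub>K k''\<^esub>"
        using less.prems k k' m' by (intro up_up free_mod_module[OF cring]) auto
      finally show ?thesis using k' by simp
    qed
    then show ?thesis using IH k by (auto simp: res_basis.simps(2))
  qed
qed

lemma gen_bd_emb:
  "gen_bd R (emb (Suc k) j) = lc (K k) {..<n k} (\<lambda>i. D k i j) (\<lambda>i. basis_vec R (emb k i))"
  by (rule gen_bd_emb_free) (rule emb_basis)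

text \<open>A column can be read back from its word; distinctness of the columns and of the
  generators of C enters here.\<close>

lemma emb_inj: "i < n k \<Longrightarrow> i' < n k \<Longrightarrow> emb k i = emb k i' \<Longrightarrow> i = i'"
proof (cases k)
  case 0
  then show "i < n k \<Longrightarrow> i' < n k \<Longrightarrow> emb k i = emb k i' \<Longrightarrow> i = i'" using c_inj by simp
next
  case (Suc k')
  assume a: "i < n k" "i' < n k" "emb k i = emb k i'"
  then have "\<forall>j<n k'. D k' j i = D k' j i'" using Suc by simp
  then show "i = i'" using a Suc by (intro D_inj[of i k' i']) auto
qed

text \<open>\<open>\<beta> b\<close> is the tuple in R^(n k) to which a map onto G sends the basis
  element \<open>b\<close>; this is the \<open>i\<close>-th coordinate of its linear
  extension.\<close>

abbreviation \<beta>ext where "\<beta>ext \<beta> \<kappa> i \<equiv> lin_ext R reg (\<lambda>b. \<beta> b i) \<kappa>"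

text \<open>The invariant that allows a retraction in degree \<open>k\<close> to be extended to degree \<open>k + 1\<close>.\<close>

definition retr_lift :: "nat \<Rightarrow> (('a, 'c) res_gen \<Rightarrow> nat \<Rightarrow> 'a) \<Rightarrow> bool" where
  "retr_lift k \<beta> \<longleftrightarrow> (\<forall>\<kappa>\<in>carrier (K k).
    (if k = 0 then lin_ext R C gen_aug \<kappa> = \<zero>\<^bsub>C\<^esub> else bd \<kappa> = (\<lambda>_. \<zero>)) \<longrightarrow>
    (\<exists>s. (\<forall>l. s l \<in> carrier R) \<and> (\<forall>i<n k. \<beta>ext \<beta> \<kappa> i = dn reg k s i)))"

definition retr_unit :: "nat \<Rightarrow> (('a, 'c) res_gen \<Rightarrow> nat \<Rightarrow> 'a) \<Rightarrow> bool" where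
  "retr_unit k \<beta> \<longleftrightarrow> (\<forall>b i. \<beta> b i \<in> carrier R) \<and>
    (\<forall>j<n k. \<forall>i<n k. \<beta> (emb k j) i = (if i = j then \<one> else \<zero>))"

lemma \<beta>ext_hom:
  assumes "retr_unit k \<beta>"
  shows "(\<lambda>\<kappa>. \<beta>ext \<beta> \<kappa> i) \<in> mod_hom R (free_mod R X) reg"
  using assms by (intro lin_ext_hom reg_module) (simp add: retr_unit_def reg_simps)

lemma \<beta>ext_basis:
  assumes "retr_unit k \<beta>"
  shows "\<beta>ext \<beta> (basis_vec R b) i = \<beta> b i"
  using assms by (intro lin_ext_basis reg_module) (simp add: retr_unit_def reg_simps)

definition retr_step :: "nat \<Rightarrow> (('a, 'c) res_gen \<Rightarrow> nat \<Rightarrow> 'a) \<Rightarrow> (('a, 'c) res_gen \<Rightarrow> nat \<Rightarrow> 'a) \<Rightarrow> bool" where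
  "retr_step k \<beta> \<beta>' \<longleftrightarrow> (\<forall>b\<in>res_basis R C (Suc k). \<forall>i<n k. dn reg k (\<beta>' b) i = \<beta>ext \<beta> (gen_bd R b) i)"

lemma retr_step_ext:
  assumes "retr_unit k \<beta>" "retr_unit (Suc k) \<beta>'" "retr_step k \<beta> \<beta>'" "\<kappa> \<in> carrier (K (Suc k))" "i < n k"
  shows "dn reg k (\<beta>ext \<beta>' \<kappa>) i = \<beta>ext \<beta> (bd \<kappa>) i"
proof (rule free_mod_hom_eqI[OF reg_module _ _ _ assms(4)])
  show "(\<lambda>\<kappa>. dn reg k (\<beta>ext \<beta>' \<kappa>) i) \<in> mod_hom R (K (Suc k)) reg"
    by (intro mod_hom_lc_fun reg_module \<beta>ext_hom[OF assms(2)]) auto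
  show "(\<lambda>\<kappa>. \<beta>ext \<beta> (bd \<kappa>) i) \<in> mod_hom R (K (Suc k)) reg"
    by (rule mod_hom_comp[OF bd_hom \<beta>ext_hom[OF assms(1)]])
  show "dn reg k (\<beta>ext \<beta>' (basis_vec R b)) i = \<beta>ext \<beta> (bd (basis_vec R b)) i" if "b \<in> res_basis R C (Suc k)" for b
    using assms(3,5) that by (simp add: \<beta>ext_basis[OF assms(2)] bd_basis retr_step_def)
qed

text \<open>A chain map to G is built on basis elements, degree by degree. On embedded generators it
  is prescribed to be the identity, which is consistent because \<open>emb\<close> is injective; on
  other basis elements any lift will do, and \<open>retr_lift\<close> provides one. Exactness of G
  restores \<open>retr_lift\<close> in the next degree.\<close>

lemma retraction_exists:
  "\<exists>\<beta>. \<forall>k. retr_unit k (\<beta> k) \<and> retr_step k (\<beta> k) (\<beta> (Suc k))"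
proof -
  have "\<exists>\<beta>. \<forall>k. (retr_unit k (\<beta> k) \<and> retr_lift k (\<beta> k)) \<and> retr_step k (\<beta> k) (\<beta> (Suc k))"
  proof (rule dependent_nat_choice)
    have "\<exists>r. (\<forall>i. r i \<in> carrier R) \<and> x = lc C {..<n 0} r c \<and> (\<forall>j<n 0. x = c j \<longrightarrow> (\<forall>i<n 0. r i = (if i = j then \<one> else \<zero>)))"
      if x: "x \<in> carrier C" for x
    proof (cases "\<exists>j<n 0. x = c j")
      case True
      then obtain j where j: "j < n 0" "x = c j" by blast
      show ?thesis
        using j c_inj lc_delta[of "{..<n 0}" j c] by (intro exI[of _ "\<lambda>i. if i = j then \<one> else \<zero>"]) auto
    next
      case False
      then show ?thesis using c_span[OF x] by blast
    qed
    then have "\<forall>x. \<exists>r. x \<in> carrier C \<longrightarrow> (\<forall>i. r i \<in> carrier R) \<and> x = lc C {..<n 0} r c \<and>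
        (\<forall>j<n 0. x = c j \<longrightarrow> (\<forall>i<n 0. r i = (if i = j then \<one> else \<zero>)))" by blast
    from choice[OF this] obtain r where r0: "\<forall>x. x \<in> carrier C \<longrightarrow> (\<forall>i. r x i \<in> carrier R) \<and> x = lc C {..<n 0} (r x) c \<and>
        (\<forall>j<n 0. x = c j \<longrightarrow> (\<forall>i<n 0. r x i = (if i = j then \<one> else \<zero>)))" ..
    have r: "\<And>x i. x \<in> carrier C \<Longrightarrow> r x i \<in> carrier R"
      "\<And>x. x \<in> carrier C \<Longrightarrow> x = lc C {..<n 0} (r x) c"
      "\<And>i j. j < n 0 \<Longrightarrow> i < n 0 \<Longrightarrow> r (c j) i = (if i = j then \<one> else \<zero>)"
      using r0 c_closed by blast+
    \<comment> \<open>\<open>gen_aug\<close> is unspecified on \<open>Rel\<close>; the default zero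
      keeps every value in R.\<close>
    define \<beta> where "\<beta> b = (if gen_aug b \<in> carrier C then r (gen_aug b) else (\<lambda>_. \<zero>))" for b :: "('a, 'c) res_gen"
    have u: "retr_unit 0 \<beta>" using r(1,3) by (auto simp: retr_unit_def \<beta>_def)
    have "retr_lift 0 \<beta>"
      unfolding retr_lift_def
    proof (intro ballI impI)
      fix \<kappa> assume \<kappa>: "\<kappa> \<in> carrier (K 0)"
        and z: "if (0::nat) = 0 then lin_ext R C gen_aug \<kappa> = \<zero>\<^bsub>C\<^esub> else bd \<kappa> = (\<lambda>_. \<zero>)"
      have e: "\<beta>ext \<beta> \<kappa> i \<in> carrier R" for i
        using mod_hom_closed[OF \<beta>ext_hom[OF u] \<kappa>] by (simp add: reg_simps)
      have h: "lin_ext R C gen_aug \<in> mod_hom R (K 0) C" by (intro lin_ext_hom module_axioms) auto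
      \<comment> \<open>In degree 0 the retraction lifts the augmentation: both sides are linear in
        \<open>\<kappa>\<close> and agree on the basis by the choice of \<open>r\<close>. An element
        of the kernel therefore yields a relation among the \<open>c i\<close>.\<close>
      have "lc C {..<n 0} (\<beta>ext \<beta> \<kappa>) c = lin_ext R C gen_aug \<kappa>"
      proof (rule free_mod_hom_eqI[OF module_axioms _ h _ \<kappa>])
        have b: "\<beta>ext \<beta> \<kappa> i \<in> carrier R" if "\<kappa> \<in> carrier (K 0)" for \<kappa> i
          using mod_hom_closed[OF \<beta>ext_hom[OF u] that] by (simp add: reg_simps)
        show "(\<lambda>\<kappa>. lc C {..<n 0} (\<beta>ext \<beta> \<kappa>) c) \<in> mod_hom R (K 0) C"
        proof (rule mod_homI)
          fix \<kappa> assume \<kappa>: "\<kappa> \<in> carrier (K 0)"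
          then show "lc C {..<n 0} (\<beta>ext \<beta> \<kappa>) c \<in> carrier C" using b by auto
          show "lc C {..<n 0} (\<beta>ext \<beta> (\<kappa> \<oplus>\<^bsub>K 0\<^esub> \<kappa>')) c = lc C {..<n 0} (\<beta>ext \<beta> \<kappa>) c \<oplus>\<^bsub>C\<^esub> lc C {..<n 0} (\<beta>ext \<beta> \<kappa>') c"
            if "\<kappa>' \<in> carrier (K 0)" for \<kappa>'
            using b[OF \<kappa>] b[OF that] mod_hom_add[OF \<beta>ext_hom[OF u] \<kappa> that]
            by (simp add: lc_add_left[symmetric] reg_simps del: free_mod_simps)
          show "lc C {..<n 0} (\<beta>ext \<beta> (a \<odot>\<^bsub>K 0\<^esub> \<kappa>)) c = a \<odot>\<^bsub>C\<^esub> lc C {..<n 0} (\<beta>ext \<beta> \<kappa>) c"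
            if "a \<in> carrier R" for a
            using b[OF \<kappa>] that mod_hom_smult[OF \<beta>ext_hom[OF u] that \<kappa>]
            by (simp add: lc_smult(2)[symmetric] reg_simps del: free_mod_simps)
        qed
        fix b assume "b \<in> res_basis R C 0"
        then obtain x where x: "x \<in> carrier C" "b = Gen x" by auto
        have "\<beta>ext \<beta> (basis_vec R b) = \<beta> b" by (intro ext \<beta>ext_basis[OF u])
        also have "\<beta> b = r x" using x by (simp add: \<beta>_def)
        finally have "\<beta>ext \<beta> (basis_vec R b) = r x" .
        moreover have "lin_ext R C gen_aug (basis_vec R b) = x"
          using x by (subst lin_ext_basis[OF module_axioms]) auto
        ultimately show "lc C {..<n 0} (\<beta>ext \<beta> (basis_vec R b)) c = lin_ext R C gen_aug (basis_vec R b)"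
          using r(2)[OF x(1)] by simp
      qed
      then have "lc C {..<n 0} (\<beta>ext \<beta> \<kappa>) c = \<zero>\<^bsub>C\<^esub>" using z by simp
      from c_exact[OF e this] show "\<exists>s. (\<forall>l. s l \<in> carrier R) \<and> (\<forall>i<n 0. \<beta>ext \<beta> \<kappa> i = dn reg 0 s i)" by simp
    qed
    with u show "\<exists>\<beta>. retr_unit 0 \<beta> \<and> retr_lift 0 \<beta>" by blast
  next
    fix \<beta> k assume "retr_unit k \<beta> \<and> retr_lift k \<beta>"
    then have u: "retr_unit k \<beta>" and l: "retr_lift k \<beta>" by blast+
    have "\<exists>s. (\<forall>l. s l \<in> carrier R) \<and> (\<forall>i<n k. dn reg k s i = \<beta>ext \<beta> (gen_bd R b) i) \<and>
        (\<forall>j<n (Suc k). b = emb (Suc k) j \<longrightarrow> (\<forall>i<n (Suc k). s i = (if i = j then \<one> else \<zero>)))"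
      if b: "b \<in> res_basis R C (Suc k)" for b
    proof (cases "\<exists>j<n (Suc k). b = emb (Suc k) j")
      case True
      then obtain j where j: "j < n (Suc k)" "b = emb (Suc k) j" by blast
      let ?s = "\<lambda>i. if i = j then \<one> else \<zero>"
      \<comment> \<open>The prescribed value is compatible with the differential, since both sides
        are column \<open>j\<close> of \<open>D k\<close>: the unit tuple selects it on one side,
        and the retraction undoes the embedding on the other.\<close>
      have "dn reg k ?s i = \<beta>ext \<beta> (gen_bd R b) i" if i: "i < n k" for i
      proof -
        have "\<beta>ext \<beta> (gen_bd R b) i = lc reg {..<n k} (\<lambda>i'. D k i' j) (\<lambda>i'. \<beta>ext \<beta> (basis_vec R (emb k i')) i)"
          unfolding j(2) gen_bd_emb using emb_basis
          by (intro mod_hom_lc[OF free_mod_module[OF cring] reg_module \<beta>ext_hom[OF u]]) (auto intro!: basis_vec_mem cring)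
        also have "\<dots> = lc reg {..<n k} (\<lambda>i'. D k i' j) (\<lambda>i'. if i' = i then \<one> else \<zero>)"
          using i u by (intro lc_cong[OF reg_module]) (auto simp: \<beta>ext_basis[OF u] retr_unit_def reg_simps)
        also have "\<dots> = lc reg {..<n k} (\<lambda>i'. if i' = i then \<one> else \<zero>) (\<lambda>i'. D k i' j)"
          by (intro lc_regular_mod_comm[OF cring]) auto
        also have "\<dots> = D k i j" using i by (intro module.lc_delta[OF reg_module]) (auto simp: reg_simps)
        also have "\<dots> = lc reg {..<n (Suc k)} ?s (D k i)"
          using j by (intro module.lc_delta[OF reg_module, symmetric]) (auto simp: reg_simps)
        also have "\<dots> = dn reg k ?s i" by (intro lc_regular_mod_comm[OF cring]) auto
        finally show ?thesis by simp
      qed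
      then show ?thesis using j emb_inj[of _ "Suc k"] by (intro exI[of _ ?s]) (auto simp del: emb.simps)
    next
      case False
      have "\<exists>s. (\<forall>l. s l \<in> carrier R) \<and> (\<forall>i<n k. \<beta>ext \<beta> (gen_bd R b) i = dn reg k s i)"
        using l Rel_basisD[OF b] unfolding retr_lift_def by (cases "k = 0") auto
      then obtain s where s: "\<forall>l. s l \<in> carrier R" "\<forall>i<n k. \<beta>ext \<beta> (gen_bd R b) i = dn reg k s i" by blast
      show ?thesis
      proof (intro exI[of _ s] conjI allI impI)
        show "dn reg k s i = \<beta>ext \<beta> (gen_bd R b) i" if "i < n k" for i using s(2) that by simp
      qed (use s(1) False in blast)+
    qed
    then have ex: "\<And>b. b \<in> res_basis R C (Suc k) \<Longrightarrow> \<exists>s. (\<forall>l. s l \<in> carrier R) \<and> (\<forall>i<n k. dn reg k s i = \<beta>ext \<beta> (gen_bd R b) i) \<and>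
        (\<forall>j<n (Suc k). b = emb (Suc k) j \<longrightarrow> (\<forall>i<n (Suc k). s i = (if i = j then \<one> else \<zero>)))" .
    \<comment> \<open>Off the basis the zero tuple is taken, because \<open>retr_unit\<close> asks
      for values in R at every \<open>b\<close>.\<close>
    have "\<forall>b. \<exists>s. (\<forall>l. s l \<in> carrier R) \<and> (b \<in> res_basis R C (Suc k) \<longrightarrow> (\<forall>i<n k. dn reg k s i = \<beta>ext \<beta> (gen_bd R b) i) \<and>
        (\<forall>j<n (Suc k). b = emb (Suc k) j \<longrightarrow> (\<forall>i<n (Suc k). s i = (if i = j then \<one> else \<zero>))))"
    proof
      fix b show "\<exists>s. (\<forall>l. s l \<in> carrier R) \<and> (b \<in> res_basis R C (Suc k) \<longrightarrow> (\<forall>i<n k. dn reg k s i = \<beta>ext \<beta> (gen_bd R b) i) \<and>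
        (\<forall>j<n (Suc k). b = emb (Suc k) j \<longrightarrow> (\<forall>i<n (Suc k). s i = (if i = j then \<one> else \<zero>))))"
      proof (cases "b \<in> res_basis R C (Suc k)")
        case True
        from ex[OF this] show ?thesis by blast
      next
        case False
        then show ?thesis by (intro exI[of _ "\<lambda>_. \<zero>"]) simp
      qed
    qed
    from choice[OF this] obtain \<beta>' where \<beta>'0: "\<forall>b. (\<forall>l. \<beta>' b l \<in> carrier R) \<and>
      (b \<in> res_basis R C (Suc k) \<longrightarrow> (\<forall>i<n k. dn reg k (\<beta>' b) i = \<beta>ext \<beta> (gen_bd R b) i) \<and>
        (\<forall>j<n (Suc k). b = emb (Suc k) j \<longrightarrow> (\<forall>i<n (Suc k). \<beta>' b i = (if i = j then \<one> else \<zero>))))" ..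
    have \<beta>': "\<And>b l. \<beta>' b l \<in> carrier R"
      "\<And>b i. b \<in> res_basis R C (Suc k) \<Longrightarrow> i < n k \<Longrightarrow> dn reg k (\<beta>' b) i = \<beta>ext \<beta> (gen_bd R b) i"
      "\<And>i j. j < n (Suc k) \<Longrightarrow> i < n (Suc k) \<Longrightarrow> \<beta>' (emb (Suc k) j) i = (if i = j then \<one> else \<zero>)"
      using \<beta>'0 emb_basis[of _ "Suc k"] by blast+
    have u': "retr_unit (Suc k) \<beta>'" using \<beta>'(1,3) by (simp add: retr_unit_def)
    have s': "retr_step k \<beta> \<beta>'" using \<beta>'(2) by (simp add: retr_step_def)
    have "retr_lift (Suc k) \<beta>'"
      unfolding retr_lift_def
    proof (intro ballI impI)
      fix \<kappa> assume \<kappa>: "\<kappa> \<in> carrier (K (Suc k))"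
        and z: "if Suc k = 0 then lin_ext R C gen_aug \<kappa> = \<zero>\<^bsub>C\<^esub> else bd \<kappa> = (\<lambda>_. \<zero>)"
      have e: "\<beta>ext \<beta>' \<kappa> i \<in> carrier R" for i
        using mod_hom_closed[OF \<beta>ext_hom[OF u'] \<kappa>] by (simp add: reg_simps)
      \<comment> \<open>The retraction sends a cycle of the canonical resolution to a cycle of G,
        and G is exact there.\<close>
      have "dn reg k (\<beta>ext \<beta>' \<kappa>) i = \<zero>" if "i < n k" for i
      proof -
        have "dn reg k (\<beta>ext \<beta>' \<kappa>) i = \<beta>ext \<beta> (bd \<kappa>) i" by (rule retr_step_ext[OF u u' s' \<kappa> that])
        also have "\<dots> = \<zero>"
          using z mod_hom_zero[OF free_mod_module[OF cring] reg_module \<beta>ext_hom[OF u]] by (simp add: reg_simps)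
        finally show ?thesis .
      qed
      from D_exact[OF e this] show "\<exists>s. (\<forall>l. s l \<in> carrier R) \<and> (\<forall>i<n (Suc k). \<beta>ext \<beta>' \<kappa> i = dn reg (Suc k) s i)" .
    qed
    with u' s' show "\<exists>\<beta>'. (retr_unit (Suc k) \<beta>' \<and> retr_lift (Suc k) \<beta>') \<and> retr_step k \<beta> \<beta>'" by blast
  qed
  then show ?thesis by blast
qed

end

text \<open>Homology is unfolded to a bare set of cosets, so \<open>P\<close> need not be known to
  be a complex of modules. The image of \<open>u\<close> acts as zero on \<open>z\<close>, which
  places \<open>z\<close> in its own coset; since homology is trivial, that coset is the image of
  the differential.\<close>

lemma homology_zeroD:
  assumes "zero_mod (homology P i)" "z \<in> carrier (obj P i)" "diff P i z = \<zero>\<^bsub>obj P (i - 1)\<^esub>"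
    and "u \<in> carrier (obj P (i + 1))" "diff P (i + 1) u \<oplus>\<^bsub>obj P i\<^esub> z = z"
  shows "z \<in> diff P (i + 1) ` carrier (obj P (i + 1))"
proof -
  let ?Z = "obj P i \<lparr>carrier := {x \<in> carrier (obj P i). diff P i x = \<zero>\<^bsub>obj P (i - 1)\<^esub>}\<rparr>"
  let ?B = "diff P (i + 1) ` carrier (obj P (i + 1))"
  have "?B +>\<^bsub>?Z\<^esub> z \<in> carrier (homology P i)"
    using assms(2,3) by (auto simp: homology_def quot_mod_def A_RCOSETS_def')
  then have "?B +>\<^bsub>?Z\<^esub> z = ?B"
    using assms(1) by (simp add: zero_mod_def homology_def quot_mod_def)
  moreover have "z \<in> ?B +>\<^bsub>?Z\<^esub> z"
    using assms(4,5) unfolding a_r_coset_def' by force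
  ultimately show ?thesis by simp
qed

section \<open>Vanishing of Ext and Tor carried over to the finite resolution\<close>

context finite_resolution
begin

declare emb.simps(2) [simp del]

lemma free_resolution_simps:
  "obj (free_resolution R C) (int k) = K k"
  "diff (free_resolution R C) (int (Suc k)) = bd"
  by (simp_all add: free_resolution_def)

text \<open>A cocycle on G is composed with the retraction and becomes a coboundary on the canonical
  resolution. The homomorphism that bounds it is restricted along \<open>emb\<close>; because the
  retraction splits \<open>emb\<close>, this solves the original system.\<close>

lemma ext_acyclicI:
  assumes "module R N" "\<And>i. i > 0 \<Longrightarrow> zero_mod (Ext_mod R i C N)"
  shows "ext_acyclic N"
  unfolding ext_acyclic_def exact_pair_def
proof (intro allI ballI impI)
  interpret N: module R N by fact
  obtain \<beta> where \<beta>u: "\<And>k. retr_unit k (\<beta> k)" and \<beta>s: "\<And>k. retr_step k (\<beta> k) (\<beta> (Suc k))"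
    using retraction_exists by blast
  fix k x assume x: "x \<in> vec N" and z: "\<forall>l<n (Suc (Suc k)). up N (Suc k) x l = \<zero>\<^bsub>N\<^esub>"
  note xc = vecD[OF x]
  have \<beta>c: "\<beta> k b i \<in> carrier R" for k b i using \<beta>u by (simp add: retr_unit_def)
  let ?P = "hom_cplx R (free_resolution R C) N"
  let ?g = "\<lambda>b. lc N {..<n (Suc k)} (\<beta> (Suc k) b) x"
  \<comment> \<open>The cocycle \<open>x\<close>, viewed as a map on G, after the retraction. It is
    cut off outside the carrier because \<open>hom_mod\<close> consists of extensional
    functions.\<close>
  define f where "f = (\<lambda>\<kappa>\<in>carrier (K (Suc k)). lin_ext R N ?g \<kappa>)"
  have gc: "?g b \<in> carrier N" for b using \<beta>c xc by auto
  have fl: "lin_ext R N ?g \<in> mod_hom R (K (Suc k)) N" using gc by (intro lin_ext_hom assms(1))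
  have fh: "f \<in> mod_hom R (K (Suc k)) N"
    by (rule mod_hom_cong[OF free_mod_module[OF cring] fl]) (simp add: f_def)
  have fe: "f (basis_vec R b) = ?g b" if "b \<in> res_basis R C (Suc k)" for b
    using basis_vec_mem[OF cring that] gc by (simp add: f_def lin_ext_basis[OF assms(1)])
  have fext: "f \<kappa> = lc N {..<n (Suc k)} (\<beta>ext (\<beta> (Suc k)) \<kappa>) x" if \<kappa>: "\<kappa> \<in> carrier (K (Suc k))" for \<kappa>
  proof -
    let ?S = "{b. \<kappa> b \<noteq> \<zero>}"
    note kc = free_mod_carrierD[OF \<kappa>]
    have "f \<kappa> = lc N ?S \<kappa> ?g"
      unfolding free_mod_hom_expand[OF assms(1) fh \<kappa>]
      using kc gc by (intro lc_cong[OF assms(1)]) (auto simp: fe)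
    also have "\<dots> = lc N {..<n (Suc k)} (\<lambda>j. \<Oplus>b\<in>?S. \<kappa> b \<otimes> \<beta> (Suc k) b j) x"
      using kc \<beta>c xc by (intro N.lc_lc) auto
    also have "\<dots> = lc N {..<n (Suc k)} (\<beta>ext (\<beta> (Suc k)) \<kappa>) x"
    proof (intro lc_cong[OF assms(1)] refl xc)
      fix j
      show "(\<Oplus>b\<in>?S. \<kappa> b \<otimes> \<beta> (Suc k) b j) = \<beta>ext (\<beta> (Suc k)) \<kappa> j"
        using kc \<beta>c by (subst lin_ext_eq_lc[OF reg_module]) (auto simp: lc_regular_mod reg_simps)
      show "\<beta>ext (\<beta> (Suc k)) \<kappa> j \<in> carrier R"
        using mod_hom_closed[OF \<beta>ext_hom[OF \<beta>u] \<kappa>] by (simp add: reg_simps)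
    qed
    finally show ?thesis .
  qed
  have cocycle: "f (bd \<kappa>) = \<zero>\<^bsub>N\<^esub>" if \<kappa>: "\<kappa> \<in> carrier (K (Suc (Suc k)))" for \<kappa>
  proof -
    have b\<kappa>: "bd \<kappa> \<in> carrier (K (Suc k))" by (rule mod_hom_closed[OF bd_hom \<kappa>])
    have e: "\<beta>ext (\<beta> (Suc (Suc k))) \<kappa> l \<in> carrier R" for l
      using mod_hom_closed[OF \<beta>ext_hom[OF \<beta>u] \<kappa>] by (simp add: reg_simps)
    have "f (bd \<kappa>) = lc N {..<n (Suc k)} (\<beta>ext (\<beta> (Suc k)) (bd \<kappa>)) x" by (rule fext[OF b\<kappa>])
    also have "\<dots> = lc N {..<n (Suc k)} (\<lambda>j. \<Oplus>l\<in>{..<n (Suc (Suc k))}. \<beta>ext (\<beta> (Suc (Suc k))) \<kappa> l \<otimes> D (Suc k) j l) x"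
    proof (intro lc_cong[OF assms(1)] refl xc)
      fix j assume j: "j \<in> {..<n (Suc k)}"
      have "\<beta>ext (\<beta> (Suc k)) (bd \<kappa>) j = dn reg (Suc k) (\<beta>ext (\<beta> (Suc (Suc k))) \<kappa>) j"
        using retr_step_ext[OF \<beta>u \<beta>u \<beta>s \<kappa>] j by simp
      also have "\<dots> = (\<Oplus>l\<in>{..<n (Suc (Suc k))}. \<beta>ext (\<beta> (Suc (Suc k))) \<kappa> l \<otimes> D (Suc k) j l)"
        unfolding lc_regular_mod using e by (intro R.finsum_cong') (auto simp: R.m_comm)
      finally show "\<beta>ext (\<beta> (Suc k)) (bd \<kappa>) j = (\<Oplus>l\<in>{..<n (Suc (Suc k))}. \<beta>ext (\<beta> (Suc (Suc k))) \<kappa> l \<otimes> D (Suc k) j l)" .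
      show "(\<Oplus>l\<in>{..<n (Suc (Suc k))}. \<beta>ext (\<beta> (Suc (Suc k))) \<kappa> l \<otimes> D (Suc k) j l) \<in> carrier R"
        using e by (intro R.finsum_closed) auto
    qed
    also have "\<dots> = lc N {..<n (Suc (Suc k))} (\<beta>ext (\<beta> (Suc (Suc k))) \<kappa>) (up N (Suc k) x)"
      using e xc by (intro N.lc_lc[symmetric]) auto
    also have "\<dots> = \<zero>\<^bsub>N\<^esub>" by (rule N.lc_zero) (use e z in auto)
    finally show ?thesis .
  qed
  have o: "obj ?P (- int k) = hom_mod R (K k) N" for k by (simp add: hom_cplx_def free_resolution_simps)
  have d: "diff ?P (- int k) = (\<lambda>f. \<lambda>\<kappa>\<in>carrier (K (Suc k)). f (bd \<kappa>))" for k
    using free_resolution_simps[of "Suc k"] free_resolution_simps(2)[of k] by (simp add: hom_cplx_def)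
  have ix: "- int (Suc k) + 1 = - int k" "- int (Suc k) - 1 = - int (Suc (Suc k))" by simp_all
  have o': "obj ?P (- int (Suc k) + 1) = hom_mod R (K k) N"
    "obj ?P (- int (Suc k) - 1) = hom_mod R (K (Suc (Suc k))) N"
    "diff ?P (- int (Suc k) + 1) = (\<lambda>f. \<lambda>\<kappa>\<in>carrier (K (Suc k)). f (bd \<kappa>))"
    unfolding ix o d by (rule refl)+
  have zm: "zero_mod (homology ?P (- int (Suc k)))"
    using assms(2)[of "Suc k"] by (simp add: Ext_mod_def)
  have "f \<in> diff ?P (- int (Suc k) + 1) ` carrier (obj ?P (- int (Suc k) + 1))"
  proof (rule homology_zeroD[OF zm])
    show "f \<in> carrier (obj ?P (- int (Suc k)))"
      unfolding o using fh by (auto simp: hom_mod_def f_def)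
    show "diff ?P (- int (Suc k)) f = \<zero>\<^bsub>obj ?P (- int (Suc k) - 1)\<^esub>"
      unfolding d o' using cocycle by (auto simp: hom_mod_def)
    show "(\<lambda>\<kappa>\<in>carrier (K k). \<zero>\<^bsub>N\<^esub>) \<in> carrier (obj ?P (- int (Suc k) + 1))"
      unfolding o' by (auto simp: hom_mod_def mod_hom_def module.smult_closed[OF free_mod_module[OF cring]]
          module_a_closed[OF free_mod_module[OF cring]]
          simp del: free_mod_simps)
    show "diff ?P (- int (Suc k) + 1) (\<lambda>\<kappa>\<in>carrier (K k). \<zero>\<^bsub>N\<^esub>) \<oplus>\<^bsub>obj ?P (- int (Suc k))\<^esub> f = f"
      unfolding o' o using mod_hom_closed[OF bd_hom, of _ k] mod_hom_closed[OF fh]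
      by (auto simp: hom_mod_def f_def fun_eq_iff)
  qed
  then obtain g where g: "g \<in> mod_hom R (K k) N" "f = (\<lambda>\<kappa>\<in>carrier (K (Suc k)). g (bd \<kappa>))"
    unfolding o' by (auto simp: hom_mod_def)
  have bm: "basis_vec R (emb k i) \<in> carrier (K k)" if "i < n k" for i k
    using emb_basis[OF that] by (intro basis_vec_mem cring)
  define y where "y i = (if i < n k then g (basis_vec R (emb k i)) else \<zero>\<^bsub>N\<^esub>)" for i
  have yv: "y \<in> vec N" using mod_hom_closed[OF g(1)] bm by (auto simp: vec_def y_def)
  have "x j = up N k y j" if j: "j < n (Suc k)" for j
  proof -
    note eb = emb_basis[OF j]
    have "up N k y j = lc N {..<n k} (\<lambda>i. D k i j) (\<lambda>i. g (basis_vec R (emb k i)))"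
      using mod_hom_closed[OF g(1)] bm by (intro lc_cong[OF assms(1)]) (auto simp: y_def)
    also have "\<dots> = g (gen_bd R (emb (Suc k) j))"
      unfolding gen_bd_emb using bm
      by (intro mod_hom_lc[OF free_mod_module[OF cring] assms(1) g(1), symmetric]) auto
    also have "\<dots> = f (basis_vec R (emb (Suc k) j))"
      unfolding g(2) using bm[OF j] by (simp add: bd_basis[OF eb] del: emb.simps)
    also have "\<dots> = lc N {..<n (Suc k)} (\<beta> (Suc k) (emb (Suc k) j)) x" by (rule fe[OF eb])
    also have "\<dots> = lc N {..<n (Suc k)} (\<lambda>i. if i = j then \<one> else \<zero>) x"
      using \<beta>u[of "Suc k"] j xc by (intro lc_cong[OF assms(1)]) (auto simp: retr_unit_def simp del: emb.simps)
    also have "\<dots> = x j" using j xc by (intro N.lc_delta) auto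
    finally show ?thesis ..
  qed
  with yv show "\<exists>y\<in>vec N. \<forall>j<n (Suc k). x j = up N k y j" by blast
qed

text \<open>The opposite route: a cycle over G is carried by \<open>emb\<close> into the canonical
  complex, becomes a boundary there, and the retraction brings the bounding element back.\<close>

lemma tor_acyclicI:
  assumes "module R M'" "\<And>i. i > 0 \<Longrightarrow> zero_mod (Tor_mod R i C M')"
  shows "tor_acyclic M'"
  unfolding tor_acyclic_def exact_pair_def
proof (intro allI ballI impI)
  interpret N: module R M' by fact
  obtain \<beta> where \<beta>u: "\<And>k. retr_unit k (\<beta> k)" and \<beta>s: "\<And>k. retr_step k (\<beta> k) (\<beta> (Suc k))"
    using retraction_exists by blast
  fix k x assume x: "x \<in> vec M'" and z: "\<forall>i<n k. dn M' k x i = \<zero>\<^bsub>M'\<^esub>"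
  note xc = vecD[OF x]
  have TP: "tensor_product R (K k) M'" for k
    using free_mod_module[OF cring] assms(1) by (simp add: tensor_product_def)
  let ?T = "\<lambda>k. tensor_mod R (K k) M'" and ?e = "\<lambda>k. tensor_elt R (K k) M'"
  have Tm: "module R (?T k)" for k by (rule tensor_product.tensor_module[OF TP])
  have tm: "tensor_map R (K k) M' bd \<in> mod_hom R (?T (Suc k)) (?T k)"
    and te: "\<kappa> \<in> carrier (K (Suc k)) \<Longrightarrow> u \<in> carrier M' \<Longrightarrow>
      tensor_map R (K k) M' bd (?e (Suc k) \<kappa> u) = ?e k (bd \<kappa>) u" for k \<kappa> u
    using tensor_map_hom[OF free_mod_module[OF cring] free_mod_module[OF cring] assms(1) bd_hom] by blast+
  note eR = tensor_product.elt_hom_right[OF TP] and eL = tensor_product.elt_hom_left[OF TP]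
    and ec = tensor_product.elt_closed[OF TP]
  have be: "\<beta>ext (\<beta> k) \<kappa> i \<in> carrier R" if "\<kappa> \<in> carrier (K k)" for \<kappa> i k
    using mod_hom_closed[OF \<beta>ext_hom[OF \<beta>u] that] by (simp add: reg_simps)
  \<comment> \<open>\<open>h k i\<close> is the \<open>i\<close>-th coordinate of the retraction
    tensored with \<open>M'\<close>.\<close>
  have "\<exists>h\<in>mod_hom R (?T k) M'. \<forall>\<kappa>\<in>carrier (K k). \<forall>u\<in>carrier M'. h (?e k \<kappa> u) = \<beta>ext (\<beta> k) \<kappa> i \<odot>\<^bsub>M'\<^esub> u" for k i
  proof (rule tensor_product.tensor_lift[OF TP assms(1)], rule bilinear_mapI)
    fix \<kappa> assume \<kappa>: "\<kappa> \<in> carrier (K k)"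
    show "(\<odot>\<^bsub>M'\<^esub>) (\<beta>ext (\<beta> k) \<kappa> i) \<in> mod_hom R M' M'"
      using be[OF \<kappa>] by (intro mod_homI) (auto simp: N.smult_r_distr N.smult_assoc1[symmetric] R.m_comm)
  next
    fix u assume u: "u \<in> carrier M'"
    note h = mod_hom_add[OF \<beta>ext_hom[OF \<beta>u]] mod_hom_smult[OF \<beta>ext_hom[OF \<beta>u]]
    show "(\<lambda>\<kappa>. \<beta>ext (\<beta> k) \<kappa> i \<odot>\<^bsub>M'\<^esub> u) \<in> mod_hom R (K k) M'"
      using be u by (intro mod_homI) (auto simp: h reg_simps N.smult_l_distr N.smult_assoc1 simp del: free_mod_simps)
  qed
  then obtain h where hh: "\<And>k i. h k i \<in> mod_hom R (?T k) M'"
    and he: "\<And>k i \<kappa> u. \<kappa> \<in> carrier (K k) \<Longrightarrow> u \<in> carrier M' \<Longrightarrow> h k i (?e k \<kappa> u) = \<beta>ext (\<beta> k) \<kappa> i \<odot>\<^bsub>M'\<^esub> u"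
    by metis
  have hd: "h (Suc k) j (tensor_map R (K (Suc k)) M' bd t) = dn M' (Suc k) (\<lambda>l. h (Suc (Suc k)) l t) j"
    if t: "t \<in> carrier (?T (Suc (Suc k)))" and j: "j < n (Suc k)" for t j
  proof (rule tensor_product.tensor_hom_eqI[OF TP assms(1) _ _ _ t])
    show "(\<lambda>t. h (Suc k) j (tensor_map R (K (Suc k)) M' bd t)) \<in> mod_hom R (?T (Suc (Suc k))) M'"
      by (rule mod_hom_comp[OF tm hh])
    show "(\<lambda>t. dn M' (Suc k) (\<lambda>l. h (Suc (Suc k)) l t) j) \<in> mod_hom R (?T (Suc (Suc k))) M'"
      by (intro mod_hom_lc_fun assms(1) hh) auto
    fix \<kappa> u assume \<kappa>: "\<kappa> \<in> carrier (K (Suc (Suc k)))" and u: "u \<in> carrier M'"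
    have "h (Suc k) j (tensor_map R (K (Suc k)) M' bd (?e (Suc (Suc k)) \<kappa> u)) = \<beta>ext (\<beta> (Suc k)) (bd \<kappa>) j \<odot>\<^bsub>M'\<^esub> u"
      by (simp add: te[OF \<kappa> u] he[OF mod_hom_closed[OF bd_hom \<kappa>] u])
    also have "\<beta>ext (\<beta> (Suc k)) (bd \<kappa>) j = (\<Oplus>l\<in>{..<n (Suc (Suc k))}. D (Suc k) j l \<otimes> \<beta>ext (\<beta> (Suc (Suc k))) \<kappa> l)"
      using retr_step_ext[OF \<beta>u \<beta>u \<beta>s \<kappa> j] by (simp add: lc_regular_mod)
    also have "\<dots> \<odot>\<^bsub>M'\<^esub> u = (\<Oplus>\<^bsub>M'\<^esub>l\<in>{..<n (Suc (Suc k))}. (D (Suc k) j l \<otimes> \<beta>ext (\<beta> (Suc (Suc k))) \<kappa> l) \<odot>\<^bsub>M'\<^esub> u)"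
      using be[OF \<kappa>] u by (intro N.finsum_smult_rdistr) auto
    also have "\<dots> = dn M' (Suc k) (\<lambda>l. h (Suc (Suc k)) l (?e (Suc (Suc k)) \<kappa> u)) j"
      unfolding lc_def using be[OF \<kappa>] u by (intro N.finsum_cong') (auto simp: he[OF \<kappa> u] N.smult_assoc1)
    finally show "h (Suc k) j (tensor_map R (K (Suc k)) M' bd (?e (Suc (Suc k)) \<kappa> u)) =
        dn M' (Suc k) (\<lambda>l. h (Suc (Suc k)) l (?e (Suc (Suc k)) \<kappa> u)) j" .
  qed
  have bm: "basis_vec R (emb k i) \<in> carrier (K k)" if "i < n k" for i k
    using emb_basis[OF that] by (intro basis_vec_mem cring)
  \<comment> \<open>The image of \<open>x\<close> under the embedding tensored with
    \<open>M'\<close>. Its boundary is a double sum; exchanging the sums brings out the system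
    \<open>z\<close> that \<open>x\<close> satisfies.\<close>
  define \<xi> where "\<xi> = lc (?T (Suc k)) {..<n (Suc k)} (\<lambda>_. \<one>) (\<lambda>j. ?e (Suc k) (basis_vec R (emb (Suc k) j)) (x j))"
  have \<xi>c: "\<xi> \<in> carrier (?T (Suc k))"
    unfolding \<xi>_def using bm xc by (intro module.lc_closed[OF Tm] ec) auto
  have "tensor_map R (K k) M' bd \<xi> = lc (?T k) {..<n (Suc k)} (\<lambda>_. \<one>)
      (\<lambda>j. tensor_map R (K k) M' bd (?e (Suc k) (basis_vec R (emb (Suc k) j)) (x j)))"
    unfolding \<xi>_def using bm xc by (intro mod_hom_lc[OF Tm Tm tm] ec) auto
  also have "\<dots> = lc (?T k) {..<n (Suc k)} (\<lambda>_. \<one>)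
      (\<lambda>j. lc (?T k) {..<n k} (\<lambda>_. \<one>) (\<lambda>i. D k i j \<odot>\<^bsub>?T k\<^esub> ?e k (basis_vec R (emb k i)) (x j)))"
  proof (intro lc_cong[OF Tm] refl)
    fix j assume j: "j \<in> {..<n (Suc k)}"
    have "tensor_map R (K k) M' bd (?e (Suc k) (basis_vec R (emb (Suc k) j)) (x j)) = ?e k (gen_bd R (emb (Suc k) j)) (x j)"
      using j te[OF bm xc, of j k j] bd_basis[OF emb_basis] by (simp del: emb.simps)
    also have "\<dots> = lc (?T k) {..<n k} (\<lambda>i. D k i j) (\<lambda>i. ?e k (basis_vec R (emb k i)) (x j))"
      unfolding gen_bd_emb using bm by (intro mod_hom_lc[OF free_mod_module[OF cring] Tm eL[OF xc]]) auto
    also have "\<dots> = lc (?T k) {..<n k} (\<lambda>_. \<one>) (\<lambda>i. D k i j \<odot>\<^bsub>?T k\<^esub> ?e k (basis_vec R (emb k i)) (x j))"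
      unfolding lc_def using bm ec[OF bm xc] module.smult_closed[OF Tm] module.smult_one[OF Tm]
      by (intro module_finsum_cong'[OF Tm]) auto
    finally show "tensor_map R (K k) M' bd (?e (Suc k) (basis_vec R (emb (Suc k) j)) (x j)) =
      lc (?T k) {..<n k} (\<lambda>_. \<one>) (\<lambda>i. D k i j \<odot>\<^bsub>?T k\<^esub> ?e k (basis_vec R (emb k i)) (x j))" .
    show "lc (?T k) {..<n k} (\<lambda>_. \<one>) (\<lambda>i. D k i j \<odot>\<^bsub>?T k\<^esub> ?e k (basis_vec R (emb k i)) (x j)) \<in> carrier (?T k)"
      using bm ec[OF bm xc] by (intro module.lc_closed[OF Tm] module.smult_closed[OF Tm]) auto
  qed auto
  also have "\<dots> = lc (?T k) {..<n k} (\<lambda>_. \<one>)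
      (\<lambda>i. lc (?T k) {..<n (Suc k)} (\<lambda>_. \<one>) (\<lambda>j. D k i j \<odot>\<^bsub>?T k\<^esub> ?e k (basis_vec R (emb k i)) (x j)))"
    using ec[OF bm xc] by (intro module.lc_swap[OF Tm] module.smult_closed[OF Tm]) auto
  also have "\<dots> = \<zero>\<^bsub>?T k\<^esub>"
  proof (rule module.lc_zero[OF Tm])
    fix i assume i: "i \<in> {..<n k}"
    have "lc (?T k) {..<n (Suc k)} (\<lambda>_. \<one>) (\<lambda>j. D k i j \<odot>\<^bsub>?T k\<^esub> ?e k (basis_vec R (emb k i)) (x j)) =
        lc (?T k) {..<n (Suc k)} (D k i) (\<lambda>j. ?e k (basis_vec R (emb k i)) (x j))"
      unfolding lc_def using i ec[OF bm xc] module.smult_closed[OF Tm] module.smult_one[OF Tm]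
      by (intro module_finsum_cong'[OF Tm]) auto
    also have "\<dots> = ?e k (basis_vec R (emb k i)) (dn M' k x i)"
      using i bm xc by (intro mod_hom_lc[OF assms(1) Tm eR, symmetric]) auto
    also have "\<dots> = \<zero>\<^bsub>?T k\<^esub>"
      using z i mod_hom_zero[OF assms(1) Tm eR[OF bm]] by simp
    finally show "lc (?T k) {..<n (Suc k)} (\<lambda>_. \<one>) (\<lambda>j. D k i j \<odot>\<^bsub>?T k\<^esub> ?e k (basis_vec R (emb k i)) (x j)) = \<zero>\<^bsub>?T k\<^esub>" .
  qed simp
  finally have cyc: "tensor_map R (K k) M' bd \<xi> = \<zero>\<^bsub>?T k\<^esub>" .
  let ?P = "tensor_cplx R (free_resolution R C) M'"
  have o: "obj ?P (int k) = ?T k" for k by (simp add: tensor_cplx_def free_resolution_simps)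
  have d: "diff ?P (int (Suc k)) = tensor_map R (K k) M' bd" for k
  proof -
    have "int (Suc k) - 1 = int k" by simp
    then show ?thesis
      using free_resolution_simps(2)[of k] free_resolution_simps(1)[of k] by (simp only: tensor_cplx_def cplx.simps)
  qed
  have ix: "int (Suc k) + 1 = int (Suc (Suc k))" "int (Suc k) - 1 = int k" by simp_all
  have zm: "zero_mod (homology ?P (int (Suc k)))"
    using assms(2)[of "Suc k"] by (simp add: Tor_mod_def)
  have "\<xi> \<in> diff ?P (int (Suc k) + 1) ` carrier (obj ?P (int (Suc k) + 1))"
  proof (rule homology_zeroD[OF zm])
    show "\<xi> \<in> carrier (obj ?P (int (Suc k)))" unfolding o by (rule \<xi>c)
    show "diff ?P (int (Suc k)) \<xi> = \<zero>\<^bsub>obj ?P (int (Suc k) - 1)\<^esub>"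
      unfolding ix d o by (rule cyc)
    show "\<zero>\<^bsub>?T (Suc (Suc k))\<^esub> \<in> carrier (obj ?P (int (Suc k) + 1))"
      unfolding ix o by (rule module_zero_closed[OF Tm])
    show "diff ?P (int (Suc k) + 1) \<zero>\<^bsub>?T (Suc (Suc k))\<^esub> \<oplus>\<^bsub>obj ?P (int (Suc k))\<^esub> \<xi> = \<xi>"
      unfolding ix d o mod_hom_zero[OF Tm Tm tm]
      by (rule module_l_zero[OF Tm \<xi>c])
  qed
  then obtain \<eta> where \<eta>: "\<eta> \<in> carrier (?T (Suc (Suc k)))" "\<xi> = tensor_map R (K (Suc k)) M' bd \<eta>"
    unfolding ix d o by blast
  have "(\<lambda>l. h (Suc (Suc k)) l \<eta>) \<in> vec M'" using mod_hom_closed[OF hh \<eta>(1)] by (simp add: vec_def)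
  moreover have "x j = dn M' (Suc k) (\<lambda>l. h (Suc (Suc k)) l \<eta>) j" if j: "j < n (Suc k)" for j
  proof -
    have "dn M' (Suc k) (\<lambda>l. h (Suc (Suc k)) l \<eta>) j = h (Suc k) j \<xi>"
      unfolding \<eta>(2) by (rule hd[OF \<eta>(1) j, symmetric])
    also have "\<dots> = lc M' {..<n (Suc k)} (\<lambda>_. \<one>) (\<lambda>j'. h (Suc k) j (?e (Suc k) (basis_vec R (emb (Suc k) j')) (x j')))"
      unfolding \<xi>_def using bm xc by (intro mod_hom_lc[OF Tm assms(1) hh] ec) auto
    also have "\<dots> = lc M' {..<n (Suc k)} (\<lambda>j'. if j' = j then \<one> else \<zero>) x"
      unfolding lc_def
    proof (intro N.finsum_cong' refl)
      fix j' assume j': "j' \<in> {..<n (Suc k)}"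
      have "h (Suc k) j (?e (Suc k) (basis_vec R (emb (Suc k) j')) (x j')) = \<beta> (Suc k) (emb (Suc k) j') j \<odot>\<^bsub>M'\<^esub> x j'"
        using j' by (subst he[OF bm xc]) (auto simp: \<beta>ext_basis[OF \<beta>u] simp del: emb.simps)
      then show "\<one> \<odot>\<^bsub>M'\<^esub> h (Suc k) j (?e (Suc k) (basis_vec R (emb (Suc k) j')) (x j')) =
          (if j' = j then \<one> else \<zero>) \<odot>\<^bsub>M'\<^esub> x j'"
        using \<beta>u[of "Suc k"] j j' xc by (auto simp: retr_unit_def simp del: emb.simps)
    qed (use xc in auto)
    also have "\<dots> = x j" using j xc by (intro N.lc_delta) auto
    finally show ?thesis ..
  qed
  ultimately show "\<exists>y\<in>vec M'. \<forall>j<n (Suc k). x j = dn M' (Suc k) y j" by blast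
qed

end

section \<open>Tensoring with a finitely presented module\<close>

context finite_resolution
begin

section \<open>Homomorphisms from C by generators and relations\<close>

lemma hom_C_eqI:
  assumes "module R X" "f \<in> mod_hom R C X" "g \<in> mod_hom R C X"
    and "\<And>i. i < n 0 \<Longrightarrow> f (c i) = g (c i)" "x \<in> carrier C"
  shows "f x = g x"
proof -
  obtain r where r: "\<forall>i. r i \<in> carrier R" "x = lc C {..<n 0} r c" using c_span[OF assms(5)] by blast
  have "f x = lc X {..<n 0} r (\<lambda>i. f (c i))"
    unfolding r(2) using r(1) by (intro mod_hom_lc[OF module_axioms assms(1,2)]) auto
  also have "\<dots> = lc X {..<n 0} r (\<lambda>i. g (c i))"
    using r(1) assms(4) mod_hom_closed[OF assms(3)] by (intro lc_cong[OF assms(1)]) auto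
  also have "\<dots> = g x"
    unfolding r(2) using r(1) by (intro mod_hom_lc[OF module_axioms assms(1,3), symmetric]) auto
  finally show ?thesis .
qed

lemma hom_C_up:
  assumes "module R X" "f \<in> mod_hom R C X" "j < n 1"
  shows "up X 0 (\<lambda>i. f (c i)) j = \<zero>\<^bsub>X\<^esub>"
proof -
  have "up X 0 (\<lambda>i. f (c i)) j = f (lc C {..<n 0} (\<lambda>i. D 0 i j) c)"
    by (intro mod_hom_lc[OF module_axioms assms(1,2), symmetric]) auto
  then show ?thesis using c_D[OF assms(3)] mod_hom_zero[OF module_axioms assms(1,2)] by simp
qed

text \<open>With \<open>hom_C_up\<close> this identifies Hom(C, X) with the kernel of the transpose
  of \<open>D 0\<close> on X^(n 0). Extending the values linearly is well defined because every
  relation among the \<open>c i\<close> is a combination of columns of \<open>D 0\<close>.\<close>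

lemma hom_from_C:
  assumes "module R X" "\<And>i. i < n 0 \<Longrightarrow> y i \<in> carrier X" "\<And>j. j < n 1 \<Longrightarrow> up X 0 y j = \<zero>\<^bsub>X\<^esub>"
  shows "\<exists>f\<in>mod_hom R C X. \<forall>i<n 0. f (c i) = y i"
proof -
  interpret X: module R X by fact
  have z: "lc X {..<n 0} r y = \<zero>\<^bsub>X\<^esub>" if r: "\<And>i. r i \<in> carrier R" "lc C {..<n 0} r c = \<zero>\<^bsub>C\<^esub>" for r
  proof -
    obtain s where s: "\<forall>j. s j \<in> carrier R" "\<forall>i<n 0. r i = lc reg {..<n 1} (D 0 i) s"
      using c_exact[OF r] by blast
    have "lc X {..<n 0} r y = lc X {..<n 0} (\<lambda>i. \<Oplus>j\<in>{..<n 1}. s j \<otimes> D 0 i j) y"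
      using s assms(2)
      by (intro lc_cong[OF assms(1)]) (auto simp: lc_regular_mod R.m_comm intro!: R.finsum_cong')
    also have "\<dots> = lc X {..<n 1} s (up X 0 y)"
      using s assms(2) by (intro X.lc_lc[symmetric]) auto
    also have "\<dots> = \<zero>\<^bsub>X\<^esub>" by (rule X.lc_zero) (use s assms(3) in auto)
    finally show ?thesis .
  qed
  have "\<forall>x. \<exists>r. x \<in> carrier C \<longrightarrow> (\<forall>i. r i \<in> carrier R) \<and> x = lc C {..<n 0} r c" using c_span by blast
  from choice[OF this] obtain r where r: "\<And>x i. x \<in> carrier C \<Longrightarrow> r x i \<in> carrier R"
    "\<And>x. x \<in> carrier C \<Longrightarrow> x = lc C {..<n 0} (r x) c" by blast
  \<comment> \<open>The value does not depend on the coefficients: two expressions of one element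
    differ by a relation, to which \<open>z\<close> applies.\<close>
  have eq: "lc X {..<n 0} a y = lc X {..<n 0} b y"
    if ab: "\<And>i. a i \<in> carrier R" "\<And>i. b i \<in> carrier R" and e: "lc C {..<n 0} a c = lc C {..<n 0} b c" for a b
  proof -
    have "lc C {..<n 0} (\<lambda>i. a i \<oplus> (\<ominus> \<one>) \<otimes> b i) c = lc C {..<n 0} a c \<ominus>\<^bsub>C\<^esub> lc C {..<n 0} b c"
      using ab by (subst lc_add_left)
        (auto simp: lc_smult a_minus_def smult_minus_one lc_closed simp del: R.l_minus)
    also have "\<dots> = \<zero>\<^bsub>C\<^esub>" using e ab by (simp add: minus_eq_zero_iff lc_closed)
    finally have "lc X {..<n 0} (\<lambda>i. a i \<oplus> (\<ominus> \<one>) \<otimes> b i) y = \<zero>\<^bsub>X\<^esub>" using ab by (intro z) auto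
    moreover have "lc X {..<n 0} (\<lambda>i. a i \<oplus> (\<ominus> \<one>) \<otimes> b i) y = lc X {..<n 0} a y \<ominus>\<^bsub>X\<^esub> lc X {..<n 0} b y"
    proof -
      have "lc X {..<n 0} (\<lambda>i. (\<ominus> \<one>) \<otimes> b i) y = (\<ominus> \<one>) \<odot>\<^bsub>X\<^esub> lc X {..<n 0} b y"
        using ab assms(2) by (intro X.lc_smult(2)) auto
      moreover have "lc X {..<n 0} (\<lambda>i. a i \<oplus> (\<ominus> \<one>) \<otimes> b i) y = lc X {..<n 0} a y \<oplus>\<^bsub>X\<^esub> lc X {..<n 0} (\<lambda>i. (\<ominus> \<one>) \<otimes> b i) y"
        using ab assms(2) by (intro X.lc_add_left) auto
      moreover have "lc X {..<n 0} b y \<in> carrier X" using ab assms(2) by (intro X.lc_closed) auto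
      ultimately show ?thesis by (simp add: a_minus_def X.smult_minus_one)
    qed
    moreover have "lc X {..<n 0} a y \<in> carrier X" "lc X {..<n 0} b y \<in> carrier X"
      using ab assms(2) by (auto intro!: X.lc_closed)
    ultimately show ?thesis by (simp add: X.minus_eq_zero_iff)
  qed
  let ?f = "\<lambda>x. lc X {..<n 0} (r x) y"
  have "?f \<in> mod_hom R C X"
  proof (rule mod_homI)
    fix x assume x: "x \<in> carrier C"
    then show "?f x \<in> carrier X" using r assms(2) by auto
    show "?f (x \<oplus>\<^bsub>C\<^esub> x') = ?f x \<oplus>\<^bsub>X\<^esub> ?f x'" if x': "x' \<in> carrier C" for x'
    proof -
      have "?f (x \<oplus>\<^bsub>C\<^esub> x') = lc X {..<n 0} (\<lambda>i. r x i \<oplus> r x' i) y"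
      proof (rule eq)
        have "lc C {..<n 0} (\<lambda>i. r x i \<oplus> r x' i) c = lc C {..<n 0} (r x) c \<oplus>\<^bsub>C\<^esub> lc C {..<n 0} (r x') c"
          using r(1)[OF x] r(1)[OF x'] by (intro lc_add_left) auto
        then show "lc C {..<n 0} (r (x \<oplus>\<^bsub>C\<^esub> x')) c = lc C {..<n 0} (\<lambda>i. r x i \<oplus> r x' i) c"
          using r(2)[OF x] r(2)[OF x'] r(2)[of "x \<oplus>\<^bsub>C\<^esub> x'"] x x' by simp
      qed (use r x x' in auto)
      also have "\<dots> = ?f x \<oplus>\<^bsub>X\<^esub> ?f x'"
        using r(1)[OF x] r(1)[OF x'] assms(2) by (intro X.lc_add_left) auto
      finally show ?thesis .
    qed
    show "?f (a \<odot>\<^bsub>C\<^esub> x) = a \<odot>\<^bsub>X\<^esub> ?f x" if a: "a \<in> carrier R" for a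
    proof -
      have "?f (a \<odot>\<^bsub>C\<^esub> x) = lc X {..<n 0} (\<lambda>i. a \<otimes> r x i) y"
      proof (rule eq)
        have "lc C {..<n 0} (\<lambda>i. a \<otimes> r x i) c = a \<odot>\<^bsub>C\<^esub> lc C {..<n 0} (r x) c"
          using r(1)[OF x] a by (intro lc_smult(2)) auto
        then show "lc C {..<n 0} (r (a \<odot>\<^bsub>C\<^esub> x)) c = lc C {..<n 0} (\<lambda>i. a \<otimes> r x i) c"
          using r(2)[OF x] r(2)[of "a \<odot>\<^bsub>C\<^esub> x"] x a by simp
      qed (use r x a in auto)
      also have "\<dots> = a \<odot>\<^bsub>X\<^esub> ?f x" using r(1)[OF x] a assms(2) by (intro X.lc_smult(2)) auto
      finally show ?thesis .
    qed
  qed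
  moreover have "?f (c i) = y i" if i: "i < n 0" for i
  proof -
    have "?f (c i) = lc X {..<n 0} (\<lambda>j. if j = i then \<one> else \<zero>) y"
    proof (rule eq)
      show "lc C {..<n 0} (r (c i)) c = lc C {..<n 0} (\<lambda>j. if j = i then \<one> else \<zero>) c"
        unfolding r(2)[of "c i", OF c_closed, symmetric] using i by (intro lc_delta[symmetric]) auto
    qed (use r in auto)
    also have "\<dots> = y i" using i assms(2) by (intro X.lc_delta) auto
    finally show ?thesis .
  qed
  ultimately show ?thesis by (intro bexI[of _ ?f]) simp_all
qed

text \<open>Tensoring the presentation of C with X gives the right exact sequence X^(n 1) -> X^(n 0)
  -> X \<otimes> C; \<open>tsum\<close> is its second map. \<open>csum\<close> is the same map with
  C on the left.\<close>

definition tsum :: "('a, 'm, 'z) module_scheme \<Rightarrow> (nat \<Rightarrow> 'm) \<Rightarrow> ('m \<times> 'c \<Rightarrow> 'a) set" where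
  "tsum X x = lc (tensor_mod R X C) {..<n 0} (\<lambda>_. \<one>) (\<lambda>i. tensor_elt R X C (x i) (c i))"

definition csum :: "('a, 'm, 'z) module_scheme \<Rightarrow> (nat \<Rightarrow> 'm) \<Rightarrow> ('c \<times> 'm \<Rightarrow> 'a) set" where
  "csum X x = lc (tensor_mod R C X) {..<n 0} (\<lambda>_. \<one>) (\<lambda>i. tensor_elt R C X (c i) (x i))"

context
  fixes X :: "('a, 'm, 'z) module_scheme"
  assumes X: "module R X"
begin

interpretation X: module R X by (rule X)
interpretation TX: tensor_product R X C using X module_axioms by (simp add: tensor_product_def)
interpretation XT: tensor_product R C X using X module_axioms by (simp add: tensor_product_def)

lemma tsum_closed: "(\<And>i. i < n 0 \<Longrightarrow> x i \<in> carrier X) \<Longrightarrow> tsum X x \<in> carrier (tensor_mod R X C)"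
  unfolding tsum_def by (intro TX.T.lc_closed TX.elt_closed) auto

lemma tsum_cong:
  assumes "\<And>i. i < n 0 \<Longrightarrow> x i = y i" "\<And>i. i < n 0 \<Longrightarrow> y i \<in> carrier X"
  shows "tsum X x = tsum X y"
  unfolding tsum_def using assms by (intro lc_cong[OF TX.tensor_module]) (auto intro!: TX.elt_closed)

lemma tsum_add:
  assumes "\<And>i. i < n 0 \<Longrightarrow> x i \<in> carrier X" "\<And>i. i < n 0 \<Longrightarrow> y i \<in> carrier X"
  shows "tsum X (\<lambda>i. x i \<oplus>\<^bsub>X\<^esub> y i) = tsum X x \<oplus>\<^bsub>tensor_mod R X C\<^esub> tsum X y"
proof -
  have "tsum X (\<lambda>i. x i \<oplus>\<^bsub>X\<^esub> y i) = lc TX.T {..<n 0} (\<lambda>_. \<one>) (\<lambda>i. TX.elt (x i) (c i) \<oplus>\<^bsub>TX.T\<^esub> TX.elt (y i) (c i))"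
    unfolding tsum_def using assms
    by (intro lc_cong[OF TX.tensor_module]) (simp_all add: TX.elt_closed mod_hom_add[OF TX.elt_hom_left])
  also have "\<dots> = tsum X x \<oplus>\<^bsub>TX.T\<^esub> tsum X y"
    unfolding tsum_def using assms by (intro TX.T.lc_add TX.elt_closed) auto
  finally show ?thesis .
qed

lemma tsum_smult:
  assumes "r \<in> carrier R" "\<And>i. i < n 0 \<Longrightarrow> x i \<in> carrier X"
  shows "tsum X (\<lambda>i. r \<odot>\<^bsub>X\<^esub> x i) = r \<odot>\<^bsub>tensor_mod R X C\<^esub> tsum X x"
proof -
  have "tsum X (\<lambda>i. r \<odot>\<^bsub>X\<^esub> x i) = lc TX.T {..<n 0} (\<lambda>_. \<one>) (\<lambda>i. r \<odot>\<^bsub>TX.T\<^esub> TX.elt (x i) (c i))"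
    unfolding tsum_def using assms
    by (intro lc_cong[OF TX.tensor_module]) (simp_all add: TX.elt_closed mod_hom_smult[OF TX.elt_hom_left])
  also have "\<dots> = r \<odot>\<^bsub>TX.T\<^esub> tsum X x"
    unfolding tsum_def using assms by (intro TX.T.lc_smult(1) TX.elt_closed) auto
  finally show ?thesis .
qed

lemma tsum_surj:
  assumes "t \<in> carrier (tensor_mod R X C)"
  shows "\<exists>x\<in>vec X. t = tsum X x"
proof -
  have s: "r \<odot>\<^bsub>TX.T\<^esub> t \<in> tsum X ` vec X" if "r \<in> carrier R" "t \<in> tsum X ` vec X" for r t
  proof -
    from that(2) obtain x where x: "x \<in> vec X" "t = tsum X x" by blast
    then have "r \<odot>\<^bsub>TX.T\<^esub> t = tsum X (\<lambda>i. r \<odot>\<^bsub>X\<^esub> x i)" using that(1) by (simp add: tsum_smult vecD)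
    moreover have "(\<lambda>i. r \<odot>\<^bsub>X\<^esub> x i) \<in> vec X" using x(1) that(1) by (simp add: vec_def)
    ultimately show ?thesis by blast
  qed
  have tc: "tsum X x \<in> carrier TX.T" if "x \<in> vec X" for x using vecD[OF that] by (rule tsum_closed)
  have "submodule (tsum X ` vec X) R TX.T"
  proof (rule TX.T.submoduleI)
    show "tsum X ` vec X \<subseteq> carrier TX.T" using tc by blast
    show "r \<odot>\<^bsub>TX.T\<^esub> t \<in> tsum X ` vec X" if "r \<in> carrier R" "t \<in> tsum X ` vec X" for r t by (rule s[OF that])
    show "\<ominus>\<^bsub>TX.T\<^esub> t \<in> tsum X ` vec X" if "t \<in> tsum X ` vec X" for t
      using s[OF _ that, of "\<ominus> \<one>"] tc that by (auto simp: TX.T.smult_minus_one)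
    have "tsum X (\<lambda>_. \<zero>\<^bsub>X\<^esub>) = \<zero>\<^bsub>TX.T\<^esub>" unfolding tsum_def
      by (rule TX.T.lc_zero) (use mod_hom_zero[OF X TX.tensor_module TX.elt_hom_left] in auto)
    moreover have "(\<lambda>_. \<zero>\<^bsub>X\<^esub>) \<in> vec X" by (simp add: vec_def)
    ultimately show "\<zero>\<^bsub>TX.T\<^esub> \<in> tsum X ` vec X" by force
    fix a b assume "a \<in> tsum X ` vec X" "b \<in> tsum X ` vec X"
    then obtain x y where x: "x \<in> vec X" "a = tsum X x" "y \<in> vec X" "b = tsum X y" by blast
    then have "a \<oplus>\<^bsub>TX.T\<^esub> b = tsum X (\<lambda>i. x i \<oplus>\<^bsub>X\<^esub> y i)" by (simp add: tsum_add vecD)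
    moreover have "(\<lambda>i. x i \<oplus>\<^bsub>X\<^esub> y i) \<in> vec X" using x by (simp add: vec_def)
    ultimately show "a \<oplus>\<^bsub>TX.T\<^esub> b \<in> tsum X ` vec X" by blast
  qed
  moreover have "TX.elt x u \<in> tsum X ` vec X" if x: "x \<in> carrier X" and u: "u \<in> carrier C" for x u
  proof -
    obtain r where r: "\<forall>i. r i \<in> carrier R" "u = lc C {..<n 0} r c" using c_span[OF u] by blast
    \<comment> \<open>The coefficients of the second factor cross the tensor sign, which turns a
      pure tensor into a \<open>tsum\<close>.\<close>
    have "TX.elt x u = lc TX.T {..<n 0} r (\<lambda>i. TX.elt x (c i))"
      unfolding r(2) using r(1) by (intro mod_hom_lc[OF module_axioms TX.tensor_module TX.elt_hom_right[OF x]]) auto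
    also have "\<dots> = tsum X (\<lambda>i. r i \<odot>\<^bsub>X\<^esub> x)"
      unfolding tsum_def lc_def using r(1) x TX.elt_closed[OF x]
      by (intro TX.T.finsum_cong') (auto simp: mod_hom_smult[OF TX.elt_hom_left])
    finally show ?thesis using r(1) x by (auto simp: vec_def)
  qed
  ultimately have "t \<in> tsum X ` vec X" by (rule TX.tensor_generated[OF _ _ assms])
  then show ?thesis by blast
qed

lemma tsum_dn:
  assumes "\<And>j. j < n 1 \<Longrightarrow> y j \<in> carrier X"
  shows "tsum X (dn X 0 y) = \<zero>\<^bsub>tensor_mod R X C\<^esub>"
proof -
  have yj: "j < n (Suc 0) \<Longrightarrow> y j \<in> carrier X" for j using assms by simp
  have "tsum X (dn X 0 y) = lc TX.T {..<n 0} (\<lambda>_. \<one>) (\<lambda>i. lc TX.T {..<n (Suc 0)} (\<lambda>_. \<one>) (\<lambda>j. D 0 i j \<odot>\<^bsub>TX.T\<^esub> TX.elt (y j) (c i)))"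
    unfolding tsum_def
  proof (intro lc_cong[OF TX.tensor_module] refl)
    fix i
    have "TX.elt (dn X 0 y i) (c i) = lc TX.T {..<n (Suc 0)} (D 0 i) (\<lambda>j. TX.elt (y j) (c i))"
      using yj by (intro mod_hom_lc[OF X TX.tensor_module TX.elt_hom_left]) auto
    also have "\<dots> = lc TX.T {..<n (Suc 0)} (\<lambda>_. \<one>) (\<lambda>j. D 0 i j \<odot>\<^bsub>TX.T\<^esub> TX.elt (y j) (c i))"
      unfolding lc_def using yj by (intro TX.T.finsum_cong') (simp_all add: TX.elt_closed Pi_def)
    finally show "TX.elt (dn X 0 y i) (c i) = lc TX.T {..<n (Suc 0)} (\<lambda>_. \<one>) (\<lambda>j. D 0 i j \<odot>\<^bsub>TX.T\<^esub> TX.elt (y j) (c i))" .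
    show "lc TX.T {..<n (Suc 0)} (\<lambda>_. \<one>) (\<lambda>j. D 0 i j \<odot>\<^bsub>TX.T\<^esub> TX.elt (y j) (c i)) \<in> carrier TX.T"
      using yj by (intro TX.T.lc_closed TX.T.smult_closed TX.elt_closed) auto
  qed simp
  also have "\<dots> = lc TX.T {..<n (Suc 0)} (\<lambda>_. \<one>) (\<lambda>j. lc TX.T {..<n 0} (\<lambda>_. \<one>) (\<lambda>i. D 0 i j \<odot>\<^bsub>TX.T\<^esub> TX.elt (y j) (c i)))"
    using yj by (intro TX.T.lc_swap) (simp_all add: TX.elt_closed)
  also have "\<dots> = \<zero>\<^bsub>TX.T\<^esub>"
  proof (rule TX.T.lc_zero)
    fix j assume j: "j \<in> {..<n (Suc 0)}"
    have "lc TX.T {..<n 0} (\<lambda>_. \<one>) (\<lambda>i. D 0 i j \<odot>\<^bsub>TX.T\<^esub> TX.elt (y j) (c i)) = lc TX.T {..<n 0} (\<lambda>i. D 0 i j) (\<lambda>i. TX.elt (y j) (c i))"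
      unfolding lc_def using j yj by (intro TX.T.finsum_cong') (simp_all add: TX.elt_closed Pi_def)
    also have "\<dots> = \<zero>\<^bsub>TX.T\<^esub>" using j yj hom_C_up[OF TX.tensor_module TX.elt_hom_right] by simp
    finally show "lc TX.T {..<n 0} (\<lambda>_. \<one>) (\<lambda>i. D 0 i j \<odot>\<^bsub>TX.T\<^esub> TX.elt (y j) (c i)) = \<zero>\<^bsub>TX.T\<^esub>" .
  qed simp
  finally show ?thesis .
qed

text \<open>Exactness at X^(n 0). To learn something from the vanishing of a tensor, a bilinear map
  is needed; its target is the cokernel of \<open>D 0\<close> on X^(n 0), and the induced map sends
  \<open>tsum X x\<close> to the class of \<open>x\<close>.\<close>

lemma tsum_zeroD:
  assumes x: "\<And>i. i < n 0 \<Longrightarrow> x i \<in> carrier X" and z: "tsum X x = \<zero>\<^bsub>tensor_mod R X C\<^esub>"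
  obtains y where "y \<in> vec X" "\<And>i. i < n 0 \<Longrightarrow> x i = dn X 0 y i"
proof -
  let ?V = "mod_power X (n 0)"
  interpret V: module R ?V by (rule X.mod_power_module)
  have ev: "(\<lambda>f. f l) \<in> mod_hom R ?V X" if "l < n 0" for l
    using that by (intro mod_homI) (auto simp: X.mod_power_mem_iff X.mod_power_apply)
  define col where "col y = (\<lambda>i. if i < n 0 then y i else undefined)" for y :: "nat \<Rightarrow> 'm"
  have colc: "col y \<in> carrier ?V" if "\<And>i. i < n 0 \<Longrightarrow> y i \<in> carrier X" for y
    using that by (simp add: col_def X.mod_power_mem_iff)
  define Kr where "Kr = {col (dn X 0 y) | y. y \<in> vec X}"
  have dnc: "dn X 0 y i \<in> carrier X" if "y \<in> vec X" for y i using vecD[OF that] by auto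
  have KrI: "col (dn X 0 y) \<in> Kr" if "y \<in> vec X" for y using that by (auto simp: Kr_def)
  have sm: "r \<odot>\<^bsub>?V\<^esub> f \<in> Kr" if r: "r \<in> carrier R" and f: "f \<in> Kr" for r f
  proof -
    from f obtain y where y: "y \<in> vec X" "f = col (dn X 0 y)" by (auto simp: Kr_def)
    have "r \<odot>\<^bsub>?V\<^esub> f = col (dn X 0 (\<lambda>j. r \<odot>\<^bsub>X\<^esub> y j))"
      using vecD[OF y(1)] r by (auto simp: fun_eq_iff y(2) X.mod_power_apply col_def X.lc_smult)
    also have "\<dots> \<in> Kr" using r vecD[OF y(1)] by (intro KrI) (simp add: vec_def)
    finally show ?thesis .
  qed
  have KrV: "Kr \<subseteq> carrier ?V" using dnc by (auto simp: Kr_def intro!: colc)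
  have Kr: "submodule Kr R ?V"
  proof (rule V.submoduleI)
    have "\<zero>\<^bsub>?V\<^esub> = col (dn X 0 (\<lambda>_. \<zero>\<^bsub>X\<^esub>))"
      by (auto simp: fun_eq_iff X.mod_power_apply col_def X.lc_zero)
    also have "\<dots> \<in> Kr" by (intro KrI) (simp add: vec_def)
    finally show "\<zero>\<^bsub>?V\<^esub> \<in> Kr" .
    show "\<ominus>\<^bsub>?V\<^esub> f \<in> Kr" if "f \<in> Kr" for f
      using sm[OF _ that, of "\<ominus> \<one>"] that KrV by (auto simp: V.smult_minus_one)
    fix f g assume "f \<in> Kr" "g \<in> Kr"
    then obtain y y' where y: "y \<in> vec X" "f = col (dn X 0 y)" "y' \<in> vec X" "g = col (dn X 0 y')"
      by (auto simp: Kr_def)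
    have "f \<oplus>\<^bsub>?V\<^esub> g = col (dn X 0 (\<lambda>j. y j \<oplus>\<^bsub>X\<^esub> y' j))"
      using vecD[OF y(1)] vecD[OF y(3)] by (auto simp: fun_eq_iff y X.mod_power_apply col_def X.lc_add)
    also have "\<dots> \<in> Kr" using y by (intro KrI) (simp add: vec_def)
    finally show "f \<oplus>\<^bsub>?V\<^esub> g \<in> Kr" .
  qed (use KrV sm in auto)
  let ?W = "quot_mod ?V Kr"
  have W: "module R ?W" by (rule V.quot_module[OF Kr])
  interpret W: module R ?W by (rule W)
  note q = V.quot_hom[OF Kr]
  define ins where "ins i u = col (\<lambda>l. if l = i then u else \<zero>\<^bsub>X\<^esub>)" for i u
  have insh: "ins i \<in> mod_hom R X ?V" for i
    by (intro mod_homI) (auto simp: ins_def fun_eq_iff X.mod_power_apply X.mod_power_mem_iff col_def)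
  \<comment> \<open>\<open>e i u\<close> is the class of the tuple with \<open>u\<close> in place
    \<open>i\<close>, the intended value at the pure tensor of \<open>u\<close> and
    \<open>c i\<close>. For fixed \<open>u\<close> these classes satisfy the relations of C, so
    \<open>hom_from_C\<close> extends them to all of C.\<close>
  define e where "e i u = Kr +>\<^bsub>?V\<^esub> ins i u" for i u
  have eh: "e i \<in> mod_hom R X ?W" for i
    unfolding e_def[abs_def] by (rule mod_hom_comp[OF insh q])
  have lcins: "lc ?V {..<n 0} (\<lambda>_. \<one>) (\<lambda>i. ins i (y i)) = col y"
    if y: "\<And>i. i < n 0 \<Longrightarrow> y i \<in> carrier X" for y
  proof
    fix l
    have insc: "ins i (y i) \<in> carrier ?V" if "i < n 0" for i using mod_hom_closed[OF insh y[OF that]] .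
    show "lc ?V {..<n 0} (\<lambda>_. \<one>) (\<lambda>i. ins i (y i)) l = col y l"
    proof (cases "l < n 0")
      case True
      have "lc ?V {..<n 0} (\<lambda>_. \<one>) (\<lambda>i. ins i (y i)) l = lc X {..<n 0} (\<lambda>_. \<one>) (\<lambda>i. ins i (y i) l)"
        using insc by (intro mod_hom_lc[OF V.module_axioms X ev[OF True]]) auto
      also have "\<dots> = lc X {..<n 0} (\<lambda>j. if j = l then \<one> else \<zero>) y"
        unfolding lc_def using True y
        by (intro X.finsum_cong') (auto simp: ins_def col_def)
      also have "\<dots> = y l" using True y by (intro X.lc_delta) auto
      finally show ?thesis using True by (simp add: col_def)
    next
      case False
      have "lc ?V {..<n 0} (\<lambda>_. \<one>) (\<lambda>i. ins i (y i)) \<in> carrier ?V" using insc by auto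
      then show ?thesis using False by (simp add: X.mod_power_mem_iff col_def)
    qed
  qed
  have upz: "up ?W 0 (\<lambda>i. e i u) j = \<zero>\<^bsub>?W\<^esub>" if u: "u \<in> carrier X" and j: "j < n 1" for u j
  proof -
    have "up ?W 0 (\<lambda>i. e i u) j = lc ?W {..<n 0} (\<lambda>_. \<one>) (\<lambda>i. e i (D 0 i j \<odot>\<^bsub>X\<^esub> u))"
      unfolding lc_def using u mod_hom_closed[OF eh]
      by (intro W.finsum_cong') (auto simp: mod_hom_smult[OF eh])
    also have "\<dots> = Kr +>\<^bsub>?V\<^esub> lc ?V {..<n 0} (\<lambda>_. \<one>) (\<lambda>i. ins i (D 0 i j \<odot>\<^bsub>X\<^esub> u))"
      unfolding e_def using u mod_hom_closed[OF insh]
      by (intro mod_hom_lc[OF V.module_axioms W q, symmetric]) auto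
    also have "\<dots> = Kr +>\<^bsub>?V\<^esub> col (\<lambda>i. D 0 i j \<odot>\<^bsub>X\<^esub> u)" using u by (subst lcins) auto
    \<comment> \<open>Column \<open>j\<close> of \<open>D 0\<close> times \<open>u\<close> is
      \<open>D 0\<close> applied to the tuple with \<open>u\<close> in place \<open>j\<close>, hence
      lies in the image that is divided out.\<close>
    also have "\<dots> = Kr +>\<^bsub>?V\<^esub> col (dn X 0 (\<lambda>l. if l = j then u else \<zero>\<^bsub>X\<^esub>))"
    proof -
      have "dn X 0 (\<lambda>l. if l = j then u else \<zero>\<^bsub>X\<^esub>) i = D 0 i j \<odot>\<^bsub>X\<^esub> u" for i
      proof -
        have "dn X 0 (\<lambda>l. if l = j then u else \<zero>\<^bsub>X\<^esub>) i = lc X {..<n (Suc 0)} (\<lambda>l. if l = j then \<one> else \<zero>) (\<lambda>l. D 0 i l \<odot>\<^bsub>X\<^esub> u)"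
          unfolding lc_def using u by (intro X.finsum_cong') auto
        also have "\<dots> = D 0 i j \<odot>\<^bsub>X\<^esub> u" using j u by (intro X.lc_delta) auto
        finally show ?thesis .
      qed
      then show ?thesis by simp
    qed
    also have "\<dots> = Kr"
    proof -
      have "(\<lambda>l. if l = j then u else \<zero>\<^bsub>X\<^esub>) \<in> vec X" using u by (simp add: vec_def)
      from KrI[OF this] show ?thesis using KrV by (subst V.quot_eq_zero_iff[OF Kr]) auto
    qed
    finally show ?thesis by (simp add: V.quot_zero[OF Kr])
  qed
  have "\<forall>u. \<exists>f. u \<in> carrier X \<longrightarrow> f \<in> mod_hom R C ?W \<and> (\<forall>i<n 0. f (c i) = e i u)"
  proof
    fix u
    show "\<exists>f. u \<in> carrier X \<longrightarrow> f \<in> mod_hom R C ?W \<and> (\<forall>i<n 0. f (c i) = e i u)"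
    proof (cases "u \<in> carrier X")
      case True
      have "\<exists>f\<in>mod_hom R C ?W. \<forall>i<n 0. f (c i) = e i u"
        by (rule hom_from_C[OF W mod_hom_closed[OF eh True] upz[OF True]])
      then show ?thesis by blast
    qed simp
  qed
  from choice[OF this] obtain f where f0: "\<forall>u. u \<in> carrier X \<longrightarrow> f u \<in> mod_hom R C ?W \<and> (\<forall>i<n 0. f u (c i) = e i u)" ..
  have f: "\<And>u. u \<in> carrier X \<Longrightarrow> f u \<in> mod_hom R C ?W"
    "\<And>u i. u \<in> carrier X \<Longrightarrow> i < n 0 \<Longrightarrow> f u (c i) = e i u" using f0 by blast+
  have bil: "bilinear_map R X C ?W f"
  proof (rule bilinear_mapI)
    show "f u \<in> mod_hom R C ?W" if "u \<in> carrier X" for u by (rule f(1)[OF that])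
    fix v assume v: "v \<in> carrier C"
    show "(\<lambda>u. f u v) \<in> mod_hom R X ?W"
    proof (rule mod_homI)
      fix u assume u: "u \<in> carrier X"
      show "f u v \<in> carrier ?W" by (rule mod_hom_closed[OF f(1)[OF u] v])
      \<comment> \<open>Linearity in \<open>u\<close> is an identity between homomorphisms from C,
        so it is enough to check it on generators.\<close>
      show "f (u \<oplus>\<^bsub>X\<^esub> u') v = f u v \<oplus>\<^bsub>?W\<^esub> f u' v" if u': "u' \<in> carrier X" for u'
      proof (rule hom_C_eqI[OF W f(1) _ _ v])
        show "(\<lambda>v. f u v \<oplus>\<^bsub>?W\<^esub> f u' v) \<in> mod_hom R C ?W"
          using mod_hom_closed[OF f(1)[OF u]] mod_hom_closed[OF f(1)[OF u']]
          by (intro mod_homI) (auto simp: mod_hom_add[OF f(1)] mod_hom_smult[OF f(1)] u u' W.smult_r_distr W.a_ac)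
      qed (use u u' in \<open>auto simp: f(2) mod_hom_add[OF eh]\<close>)
      show "f (a \<odot>\<^bsub>X\<^esub> u) v = a \<odot>\<^bsub>?W\<^esub> f u v" if a: "a \<in> carrier R" for a
      proof (rule hom_C_eqI[OF W f(1) _ _ v])
        show "(\<lambda>v. a \<odot>\<^bsub>?W\<^esub> f u v) \<in> mod_hom R C ?W"
          using mod_hom_closed[OF f(1)[OF u]] a
          by (intro mod_homI) (auto simp: mod_hom_add[OF f(1)] mod_hom_smult[OF f(1)] u W.smult_r_distr
            W.smult_assoc1[symmetric] R.m_comm)
      qed (use u a in \<open>auto simp: f(2) mod_hom_smult[OF eh]\<close>)
    qed
  qed
  obtain h where h: "h \<in> mod_hom R TX.T ?W" "\<forall>u\<in>carrier X. \<forall>v\<in>carrier C. h (TX.elt u v) = f u v"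
    using TX.tensor_lift[OF W bil] by blast
  have "h (tsum X x) = lc ?W {..<n 0} (\<lambda>_. \<one>) (\<lambda>i. h (TX.elt (x i) (c i)))"
    unfolding tsum_def using x by (intro mod_hom_lc[OF TX.tensor_module W h(1)]) (auto intro!: TX.elt_closed)
  also have "\<dots> = lc ?W {..<n 0} (\<lambda>_. \<one>) (\<lambda>i. Kr +>\<^bsub>?V\<^esub> ins i (x i))"
    using x h(2) f(2) mod_hom_closed[OF eh] by (intro lc_cong[OF W]) (auto simp: e_def)
  also have "\<dots> = Kr +>\<^bsub>?V\<^esub> lc ?V {..<n 0} (\<lambda>_. \<one>) (\<lambda>i. ins i (x i))"
    using x mod_hom_closed[OF insh] by (intro mod_hom_lc[OF V.module_axioms W q, symmetric]) auto
  also have "\<dots> = Kr +>\<^bsub>?V\<^esub> col x" using lcins[OF x] by simp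
  finally have "Kr +>\<^bsub>?V\<^esub> col x = Kr"
    using z mod_hom_zero[OF TX.tensor_module W h(1)] V.quot_zero[OF Kr] by simp
  then have "col x \<in> Kr" using colc[OF x] by (simp add: V.quot_eq_zero_iff[OF Kr])
  then obtain y where y: "y \<in> vec X" "col x = col (dn X 0 y)" by (auto simp: Kr_def)
  show thesis
  proof (rule that[OF y(1)])
    show "x i = dn X 0 y i" if "i < n 0" for i using fun_cong[OF y(2), of i] that by (simp add: col_def)
  qed
qed

text \<open>Carries the presentation over to C \<otimes> X: the facts on \<open>csum\<close> are
  those on \<open>tsum\<close> seen through \<open>s\<close> and \<open>s'\<close>.\<close>

lemma swap_sums:
  obtains s s' where "s \<in> mod_hom R (tensor_mod R X C) (tensor_mod R C X)"
    and "s' \<in> mod_hom R (tensor_mod R C X) (tensor_mod R X C)"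
    and "\<And>x. (\<And>i. i < n 0 \<Longrightarrow> x i \<in> carrier X) \<Longrightarrow> s (tsum X x) = csum X x"
    and "\<And>x. (\<And>i. i < n 0 \<Longrightarrow> x i \<in> carrier X) \<Longrightarrow> s' (csum X x) = tsum X x"
    and "\<And>t. t \<in> carrier (tensor_mod R C X) \<Longrightarrow> s (s' t) = t"
proof -
  obtain s where s: "s \<in> mod_hom R TX.T XT.T" "\<forall>u\<in>carrier X. \<forall>v\<in>carrier C. s (TX.elt u v) = XT.elt v u"
    using tensor_swap[OF X module_axioms] by blast
  obtain s' where s': "s' \<in> mod_hom R XT.T TX.T" "\<forall>v\<in>carrier C. \<forall>u\<in>carrier X. s' (XT.elt v u) = TX.elt u v"
    using tensor_swap[OF module_axioms X] by blast
  show thesis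
  proof (rule that[OF s(1) s'(1)])
    fix x assume x: "\<And>i. i < n 0 \<Longrightarrow> x i \<in> carrier X"
    have "s (tsum X x) = lc XT.T {..<n 0} (\<lambda>_. \<one>) (\<lambda>i. s (TX.elt (x i) (c i)))"
      unfolding tsum_def using x by (intro mod_hom_lc[OF TX.tensor_module XT.tensor_module s(1)]) (auto intro!: TX.elt_closed)
    also have "\<dots> = csum X x" unfolding csum_def
      using x s(2) by (intro lc_cong[OF XT.tensor_module]) (auto intro!: XT.elt_closed)
    finally show "s (tsum X x) = csum X x" .
    have "s' (csum X x) = lc TX.T {..<n 0} (\<lambda>_. \<one>) (\<lambda>i. s' (XT.elt (c i) (x i)))"
      unfolding csum_def using x by (intro mod_hom_lc[OF XT.tensor_module TX.tensor_module s'(1)]) (auto intro!: XT.elt_closed)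
    also have "\<dots> = tsum X x" unfolding tsum_def
      using x s'(2) by (intro lc_cong[OF TX.tensor_module]) (auto intro!: TX.elt_closed)
    finally show "s' (csum X x) = tsum X x" .
  next
    fix t assume t: "t \<in> carrier XT.T"
    show "s (s' t) = t"
    proof (rule XT.tensor_hom_eqI[OF XT.tensor_module mod_hom_comp[OF s'(1) s(1)] mod_hom_ident _ t])
      show "s (s' (XT.elt v u)) = XT.elt v u" if "v \<in> carrier C" "u \<in> carrier X" for v u
        using s(2) s'(2) that by simp
    qed
  qed
qed

lemma csum_closed: "(\<And>i. i < n 0 \<Longrightarrow> x i \<in> carrier X) \<Longrightarrow> csum X x \<in> carrier (tensor_mod R C X)"
  unfolding csum_def by (intro XT.T.lc_closed XT.elt_closed) auto

lemma csum_surj: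
  assumes "t \<in> carrier (tensor_mod R C X)"
  shows "\<exists>x\<in>vec X. t = csum X x"
proof (rule swap_sums)
  fix s s' assume s: "s' \<in> mod_hom R (tensor_mod R C X) (tensor_mod R X C)"
    "\<And>x. (\<And>i. i < n 0 \<Longrightarrow> x i \<in> carrier X) \<Longrightarrow> s (tsum X x) = csum X x"
    "\<And>t. t \<in> carrier (tensor_mod R C X) \<Longrightarrow> s (s' t) = t"
  obtain x where x: "x \<in> vec X" "s' t = tsum X x" using tsum_surj[OF mod_hom_closed[OF s(1) assms]] by blast
  then have "t = csum X x" using s(2)[of x] s(3)[OF assms] vecD[OF x(1)] by simp
  with x(1) show ?thesis by blast
qed

lemma csum_zeroD:
  assumes x: "\<And>i. i < n 0 \<Longrightarrow> x i \<in> carrier X" and z: "csum X x = \<zero>\<^bsub>tensor_mod R C X\<^esub>"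
  obtains y where "y \<in> vec X" "\<And>i. i < n 0 \<Longrightarrow> x i = dn X 0 y i"
proof (rule swap_sums)
  fix s s' assume s: "s' \<in> mod_hom R (tensor_mod R C X) (tensor_mod R X C)"
    "\<And>x. (\<And>i. i < n 0 \<Longrightarrow> x i \<in> carrier X) \<Longrightarrow> s' (csum X x) = tsum X x"
  have "tsum X x = \<zero>\<^bsub>tensor_mod R X C\<^esub>"
    using s(2)[of x] x z mod_hom_zero[OF XT.tensor_module TX.tensor_module s(1)] by simp
  from tsum_zeroD[OF x this] show thesis using that by blast
qed

lemma csum_cong:
  assumes "\<And>i. i < n 0 \<Longrightarrow> x i = y i" "\<And>i. i < n 0 \<Longrightarrow> y i \<in> carrier X"
  shows "csum X x = csum X y"
  unfolding csum_def using assms by (intro lc_cong[OF XT.tensor_module]) (auto intro!: XT.elt_closed)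

lemma csum_zeroI:
  assumes "\<And>j. j < n 1 \<Longrightarrow> y j \<in> carrier X" "\<And>i. i < n 0 \<Longrightarrow> x i = dn X 0 y i"
  shows "csum X x = \<zero>\<^bsub>tensor_mod R C X\<^esub>"
proof (rule swap_sums)
  fix s s' assume s: "s \<in> mod_hom R (tensor_mod R X C) (tensor_mod R C X)"
    "\<And>x. (\<And>i. i < n 0 \<Longrightarrow> x i \<in> carrier X) \<Longrightarrow> s (tsum X x) = csum X x"
  have d: "dn X 0 y i \<in> carrier X" for i using assms(1) by auto
  have "csum X x = csum X (dn X 0 y)" using assms(2) d by (intro csum_cong)
  also have "\<dots> = s (tsum X (dn X 0 y))" using s(2)[of "dn X 0 y"] d by simp
  also have "\<dots> = \<zero>\<^bsub>tensor_mod R C X\<^esub>"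
    using tsum_dn[OF assms(1)] mod_hom_zero[OF TX.tensor_module XT.tensor_module s(1)] by simp
  finally show ?thesis .
qed

lemma csum_add:
  assumes "\<And>i. i < n 0 \<Longrightarrow> x i \<in> carrier X" "\<And>i. i < n 0 \<Longrightarrow> y i \<in> carrier X"
  shows "csum X (\<lambda>i. x i \<oplus>\<^bsub>X\<^esub> y i) = csum X x \<oplus>\<^bsub>tensor_mod R C X\<^esub> csum X y"
proof (rule swap_sums)
  fix s s' assume s: "s \<in> mod_hom R (tensor_mod R X C) (tensor_mod R C X)"
    "\<And>x. (\<And>i. i < n 0 \<Longrightarrow> x i \<in> carrier X) \<Longrightarrow> s (tsum X x) = csum X x"
  have "csum X (\<lambda>i. x i \<oplus>\<^bsub>X\<^esub> y i) = s (tsum X (\<lambda>i. x i \<oplus>\<^bsub>X\<^esub> y i))" using assms by (simp add: s(2))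
  then show ?thesis using assms by (simp add: tsum_add mod_hom_add[OF s(1)] tsum_closed s(2))
qed

lemma csum_smult:
  assumes "r \<in> carrier R" "\<And>i. i < n 0 \<Longrightarrow> x i \<in> carrier X"
  shows "csum X (\<lambda>i. r \<odot>\<^bsub>X\<^esub> x i) = r \<odot>\<^bsub>tensor_mod R C X\<^esub> csum X x"
proof (rule swap_sums)
  fix s s' assume s: "s \<in> mod_hom R (tensor_mod R X C) (tensor_mod R C X)"
    "\<And>x. (\<And>i. i < n 0 \<Longrightarrow> x i \<in> carrier X) \<Longrightarrow> s (tsum X x) = csum X x"
  have "csum X (\<lambda>i. r \<odot>\<^bsub>X\<^esub> x i) = s (tsum X (\<lambda>i. r \<odot>\<^bsub>X\<^esub> x i))" using assms by (simp add: s(2))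
  then show ?thesis using assms by (simp add: tsum_smult mod_hom_smult[OF s(1)] tsum_closed s(2))
qed

end

lemma tsum_map:
  assumes "module R X" "module R Y" "f \<in> mod_hom R X Y" "\<And>i. i < n 0 \<Longrightarrow> x i \<in> carrier X"
  shows "tensor_map R Y C f (tsum X x) = tsum Y (\<lambda>i. f (x i))"
proof -
  interpret TX: tensor_product R X C using assms module_axioms by (simp add: tensor_product_def)
  interpret TY: tensor_product R Y C using assms module_axioms by (simp add: tensor_product_def)
  note t = tensor_map_hom[OF assms(1,2) module_axioms assms(3)]
  have "tensor_map R Y C f (tsum X x) = lc TY.T {..<n 0} (\<lambda>_. \<one>) (\<lambda>i. tensor_map R Y C f (TX.elt (x i) (c i)))"
    unfolding tsum_def using assms(4)
    by (intro mod_hom_lc[OF TX.tensor_module TY.tensor_module t(1)]) (auto intro!: TX.elt_closed)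
  also have "\<dots> = tsum Y (\<lambda>i. f (x i))"
    unfolding tsum_def using assms(4) mod_hom_closed[OF assms(3)] t(2)
    by (intro lc_cong[OF TY.tensor_module]) (auto intro!: TY.elt_closed)
  finally show ?thesis .
qed

end

section \<open>Projective modules and the homothety isomorphism\<close>

text \<open>Lifting the identity along the canonical surjection from the free module on the set
  \<open>carrier P\<close> gives a splitting. \<open>\<sigma> b\<close> is its coordinate at
  \<open>b\<close>, so the summands are indexed by the elements of P themselves.\<close>

lemma projective_sum_retract:
  assumes "projective_mod R P"
  shows "\<exists>\<sigma>. sum_retract R (regular_mod R) P (carrier P) \<sigma> (\<lambda>b r. r \<odot>\<^bsub>P\<^esub> b)"
proof -
  have P: "module R P" using assms by (simp add: projective_mod_def)
  interpret P: module R P by (rule P)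
  note R = P.R.is_cring
  let ?F = "free_mod R (carrier P)" and ?g = "lin_ext R P (\<lambda>x. x)"
  have F: "module R ?F" by (rule free_mod_module[OF R])
  have g: "?g \<in> mod_hom R ?F P" by (intro lin_ext_hom P)
  have "?g ` carrier ?F = carrier P"
  proof
    show "?g ` carrier ?F \<subseteq> carrier P" using mod_hom_closed[OF g] by blast
    show "carrier P \<subseteq> ?g ` carrier ?F"
      using basis_vec_mem[OF R] lin_ext_basis[OF P, of "\<lambda>x. x"] by (metis image_eqI subsetI)
  qed
  then obtain h where h: "h \<in> mod_hom R P ?F" "\<forall>x\<in>carrier P. ?g (h x) = x"
    using assms F P g mod_hom_ident[of R P] unfolding projective_mod_def by blast
  have "sum_retract R (regular_mod R) P (carrier P) (\<lambda>b x. h x b) (\<lambda>b r. r \<odot>\<^bsub>P\<^esub> b)"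
    unfolding sum_retract_def
  proof (intro conjI ballI)
    fix b assume b: "b \<in> carrier P"
    show "(\<lambda>x. h x b) \<in> mod_hom R P (regular_mod R)"
      by (rule mod_hom_comp[OF h(1) free_mod_eval_hom[OF R]])
    show "(\<lambda>r. r \<odot>\<^bsub>P\<^esub> b) \<in> mod_hom R (regular_mod R) P"
      using b by (intro mod_homI) (auto simp: regular_mod_def P.smult_l_distr P.smult_assoc1)
  next
    fix x assume x: "x \<in> carrier P"
    note fc = free_mod_carrierD[OF mod_hom_closed[OF h(1) x]]
    let ?S = "{b. h x b \<noteq> \<zero>\<^bsub>R\<^esub>}"
    have "x = ?g (h x)" using h(2) x by simp
    also have "\<dots> = lc P ?S (h x) (\<lambda>b. b)" using fc by (intro lin_ext_eq_lc P) auto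
    also have "\<dots> = lc P ?S (\<lambda>_. \<one>\<^bsub>R\<^esub>) (\<lambda>b. h x b \<odot>\<^bsub>P\<^esub> b)"
      unfolding lc_def using fc by (intro P.finsum_cong') auto
    finally show "\<exists>S. finite S \<and> S \<subseteq> carrier P \<and> (\<forall>b\<in>carrier P - S. h x b = \<zero>\<^bsub>regular_mod R\<^esub>) \<and>
        x = lc P S (\<lambda>_. \<one>\<^bsub>R\<^esub>) (\<lambda>b. h x b \<odot>\<^bsub>P\<^esub> b)"
      using fc by (intro exI[of _ ?S]) (auto simp: regular_mod_def)
  qed
  then show ?thesis by blast
qed

locale semidualizing_resolution = finite_resolution +
  assumes homothety_surj: "f \<in> mod_hom R C C \<Longrightarrow> \<exists>r\<in>carrier R. \<forall>x\<in>carrier C. f x = r \<odot>\<^bsub>C\<^esub> x"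
    and homothety_inj: "\<lbrakk>r \<in> carrier R; \<And>x. x \<in> carrier C \<Longrightarrow> r \<odot>\<^bsub>C\<^esub> x = \<zero>\<^bsub>C\<^esub>\<rbrakk> \<Longrightarrow> r = \<zero>"
    and ext_acyclic_C: "ext_acyclic C"
begin

lemma projective_tor_acyclic:
  assumes "projective_mod R P"
  shows "tor_acyclic P"
proof -
  have P: "module R P" using assms by (simp add: projective_mod_def)
  obtain \<sigma> where "sum_retract R reg P (carrier P) \<sigma> (\<lambda>b r. r \<odot>\<^bsub>P\<^esub> b)"
    using projective_sum_retract[OF assms] by blast
  from exact_pair_retract[OF reg_module P this] show ?thesis
    using tor_acyclic_reg unfolding tor_acyclic_def by simp
qed

text \<open>\<open>\<tau> b\<close> is \<open>\<sigma> b\<close> tensored with C. Only finitely many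
  summands occur in an element of P \<otimes> C, because it is a \<open>tsum\<close> and thus
  involves finitely many elements of P.\<close>

lemma projective_tensor_retract:
  assumes P: "module R P" and sr: "sum_retract R reg P (carrier P) \<sigma> (\<lambda>b r. r \<odot>\<^bsub>P\<^esub> b)"
  shows "\<exists>\<tau>. (\<forall>b\<in>carrier P. \<forall>p\<in>carrier P. \<forall>x\<in>carrier C. \<tau> b (tensor_elt R P C p x) = \<sigma> b p \<odot>\<^bsub>C\<^esub> x) \<and>
    sum_retract R C (tensor_mod R P C) (carrier P) \<tau> (tensor_elt R P C)"
proof -
  interpret P: module R P by (rule P)
  interpret T: tensor_product R P C using P module_axioms by (simp add: tensor_product_def)
  have \<sigma>: "\<sigma> b \<in> mod_hom R P reg" if "b \<in> carrier P" for b using sr that by (simp add: sum_retract_def)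
  have \<sigma>c: "\<sigma> b p \<in> carrier R" if "b \<in> carrier P" "p \<in> carrier P" for b p
    using mod_hom_closed[OF \<sigma>] that by (simp add: reg_simps)
  have "\<exists>\<tau>\<in>mod_hom R T.T C. \<forall>p\<in>carrier P. \<forall>x\<in>carrier C. \<tau> (T.elt p x) = \<sigma> b p \<odot>\<^bsub>C\<^esub> x" if b: "b \<in> carrier P" for b
  proof (rule T.tensor_lift[OF module_axioms], rule bilinear_mapI)
    show "(\<odot>\<^bsub>C\<^esub>) (\<sigma> b p) \<in> mod_hom R C C" if "p \<in> carrier P" for p
      using \<sigma>c[OF b that] by (intro mod_homI) (auto simp: smult_r_distr smult_assoc1[symmetric] R.m_comm)
    show "(\<lambda>p. \<sigma> b p \<odot>\<^bsub>C\<^esub> x) \<in> mod_hom R P C" if "x \<in> carrier C" for x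
      using \<sigma>c[OF b] that by (intro mod_homI)
        (auto simp: mod_hom_add[OF \<sigma>[OF b]] mod_hom_smult[OF \<sigma>[OF b]] reg_simps smult_l_distr smult_assoc1)
  qed
  then have "\<forall>b\<in>carrier P. \<exists>\<tau>. \<tau> \<in> mod_hom R T.T C \<and> (\<forall>p\<in>carrier P. \<forall>x\<in>carrier C. \<tau> (T.elt p x) = \<sigma> b p \<odot>\<^bsub>C\<^esub> x)"
    by blast
  from bchoice[OF this] obtain \<tau> where \<tau>0: "\<forall>b\<in>carrier P. \<tau> b \<in> mod_hom R T.T C \<and> (\<forall>p\<in>carrier P. \<forall>x\<in>carrier C. \<tau> b (T.elt p x) = \<sigma> b p \<odot>\<^bsub>C\<^esub> x)" ..
  have \<tau>: "\<And>b. b \<in> carrier P \<Longrightarrow> \<tau> b \<in> mod_hom R T.T C"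
    "\<And>b p x. b \<in> carrier P \<Longrightarrow> p \<in> carrier P \<Longrightarrow> x \<in> carrier C \<Longrightarrow> \<tau> b (T.elt p x) = \<sigma> b p \<odot>\<^bsub>C\<^esub> x"
    using \<tau>0 by blast+
  have "\<exists>S. finite S \<and> S \<subseteq> carrier P \<and> (\<forall>b\<in>carrier P - S. \<tau> b t = \<zero>\<^bsub>C\<^esub>) \<and>
      t = lc T.T S (\<lambda>_. \<one>) (\<lambda>b. T.elt b (\<tau> b t))" if t: "t \<in> carrier T.T" for t
  proof -
    obtain x where x: "x \<in> vec P" "t = tsum P x" using tsum_surj[OF P t] by blast
    note xc = vecD[OF x(1)]
    obtain S where S: "finite S" "S \<subseteq> carrier P" "\<forall>b\<in>carrier P - S. \<forall>j<n 0. \<sigma> b (x j) = \<zero>\<^bsub>reg\<^esub>"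
      "\<forall>j<n 0. x j = lc P S (\<lambda>_. \<one>) (\<lambda>b. \<sigma> b (x j) \<odot>\<^bsub>P\<^esub> b)"
      using sum_retract_family[OF reg_module P sr, of "n 0" x] xc by blast
    have Sc: "b \<in> carrier P" if "b \<in> S" for b using S(2) that by blast
    have \<tau>t: "\<tau> b t = lc C {..<n 0} (\<lambda>_. \<one>) (\<lambda>i. \<sigma> b (x i) \<odot>\<^bsub>C\<^esub> c i)" if b: "b \<in> carrier P" for b
    proof -
      have "\<tau> b t = lc C {..<n 0} (\<lambda>_. \<one>) (\<lambda>i. \<tau> b (T.elt (x i) (c i)))"
        unfolding x(2) tsum_def using xc by (intro mod_hom_lc[OF T.tensor_module module_axioms \<tau>(1)[OF b]] T.elt_closed) auto
      also have "\<dots> = lc C {..<n 0} (\<lambda>_. \<one>) (\<lambda>i. \<sigma> b (x i) \<odot>\<^bsub>C\<^esub> c i)"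
        using xc \<sigma>c b by (intro lc_cong[OF module_axioms]) (auto simp: \<tau>(2))
      finally show ?thesis .
    qed
    have "\<tau> b t = \<zero>\<^bsub>C\<^esub>" if "b \<in> carrier P - S" for b
    proof -
      have "lc C {..<n 0} (\<lambda>_. \<one>) (\<lambda>i. \<sigma> b (x i) \<odot>\<^bsub>C\<^esub> c i) = \<zero>\<^bsub>C\<^esub>"
        by (rule lc_zero) (use S(3) that in \<open>auto simp: reg_simps\<close>)
      then show ?thesis using \<tau>t that by simp
    qed
    moreover have "t = lc T.T S (\<lambda>_. \<one>) (\<lambda>b. T.elt b (\<tau> b t))"
    proof -
      \<comment> \<open>Each \<open>x i\<close> is expanded over \<open>S\<close>, the coefficients
        cross the tensor sign, and the two sums are exchanged.\<close>
      have "t = lc T.T {..<n 0} (\<lambda>_. \<one>) (\<lambda>i. lc T.T S (\<lambda>_. \<one>) (\<lambda>b. T.elt b (\<sigma> b (x i) \<odot>\<^bsub>C\<^esub> c i)))"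
        unfolding x(2) tsum_def
      proof (intro lc_cong[OF T.tensor_module] refl)
        fix i assume i: "i \<in> {..<n 0}"
        have "T.elt (x i) (c i) = T.elt (lc P S (\<lambda>_. \<one>) (\<lambda>b. \<sigma> b (x i) \<odot>\<^bsub>P\<^esub> b)) (c i)" using S(4) i by auto
        also have "\<dots> = lc T.T S (\<lambda>_. \<one>) (\<lambda>b. T.elt (\<sigma> b (x i) \<odot>\<^bsub>P\<^esub> b) (c i))"
          using S(1) Sc \<sigma>c xc by (intro mod_hom_lc[OF P T.tensor_module T.elt_hom_left]) auto
        also have "\<dots> = lc T.T S (\<lambda>_. \<one>) (\<lambda>b. T.elt b (\<sigma> b (x i) \<odot>\<^bsub>C\<^esub> c i))"
          using Sc \<sigma>c xc by (intro lc_cong[OF T.tensor_module])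
            (auto simp: mod_hom_smult[OF T.elt_hom_left] mod_hom_smult[OF T.elt_hom_right] T.elt_closed)
        finally show "T.elt (x i) (c i) = lc T.T S (\<lambda>_. \<one>) (\<lambda>b. T.elt b (\<sigma> b (x i) \<odot>\<^bsub>C\<^esub> c i))" .
        show "lc T.T S (\<lambda>_. \<one>) (\<lambda>b. T.elt b (\<sigma> b (x i) \<odot>\<^bsub>C\<^esub> c i)) \<in> carrier T.T"
          using Sc \<sigma>c xc by (intro T.T.lc_closed T.elt_closed) auto
      qed simp
      also have "\<dots> = lc T.T S (\<lambda>_. \<one>) (\<lambda>b. lc T.T {..<n 0} (\<lambda>_. \<one>) (\<lambda>i. T.elt b (\<sigma> b (x i) \<odot>\<^bsub>C\<^esub> c i)))"
        using S(1) Sc \<sigma>c xc by (intro T.T.lc_swap T.elt_closed) auto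
      also have "\<dots> = lc T.T S (\<lambda>_. \<one>) (\<lambda>b. T.elt b (\<tau> b t))"
      proof (intro lc_cong[OF T.tensor_module] refl)
        fix b assume b: "b \<in> S"
        show "lc T.T {..<n 0} (\<lambda>_. \<one>) (\<lambda>i. T.elt b (\<sigma> b (x i) \<odot>\<^bsub>C\<^esub> c i)) = T.elt b (\<tau> b t)"
          unfolding \<tau>t[OF Sc[OF b]] using Sc[OF b] \<sigma>c xc
          by (intro mod_hom_lc[OF module_axioms T.tensor_module T.elt_hom_right, symmetric]) auto
        show "T.elt b (\<tau> b t) \<in> carrier T.T"
          using Sc[OF b] mod_hom_closed[OF \<tau>(1) t] by (intro T.elt_closed) auto
      qed simp
      finally show ?thesis .
    qed
    ultimately show ?thesis using S(1,2) by blast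
  qed
  then have "sum_retract R C T.T (carrier P) \<tau> T.elt"
    unfolding sum_retract_def using \<tau>(1) T.elt_hom_right by blast
  with \<tau>(2) show ?thesis by blast
qed

lemma projective_tensor_ext_acyclic:
  assumes "projective_mod R P"
  shows "ext_acyclic (tensor_mod R P C)"
proof -
  have P: "module R P" using assms by (simp add: projective_mod_def)
  interpret T: tensor_product R P C using P module_axioms by (simp add: tensor_product_def)
  obtain \<sigma> where "sum_retract R reg P (carrier P) \<sigma> (\<lambda>b r. r \<odot>\<^bsub>P\<^esub> b)"
    using projective_sum_retract[OF assms] by blast
  from projective_tensor_retract[OF P this] obtain \<tau>
    where "sum_retract R C (tensor_mod R P C) (carrier P) \<tau> (tensor_elt R P C)" by blast
  from exact_pair_retract[OF module_axioms T.tensor_module this] show ?thesis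
    using ext_acyclic_C unfolding ext_acyclic_def by simp
qed

text \<open>Injectivity of P -> Hom(C, P \<otimes> C). Under \<open>\<tau> b\<close> the hypothesis
  says that the coordinate \<open>\<sigma> b p\<close> annihilates C, so it is zero by the homothety
  map; with all its coordinates, \<open>p\<close> is zero.\<close>

lemma projective_tensor_inj:
  assumes "projective_mod R P" "p \<in> carrier P"
    and "\<And>i. i < n 0 \<Longrightarrow> tensor_elt R P C p (c i) = \<zero>\<^bsub>tensor_mod R P C\<^esub>"
  shows "p = \<zero>\<^bsub>P\<^esub>"
proof -
  have P: "module R P" using assms by (simp add: projective_mod_def)
  interpret P: module R P by (rule P)
  interpret T: tensor_product R P C using P module_axioms by (simp add: tensor_product_def)
  obtain \<sigma> where \<sigma>: "sum_retract R reg P (carrier P) \<sigma> (\<lambda>b r. r \<odot>\<^bsub>P\<^esub> b)"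
    using projective_sum_retract[OF assms(1)] by blast
  from projective_tensor_retract[OF P \<sigma>] obtain \<tau>
    where \<tau>: "\<forall>b\<in>carrier P. \<forall>p\<in>carrier P. \<forall>x\<in>carrier C. \<tau> b (tensor_elt R P C p x) = \<sigma> b p \<odot>\<^bsub>C\<^esub> x"
      "sum_retract R C (tensor_mod R P C) (carrier P) \<tau> (tensor_elt R P C)" by blast
  have "\<sigma> b p = \<zero>" if b: "b \<in> carrier P" for b
  proof (rule homothety_inj)
    have \<tau>h: "\<tau> b \<in> mod_hom R T.T C" using \<tau>(2) b by (simp add: sum_retract_def)
    have "\<sigma> b \<in> mod_hom R P reg" using \<sigma> b by (simp add: sum_retract_def)
    from mod_hom_closed[OF this assms(2)] show r: "\<sigma> b p \<in> carrier R" by (simp add: reg_simps)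
    fix x assume x: "x \<in> carrier C"
    show "\<sigma> b p \<odot>\<^bsub>C\<^esub> x = \<zero>\<^bsub>C\<^esub>"
    proof (rule hom_C_eqI[OF module_axioms _ _ _ x])
      show "(\<odot>\<^bsub>C\<^esub>) (\<sigma> b p) \<in> mod_hom R C C"
        using r by (intro mod_homI) (auto simp: smult_r_distr smult_assoc1[symmetric] R.m_comm)
      show "(\<lambda>_. \<zero>\<^bsub>C\<^esub>) \<in> mod_hom R C C" by (intro mod_homI) auto
      show "\<sigma> b p \<odot>\<^bsub>C\<^esub> c i = \<zero>\<^bsub>C\<^esub>" if "i < n 0" for i
      proof -
        have "\<sigma> b p \<odot>\<^bsub>C\<^esub> c i = \<tau> b (T.elt p (c i))" using \<tau>(1) b assms(2) by simp
        also have "\<dots> = \<zero>\<^bsub>C\<^esub>"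
          unfolding assms(3)[OF that] by (rule mod_hom_zero[OF T.tensor_module module_axioms \<tau>h])
        finally show ?thesis .
      qed
    qed
  qed
  moreover obtain S where S: "S \<subseteq> carrier P" "p = lc P S (\<lambda>_. \<one>) (\<lambda>b. \<sigma> b p \<odot>\<^bsub>P\<^esub> b)"
    using \<sigma> assms(2) unfolding sum_retract_def by blast
  ultimately have "lc P S (\<lambda>_. \<one>) (\<lambda>b. \<sigma> b p \<odot>\<^bsub>P\<^esub> b) = \<zero>\<^bsub>P\<^esub>"
    by (intro P.lc_zero) auto
  with S(2) show ?thesis by simp
qed

text \<open>Surjectivity of P -> Hom(C, P \<otimes> C). A tuple killed by the transpose of
  \<open>D 0\<close> is a homomorphism from C. Its components under \<open>\<tau> b\<close> are
  endomorphisms of C, hence multiplications by ring elements, and these are the coefficients of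
  \<open>p\<close>. Finitely many summands suffice because C has finitely many generators.\<close>

lemma projective_tensor_surj:
  assumes "projective_mod R P" "\<And>i. i < n 0 \<Longrightarrow> q i \<in> carrier (tensor_mod R P C)"
    and "\<And>j. j < n 1 \<Longrightarrow> up (tensor_mod R P C) 0 q j = \<zero>\<^bsub>tensor_mod R P C\<^esub>"
  shows "\<exists>p\<in>carrier P. \<forall>i<n 0. q i = tensor_elt R P C p (c i)"
proof -
  have P: "module R P" using assms by (simp add: projective_mod_def)
  interpret P: module R P by (rule P)
  interpret T: tensor_product R P C using P module_axioms by (simp add: tensor_product_def)
  obtain \<sigma> where \<sigma>: "sum_retract R reg P (carrier P) \<sigma> (\<lambda>b r. r \<odot>\<^bsub>P\<^esub> b)"
    using projective_sum_retract[OF assms(1)] by blast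
  from projective_tensor_retract[OF P \<sigma>] obtain \<tau>
    where \<tau>: "sum_retract R C (tensor_mod R P C) (carrier P) \<tau> (tensor_elt R P C)" by blast
  have \<tau>h: "\<tau> b \<in> mod_hom R T.T C" if "b \<in> carrier P" for b using \<tau> that by (simp add: sum_retract_def)
  obtain S where S: "finite S" "S \<subseteq> carrier P" "\<forall>i<n 0. q i = lc T.T S (\<lambda>_. \<one>) (\<lambda>b. T.elt b (\<tau> b (q i)))"
    using sum_retract_family[OF module_axioms T.tensor_module \<tau>, of "n 0" q] assms(2) by blast
  have Sc: "b \<in> carrier P" if "b \<in> S" for b using S(2) that by blast
  have "\<exists>r. r \<in> carrier R \<and> (\<forall>i<n 0. \<tau> b (q i) = r \<odot>\<^bsub>C\<^esub> c i)" if b: "b \<in> carrier P" for b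
  proof -
    have "\<exists>f\<in>mod_hom R C C. \<forall>i<n 0. f (c i) = \<tau> b (q i)"
    proof (rule hom_from_C[OF module_axioms])
      show "\<tau> b (q i) \<in> carrier C" if "i < n 0" for i by (rule mod_hom_closed[OF \<tau>h[OF b] assms(2)[OF that]])
      fix j assume j: "j < n 1"
      have "up C 0 (\<lambda>i. \<tau> b (q i)) j = \<tau> b (up T.T 0 q j)"
        using assms(2) by (intro mod_hom_lc[OF T.tensor_module module_axioms \<tau>h[OF b], symmetric]) auto
      then show "up C 0 (\<lambda>i. \<tau> b (q i)) j = \<zero>\<^bsub>C\<^esub>"
        using assms(3)[OF j] mod_hom_zero[OF T.tensor_module module_axioms \<tau>h[OF b]] by simp
    qed
    then obtain f where f: "f \<in> mod_hom R C C" "\<forall>i<n 0. f (c i) = \<tau> b (q i)" by blast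
    from homothety_surj[OF f(1)] obtain r where "r \<in> carrier R" "\<forall>x\<in>carrier C. f x = r \<odot>\<^bsub>C\<^esub> x" by blast
    with f(2) show ?thesis by (metis c_closed)
  qed
  then have "\<forall>b\<in>carrier P. \<exists>r. r \<in> carrier R \<and> (\<forall>i<n 0. \<tau> b (q i) = r \<odot>\<^bsub>C\<^esub> c i)" by blast
  from bchoice[OF this] obtain r where r0: "\<forall>b\<in>carrier P. r b \<in> carrier R \<and> (\<forall>i<n 0. \<tau> b (q i) = r b \<odot>\<^bsub>C\<^esub> c i)" ..
  have r: "\<And>b. b \<in> carrier P \<Longrightarrow> r b \<in> carrier R" "\<And>b i. b \<in> carrier P \<Longrightarrow> i < n 0 \<Longrightarrow> \<tau> b (q i) = r b \<odot>\<^bsub>C\<^esub> c i"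
    using r0 by blast+
  let ?p = "lc P S r (\<lambda>b. b)"
  have "?p \<in> carrier P" using Sc r by auto
  moreover have "q i = T.elt ?p (c i)" if i: "i < n 0" for i
  proof -
    have "T.elt ?p (c i) = lc T.T S r (\<lambda>b. T.elt b (c i))"
      using S(1) Sc r by (intro mod_hom_lc[OF P T.tensor_module T.elt_hom_left]) auto
    also have "\<dots> = lc T.T S (\<lambda>_. \<one>) (\<lambda>b. T.elt b (\<tau> b (q i)))"
      unfolding lc_def using Sc r i
      by (intro T.T.finsum_cong') (auto simp: mod_hom_smult[OF T.elt_hom_right] T.elt_closed)
    also have "\<dots> = q i" using S(3) i by simp
    finally show ?thesis ..
  qed
  ultimately show ?thesis by blast
qed

text \<open>Hence a complex of projectives and its tensor product with C are nonzero in the same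
  degrees, which gives them the same supremum and the same bounds.\<close>

lemma projective_tensor_zero_iff:
  assumes "projective_mod R P"
  shows "zero_mod (tensor_mod R P C) \<longleftrightarrow> zero_mod P"
proof -
  have P: "module R P" using assms by (simp add: projective_mod_def)
  interpret P: module R P by (rule P)
  interpret T: tensor_product R P C using P module_axioms by (simp add: tensor_product_def)
  show ?thesis
  proof
    assume z: "zero_mod (tensor_mod R P C)"
    have "p = \<zero>\<^bsub>P\<^esub>" if p: "p \<in> carrier P" for p
    proof (rule projective_tensor_inj[OF assms p])
      fix i show "T.elt p (c i) = \<zero>\<^bsub>T.T\<^esub>"
        using T.elt_closed[OF p c_closed] z by (auto simp: zero_mod_def)
    qed
    then show "zero_mod P" by (auto simp: zero_mod_def)
  next
    assume z: "zero_mod P"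
    have "t = \<zero>\<^bsub>T.T\<^esub>" if t: "t \<in> carrier T.T" for t
    proof -
      obtain x where x: "x \<in> vec P" "t = tsum P x" using tsum_surj[OF P t] by blast
      have x0: "x i = \<zero>\<^bsub>P\<^esub>" for i using vecD[OF x(1), of i] z by (auto simp: zero_mod_def)
      show ?thesis unfolding x(2) tsum_def x0
        by (rule T.T.lc_zero) (auto intro!: mod_hom_zero[OF P T.tensor_module T.elt_hom_left])
    qed
    then show "zero_mod (tensor_mod R P C)" by (auto simp: zero_mod_def)
  qed
qed

end

section \<open>Coordinates on homology\<close>

definition cyc :: "('a, 'p) cplx \<Rightarrow> int \<Rightarrow> 'p set" where
  "cyc X i = {x \<in> carrier (obj X i). diff X i x = \<zero>\<^bsub>obj X (i - 1)\<^esub>}"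

definition bnd :: "('a, 'p) cplx \<Rightarrow> int \<Rightarrow> 'p set" where
  "bnd X i = diff X (i + 1) ` carrier (obj X (i + 1))"

lemma homology_eq: "homology X i = quot_mod (obj X i\<lparr>carrier := cyc X i\<rparr>) (bnd X i)"
  by (simp add: homology_def cyc_def bnd_def)

lemma bnd_pred: "bnd X (i - 1) = diff X i ` carrier (obj X i)"
  by (simp add: bnd_def)

context
  fixes R :: "('a, 'r) ring_scheme" and X :: "('a, 'p) cplx"
  assumes X: "is_cplx R X"
begin

lemma cplx_module: "module R (obj X i)"
  using X by (simp add: is_cplx_def)

lemma cplx_diff: "diff X i \<in> mod_hom R (obj X i) (obj X (i - 1))"
  using X by (simp add: is_cplx_def)

lemma cplx_diff_Suc: "diff X (i + 1) \<in> mod_hom R (obj X (i + 1)) (obj X i)"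
  using cplx_diff[of "i + 1"] by simp

lemma cplx_diff_diff:
  assumes "x \<in> carrier (obj X i)"
  shows "diff X (i - 1) (diff X i x) = \<zero>\<^bsub>obj X (i - 1 - 1)\<^esub>"
proof -
  have "i - 1 - 1 = i - 2" by simp
  then show ?thesis using X assms by (simp add: is_cplx_def del: diff_diff_eq)
qed

lemma cyc_submodule: "submodule (cyc X i) R (obj X i)"
  unfolding cyc_def by (rule mod_hom_kernel_submodule[OF cplx_module cplx_module cplx_diff])

lemma bnd_submodule: "submodule (bnd X i) R (obj X i)"
  unfolding bnd_def by (rule mod_hom_image_submodule[OF cplx_module cplx_module cplx_diff_Suc])

lemma cycD: "x \<in> cyc X i \<Longrightarrow> x \<in> carrier (obj X i)"
  by (simp add: cyc_def)

lemma bnd_cyc: "x \<in> bnd X i \<Longrightarrow> x \<in> cyc X i"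
  using mod_hom_closed[OF cplx_diff_Suc[of i]] cplx_diff_diff[of _ "i + 1"]
  by (auto simp: bnd_def cyc_def)

lemma cyc_module: "module R (obj X i\<lparr>carrier := cyc X i\<rparr>)"
  by (rule submodule.submodule_is_module[OF cyc_submodule cplx_module])

lemma bnd_submodule_cyc: "submodule (bnd X i) R (obj X i\<lparr>carrier := cyc X i\<rparr>)"
proof -
  interpret Z: module R "obj X i\<lparr>carrier := cyc X i\<rparr>" by (rule cyc_module)
  interpret O: module R "obj X i" by (rule cplx_module)
  note e = O.submoduleE[OF bnd_submodule[of i]]
  show ?thesis
  proof (rule Z.submoduleI)
    show "\<ominus>\<^bsub>obj X i\<lparr>carrier := cyc X i\<rparr>\<^esub> b \<in> bnd X i" if "b \<in> bnd X i" for b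
      using e(4)[of "\<ominus>\<^bsub>R\<^esub> \<one>\<^bsub>R\<^esub>" b] that bnd_cyc[OF that] by (simp add: Z.smult_minus_one)
  qed (use bnd_cyc submodule_zero[OF bnd_submodule[of i]] e in auto)
qed

lemma homology_module: "module R (homology X i)"
  unfolding homology_eq by (rule module.quot_module[OF cyc_module bnd_submodule_cyc])

lemma cyc_lc:
  assumes "finite S" "\<And>s. s \<in> S \<Longrightarrow> a s \<in> carrier R" "\<And>s. s \<in> S \<Longrightarrow> x s \<in> cyc X i"
  shows "lc (obj X i) S a x \<in> cyc X i"
  by (rule module.submodule_lc[OF cplx_module cyc_submodule assms])

lemma cyc_minus: "x \<in> cyc X i \<Longrightarrow> y \<in> cyc X i \<Longrightarrow> x \<ominus>\<^bsub>obj X i\<^esub> y \<in> cyc X i"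
  unfolding a_minus_def
  by (intro module.submoduleE(5)[OF cplx_module cyc_submodule] module.submoduleE(3)[OF cplx_module cyc_submodule])

lemma zero_mod_homology_iff: "zero_mod (homology X i) \<longleftrightarrow> cyc X i = bnd X i"
proof -
  interpret Z: module R "obj X i\<lparr>carrier := cyc X i\<rparr>" by (rule cyc_module)
  note B = bnd_submodule_cyc[of i]
  have "zero_mod (homology X i) \<longleftrightarrow> (\<forall>z\<in>cyc X i. bnd X i +>\<^bsub>obj X i\<lparr>carrier := cyc X i\<rparr>\<^esub> z = bnd X i)"
  proof -
    have "bnd X i \<in> carrier (homology X i)"
      using module_zero_closed[OF homology_module[of i]]
      by (simp add: homology_eq Z.quot_zero[OF B])
    then show ?thesis unfolding zero_mod_def
      by (auto simp: homology_eq Z.quot_zero[OF B] Z.quot_carrier[OF B])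
  qed
  also have "\<dots> \<longleftrightarrow> cyc X i = bnd X i"
    using bnd_cyc by (auto simp: Z.quot_eq_zero_iff[OF B])
  finally show ?thesis .
qed

lemma zero_mod_bnd_cyc:
  assumes "zero_mod (obj X j)"
  shows "bnd X j = {\<zero>\<^bsub>obj X j\<^esub>}" "cyc X j = {\<zero>\<^bsub>obj X j\<^esub>}"
  using submodule_zero[OF bnd_submodule[of j]] submodule_zero[OF cyc_submodule[of j]]
    submodule_imp_subset[OF bnd_submodule[of j]] submodule_imp_subset[OF cyc_submodule[of j]]
    assms unfolding zero_mod_def by auto

lemma zero_mod_imp_homology: "zero_mod (obj X i) \<Longrightarrow> zero_mod (homology X i)"
  by (simp add: zero_mod_homology_iff zero_mod_bnd_cyc)

end

text \<open>An isomorphism of homology with the power L^a, expressed by its components on cycles: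
  they are jointly surjective and have the boundaries as common kernel. The inductions then need no
  cosets.\<close>

definition homology_coords ::
  "('a, 'r) ring_scheme \<Rightarrow> ('a, 'p) cplx \<Rightarrow> int \<Rightarrow> ('a, 'l, 'z) module_scheme \<Rightarrow> nat \<Rightarrow> (nat \<Rightarrow> 'p \<Rightarrow> 'l) \<Rightarrow> bool"
where
  "homology_coords R X i L a \<pi> \<longleftrightarrow>
    (\<forall>k<a. \<pi> k \<in> mod_hom R (obj X i\<lparr>carrier := cyc X i\<rparr>) L) \<and>
    (\<forall>m. (\<forall>k<a. m k \<in> carrier L) \<longrightarrow> (\<exists>z\<in>cyc X i. \<forall>k<a. \<pi> k z = m k)) \<and>
    (\<forall>z\<in>cyc X i. (\<forall>k<a. \<pi> k z = \<zero>\<^bsub>L\<^esub>) \<longleftrightarrow> z \<in> bnd X i)"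

lemma homology_coords_exist:
  assumes X: "is_cplx R X" and L: "module R L"
    and "isomorphic_mod R (homology X i) (mod_power L a)"
  shows "\<exists>\<pi>. homology_coords R X i L a \<pi>"
proof -
  interpret Z: module R "obj X i\<lparr>carrier := cyc X i\<rparr>" by (rule cyc_module[OF X])
  interpret L: module R L by (rule L)
  note B = bnd_submodule_cyc[OF X, of i]
  let ?q = "\<lambda>z. bnd X i +>\<^bsub>obj X i\<lparr>carrier := cyc X i\<rparr>\<^esub> z"
  obtain \<phi> where \<phi>: "\<phi> \<in> mod_hom R (homology X i) (mod_power L a)"
    "bij_betw \<phi> (carrier (homology X i)) (carrier (mod_power L a))"
    using assms(3) by (auto simp: isomorphic_mod_def mod_iso_def)
  have q: "?q \<in> mod_hom R (obj X i\<lparr>carrier := cyc X i\<rparr>) (homology X i)"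
    unfolding homology_eq by (rule Z.quot_hom[OF B])
  have q\<phi>: "(\<lambda>z. \<phi> (?q z)) \<in> mod_hom R (obj X i\<lparr>carrier := cyc X i\<rparr>) (mod_power L a)"
    by (rule mod_hom_comp[OF q \<phi>(1)])
  have ev: "(\<lambda>f. f k) \<in> mod_hom R (mod_power L a) L" if "k < a" for k
    using that by (intro mod_homI) (auto simp: L.mod_power_mem_iff L.mod_power_apply)
  have "homology_coords R X i L a (\<lambda>k z. \<phi> (?q z) k)"
    unfolding homology_coords_def
  proof (intro conjI allI impI ballI)
    show "(\<lambda>z. \<phi> (?q z) k) \<in> mod_hom R (obj X i\<lparr>carrier := cyc X i\<rparr>) L" if "k < a" for k
      by (rule mod_hom_comp[OF q\<phi> ev[OF that]])
    show "\<exists>z\<in>cyc X i. \<forall>k<a. \<phi> (?q z) k = m k" if m: "\<forall>k<a. m k \<in> carrier L" for m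
    proof -
      let ?m = "\<lambda>k. if k < a then m k else undefined"
      have "?m \<in> carrier (mod_power L a)" using m by (simp add: L.mod_power_mem_iff)
      then have "?m \<in> \<phi> ` carrier (homology X i)" using bij_betw_imp_surj_on[OF \<phi>(2)] by simp
      then obtain H where H: "H \<in> carrier (homology X i)" "\<phi> H = ?m" by (metis (mono_tags) imageE)
      then obtain z where "z \<in> cyc X i" "H = ?q z"
        unfolding homology_eq Z.quot_carrier[OF B] by auto
      then show ?thesis using H(2) by (intro bexI[of _ z]) auto
    qed
    show "(\<forall>k<a. \<phi> (?q z) k = \<zero>\<^bsub>L\<^esub>) \<longleftrightarrow> z \<in> bnd X i" if z: "z \<in> cyc X i" for z
    proof -
      have qz: "?q z \<in> carrier (homology X i)" using mod_hom_closed[OF q, of z] z by simp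
      have H0: "bnd X i \<in> carrier (homology X i)"
        using module_zero_closed[OF homology_module[OF X, of i]]
        by (simp add: homology_eq Z.quot_zero[OF B])
      have \<phi>0: "\<phi> (bnd X i) = \<zero>\<^bsub>mod_power L a\<^esub>"
        using mod_hom_zero[OF homology_module[OF X] L.mod_power_module \<phi>(1)]
        by (simp add: homology_eq Z.quot_zero[OF B])
      have "(\<forall>k<a. \<phi> (?q z) k = \<zero>\<^bsub>L\<^esub>) \<longleftrightarrow> \<phi> (?q z) = \<zero>\<^bsub>mod_power L a\<^esub>"
        using mod_hom_closed[OF \<phi>(1) qz] by (auto simp: fun_eq_iff L.mod_power_apply L.mod_power_mem_iff)
      also have "\<dots> \<longleftrightarrow> ?q z = bnd X i"
        unfolding \<phi>0[symmetric] using \<phi>(2) qz H0 by (auto simp: bij_betw_def inj_on_def)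
      also have "\<dots> \<longleftrightarrow> z \<in> bnd X i" using z by (simp add: Z.quot_eq_zero_iff[OF B])
      finally show ?thesis .
    qed
  qed
  then show ?thesis by blast
qed

text \<open>The way back to an isomorphism. \<open>ker\<close> covers well-definedness and
  injectivity at once. Tuples are arbitrary from index \<open>a\<close> on, and \<open>tr\<close>
  brings them into the form used by \<open>mod_power\<close>.\<close>

lemma homology_iso_relI:
  fixes L :: "('a, 'l, 'z) module_scheme"
  assumes X: "is_cplx R X" and L: "module R L"
    and cl: "\<And>z m. \<rho> z m \<Longrightarrow> z \<in> cyc X i \<and> (\<forall>k<a. m k \<in> carrier L)"
    and tot: "\<And>z. z \<in> cyc X i \<Longrightarrow> \<exists>m. \<rho> z m"
    and sur: "\<And>m. (\<forall>k<a. m k \<in> carrier L) \<Longrightarrow> \<exists>z m'. \<rho> z m' \<and> (\<forall>k<a. m' k = m k)"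
    and add: "\<And>z m z' m'. \<rho> z m \<Longrightarrow> \<rho> z' m' \<Longrightarrow> \<rho> (z \<oplus>\<^bsub>obj X i\<^esub> z') (\<lambda>k. m k \<oplus>\<^bsub>L\<^esub> m' k)"
    and smult: "\<And>r z m. r \<in> carrier R \<Longrightarrow> \<rho> z m \<Longrightarrow> \<rho> (r \<odot>\<^bsub>obj X i\<^esub> z) (\<lambda>k. r \<odot>\<^bsub>L\<^esub> m k)"
    and ker: "\<And>z m. \<rho> z m \<Longrightarrow> z \<in> bnd X i \<longleftrightarrow> (\<forall>k<a. m k = \<zero>\<^bsub>L\<^esub>)"
  shows "isomorphic_mod R (homology X i) (mod_power L a)"
proof -
  interpret Z: module R "obj X i\<lparr>carrier := cyc X i\<rparr>" by (rule cyc_module[OF X])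
  interpret L: module R L by (rule L)
  note B = bnd_submodule_cyc[OF X, of i]
  let ?q = "\<lambda>z. bnd X i +>\<^bsub>obj X i\<lparr>carrier := cyc X i\<rparr>\<^esub> z"
  have q: "?q \<in> mod_hom R (obj X i\<lparr>carrier := cyc X i\<rparr>) (homology X i)"
    unfolding homology_eq by (rule Z.quot_hom[OF B])
  have q0: "?q z = \<zero>\<^bsub>homology X i\<^esub> \<longleftrightarrow> z \<in> bnd X i" if "z \<in> cyc X i" for z
    using that by (simp add: homology_eq Z.quot_zero[OF B] Z.quot_eq_zero_iff[OF B])
  define tr where "tr m = (\<lambda>k. if k < a then m k else undefined)" for m :: "nat \<Rightarrow> 'l"
  have trc: "tr m \<in> carrier (mod_power L a)" if "\<forall>k<a. m k \<in> carrier L" for m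
    using that by (simp add: tr_def L.mod_power_mem_iff)
  define \<rho>' where "\<rho>' H f \<longleftrightarrow> (\<exists>z m. \<rho> z m \<and> H = ?q z \<and> f = tr m)" for H f
  show ?thesis
  proof (rule isomorphic_mod_relI[OF homology_module[OF X] L.mod_power_module, where \<rho> = \<rho>'])
    show "H \<in> carrier (homology X i) \<and> f \<in> carrier (mod_power L a)" if "\<rho>' H f" for H f
      using that cl trc mod_hom_closed[OF q] unfolding \<rho>'_def by fastforce
    show "\<exists>f. \<rho>' H f" if "H \<in> carrier (homology X i)" for H
    proof -
      from that obtain z where "z \<in> cyc X i" "H = ?q z"
        unfolding homology_eq Z.quot_carrier[OF B] by auto
      then show ?thesis using tot unfolding \<rho>'_def by blast
    qed
    show "\<exists>H. \<rho>' H f" if f: "f \<in> carrier (mod_power L a)" for f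
    proof -
      have "\<forall>k<a. f k \<in> carrier L" using f by (simp add: L.mod_power_mem_iff)
      from sur[OF this] obtain z m where zm: "\<rho> z m" "\<forall>k<a. m k = f k" by blast
      have "f = tr m" using f zm(2) by (auto simp: tr_def L.mod_power_mem_iff)
      then show ?thesis using zm(1) unfolding \<rho>'_def by blast
    qed
    show "\<rho>' (H \<oplus>\<^bsub>homology X i\<^esub> H') (f \<oplus>\<^bsub>mod_power L a\<^esub> f')" if "\<rho>' H f" "\<rho>' H' f'" for H f H' f'
    proof -
      from that obtain z m z' m' where *: "\<rho> z m" "H = ?q z" "f = tr m" "\<rho> z' m'" "H' = ?q z'" "f' = tr m'"
        unfolding \<rho>'_def by blast
      have "H \<oplus>\<^bsub>homology X i\<^esub> H' = ?q (z \<oplus>\<^bsub>obj X i\<^esub> z')"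
        using mod_hom_add[OF q, of z z'] cl[OF *(1)] cl[OF *(4)] by (simp add: *)
      moreover have "f \<oplus>\<^bsub>mod_power L a\<^esub> f' = tr (\<lambda>k. m k \<oplus>\<^bsub>L\<^esub> m' k)"
        by (auto simp: fun_eq_iff L.mod_power_apply tr_def *)
      ultimately show ?thesis using add[OF *(1,4)] unfolding \<rho>'_def by blast
    qed
    show "\<rho>' (r \<odot>\<^bsub>homology X i\<^esub> H) (r \<odot>\<^bsub>mod_power L a\<^esub> f)" if r: "r \<in> carrier R" and "\<rho>' H f" for r H f
    proof -
      from that(2) obtain z m where *: "\<rho> z m" "H = ?q z" "f = tr m" unfolding \<rho>'_def by blast
      have "r \<odot>\<^bsub>homology X i\<^esub> H = ?q (r \<odot>\<^bsub>obj X i\<^esub> z)"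
        using mod_hom_smult[OF q r, of z] cl[OF *(1)] by (simp add: *)
      moreover have "r \<odot>\<^bsub>mod_power L a\<^esub> f = tr (\<lambda>k. r \<odot>\<^bsub>L\<^esub> m k)"
        by (auto simp: fun_eq_iff L.mod_power_apply tr_def *)
      ultimately show ?thesis using smult[OF r *(1)] unfolding \<rho>'_def by blast
    qed
    show "f = \<zero>\<^bsub>mod_power L a\<^esub>" if "\<rho>' \<zero>\<^bsub>homology X i\<^esub> f" for f
    proof -
      from that obtain z m where *: "\<rho> z m" "\<zero>\<^bsub>homology X i\<^esub> = ?q z" "f = tr m" unfolding \<rho>'_def by blast
      then have "\<forall>k<a. m k = \<zero>\<^bsub>L\<^esub>" using q0[of z] cl[OF *(1)] ker[OF *(1)] by simp
      then show ?thesis by (auto simp: fun_eq_iff L.mod_power_apply tr_def *(3))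
    qed
    show "H = \<zero>\<^bsub>homology X i\<^esub>" if "\<rho>' H \<zero>\<^bsub>mod_power L a\<^esub>" for H
    proof -
      from that obtain z m where *: "\<rho> z m" "H = ?q z" "\<zero>\<^bsub>mod_power L a\<^esub> = tr m" unfolding \<rho>'_def by blast
      have "m k = \<zero>\<^bsub>L\<^esub>" if "k < a" for k
        using fun_cong[OF *(3), of k] that by (simp add: L.mod_power_apply tr_def)
      then show ?thesis using q0[of z] cl[OF *(1)] ker[OF *(1)] *(2) by simp
    qed
  qed
qed

section \<open>Linear systems modulo boundaries\<close>

context
  fixes R :: "('a, 'r) ring_scheme" and X :: "('a, 'p) cplx" and L :: "('a, 'l, 'z) module_scheme"
    and i a \<pi>
  assumes X: "is_cplx R X" and L: "module R L" and \<pi>: "homology_coords R X i L a \<pi>"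
begin

lemma coords_hom: "k < a \<Longrightarrow> \<pi> k \<in> mod_hom R (obj X i\<lparr>carrier := cyc X i\<rparr>) L"
  using \<pi> by (simp add: homology_coords_def)

lemma coords_closed: "k < a \<Longrightarrow> z \<in> cyc X i \<Longrightarrow> \<pi> k z \<in> carrier L"
  using mod_hom_closed[OF coords_hom, of k z] by simp

lemma coords_add:
  "k < a \<Longrightarrow> z \<in> cyc X i \<Longrightarrow> w \<in> cyc X i \<Longrightarrow> \<pi> k (z \<oplus>\<^bsub>obj X i\<^esub> w) = \<pi> k z \<oplus>\<^bsub>L\<^esub> \<pi> k w"
  using mod_hom_add[OF coords_hom, of k z w] by simp

lemma coords_smult:
  "k < a \<Longrightarrow> r \<in> carrier R \<Longrightarrow> z \<in> cyc X i \<Longrightarrow> \<pi> k (r \<odot>\<^bsub>obj X i\<^esub> z) = r \<odot>\<^bsub>L\<^esub> \<pi> k z"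
  using mod_hom_smult[OF coords_hom, of k r z] by simp

lemma coords_minus:
  assumes "k < a" "z \<in> cyc X i" "w \<in> cyc X i"
  shows "\<pi> k (z \<ominus>\<^bsub>obj X i\<^esub> w) = \<pi> k z \<ominus>\<^bsub>L\<^esub> \<pi> k w"
proof -
  interpret O: module R "obj X i" by (rule cplx_module[OF X])
  interpret L: module R L by (rule L)
  have m: "(\<ominus>\<^bsub>R\<^esub> \<one>\<^bsub>R\<^esub>) \<odot>\<^bsub>obj X i\<^esub> w \<in> cyc X i"
    using assms(3) by (intro O.submoduleE(4)[OF cyc_submodule[OF X]]) auto
  show ?thesis
    using assms m coords_closed[OF assms(1,3)] cycD[OF X assms(3)]
    by (simp add: a_minus_def O.smult_minus_one L.smult_minus_one coords_add coords_smult)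
qed

lemma coords_lc:
  assumes "k < a" "finite S" "\<And>s. s \<in> S \<Longrightarrow> r s \<in> carrier R" "\<And>s. s \<in> S \<Longrightarrow> z s \<in> cyc X i"
  shows "\<pi> k (lc (obj X i) S r z) = lc L S r (\<lambda>s. \<pi> k (z s))"
proof -
  have i: "(\<lambda>x. x) \<in> mod_hom R (obj X i\<lparr>carrier := cyc X i\<rparr>) (obj X i)"
    using cycD[OF X] by (intro mod_homI) auto
  have "lc (obj X i\<lparr>carrier := cyc X i\<rparr>) S r z = lc (obj X i) S r z"
    using assms by (intro mod_hom_lc[OF cyc_module[OF X] cplx_module[OF X] i]) auto
  moreover have "\<pi> k (lc (obj X i\<lparr>carrier := cyc X i\<rparr>) S r z) = lc L S r (\<lambda>s. \<pi> k (z s))"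
    using assms by (intro mod_hom_lc[OF cyc_module[OF X] L coords_hom]) auto
  ultimately show ?thesis by simp
qed

lemma coords_surj: "(\<And>k. k < a \<Longrightarrow> m k \<in> carrier L) \<Longrightarrow> \<exists>z\<in>cyc X i. \<forall>k<a. \<pi> k z = m k"
  using \<pi> by (simp add: homology_coords_def)

lemma coords_zero_iff: "z \<in> cyc X i \<Longrightarrow> (\<forall>k<a. \<pi> k z = \<zero>\<^bsub>L\<^esub>) \<longleftrightarrow> z \<in> bnd X i"
  using \<pi> by (simp add: homology_coords_def)

lemma coords_lift:
  assumes "\<And>k l. k < a \<Longrightarrow> m k l \<in> carrier L"
  shows "\<exists>w. (\<forall>l::nat. w l \<in> cyc X i) \<and> (\<forall>k<a. \<forall>l. \<pi> k (w l) = m k l)"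
proof -
  have "\<forall>l. \<exists>z. z \<in> cyc X i \<and> (\<forall>k<a. \<pi> k z = m k l)"
  proof
    fix l
    from coords_surj[of "\<lambda>k. m k l"] assms show "\<exists>z. z \<in> cyc X i \<and> (\<forall>k<a. \<pi> k z = m k l)" by blast
  qed
  from choice[OF this] show ?thesis by blast
qed

text \<open>A system over cycles modulo boundaries is one system over L for each coordinate.
  Exactness over L solves these, and \<open>coords_lift\<close> turns the solutions into
  cycles.\<close>

lemma coords_exact:
  assumes "exact_pair L l m p U V" "\<And>s t. U s t \<in> carrier R" "\<And>s t. V s t \<in> carrier R"
    and z: "\<And>j. j < m \<Longrightarrow> z j \<in> cyc X i"
    and "\<And>s. s < l \<Longrightarrow> lc (obj X i) {..<m} (U s) z \<in> bnd X i"
  shows "\<exists>w. (\<forall>j. w j \<in> cyc X i) \<and> (\<forall>j<m. z j \<ominus>\<^bsub>obj X i\<^esub> lc (obj X i) {..<p} (V j) w \<in> bnd X i)"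
proof -
  interpret L: module R L by (rule L)
  have "\<exists>y. y \<in> vec L \<and> (\<forall>j<m. \<pi> k (z j) = lc L {..<p} (V j) y)" if k: "k < a" for k
  proof -
    let ?x = "\<lambda>j. if j < m then \<pi> k (z j) else \<zero>\<^bsub>L\<^esub>"
    have xv: "?x \<in> vec L" using coords_closed[OF k z] by (simp add: vec_def)
    have "lc L {..<m} (U s) ?x = \<zero>\<^bsub>L\<^esub>" if s: "s < l" for s
    proof -
      have "lc L {..<m} (U s) ?x = lc L {..<m} (U s) (\<lambda>j. \<pi> k (z j))"
        using assms(2) coords_closed[OF k z] by (intro lc_cong[OF L]) auto
      also have "\<dots> = \<pi> k (lc (obj X i) {..<m} (U s) z)"
        using assms(2) z by (intro coords_lc[OF k, symmetric]) auto
      also have "\<dots> = \<zero>\<^bsub>L\<^esub>" using coords_zero_iff[OF bnd_cyc[OF X assms(5)[OF s]]] assms(5)[OF s] k by blast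
      finally show ?thesis .
    qed
    with xv obtain y where "y \<in> vec L" "\<forall>j<m. ?x j = lc L {..<p} (V j) y"
      using assms(1) unfolding exact_pair_def by blast
    then show ?thesis by auto
  qed
  then have "\<forall>k\<in>{..<a}. \<exists>y. y \<in> vec L \<and> (\<forall>j<m. \<pi> k (z j) = lc L {..<p} (V j) y)" by blast
  from bchoice[OF this] obtain y where y: "\<forall>k\<in>{..<a}. y k \<in> vec L \<and> (\<forall>j<m. \<pi> k (z j) = lc L {..<p} (V j) (y k))" ..
  have yc: "y k j \<in> carrier L" if "k < a" for k j using y that by (auto simp: vec_def)
  obtain w where w: "\<forall>l. w l \<in> cyc X i" "\<forall>k<a. \<forall>l. \<pi> k (w l) = y k l"
    using coords_lift[of y] yc by blast
  have "z j \<ominus>\<^bsub>obj X i\<^esub> lc (obj X i) {..<p} (V j) w \<in> bnd X i" if j: "j < m" for j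
  proof -
    have lw: "lc (obj X i) {..<p} (V j) w \<in> cyc X i"
      using assms(3) w(1) by (intro cyc_lc[OF X]) auto
    have "\<pi> k (z j \<ominus>\<^bsub>obj X i\<^esub> lc (obj X i) {..<p} (V j) w) = \<zero>\<^bsub>L\<^esub>" if k: "k < a" for k
    proof -
      have "\<pi> k (lc (obj X i) {..<p} (V j) w) = lc L {..<p} (V j) (\<lambda>l. \<pi> k (w l))"
        using assms(3) w(1) by (intro coords_lc[OF k]) auto
      also have "\<dots> = lc L {..<p} (V j) (y k)" using w(2) k by simp
      also have "\<dots> = \<pi> k (z j)" using y k j by simp
      finally show ?thesis
        using coords_minus[OF k z[OF j] lw] coords_closed[OF k z[OF j]] by (simp add: L.minus_eq_zero_iff)
    qed
    then show ?thesis using coords_zero_iff[OF cyc_minus[OF X z[OF j] lw]] by blast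
  qed
  with w(1) show ?thesis by blast
qed

end

section \<open>Homology and tensoring with a semidualizing module\<close>

context finite_resolution
begin

text \<open>Tor-acyclicity of the submodule N, stated inside X: no module with carrier N has to be
  formed, and homomorphisms out of X apply directly. \<open>ext_exact_on\<close> does the same for
  Ext.\<close>

definition tor_exact_on :: "('a, 'm, 'z) module_scheme \<Rightarrow> 'm set \<Rightarrow> bool" where
  "tor_exact_on X N \<longleftrightarrow> (\<forall>k x. (\<forall>l<n (Suc k). x l \<in> N) \<longrightarrow> (\<forall>i<n k. dn X k x i = \<zero>\<^bsub>X\<^esub>) \<longrightarrow>
    (\<exists>y. (\<forall>l. y l \<in> N) \<and> (\<forall>l<n (Suc k). x l = dn X (Suc k) y l)))"

definition ext_exact_on :: "('a, 'm, 'z) module_scheme \<Rightarrow> 'm set \<Rightarrow> bool" where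
  "ext_exact_on X N \<longleftrightarrow> (\<forall>k x. (\<forall>l<n (Suc k). x l \<in> N) \<longrightarrow>
    (\<forall>i<n (Suc (Suc k)). up X (Suc k) x i = \<zero>\<^bsub>X\<^esub>) \<longrightarrow>
    (\<exists>y. (\<forall>l. y l \<in> N) \<and> (\<forall>l<n (Suc k). x l = up X k y l)))"

lemma tor_exact_onD:
  assumes "tor_exact_on X N" "\<And>l. l < n (Suc k) \<Longrightarrow> x l \<in> N" "\<And>i. i < n k \<Longrightarrow> dn X k x i = \<zero>\<^bsub>X\<^esub>"
  shows "\<exists>y. (\<forall>l. y l \<in> N) \<and> (\<forall>l<n (Suc k). x l = dn X (Suc k) y l)"
  using assms unfolding tor_exact_on_def by blast

lemma ext_exact_onD:
  assumes "ext_exact_on X N" "\<And>l. l < n (Suc k) \<Longrightarrow> x l \<in> N"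
    and "\<And>i. i < n (Suc (Suc k)) \<Longrightarrow> up X (Suc k) x i = \<zero>\<^bsub>X\<^esub>"
  shows "\<exists>y. (\<forall>l. y l \<in> N) \<and> (\<forall>l<n (Suc k). x l = up X k y l)"
  using assms unfolding ext_exact_on_def by blast

lemma tor_acyclic_exact_on:
  assumes X: "module R X" and "tor_acyclic X"
  shows "tor_exact_on X (carrier X)"
  unfolding tor_exact_on_def
proof (intro allI impI)
  interpret X: module R X by (rule X)
  fix k x assume x: "\<forall>l<n (Suc k). x l \<in> carrier X" and z: "\<forall>i<n k. dn X k x i = \<zero>\<^bsub>X\<^esub>"
  let ?x = "\<lambda>l. if l < n (Suc k) then x l else \<zero>\<^bsub>X\<^esub>"
  have "?x \<in> vec X" using x by (simp add: vec_def)
  moreover have "dn X k ?x i = \<zero>\<^bsub>X\<^esub>" if "i < n k" for i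
  proof -
    have "dn X k ?x i = dn X k x i" using x by (intro lc_cong[OF X]) auto
    then show ?thesis using z that by simp
  qed
  ultimately obtain y where "y \<in> vec X" "\<And>j. j < n (Suc k) \<Longrightarrow> ?x j = dn X (Suc k) y j"
    using tor_acyclicD[OF assms(2)] by blast
  then show "\<exists>y. (\<forall>l. y l \<in> carrier X) \<and> (\<forall>l<n (Suc k). x l = dn X (Suc k) y l)"
    by (intro exI[of _ y]) (auto simp: vec_def)
qed

lemma ext_acyclic_exact_on:
  assumes X: "module R X" and "ext_acyclic X"
  shows "ext_exact_on X (carrier X)"
  unfolding ext_exact_on_def
proof (intro allI impI)
  interpret X: module R X by (rule X)
  fix k x assume x: "\<forall>l<n (Suc k). x l \<in> carrier X"
    and z: "\<forall>i<n (Suc (Suc k)). up X (Suc k) x i = \<zero>\<^bsub>X\<^esub>"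
  let ?x = "\<lambda>l. if l < n (Suc k) then x l else \<zero>\<^bsub>X\<^esub>"
  have "?x \<in> vec X" using x by (simp add: vec_def)
  moreover have "up X (Suc k) ?x i = \<zero>\<^bsub>X\<^esub>" if "i < n (Suc (Suc k))" for i
  proof -
    have "up X (Suc k) ?x i = up X (Suc k) x i" using x by (intro lc_cong[OF X]) auto
    then show ?thesis using z that by simp
  qed
  ultimately obtain y where "y \<in> vec X" "\<And>j. j < n (Suc k) \<Longrightarrow> ?x j = up X k y j"
    using ext_acyclicD[OF assms(2)] by blast
  then show "\<exists>y. (\<forall>l. y l \<in> carrier X) \<and> (\<forall>l<n (Suc k). x l = up X k y l)"
    by (intro exI[of _ y]) (auto simp: vec_def)
qed

lemma exact_on_zero:
  assumes X: "module R X" and "N = {\<zero>\<^bsub>X\<^esub>}"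
  shows "tor_exact_on X N" "ext_exact_on X N"
proof -
  interpret X: module R X by (rule X)
  have d: "dn X k (\<lambda>_. \<zero>\<^bsub>X\<^esub>) i = \<zero>\<^bsub>X\<^esub>" "up X k (\<lambda>_. \<zero>\<^bsub>X\<^esub>) i = \<zero>\<^bsub>X\<^esub>" for k i
    by (rule X.lc_zero; simp)+
  show "tor_exact_on X N" "ext_exact_on X N"
    unfolding tor_exact_on_def ext_exact_on_def assms(2)
    by (intro allI impI exI[of _ "\<lambda>_. \<zero>\<^bsub>X\<^esub>"]; simp add: d)+
qed

lemma dn_dn':
  assumes X: "module R X" and "\<And>l. l < n (Suc (Suc k)) \<Longrightarrow> x l \<in> carrier X" "i < n k"
  shows "dn X k (dn X (Suc k) x) i = \<zero>\<^bsub>X\<^esub>"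
proof -
  interpret X: module R X by (rule X)
  let ?x = "\<lambda>l. if l < n (Suc (Suc k)) then x l else \<zero>\<^bsub>X\<^esub>"
  have "?x \<in> vec X" using assms(2) by (simp add: vec_def)
  from dn_dn[OF X this assms(3)] have "dn X k (dn X (Suc k) ?x) i = \<zero>\<^bsub>X\<^esub>" .
  moreover have "dn X (Suc k) ?x = dn X (Suc k) x"
    using assms(2) by (intro ext lc_cong[OF X]) auto
  ultimately show ?thesis by simp
qed

text \<open>Vanishing of Tor in degree \<open>k + 1\<close> for the boundaries one degree lower: the
  differential of \<open>u\<close> is a relation among boundaries, hence comes from a tuple
  \<open>s\<close> through \<open>D (Suc k)\<close>, and subtracting the image of \<open>s\<close>
  makes \<open>u\<close> consist of cycles. For \<open>k = 0\<close> this says that tensoring the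
  inclusion of the cycles with C keeps it injective.\<close>

lemma tor_cycle_correction:
  assumes X: "is_cplx R X" and B: "tor_exact_on (obj X (j - 1)) (bnd X (j - 1))"
    and u: "\<And>l. u l \<in> carrier (obj X j)" and z: "\<And>i. i < n k \<Longrightarrow> dn (obj X j) k u i \<in> cyc X j"
  shows "\<exists>v. (\<forall>l. v l \<in> carrier (obj X j)) \<and> (\<forall>l<n (Suc k). v l \<in> cyc X j) \<and>
    (\<forall>i<n k. dn (obj X j) k v i = dn (obj X j) k u i)"
proof -
  let ?O = "obj X j" and ?O' = "obj X (j - 1)" and ?d = "diff X j"
  have O: "module R ?O" and O': "module R ?O'" and d: "?d \<in> mod_hom R ?O ?O'"
    using cplx_module[OF X] cplx_diff[OF X] by blast+
  interpret O: module R ?O by (rule O)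
  interpret O': module R ?O' by (rule O')
  have du: "dn ?O' k (\<lambda>l. ?d (u l)) i = \<zero>\<^bsub>?O'\<^esub>" if i: "i < n k" for i
  proof -
    have "dn ?O' k (\<lambda>l. ?d (u l)) i = ?d (dn ?O k u i)"
      using u by (intro mod_hom_lc[OF O O' d, symmetric]) auto
    then show ?thesis using z[OF i] by (simp add: cyc_def)
  qed
  have "?d (u l) \<in> bnd X (j - 1)" for l using u by (auto simp: bnd_pred)
  from tor_exact_onD[where x = "\<lambda>l. ?d (u l)" and k = k, OF B this du] obtain y
    where y: "\<And>l. y l \<in> bnd X (j - 1)" "\<And>l. l < n (Suc k) \<Longrightarrow> ?d (u l) = dn ?O' (Suc k) y l"
    by blast
  have "\<forall>l. \<exists>s. s \<in> carrier ?O \<and> y l = ?d s" using y(1) by (auto simp: bnd_pred)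
  from choice[OF this] obtain s where s: "\<And>l. s l \<in> carrier ?O" "\<And>l. y l = ?d (s l)" by blast
  define v where "v l = u l \<ominus>\<^bsub>?O\<^esub> dn ?O (Suc k) s l" for l
  have sc: "dn ?O (Suc k) s l \<in> carrier ?O" for l using s(1) by auto
  have vO: "v l \<in> carrier ?O" for l using u sc by (simp add: v_def)
  have "v l \<in> cyc X j" if l: "l < n (Suc k)" for l
  proof -
    have "?d (dn ?O (Suc k) s l) = dn ?O' (Suc k) (\<lambda>l. ?d (s l)) l"
      using s(1) by (intro mod_hom_lc[OF O O' d]) auto
    also have "\<dots> = ?d (u l)" unfolding y(2)[OF l] s(2)[symmetric] by (rule refl)
    finally have "?d (v l) = \<zero>\<^bsub>?O'\<^esub>"
      using u sc mod_hom_closed[OF d] by (simp add: v_def mod_hom_minus[OF O O' d] O'.minus_eq_zero_iff)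
    then show ?thesis using vO by (simp add: cyc_def)
  qed
  moreover have "dn ?O k v i = dn ?O k u i" if i: "i < n k" for i
  proof -
    have "dn ?O k v i = dn ?O k u i \<ominus>\<^bsub>?O\<^esub> dn ?O k (dn ?O (Suc k) s) i"
      unfolding v_def using u sc by (intro O.lc_minus) auto
    also have "\<dots> = dn ?O k u i"
      using dn_dn'[OF O s(1) i] cycD[OF X z[OF i]] by (simp add: O.minus_zero)
    finally show ?thesis .
  qed
  ultimately show ?thesis using vO by blast
qed

text \<open>Pass from \<open>B\<^sub>j\<^sub>-\<^sub>1\<close> to the cycles \<open>Z\<^sub>j\<close> by the surjection from the
  \<open>j\<close>-th term, and from \<open>Z\<^sub>j\<close> to \<open>B\<^sub>j\<close> by the surjection onto homology.\<close>

lemma tor_exact_bnd_step: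
  assumes X: "is_cplx R X" and L: "module R L" "tor_acyclic L" "homology_coords R X j L a \<pi>"
    and T: "tor_acyclic (obj X j)" and B: "tor_exact_on (obj X (j - 1)) (bnd X (j - 1))"
  shows "tor_exact_on (obj X j) (bnd X j)"
  unfolding tor_exact_on_def
proof (intro allI impI)
  let ?O = "obj X j"
  have O: "module R ?O" by (rule cplx_module[OF X])
  interpret O: module R ?O by (rule O)
  fix k x assume x: "\<forall>l<n (Suc k). x l \<in> bnd X j" and z: "\<forall>i<n k. dn ?O k x i = \<zero>\<^bsub>?O\<^esub>"
  have xZ: "x l \<in> cyc X j" if "l < n (Suc k)" for l using bnd_cyc[OF X] x that by blast
  have xO: "x l \<in> carrier ?O" if "l < n (Suc k)" for l using cycD[OF X xZ[OF that]] .
  \<comment> \<open>A solution is found in the whole term, then moved into the cycles, then into the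
    boundaries.\<close>
  obtain q where q: "\<And>l. q l \<in> carrier ?O" "\<And>l. l < n (Suc k) \<Longrightarrow> x l = dn ?O (Suc k) q l"
    using tor_exact_onD[where x = x and k = k, OF tor_acyclic_exact_on[OF O T] xO z[rule_format]] by blast
  have "dn ?O (Suc k) q l \<in> cyc X j" if "l < n (Suc k)" for l
    using q(2)[OF that] xZ[OF that] by simp
  from tor_cycle_correction[OF X B q(1) this] obtain q' where q'O: "\<And>l. q' l \<in> carrier ?O"
    and q'Z: "\<And>l. l < n (Suc (Suc k)) \<Longrightarrow> q' l \<in> cyc X j"
    and "\<forall>l<n (Suc k). dn ?O (Suc k) q' l = dn ?O (Suc k) q l" by blast
  then have dq': "dn ?O (Suc k) q' l = x l" if "l < n (Suc k)" for l using q(2) that by simp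
  \<comment> \<open>Modulo boundaries \<open>q'\<close> is a relation, so exactness over L one
    degree higher writes it as the image of cycles \<open>w\<close> up to boundaries.\<close>
  obtain w where w: "\<forall>l. w l \<in> cyc X j"
    "\<forall>l<n (Suc (Suc k)). q' l \<ominus>\<^bsub>?O\<^esub> dn ?O (Suc (Suc k)) w l \<in> bnd X j"
  proof -
    have e: "exact_pair L (n (Suc k)) (n (Suc (Suc k))) (n (Suc (Suc (Suc k)))) (D (Suc k)) (D (Suc (Suc k)))"
      using L(2) by (simp add: tor_acyclic_def)
    have "dn ?O (Suc k) q' i \<in> bnd X j" if "i < n (Suc k)" for i using dq'[OF that] x that by simp
    from coords_exact[OF X L(1,3) e D_closed D_closed q'Z this] show thesis
      using that by blast
  qed
  have wO: "w l \<in> carrier ?O" for l using cycD[OF X] w(1) by blast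
  have wc: "dn ?O (Suc (Suc k)) w l \<in> carrier ?O" for l using wO by auto
  \<comment> \<open>Subtracting the image of \<open>w\<close> leaves boundaries and does not affect
    the value of \<open>D (Suc k)\<close>, since consecutive matrices compose to zero.\<close>
  define b where "b l = (if l < n (Suc (Suc k)) then q' l \<ominus>\<^bsub>?O\<^esub> dn ?O (Suc (Suc k)) w l else \<zero>\<^bsub>?O\<^esub>)" for l
  have bB: "b l \<in> bnd X j" for l
    using w(2) submodule_zero[OF bnd_submodule[OF X, of j]] by (simp add: b_def)
  have "x l = dn ?O (Suc k) b l" if l: "l < n (Suc k)" for l
  proof -
    have "dn ?O (Suc k) b l = dn ?O (Suc k) (\<lambda>l. q' l \<ominus>\<^bsub>?O\<^esub> dn ?O (Suc (Suc k)) w l) l"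
      using q'O wc by (intro lc_cong[OF O]) (auto simp: b_def)
    also have "\<dots> = dn ?O (Suc k) q' l \<ominus>\<^bsub>?O\<^esub> dn ?O (Suc k) (dn ?O (Suc (Suc k)) w) l"
      using q'O wc by (intro O.lc_minus) auto
    also have "\<dots> = x l" using dn_dn'[OF O wO l] dq'[OF l] xO[OF l] by (simp add: O.minus_zero)
    finally show ?thesis ..
  qed
  with bB show "\<exists>y. (\<forall>l. y l \<in> bnd X j) \<and> (\<forall>l<n (Suc k). x l = dn ?O (Suc k) y l)" by blast
qed

text \<open>Cycles are an extension of homology by boundaries: a cocycle is solved modulo boundaries
  through the coordinates, and the error is a cocycle of boundaries, which \<open>B\<close>
  solves.\<close>

lemma ext_exact_cyc_step:
  assumes X: "is_cplx R X" and L: "module R L" "ext_acyclic L" "homology_coords R X j L a \<pi>"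
    and B: "ext_exact_on (obj X j) (bnd X j)"
  shows "ext_exact_on (obj X j) (cyc X j)"
  unfolding ext_exact_on_def
proof (intro allI impI)
  let ?O = "obj X j"
  have O: "module R ?O" using cplx_module[OF X] .
  interpret O: module R ?O by (rule O)
  fix k z assume z: "\<forall>l<n (Suc k). z l \<in> cyc X j" and u: "\<forall>i<n (Suc (Suc k)). up ?O (Suc k) z i = \<zero>\<^bsub>?O\<^esub>"
  obtain w where w: "\<forall>l. w l \<in> cyc X j" "\<forall>l<n (Suc k). z l \<ominus>\<^bsub>?O\<^esub> up ?O k w l \<in> bnd X j"
  proof -
    have e: "exact_pair L (n (Suc (Suc k))) (n (Suc k)) (n k) (\<lambda>l j. D (Suc k) j l) (\<lambda>j i. D k i j)"
      using L(2) by (simp add: ext_acyclic_def)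
    have z': "z l \<in> cyc X j" if "l < n (Suc k)" for l using z that by simp
    have "up ?O (Suc k) z i \<in> bnd X j" if "i < n (Suc (Suc k))" for i
      using u that submodule_zero[OF bnd_submodule[OF X, of j]] by simp
    from coords_exact[OF X L(1,3) e D_closed D_closed z' this] show thesis
      using that by blast
  qed
  have wO: "w l \<in> carrier ?O" for l using cycD[OF X] w(1) by blast
  have zO: "z l \<in> carrier ?O" if "l < n (Suc k)" for l using cycD[OF X] z that by blast
  have wc: "up ?O k w l \<in> carrier ?O" for l using wO by auto
  have "up ?O (Suc k) (\<lambda>l. z l \<ominus>\<^bsub>?O\<^esub> up ?O k w l) i = \<zero>\<^bsub>?O\<^esub>" if i: "i < n (Suc (Suc k))" for i
  proof -
    have "up ?O (Suc k) (\<lambda>l. z l \<ominus>\<^bsub>?O\<^esub> up ?O k w l) i = up ?O (Suc k) z i \<ominus>\<^bsub>?O\<^esub> up ?O (Suc k) (up ?O k w) i"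
      using zO wc by (intro O.lc_minus) auto
    then show ?thesis using u i up_up[OF O wO i] by (simp add: O.minus_zero)
  qed
  from ext_exact_onD[where x = "\<lambda>l. z l \<ominus>\<^bsub>?O\<^esub> up ?O k w l" and k = k, OF B w(2)[rule_format] this]
  obtain b where b: "\<And>l. b l \<in> bnd X j" "\<And>l. l < n (Suc k) \<Longrightarrow> z l \<ominus>\<^bsub>?O\<^esub> up ?O k w l = up ?O k b l"
    by blast
  have bZ: "b l \<in> cyc X j" for l using bnd_cyc[OF X b(1)] .
  have bO: "b l \<in> carrier ?O" for l using cycD[OF X bZ] .
  have "z l = up ?O k (\<lambda>l. b l \<oplus>\<^bsub>?O\<^esub> w l) l" if l: "l < n (Suc k)" for l
  proof -
    have "up ?O k (\<lambda>l. b l \<oplus>\<^bsub>?O\<^esub> w l) l = up ?O k b l \<oplus>\<^bsub>?O\<^esub> up ?O k w l"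
      using bO wO by (intro O.lc_add) auto
    also have "\<dots> = z l" using b(2)[OF l, symmetric] zO[OF l] wc by (simp add: O.minus_add_cancel)
    finally show ?thesis ..
  qed
  moreover have "b l \<oplus>\<^bsub>?O\<^esub> w l \<in> cyc X j" for l
    using bZ w(1) O.submoduleE(5)[OF cyc_submodule[OF X]] by blast
  ultimately show "\<exists>y. (\<forall>l. y l \<in> cyc X j) \<and> (\<forall>l<n (Suc k). z l = up ?O k y l)"
    by (intro exI[of _ "\<lambda>l. b l \<oplus>\<^bsub>?O\<^esub> w l"]) auto
qed

text \<open>Dimension shift: boundaries in degree \<open>j - 1\<close> are the quotient of
  \<open>obj X j\<close> by its cycles, so their Ext in degree \<open>k + 1\<close> embeds into that
  of the cycles in degree \<open>k + 2\<close>. A lift \<open>q\<close> of \<open>x\<close> is a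
  cocycle only up to cycles; correcting it by the solution \<open>z\<close> gives a cocycle of the
  acyclic term, and the differential kills the correction.\<close>

lemma ext_exact_bnd_step:
  assumes X: "is_cplx R X" and E: "ext_acyclic (obj X j)" and Z: "ext_exact_on (obj X j) (cyc X j)"
  shows "ext_exact_on (obj X (j - 1)) (bnd X (j - 1))"
  unfolding ext_exact_on_def
proof (intro allI impI)
  let ?O = "obj X j" and ?O' = "obj X (j - 1)" and ?d = "diff X j"
  have O: "module R ?O" and O': "module R ?O'" and d: "?d \<in> mod_hom R ?O ?O'"
    using cplx_module[OF X] cplx_diff[OF X] by blast+
  interpret O: module R ?O by (rule O)
  interpret O': module R ?O' by (rule O')
  fix k x assume x: "\<forall>l<n (Suc k). x l \<in> bnd X (j - 1)"
    and u: "\<forall>i<n (Suc (Suc k)). up ?O' (Suc k) x i = \<zero>\<^bsub>?O'\<^esub>"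
  have "\<forall>l\<in>{..<n (Suc k)}. \<exists>q. q \<in> carrier ?O \<and> x l = ?d q" using x by (auto simp: bnd_pred)
  from bchoice[OF this] obtain q where q: "\<And>l. l < n (Suc k) \<Longrightarrow> q l \<in> carrier ?O" "\<And>l. l < n (Suc k) \<Longrightarrow> x l = ?d (q l)"
    by blast
  have uq: "up ?O (Suc k) q i \<in> cyc X j" if i: "i < n (Suc (Suc k))" for i
  proof -
    have "?d (up ?O (Suc k) q i) = up ?O' (Suc k) (\<lambda>l. ?d (q l)) i"
      using q(1) by (intro mod_hom_lc[OF O O' d]) auto
    also have "\<dots> = up ?O' (Suc k) x i"
      using q mod_hom_closed[OF d] by (intro lc_cong[OF O']) auto
    finally have "?d (up ?O (Suc k) q i) = \<zero>\<^bsub>?O'\<^esub>" using u i by simp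
    moreover have "up ?O (Suc k) q i \<in> carrier ?O" using q(1) by auto
    ultimately show ?thesis by (simp add: cyc_def)
  qed
  have "up ?O (Suc (Suc k)) (up ?O (Suc k) q) i = \<zero>\<^bsub>?O\<^esub>" if "i < n (Suc (Suc (Suc k)))" for i
    by (rule up_up[OF O q(1) that])
  from ext_exact_onD[where x = "up ?O (Suc k) q" and k = "Suc k", OF Z uq this]
  obtain z where z: "\<And>l. z l \<in> cyc X j" "\<And>l. l < n (Suc (Suc k)) \<Longrightarrow> up ?O (Suc k) q l = up ?O (Suc k) z l"
    by blast
  have zO: "z l \<in> carrier ?O" for l using cycD[OF X z(1)] .
  have uzc: "up ?O (Suc k) z i \<in> carrier ?O" for i using zO by auto
  have "up ?O (Suc k) (\<lambda>l. q l \<ominus>\<^bsub>?O\<^esub> z l) i = \<zero>\<^bsub>?O\<^esub>" if i: "i < n (Suc (Suc k))" for i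
  proof -
    have "up ?O (Suc k) (\<lambda>l. q l \<ominus>\<^bsub>?O\<^esub> z l) i = up ?O (Suc k) q i \<ominus>\<^bsub>?O\<^esub> up ?O (Suc k) z i"
      using q(1) zO by (intro O.lc_minus) auto
    then show ?thesis using z(2)[OF i] uzc by (simp add: O.minus_eq_zero_iff)
  qed
  from ext_exact_onD[where x = "\<lambda>l. q l \<ominus>\<^bsub>?O\<^esub> z l" and k = k, OF ext_acyclic_exact_on[OF O E] O.minus_closed[OF q(1) zO] this]
  obtain y where y: "\<And>l. y l \<in> carrier ?O" "\<And>l. l < n (Suc k) \<Longrightarrow> q l \<ominus>\<^bsub>?O\<^esub> z l = up ?O k y l"
    by blast
  have "x l = up ?O' k (\<lambda>l. ?d (y l)) l" if l: "l < n (Suc k)" for l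
  proof -
    have "up ?O' k (\<lambda>l. ?d (y l)) l = ?d (up ?O k y l)"
      using y(1) by (intro mod_hom_lc[OF O O' d, symmetric]) auto
    also have "\<dots> = ?d (q l) \<ominus>\<^bsub>?O'\<^esub> ?d (z l)"
      unfolding y(2)[OF l, symmetric] by (rule mod_hom_minus[OF O O' d q(1)[OF l] zO])
    also have "\<dots> = x l"
      using z(1)[of l] q[OF l] mod_hom_closed[OF d q(1)[OF l]] by (simp add: cyc_def O'.minus_zero)
    finally show ?thesis ..
  qed
  moreover have "?d (y l) \<in> bnd X (j - 1)" for l using y(1) by (auto simp: bnd_pred)
  ultimately show "\<exists>y. (\<forall>l. y l \<in> bnd X (j - 1)) \<and> (\<forall>l<n (Suc k). x l = up ?O' k y l)"
    by (intro exI[of _ "\<lambda>l. ?d (y l)"]) auto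
qed

section \<open>The inductions along a bounded complex\<close>

lemma tor_exact_bnd:
  assumes X: "is_cplx R X" and L: "module R L" "tor_acyclic L" "\<And>j. homology_coords R X j L (a j) (\<pi> j)"
    and T: "\<And>j. tor_acyclic (obj X j)" and "bounded_below_cplx X"
  shows "tor_exact_on (obj X j) (bnd X j)"
proof -
  obtain N where N: "\<And>i. i < N \<Longrightarrow> zero_mod (obj X i)" using assms(6) by (auto simp: bounded_below_cplx_def)
  have low: "tor_exact_on (obj X i) (bnd X i)" if "i < N" for i
    by (rule exact_on_zero(1)[OF cplx_module[OF X] zero_mod_bnd_cyc(1)[OF X N[OF that]]])
  show ?thesis
  proof (cases "j < N")
    case False
    \<comment> \<open>The degree \<open>N - 1\<close> is the last one known to carry a zero term, so
      its boundaries are acyclic.\<close>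
    then have "N - 1 \<le> j" by simp
    then show ?thesis
    proof (induction j rule: int_ge_induct)
      case base
      show ?case by (rule low) simp
    next
      case (step i)
      from tor_exact_bnd_step[OF X L(1,2,3) T, of "i + 1"] step.IH show ?case by simp
    qed
  qed (rule low)
qed

lemma ext_exact_bnd_cyc:
  assumes X: "is_cplx R X" and L: "module R L" "ext_acyclic L" "\<And>j. homology_coords R X j L (a j) (\<pi> j)"
    and T: "\<And>j. ext_acyclic (obj X j)" and b: "\<exists>N. \<forall>i>N. zero_mod (obj X i)"
  shows "ext_exact_on (obj X j) (bnd X j)" "ext_exact_on (obj X j) (cyc X j)"
proof -
  obtain N where N: "\<And>i. i > N \<Longrightarrow> zero_mod (obj X i)" using b by blast
  have high: "ext_exact_on (obj X i) (bnd X i)" if "i > N" for i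
    by (rule exact_on_zero(2)[OF cplx_module[OF X] zero_mod_bnd_cyc(1)[OF X N[OF that]]])
  show *: "ext_exact_on (obj X j) (bnd X j)"
  proof (cases "j > N")
    case False
    then have "j \<le> N + 1" by simp
    then show ?thesis
    proof (induction j rule: int_le_induct)
      case base
      show ?case by (rule high) simp
    next
      case (step i)
      \<comment> \<open>Each step down runs from the boundaries of a degree through the cycles of
        the same degree to the boundaries below.\<close>
      show ?case
        by (rule ext_exact_bnd_step[OF X T ext_exact_cyc_step[OF X L step.IH]])
    qed
  qed (rule high)
  show "ext_exact_on (obj X j) (cyc X j)" by (rule ext_exact_cyc_step[OF X L *])
qed

section \<open>The complex P \<otimes> C and its cycles\<close>

lemma tensor_cplx_is_cplx:
  assumes P: "is_cplx R P"
  shows "is_cplx R (tensor_cplx R P C)"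
  unfolding is_cplx_def
proof (intro allI conjI ballI)
  fix i
  have TP: "tensor_product R (obj P i) C" for i
    using cplx_module[OF P] module_axioms by (simp add: tensor_product_def)
  note Tm = tensor_product.tensor_module[OF TP]
  show "module R (obj (tensor_cplx R P C) i)" using Tm by (simp add: tensor_cplx_def)
  show "diff (tensor_cplx R P C) i \<in> mod_hom R (obj (tensor_cplx R P C) i) (obj (tensor_cplx R P C) (i - 1))"
    using tensor_map_hom(1)[OF cplx_module[OF P] cplx_module[OF P] module_axioms cplx_diff[OF P]]
    by (simp add: tensor_cplx_def)
  fix t assume "t \<in> carrier (obj (tensor_cplx R P C) i)"
  then have "t \<in> carrier (tensor_mod R (obj P i) C)" by (simp add: tensor_cplx_def)
  then obtain x where x: "x \<in> vec (obj P i)" "t = tsum (obj P i) x"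
    using tsum_surj[OF cplx_module[OF P]] by blast
  note xc = vecD[OF x(1)] and dc = mod_hom_closed[OF cplx_diff[OF P]]
  have d1: "diff P (i - 1) \<in> mod_hom R (obj P (i - 1)) (obj P (i - 2))"
    using cplx_diff[OF P, of "i - 1"] by simp
  have "diff (tensor_cplx R P C) (i - 1) (diff (tensor_cplx R P C) i t) =
      tensor_map R (obj P (i - 2)) C (diff P (i - 1)) (tensor_map R (obj P (i - 1)) C (diff P i) t)"
    by (simp add: tensor_cplx_def)
  also have "\<dots> = tsum (obj P (i - 2)) (\<lambda>l. diff P (i - 1) (diff P i (x l)))"
    unfolding x(2) using xc dc
    by (simp add: tsum_map[OF cplx_module[OF P] cplx_module[OF P] cplx_diff[OF P]]
        tsum_map[OF cplx_module[OF P] cplx_module[OF P] d1])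
  also have "\<dots> = tsum (obj P (i - 2)) (\<lambda>l. \<zero>\<^bsub>obj P (i - 2)\<^esub>)"
    using P xc by (simp add: is_cplx_def)
  also have "\<dots> = \<zero>\<^bsub>tensor_mod R (obj P (i - 2)) C\<^esub>"
    unfolding tsum_def
    by (rule module.lc_zero[OF Tm])
       (auto intro!: mod_hom_zero[OF cplx_module[OF P] Tm tensor_product.elt_hom_left[OF TP]])
  finally show "diff (tensor_cplx R P C) (i - 1) (diff (tensor_cplx R P C) i t) = \<zero>\<^bsub>obj (tensor_cplx R P C) (i - 2)\<^esub>"
    by (simp add: tensor_cplx_def)
qed

end

context semidualizing_resolution
begin

context
  fixes P :: "('a, 'p) cplx" and Q :: "('a, ('p \<times> 'c \<Rightarrow> 'a) set) cplx"
  assumes P: "is_cplx R P" and proj: "\<And>i. projective_mod R (obj P i)"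
  defines "Q \<equiv> tensor_cplx R P C"
begin

lemma Q_obj: "obj Q i = tensor_mod R (obj P i) C"
  by (simp add: Q_def tensor_cplx_def)

lemma Q_cplx: "is_cplx R Q"
  unfolding Q_def by (rule tensor_cplx_is_cplx[OF P])

lemma Q_diff_tsum:
  assumes "\<And>l. l < n 0 \<Longrightarrow> x l \<in> carrier (obj P i)"
  shows "diff Q i (tsum (obj P i) x) = tsum (obj P (i - 1)) (\<lambda>l. diff P i (x l))"
  using tsum_map[OF cplx_module[OF P] cplx_module[OF P] cplx_diff[OF P] assms]
  by (simp add: Q_def tensor_cplx_def)

lemma Q_diff_elt:
  assumes "p \<in> carrier (obj P i)" "x \<in> carrier C"
  shows "diff Q i (tensor_elt R (obj P i) C p x) = tensor_elt R (obj P (i - 1)) C (diff P i p) x"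
  using tensor_map_hom(2)[OF cplx_module[OF P] cplx_module[OF P] module_axioms cplx_diff[OF P] assms]
  by (simp add: Q_def tensor_cplx_def)

lemma P_product: "tensor_product R (obj P i) C"
  using cplx_module[OF P] module_axioms by (simp add: tensor_product_def)

lemma tsum_zero: "tsum (obj P i) (\<lambda>_. \<zero>\<^bsub>obj P i\<^esub>) = \<zero>\<^bsub>obj Q i\<^esub>"
  unfolding tsum_def Q_obj
  by (rule module.lc_zero[OF tensor_product.tensor_module[OF P_product]])
    (auto intro!: mod_hom_zero[OF cplx_module[OF P] tensor_product.tensor_module[OF P_product]
        tensor_product.elt_hom_left[OF P_product]])

lemma tsum_cyc:
  assumes "\<And>l. z l \<in> cyc P i"
  shows "tsum (obj P i) z \<in> cyc Q i"
proof -
  have zc: "z l \<in> carrier (obj P i)" for l using cycD[OF P assms] .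
  have "diff Q i (tsum (obj P i) z) = tsum (obj P (i - 1)) (\<lambda>_. \<zero>\<^bsub>obj P (i - 1)\<^esub>)"
    using assms by (simp add: Q_diff_tsum zc cyc_def)
  then show ?thesis using tsum_closed[OF cplx_module[OF P] zc] by (simp add: cyc_def tsum_zero Q_obj)
qed

subsection \<open>From homology of \<open>P\<close> to homology of \<open>P \<otimes> C\<close>\<close>

context
  fixes M' :: "('a, 'm) module" and a :: "int \<Rightarrow> nat" and \<pi> :: "int \<Rightarrow> nat \<Rightarrow> 'p \<Rightarrow> 'm"
  assumes M': "module R M'" and torM: "tor_acyclic M'"
    and \<pi>: "\<And>j. homology_coords R P j M' (a j) (\<pi> j)"
    and bb: "bounded_below_cplx P"
begin

lemma bnd_tor_exact: "tor_exact_on (obj P j) (bnd P j)"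
  by (rule tor_exact_bnd[OF P M' torM \<pi> projective_tor_acyclic[OF proj] bb])

text \<open>Rests on injectivity of B \<otimes> C -> P \<otimes> C one degree lower. The relation
  that kills the tuple \<open>?d (p l)\<close> is found in the whole term, moved to cycles by
  \<open>tor_cycle_correction\<close>, and moved on to boundaries because Tor vanishes in degree 1
  for \<open>M'\<close>. Lifted along \<open>?d\<close>, it corrects \<open>p\<close> to
  cycles.\<close>

lemma cyc_tensor_lift:
  assumes "\<zeta> \<in> cyc Q j"
  shows "\<exists>z. (\<forall>l. z l \<in> cyc P j) \<and> \<zeta> = tsum (obj P j) z"
proof -
  define h where "h = j - 1"
  let ?O = "obj P j" and ?O' = "obj P h" and ?d = "diff P j"
  have O: "module R ?O" and O': "module R ?O'" by (rule cplx_module[OF P])+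
  have d: "?d \<in> mod_hom R ?O ?O'" unfolding h_def by (rule cplx_diff[OF P])
  have bh: "bnd P h = ?d ` carrier ?O" by (simp add: h_def bnd_pred)
  interpret O: module R ?O by (rule O)
  interpret O': module R ?O' by (rule O')
  obtain p where p: "p \<in> vec ?O" "\<zeta> = tsum ?O p"
    using tsum_surj[OF O] cycD[OF Q_cplx assms] by (auto simp: Q_obj)
  note pc = vecD[OF p(1)] and dc = mod_hom_closed[OF d]
  have "tsum ?O' (\<lambda>l. ?d (p l)) = \<zero>\<^bsub>tensor_mod R ?O' C\<^esub>"
    using assms Q_diff_tsum[of p j] pc by (simp add: cyc_def p(2) Q_obj h_def)
  from tsum_zeroD[OF O' dc[OF pc] this] obtain u
    where u: "u \<in> vec ?O'" "\<And>i. i < n 0 \<Longrightarrow> ?d (p i) = dn ?O' 0 u i" by blast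
  note uc = vecD[OF u(1)]
  have "dn ?O' 0 u i \<in> cyc P h" if i: "i < n 0" for i
    unfolding u(2)[OF i, symmetric] using cplx_diff_diff[OF P pc[of i]] dc[OF pc] by (simp add: cyc_def h_def)
  from tor_cycle_correction[OF P bnd_tor_exact uc this] obtain u' where u'O: "\<And>l. u' l \<in> carrier ?O'"
    and u'Z: "\<And>l. l < n (Suc 0) \<Longrightarrow> u' l \<in> cyc P h" and "\<forall>i<n 0. dn ?O' 0 u' i = dn ?O' 0 u i" by blast
  then have du': "dn ?O' 0 u' i = ?d (p i)" if "i < n 0" for i using u(2) that by simp
  obtain w where w: "\<forall>l. w l \<in> cyc P h" "\<forall>l<n (Suc 0). u' l \<ominus>\<^bsub>?O'\<^esub> dn ?O' (Suc 0) w l \<in> bnd P h"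
  proof -
    have e: "exact_pair M' (n 0) (n (Suc 0)) (n (Suc (Suc 0))) (D 0) (D (Suc 0))"
      using torM by (simp add: tor_acyclic_def)
    have "dn ?O' 0 u' i \<in> bnd P h" if "i < n 0" for i using du'[OF that] pc by (auto simp: bh)
    from coords_exact[OF P M' \<pi> e D_closed D_closed u'Z this] show thesis using that by blast
  qed
  have wO: "w l \<in> carrier ?O'" for l using cycD[OF P] w(1) by blast
  have wc: "dn ?O' (Suc 0) w l \<in> carrier ?O'" for l using wO by auto
  have "\<forall>l\<in>{..<n (Suc 0)}. \<exists>t. t \<in> carrier ?O \<and> u' l \<ominus>\<^bsub>?O'\<^esub> dn ?O' (Suc 0) w l = ?d t"
    using w(2) by (auto simp: bh)
  from bchoice[OF this] obtain t where t: "\<And>l. l < n (Suc 0) \<Longrightarrow> t l \<in> carrier ?O"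
    "\<And>l. l < n (Suc 0) \<Longrightarrow> u' l \<ominus>\<^bsub>?O'\<^esub> dn ?O' (Suc 0) w l = ?d (t l)" by blast
  have tc: "dn ?O 0 t i \<in> carrier ?O" for i using t(1) by auto
  have dt: "?d (dn ?O 0 t i) = ?d (p i)" if i: "i < n 0" for i
  proof -
    have "?d (dn ?O 0 t i) = dn ?O' 0 (\<lambda>l. ?d (t l)) i"
      using t(1) by (intro mod_hom_lc[OF O O' d]) auto
    also have "\<dots> = dn ?O' 0 (\<lambda>l. u' l \<ominus>\<^bsub>?O'\<^esub> dn ?O' (Suc 0) w l) i"
      using u'O wc by (intro lc_cong[OF O']) (auto simp: t(2)[symmetric])
    also have "\<dots> = dn ?O' 0 u' i \<ominus>\<^bsub>?O'\<^esub> dn ?O' 0 (dn ?O' (Suc 0) w) i"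
      using u'O wc by (intro O'.lc_minus) auto
    also have "\<dots> = ?d (p i)" using dn_dn'[OF O' wO i] du'[OF i] dc[OF pc] by (simp add: O'.minus_zero)
    finally show ?thesis .
  qed
  \<comment> \<open>The subtracted tuple lies in the image of \<open>D 0\<close>, so the tensor
    stays the same while the entries become cycles. Zero from \<open>n 0\<close> on makes every
    entry a cycle.\<close>
  define z where "z i = (if i < n 0 then p i \<ominus>\<^bsub>?O\<^esub> dn ?O 0 t i else \<zero>\<^bsub>?O\<^esub>)" for i
  have "z i \<in> cyc P j" for i
  proof (cases "i < n 0")
    case True
    then have "?d (z i) = \<zero>\<^bsub>?O'\<^esub>"
      using pc tc dc by (simp add: z_def mod_hom_minus[OF O O' d] dt O'.minus_eq_zero_iff)
    then show ?thesis using pc tc by (simp add: cyc_def z_def h_def)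
  next
    case False
    then show ?thesis using submodule_zero[OF cyc_submodule[OF P, of j]] by (simp add: z_def)
  qed
  moreover have "\<zeta> = tsum ?O z"
  proof -
    interpret T: tensor_product R ?O C by (rule P_product)
    have zO: "z i \<in> carrier ?O" for i using pc tc by (simp add: z_def)
    have "\<zeta> = tsum ?O (\<lambda>i. z i \<oplus>\<^bsub>?O\<^esub> dn ?O 0 t i)"
      unfolding p(2) using pc tc by (intro tsum_cong[OF O]) (auto simp: z_def O.minus_add_cancel)
    also have "\<dots> = tsum ?O z \<oplus>\<^bsub>T.T\<^esub> tsum ?O (dn ?O 0 t)" using zO tc by (intro tsum_add[OF O])
    also have "tsum ?O (dn ?O 0 t) = \<zero>\<^bsub>T.T\<^esub>" using t(1) by (intro tsum_dn[OF O]) simp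
    finally show ?thesis using tsum_closed[OF O zO] by simp
  qed
  ultimately show ?thesis by blast
qed

text \<open>The coordinates tensored with C detect boundaries. Forward: up to boundaries the tuple
  is a zero tensor, and its relation can be chosen among cycles, where the coordinates apply and
  give a relation in \<open>M'\<close>. Backward: relations in \<open>M'\<close> lift to cycles, and
  subtracting their image leaves boundaries.\<close>

lemma tsum_bnd_iff:
  assumes z: "\<And>l. z l \<in> cyc P j"
  shows "tsum (obj P j) z \<in> bnd Q j \<longleftrightarrow> (\<forall>k<a j. csum M' (\<lambda>i. \<pi> j k (z i)) = \<zero>\<^bsub>tensor_mod R C M'\<^esub>)"
proof -
  let ?O = "obj P j" and ?U = "obj P (j + 1)" and ?e = "diff P (j + 1)"
  have O: "module R ?O" and U: "module R ?U" by (rule cplx_module[OF P])+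
  have e: "?e \<in> mod_hom R ?U ?O" by (rule cplx_diff_Suc[OF P])
  interpret O: module R ?O by (rule O)
  interpret M': module R M' by (rule M')
  interpret T: tensor_product R ?O C by (rule P_product)
  have Qe: "diff Q (j + 1) (tsum ?U q) = tsum ?O (\<lambda>l. ?e (q l))" if "\<And>l. l < n 0 \<Longrightarrow> q l \<in> carrier ?U" for q
    using Q_diff_tsum[of q "j + 1"] that by simp
  note zO = cycD[OF P z] and cc = coords_closed[OF P M' \<pi>]
  show ?thesis
  proof
    assume "tsum ?O z \<in> bnd Q j"
    then obtain t where t: "t \<in> carrier (tensor_mod R ?U C)" "tsum ?O z = diff Q (j + 1) t"
      by (auto simp: bnd_def Q_obj)
    obtain q where q: "q \<in> vec ?U" "t = tsum ?U q" using tsum_surj[OF U t(1)] by blast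
    note qc = vecD[OF q(1)]
    have eq: "?e (q l) \<in> bnd P j" for l using qc by (auto simp: bnd_def)
    have eqZ: "?e (q l) \<in> cyc P j" for l using bnd_cyc[OF P eq] .
    have eqO: "?e (q l) \<in> carrier ?O" for l using cycD[OF P eqZ] .
    define x where "x l = z l \<ominus>\<^bsub>?O\<^esub> ?e (q l)" for l
    have xO: "x l \<in> carrier ?O" for l using zO eqO by (simp add: x_def)
    have xZ: "x l \<in> cyc P j" for l unfolding x_def by (rule cyc_minus[OF P z eqZ])
    \<comment> \<open>\<open>z\<close> and its boundary part have the same \<open>tsum\<close>, so
      that of their difference \<open>x\<close> cancels.\<close>
    have x1: "tsum ?O z = tsum ?O x \<oplus>\<^bsub>T.T\<^esub> tsum ?O z"
    proof -
      have "tsum ?O z = tsum ?O (\<lambda>l. x l \<oplus>\<^bsub>?O\<^esub> ?e (q l))"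
        using zO eqO by (intro tsum_cong[OF O]) (auto simp: x_def O.minus_add_cancel)
      also have "\<dots> = tsum ?O x \<oplus>\<^bsub>T.T\<^esub> tsum ?O (\<lambda>l. ?e (q l))" using xO eqO by (intro tsum_add[OF O])
      also have "tsum ?O (\<lambda>l. ?e (q l)) = tsum ?O z" unfolding t(2) q(2) by (rule Qe[OF qc, symmetric])
      finally show ?thesis .
    qed
    have "(tsum ?O x \<oplus>\<^bsub>T.T\<^esub> tsum ?O z) \<ominus>\<^bsub>T.T\<^esub> tsum ?O z = tsum ?O x"
      by (rule T.T.add_minus_cancel[OF tsum_closed[OF O xO] tsum_closed[OF O zO]])
    moreover have "tsum ?O z \<ominus>\<^bsub>T.T\<^esub> tsum ?O z = \<zero>\<^bsub>T.T\<^esub>"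
      using tsum_closed[OF O zO] by (simp add: T.T.minus_eq_zero_iff)
    ultimately have "tsum ?O x = \<zero>\<^bsub>T.T\<^esub>" using x1 by simp
    from tsum_zeroD[OF O xO this] obtain u where u: "u \<in> vec ?O" "\<And>i. i < n 0 \<Longrightarrow> x i = dn ?O 0 u i" by blast
    note uc = vecD[OF u(1)]
    have "dn ?O 0 u i \<in> cyc P j" if "i < n 0" for i using u(2)[OF that] xZ[of i] by simp
    from tor_cycle_correction[OF P bnd_tor_exact uc this] obtain u'
      where u'Z: "\<And>l. l < n (Suc 0) \<Longrightarrow> u' l \<in> cyc P j" and "\<forall>i<n 0. dn ?O 0 u' i = dn ?O 0 u i" by blast
    then have du': "dn ?O 0 u' i = x i" if "i < n 0" for i using u(2) that by simp
    show "\<forall>k<a j. csum M' (\<lambda>i. \<pi> j k (z i)) = \<zero>\<^bsub>tensor_mod R C M'\<^esub>"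
    proof (intro allI impI)
      fix k assume k: "k < a j"
      show "csum M' (\<lambda>i. \<pi> j k (z i)) = \<zero>\<^bsub>tensor_mod R C M'\<^esub>"
      proof (rule csum_zeroI[OF M'])
        show "\<pi> j k (u' l) \<in> carrier M'" if "l < n 1" for l using cc[OF k u'Z] that by simp
        fix i assume i: "i < n 0"
        have "\<pi> j k (z i) = \<pi> j k (x i \<oplus>\<^bsub>?O\<^esub> ?e (q i))"
          using zO eqO by (simp add: x_def O.minus_add_cancel)
        also have "\<dots> = \<pi> j k (x i) \<oplus>\<^bsub>M'\<^esub> \<pi> j k (?e (q i))" by (rule coords_add[OF P M' \<pi> k xZ eqZ])
        also have "\<pi> j k (?e (q i)) = \<zero>\<^bsub>M'\<^esub>" using coords_zero_iff[OF P M' \<pi> eqZ[of i]] eq[of i] k by blast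
        also have "\<pi> j k (x i) \<oplus>\<^bsub>M'\<^esub> \<zero>\<^bsub>M'\<^esub> = \<pi> j k (x i)" using cc[OF k xZ] by simp
        also have "\<pi> j k (x i) = \<pi> j k (dn ?O 0 u' i)" unfolding du'[OF i] by (rule refl)
        also have "\<dots> = dn M' 0 (\<lambda>l. \<pi> j k (u' l)) i"
          using u'Z by (intro coords_lc[OF P M' \<pi> k]) auto
        finally show "\<pi> j k (z i) = dn M' 0 (\<lambda>l. \<pi> j k (u' l)) i" .
      qed
    qed
  next
    assume c0: "\<forall>k<a j. csum M' (\<lambda>i. \<pi> j k (z i)) = \<zero>\<^bsub>tensor_mod R C M'\<^esub>"
    have "\<forall>k\<in>{..<a j}. \<exists>y. y \<in> vec M' \<and> (\<forall>i<n 0. \<pi> j k (z i) = dn M' 0 y i)"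
    proof
      fix k assume k: "k \<in> {..<a j}"
      have k0: "csum M' (\<lambda>i. \<pi> j k (z i)) = \<zero>\<^bsub>tensor_mod R C M'\<^esub>" using c0 k by simp
      have "\<pi> j k (z i) \<in> carrier M'" for i using cc[OF _ z] k by simp
      from csum_zeroD[where x = "\<lambda>i. \<pi> j k (z i)", OF M' this k0] obtain y
        where "y \<in> vec M'" "\<And>i. i < n 0 \<Longrightarrow> \<pi> j k (z i) = dn M' 0 y i" by blast
      then show "\<exists>y. y \<in> vec M' \<and> (\<forall>i<n 0. \<pi> j k (z i) = dn M' 0 y i)" by (intro exI[of _ y]) simp
    qed
    from bchoice[OF this] obtain y where y: "\<forall>k\<in>{..<a j}. y k \<in> vec M' \<and> (\<forall>i<n 0. \<pi> j k (z i) = dn M' 0 (y k) i)" ..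
    have yc: "y k l \<in> carrier M'" if "k < a j" for k l using y that by (auto simp: vec_def)
    obtain w where w: "\<forall>l. w l \<in> cyc P j" "\<forall>k<a j. \<forall>l. \<pi> j k (w l) = y k l"
      using coords_lift[OF P M' \<pi>, where m = y] yc by blast
    have wO: "w l \<in> carrier ?O" for l using cycD[OF P] w(1) by blast
    have wc: "dn ?O 0 w l \<in> carrier ?O" for l using wO by auto
    have wZ: "dn ?O 0 w l \<in> cyc P j" for l using w(1) by (intro cyc_lc[OF P]) auto
    have "z i \<ominus>\<^bsub>?O\<^esub> dn ?O 0 w i \<in> bnd P j" if i: "i < n 0" for i
    proof -
      have "\<pi> j k (z i \<ominus>\<^bsub>?O\<^esub> dn ?O 0 w i) = \<zero>\<^bsub>M'\<^esub>" if k: "k < a j" for k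
      proof -
        have "\<pi> j k (dn ?O 0 w i) = dn M' 0 (\<lambda>l. \<pi> j k (w l)) i"
          using w(1) by (intro coords_lc[OF P M' \<pi> k]) auto
        also have "\<dots> = dn M' 0 (y k) i" using w(2) k by simp
        also have "\<dots> = \<pi> j k (z i)" using y k i by simp
        finally show ?thesis
          using coords_minus[OF P M' \<pi> k z wZ] cc[OF k z] by (simp add: M'.minus_eq_zero_iff)
      qed
      then show ?thesis using coords_zero_iff[OF P M' \<pi> cyc_minus[OF P z wZ]] by blast
    qed
    then have "\<forall>i\<in>{..<n 0}. \<exists>q. q \<in> carrier ?U \<and> z i \<ominus>\<^bsub>?O\<^esub> dn ?O 0 w i = ?e q" by (auto simp: bnd_def)
    from bchoice[OF this] obtain q where q: "\<And>i. i < n 0 \<Longrightarrow> q i \<in> carrier ?U"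
      "\<And>i. i < n 0 \<Longrightarrow> z i \<ominus>\<^bsub>?O\<^esub> dn ?O 0 w i = ?e (q i)" by blast
    have eO: "?e (q i) \<in> carrier ?O" if "i < n 0" for i using mod_hom_closed[OF e q(1)[OF that]] .
    have "tsum ?O z = tsum ?O (\<lambda>i. ?e (q i) \<oplus>\<^bsub>?O\<^esub> dn ?O 0 w i)"
    proof (rule tsum_cong[OF O])
      show "z i = ?e (q i) \<oplus>\<^bsub>?O\<^esub> dn ?O 0 w i" if "i < n 0" for i
        using q(2)[OF that, symmetric] zO wc by (simp add: O.minus_add_cancel)
    qed (use eO wc in auto)
    also have "\<dots> = tsum ?O (\<lambda>i. ?e (q i)) \<oplus>\<^bsub>T.T\<^esub> tsum ?O (dn ?O 0 w)" using eO wc by (intro tsum_add[OF O])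
    also have "tsum ?O (dn ?O 0 w) = \<zero>\<^bsub>T.T\<^esub>" using wO by (intro tsum_dn[OF O])
    also have "tsum ?O (\<lambda>i. ?e (q i)) \<oplus>\<^bsub>T.T\<^esub> \<zero>\<^bsub>T.T\<^esub> = tsum ?O (\<lambda>i. ?e (q i))"
      using tsum_closed[OF O eO] by simp
    also have "\<dots> = diff Q (j + 1) (tsum ?U q)" using Qe[OF q(1)] by simp
    also have "\<dots> \<in> bnd Q j" using tsum_closed[OF U q(1)] by (auto simp: bnd_def Q_obj)
    finally show "tsum ?O z \<in> bnd Q j" .
  qed
qed

text \<open>A cycle of P \<otimes> C is related to the coordinates of any tuple of cycles of P that
  represents it: \<open>cyc_tensor_lift\<close> supplies such a tuple, and
  \<open>tsum_bnd_iff\<close> makes the choice irrelevant modulo boundaries.\<close>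

lemma tensor_homology_power:
  "isomorphic_mod R (homology Q j) (mod_power (tensor_mod R C M') (a j))"
proof -
  let ?O = "obj P j"
  have O: "module R ?O" by (rule cplx_module[OF P])
  interpret O: module R ?O by (rule O)
  interpret CM: tensor_product R C M' using M' module_axioms by (simp add: tensor_product_def)
  note cc = coords_closed[OF P M' \<pi>]
  note Ze = O.submoduleE[OF cyc_submodule[OF P, of j]]
  define \<rho> where "\<rho> \<zeta> m \<longleftrightarrow> (\<exists>z. (\<forall>l. z l \<in> cyc P j) \<and> \<zeta> = tsum ?O z \<and>
      (\<forall>k<a j. m k = csum M' (\<lambda>i. \<pi> j k (z i))))" for \<zeta> m
  show ?thesis
  proof (rule homology_iso_relI[OF Q_cplx CM.tensor_module, where \<rho> = \<rho>])
    fix \<zeta> m assume "\<rho> \<zeta> m"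
    then obtain z where z: "\<And>l. z l \<in> cyc P j" "\<zeta> = tsum ?O z" "\<forall>k<a j. m k = csum M' (\<lambda>i. \<pi> j k (z i))"
      unfolding \<rho>_def by blast
    have zO: "z l \<in> carrier ?O" for l using cycD[OF P z(1)] .
    show "\<zeta> \<in> cyc Q j \<and> (\<forall>k<a j. m k \<in> carrier CM.T)"
      using tsum_cyc[OF z(1)] csum_closed[OF M' cc[OF _ z(1)]] z(2,3) by simp
    show "\<zeta> \<in> bnd Q j \<longleftrightarrow> (\<forall>k<a j. m k = \<zero>\<^bsub>CM.T\<^esub>)"
      using tsum_bnd_iff[OF z(1)] z(2,3) by simp
    show "\<rho> (r \<odot>\<^bsub>obj Q j\<^esub> \<zeta>) (\<lambda>k. r \<odot>\<^bsub>CM.T\<^esub> m k)" if r: "r \<in> carrier R" for r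
      unfolding \<rho>_def
    proof (intro exI conjI allI impI)
      show "r \<odot>\<^bsub>?O\<^esub> z l \<in> cyc P j" for l using Ze(4)[OF r z(1)] .
      show "r \<odot>\<^bsub>obj Q j\<^esub> \<zeta> = tsum ?O (\<lambda>l. r \<odot>\<^bsub>?O\<^esub> z l)"
        using tsum_smult[OF O r zO] by (simp add: z(2) Q_obj)
      fix k assume k: "k < a j"
      have "csum M' (\<lambda>i. \<pi> j k (r \<odot>\<^bsub>?O\<^esub> z i)) = csum M' (\<lambda>i. r \<odot>\<^bsub>M'\<^esub> \<pi> j k (z i))"
        using coords_smult[OF P M' \<pi> k r z(1)] by simp
      then show "r \<odot>\<^bsub>CM.T\<^esub> m k = csum M' (\<lambda>i. \<pi> j k (r \<odot>\<^bsub>?O\<^esub> z i))"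
        using csum_smult[OF M' r cc[OF k z(1)]] z(3) k by simp
    qed
    fix \<zeta>' m' assume "\<rho> \<zeta>' m'"
    then obtain z' where z': "\<And>l. z' l \<in> cyc P j" "\<zeta>' = tsum ?O z'" "\<forall>k<a j. m' k = csum M' (\<lambda>i. \<pi> j k (z' i))"
      unfolding \<rho>_def by blast
    have zO': "z' l \<in> carrier ?O" for l using cycD[OF P z'(1)] .
    show "\<rho> (\<zeta> \<oplus>\<^bsub>obj Q j\<^esub> \<zeta>') (\<lambda>k. m k \<oplus>\<^bsub>CM.T\<^esub> m' k)"
      unfolding \<rho>_def
    proof (intro exI conjI allI impI)
      show "z l \<oplus>\<^bsub>?O\<^esub> z' l \<in> cyc P j" for l using Ze(5)[OF z(1) z'(1)] .
      show "\<zeta> \<oplus>\<^bsub>obj Q j\<^esub> \<zeta>' = tsum ?O (\<lambda>l. z l \<oplus>\<^bsub>?O\<^esub> z' l)"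
        using tsum_add[OF O zO zO'] by (simp add: z(2) z'(2) Q_obj)
      fix k assume k: "k < a j"
      have "csum M' (\<lambda>i. \<pi> j k (z i \<oplus>\<^bsub>?O\<^esub> z' i)) = csum M' (\<lambda>i. \<pi> j k (z i) \<oplus>\<^bsub>M'\<^esub> \<pi> j k (z' i))"
        using coords_add[OF P M' \<pi> k z(1) z'(1)] by simp
      then show "m k \<oplus>\<^bsub>CM.T\<^esub> m' k = csum M' (\<lambda>i. \<pi> j k (z i \<oplus>\<^bsub>?O\<^esub> z' i))"
        using csum_add[OF M' cc[OF k z(1)] cc[OF k z'(1)]] z(3) z'(3) k by simp
    qed
  next
    fix \<zeta> assume "\<zeta> \<in> cyc Q j"
    from cyc_tensor_lift[OF this] obtain z where z: "\<forall>l. z l \<in> cyc P j" "\<zeta> = tsum ?O z" by blast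
    then show "\<exists>m. \<rho> \<zeta> m" unfolding \<rho>_def by (intro exI[of _ "\<lambda>k. csum M' (\<lambda>i. \<pi> j k (z i))"] exI[of _ z]) auto
  next
    fix m assume m: "\<forall>k<a j. m k \<in> carrier CM.T"
    have "\<forall>k\<in>{..<a j}. \<exists>x. x \<in> vec M' \<and> m k = csum M' x" using csum_surj[OF M'] m by blast
    from bchoice[OF this] obtain x where x: "\<forall>k\<in>{..<a j}. x k \<in> vec M' \<and> m k = csum M' (x k)" ..
    have xc: "x k l \<in> carrier M'" if "k < a j" for k l using x that by (auto simp: vec_def)
    obtain z where z: "\<forall>l. z l \<in> cyc P j" "\<forall>k<a j. \<forall>l. \<pi> j k (z l) = x k l"
      using coords_lift[OF P M' \<pi>, where m = x] xc by blast
    have "\<rho> (tsum ?O z) (\<lambda>k. csum M' (\<lambda>i. \<pi> j k (z i)))" unfolding \<rho>_def using z(1) by blast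
    moreover have "\<forall>k<a j. csum M' (\<lambda>i. \<pi> j k (z i)) = m k" using z(2) x by simp
    ultimately show "\<exists>z m'. \<rho> z m' \<and> (\<forall>k<a j. m' k = m k)" by blast
  qed
qed

end

subsection \<open>From homology of \<open>P \<otimes> C\<close> to homology of \<open>P\<close>\<close>

context
  fixes M' :: "('a, 'm) module" and b :: "int \<Rightarrow> nat"
    and \<pi> :: "int \<Rightarrow> nat \<Rightarrow> ('p \<times> 'c \<Rightarrow> 'a) set \<Rightarrow> ('c \<times> 'm \<Rightarrow> 'a) set"
  assumes M': "module R M'" and extN: "ext_acyclic (tensor_mod R C M')"
    and elt_inj: "\<And>m. m \<in> carrier M' \<Longrightarrow> (\<And>i. i < n 0 \<Longrightarrow> tensor_elt R C M' (c i) m = \<zero>\<^bsub>tensor_mod R C M'\<^esub>) \<Longrightarrow> m = \<zero>\<^bsub>M'\<^esub>"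
    and elt_surj: "\<And>y. (\<And>i. i < n 0 \<Longrightarrow> y i \<in> carrier (tensor_mod R C M')) \<Longrightarrow>
      (\<And>j. j < n 1 \<Longrightarrow> up (tensor_mod R C M') 0 y j = \<zero>\<^bsub>tensor_mod R C M'\<^esub>) \<Longrightarrow>
      \<exists>m\<in>carrier M'. \<forall>i<n 0. y i = tensor_elt R C M' (c i) m"
    and \<pi>: "\<And>j. homology_coords R Q j (tensor_mod R C M') (b j) (\<pi> j)"
    and ba: "\<exists>N. \<forall>i>N. zero_mod (obj Q i)"
begin

lemma Q_ext_exact: "ext_exact_on (obj Q j) (bnd Q j)" "ext_exact_on (obj Q j) (cyc Q j)"
proof -
  have N: "module R (tensor_mod R C M')"
    using M' module_axioms by (intro tensor_product.tensor_module) (simp add: tensor_product_def)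
  have E: "ext_acyclic (obj Q i)" for i unfolding Q_obj by (rule projective_tensor_ext_acyclic[OF proj])
  show "ext_exact_on (obj Q j) (bnd Q j)" "ext_exact_on (obj Q j) (cyc Q j)"
    by (rule ext_exact_bnd_cyc[OF Q_cplx N extN \<pi> E ba])+
qed

text \<open>Hom(C, -) is applied to P \<otimes> C in terms of tuples: \<open>p\<close> gives the
  tensors of \<open>p\<close> with the \<open>c i\<close>, and an element of \<open>M'\<close> gives
  the tensors of the \<open>c i\<close> with it. \<open>\<rho>\<close> asks that the coordinates of
  the former be the latter. A tuple obtained by lifting need not be a homomorphism; its defect under
  the transpose of \<open>D 0\<close> is repaired by vanishing of Ext in degree 1 for cycles or
  boundaries.\<close>

lemma homology_power_of_tensor: "isomorphic_mod R (homology P j) (mod_power M' (b j))"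
proof -
  let ?O = "obj P j" and ?e = "tensor_elt R (obj P j) C" and ?N = "tensor_mod R C M'" and ?f = "tensor_elt R C M'"
    and ?U = "obj P (j + 1)" and ?g = "tensor_elt R (obj P (j + 1)) C"
  have O: "module R ?O" by (rule cplx_module[OF P])
  have Q: "module R (obj Q j)" "module R (obj Q (j + 1))" by (rule cplx_module[OF Q_cplx])+
  interpret O: module R ?O by (rule O)
  interpret Q: module R "obj Q j" by (rule Q)
  interpret Q': module R "obj Q (j + 1)" by (rule Q)
  interpret U: module R ?U by (rule cplx_module[OF P])
  interpret M': module R M' by (rule M')
  interpret CM: tensor_product R C M' using M' module_axioms by (simp add: tensor_product_def)
  interpret T: tensor_product R ?O C by (rule P_product)
  interpret T1: tensor_product R ?U C by (rule P_product)
  note N = CM.tensor_module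
  have eh: "(\<lambda>p. ?e p (c i)) \<in> mod_hom R ?O (obj Q j)" for i
    unfolding Q_obj by (rule T.elt_hom_left) simp
  have gh: "(\<lambda>p. ?g p (c i)) \<in> mod_hom R ?U (obj Q (j + 1))" for i
    unfolding Q_obj by (rule T1.elt_hom_left) simp
  have fh: "?f (c i) \<in> mod_hom R M' ?N" for i by (rule CM.elt_hom_right) simp
  have eup: "up (obj Q j) 0 (\<lambda>i. ?e p (c i)) l = \<zero>\<^bsub>obj Q j\<^esub>" if "p \<in> carrier ?O" "l < n 1" for p l
    unfolding Q_obj by (rule hom_C_up[OF T.tensor_module T.elt_hom_right[OF that(1)] that(2)])
  have fup: "up ?N 0 (\<lambda>i. ?f (c i) m) l = \<zero>\<^bsub>?N\<^esub>" if "m \<in> carrier M'" "l < n 1" for m l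
    by (rule hom_C_up[OF N CM.elt_hom_left[OF that(1)] that(2)])
  have einj: "p = \<zero>\<^bsub>obj P i\<^esub>"
    if "p \<in> carrier (obj P i)" "\<And>l. l < n 0 \<Longrightarrow> tensor_elt R (obj P i) C p (c l) = \<zero>\<^bsub>obj Q i\<^esub>" for p i
    using projective_tensor_inj[OF proj that(1)] that(2) by (simp add: Q_obj)
  have esurj: "\<exists>p\<in>carrier (obj P i). \<forall>l<n 0. q l = tensor_elt R (obj P i) C p (c l)"
    if "\<And>l. l < n 0 \<Longrightarrow> q l \<in> carrier (obj Q i)" "\<And>l. l < n 1 \<Longrightarrow> up (obj Q i) 0 q l = \<zero>\<^bsub>obj Q i\<^esub>" for q i
    using projective_tensor_surj[OF proj, of q i] that unfolding Q_obj by blast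
  have eZ: "?e p (c i) \<in> cyc Q j" if "p \<in> cyc P j" for p i
  proof -
    have pO: "p \<in> carrier ?O" by (rule cycD[OF P that])
    have "diff Q j (?e p (c i)) = tensor_elt R (obj P (j - 1)) C \<zero>\<^bsub>obj P (j - 1)\<^esub> (c i)"
      using that by (simp add: Q_diff_elt[OF pO] cyc_def)
    also have "\<dots> = \<zero>\<^bsub>obj Q (j - 1)\<^esub>"
      unfolding Q_obj
      by (rule mod_hom_zero[OF cplx_module[OF P] tensor_product.tensor_module[OF P_product]
          tensor_product.elt_hom_left[OF P_product c_closed]])
    finally show ?thesis using mod_hom_closed[OF eh pO] by (simp add: cyc_def)
  qed
  have gd: "diff Q (j + 1) (?g p (c i)) = ?e (diff P (j + 1) p) (c i)" if "p \<in> carrier ?U" for p i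
    using Q_diff_elt[OF that c_closed, of i] by simp
  note cc = coords_closed[OF Q_cplx N \<pi>] and cz = coords_zero_iff[OF Q_cplx N \<pi>]
  note Ze = O.submoduleE[OF cyc_submodule[OF P, of j]]
  define \<rho> where "\<rho> p m \<longleftrightarrow> p \<in> cyc P j \<and> (\<forall>k<b j. m k \<in> carrier M') \<and>
      (\<forall>k<b j. \<forall>i<n 0. \<pi> j k (?e p (c i)) = ?f (c i) (m k))" for p m
  show ?thesis
  proof (rule homology_iso_relI[OF P M', where \<rho> = \<rho>])
    fix p m assume "\<rho> p m"
    then have pm: "p \<in> cyc P j" "\<And>k. k < b j \<Longrightarrow> m k \<in> carrier M'"
      "\<And>k i. k < b j \<Longrightarrow> i < n 0 \<Longrightarrow> \<pi> j k (?e p (c i)) = ?f (c i) (m k)" unfolding \<rho>_def by blast+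
    have pO: "p \<in> carrier ?O" by (rule cycD[OF P pm(1)])
    show "p \<in> cyc P j \<and> (\<forall>k<b j. m k \<in> carrier M')" using pm by blast
    show "\<rho> (r \<odot>\<^bsub>?O\<^esub> p) (\<lambda>k. r \<odot>\<^bsub>M'\<^esub> m k)" if r: "r \<in> carrier R" for r
      unfolding \<rho>_def using pm r Ze(4)
      by (simp add: mod_hom_smult[OF eh r pO] coords_smult[OF Q_cplx N \<pi> _ r eZ] mod_hom_smult[OF fh r])
    show "p \<in> bnd P j \<longleftrightarrow> (\<forall>k<b j. m k = \<zero>\<^bsub>M'\<^esub>)"
    proof
      assume "p \<in> bnd P j"
      then obtain p' where p': "p' \<in> carrier ?U" "p = diff P (j + 1) p'" by (auto simp: bnd_def)
      have "?e p (c i) \<in> bnd Q j" for i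
        using gd[OF p'(1), of i] mod_hom_closed[OF gh p'(1)] unfolding bnd_def p'(2) by (metis image_eqI)
      then have "\<pi> j k (?e p (c i)) = \<zero>\<^bsub>?N\<^esub>" if "k < b j" for k i
        using cz[OF eZ[OF pm(1)]] that by blast
      then show "\<forall>k<b j. m k = \<zero>\<^bsub>M'\<^esub>" using pm(2,3) elt_inj by simp
    next
      assume m0: "\<forall>k<b j. m k = \<zero>\<^bsub>M'\<^esub>"
      have "?e p (c i) \<in> bnd Q j" if i: "i < n 0" for i
      proof -
        have "\<pi> j k (?e p (c i)) = \<zero>\<^bsub>?N\<^esub>" if "k < b j" for k
          using pm(3)[OF that i] m0 that mod_hom_zero[OF M' N fh] by simp
        then show ?thesis using cz[OF eZ[OF pm(1)]] by blast
      qed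
      then have "\<forall>i\<in>{..<n 0}. \<exists>q. q \<in> carrier (obj Q (j + 1)) \<and> ?e p (c i) = diff Q (j + 1) q"
        by (auto simp: bnd_def)
      from bchoice[OF this] obtain q where q: "\<And>i. i < n 0 \<Longrightarrow> q i \<in> carrier (obj Q (j + 1))"
        "\<And>i. i < n 0 \<Longrightarrow> ?e p (c i) = diff Q (j + 1) (q i)" by blast
      note dh = cplx_diff_Suc[OF Q_cplx, of j]
      \<comment> \<open>The preimages \<open>q i\<close> are chosen one at a time, so they satisfy
        the relations of C only up to cycles. Ext-acyclicity of the cycles in degree
        \<open>j + 1\<close> supplies cycles \<open>z\<close> with the same defect, and the
        difference of \<open>q\<close> and \<open>z\<close> then comes from an element of P.\<close>
      have "up (obj Q (j + 1)) 0 q l \<in> cyc Q (j + 1)" if l: "l < n (Suc 0)" for l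
      proof -
        have "diff Q (j + 1) (up (obj Q (j + 1)) 0 q l) = up (obj Q j) 0 (\<lambda>i. diff Q (j + 1) (q i)) l"
          using q(1) by (intro mod_hom_lc[OF Q(2,1) dh]) auto
        also have "\<dots> = up (obj Q j) 0 (\<lambda>i. ?e p (c i)) l"
          using mod_hom_closed[OF eh pO] by (intro lc_cong[OF Q(1)]) (auto simp: q(2)[symmetric])
        also have "\<dots> = \<zero>\<^bsub>obj Q j\<^esub>" using eup[OF pO] l by simp
        finally have "diff Q (j + 1) (up (obj Q (j + 1)) 0 q l) = \<zero>\<^bsub>obj Q j\<^esub>" .
        moreover have "up (obj Q (j + 1)) 0 q l \<in> carrier (obj Q (j + 1))" using q(1) by auto
        ultimately show ?thesis by (simp add: cyc_def)
      qed
      note uq = this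
      have "up (obj Q (j + 1)) (Suc 0) (up (obj Q (j + 1)) 0 q) l = \<zero>\<^bsub>obj Q (j + 1)\<^esub>" if "l < n (Suc (Suc 0))" for l
        by (rule up_up[OF Q(2) q(1) that])
      from ext_exact_onD[where x = "up (obj Q (j + 1)) 0 q" and k = 0, OF Q_ext_exact(2)[of "j + 1"] uq this]
      obtain z where z: "\<And>l. z l \<in> cyc Q (j + 1)"
        "\<And>l. l < n (Suc 0) \<Longrightarrow> up (obj Q (j + 1)) 0 q l = up (obj Q (j + 1)) 0 z l" by blast
      have zO: "z l \<in> carrier (obj Q (j + 1))" for l using cycD[OF Q_cplx z(1)] .
      have "\<exists>p'\<in>carrier ?U. \<forall>l<n 0. q l \<ominus>\<^bsub>obj Q (j + 1)\<^esub> z l = ?g p' (c l)"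
      proof (rule esurj)
        fix l assume l: "l < n 1"
        have "up (obj Q (j + 1)) 0 (\<lambda>l. q l \<ominus>\<^bsub>obj Q (j + 1)\<^esub> z l) l =
            up (obj Q (j + 1)) 0 q l \<ominus>\<^bsub>obj Q (j + 1)\<^esub> up (obj Q (j + 1)) 0 z l"
          using q(1) zO by (intro Q'.lc_minus) auto
        moreover have "up (obj Q (j + 1)) 0 z l \<in> carrier (obj Q (j + 1))" using zO by auto
        ultimately show "up (obj Q (j + 1)) 0 (\<lambda>l. q l \<ominus>\<^bsub>obj Q (j + 1)\<^esub> z l) l = \<zero>\<^bsub>obj Q (j + 1)\<^esub>"
          using z(2)[of l] l by (simp add: Q'.minus_eq_zero_iff)
      qed (use q(1) zO in auto)
      then obtain p' where p': "p' \<in> carrier ?U" "\<forall>l<n 0. q l \<ominus>\<^bsub>obj Q (j + 1)\<^esub> z l = ?g p' (c l)" by blast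
      have dp': "diff P (j + 1) p' \<in> carrier ?O" by (rule mod_hom_closed[OF cplx_diff_Suc[OF P] p'(1)])
      have "p \<ominus>\<^bsub>?O\<^esub> diff P (j + 1) p' = \<zero>\<^bsub>?O\<^esub>"
      proof (rule einj)
        fix l assume l: "l < n 0"
        have "?e (diff P (j + 1) p') (c l) = diff Q (j + 1) (q l \<ominus>\<^bsub>obj Q (j + 1)\<^esub> z l)"
          using gd[OF p'(1), of l] p'(2) l by simp
        also have "\<dots> = ?e p (c l) \<ominus>\<^bsub>obj Q j\<^esub> \<zero>\<^bsub>obj Q j\<^esub>"
          using z(1)[of l] by (simp add: mod_hom_minus[OF Q(2,1) dh q(1)[OF l] zO] q(2)[OF l] cyc_def)
        also have "\<dots> = ?e p (c l)" using mod_hom_closed[OF eh pO] by (simp add: Q.minus_zero)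
        finally show "?e (p \<ominus>\<^bsub>?O\<^esub> diff P (j + 1) p') (c l) = \<zero>\<^bsub>obj Q j\<^esub>"
          using mod_hom_closed[OF eh pO] by (simp add: mod_hom_minus[OF O Q(1) eh pO dp'] Q.minus_eq_zero_iff)
      qed (use pO dp' in simp)
      then have "p = diff P (j + 1) p'" using pO dp' by (simp add: O.minus_eq_zero_iff)
      then show "p \<in> bnd P j" using p'(1) by (auto simp: bnd_def)
    qed
    fix p' m' assume "\<rho> p' m'"
    then have pm': "p' \<in> cyc P j" "\<And>k. k < b j \<Longrightarrow> m' k \<in> carrier M'"
      "\<And>k i. k < b j \<Longrightarrow> i < n 0 \<Longrightarrow> \<pi> j k (?e p' (c i)) = ?f (c i) (m' k)" unfolding \<rho>_def by blast+
    have pO': "p' \<in> carrier ?O" by (rule cycD[OF P pm'(1)])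
    show "\<rho> (p \<oplus>\<^bsub>?O\<^esub> p') (\<lambda>k. m k \<oplus>\<^bsub>M'\<^esub> m' k)"
      unfolding \<rho>_def using pm pm' Ze(5)
      by (simp add: mod_hom_add[OF eh pO pO'] coords_add[OF Q_cplx N \<pi> _ eZ eZ] mod_hom_add[OF fh])
  next
    fix p assume p: "p \<in> cyc P j"
    have pO: "p \<in> carrier ?O" by (rule cycD[OF P p])
    \<comment> \<open>Each coordinate of the tuple of \<open>p\<close> is again killed by the
      transpose of \<open>D 0\<close>, so it is a homomorphism C -> C \<otimes> M', and
      \<open>elt_surj\<close> finds the element behind it.\<close>
    have "\<forall>k\<in>{..<b j}. \<exists>m. m \<in> carrier M' \<and> (\<forall>i<n 0. \<pi> j k (?e p (c i)) = ?f (c i) m)"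
    proof
      fix k assume "k \<in> {..<b j}"
      then have k: "k < b j" by simp
      have "\<exists>m\<in>carrier M'. \<forall>i<n 0. \<pi> j k (?e p (c i)) = ?f (c i) m"
      proof (rule elt_surj)
        show "\<pi> j k (?e p (c i)) \<in> carrier ?N" for i by (rule cc[OF k eZ[OF p]])
        fix l assume l: "l < n 1"
        have "up ?N 0 (\<lambda>i. \<pi> j k (?e p (c i))) l = \<pi> j k (up (obj Q j) 0 (\<lambda>i. ?e p (c i)) l)"
          using eZ[OF p] by (intro coords_lc[OF Q_cplx N \<pi> k, symmetric]) auto
        also have "\<dots> = \<zero>\<^bsub>?N\<^esub>"
          unfolding eup[OF pO l] using submodule_zero[OF bnd_submodule[OF Q_cplx, of j]]
            submodule_zero[OF cyc_submodule[OF Q_cplx, of j]] cz k by blast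
        finally show "up ?N 0 (\<lambda>i. \<pi> j k (?e p (c i))) l = \<zero>\<^bsub>?N\<^esub>" .
      qed
      then show "\<exists>m. m \<in> carrier M' \<and> (\<forall>i<n 0. \<pi> j k (?e p (c i)) = ?f (c i) m)" by blast
    qed
    from bchoice[OF this] obtain m where
      "\<forall>k\<in>{..<b j}. m k \<in> carrier M' \<and> (\<forall>i<n 0. \<pi> j k (?e p (c i)) = ?f (c i) (m k))" ..
    then show "\<exists>m. \<rho> p m" unfolding \<rho>_def using p by (intro exI[of _ m]) simp
  next
    fix m assume m: "\<forall>k<b j. m k \<in> carrier M'"
    have fm: "?f (c i) (m k) \<in> carrier ?N" if "k < b j" for k i using mod_hom_closed[OF fh] m that by simp
    obtain z where z: "\<forall>i. z i \<in> cyc Q j" "\<forall>k<b j. \<forall>i. \<pi> j k (z i) = ?f (c i) (m k)"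
      using coords_lift[OF Q_cplx N \<pi>, where m = "\<lambda>k i. ?f (c i) (m k)" and i = j, OF fm] by blast
    have zO: "z i \<in> carrier (obj Q j)" for i using cycD[OF Q_cplx] z(1) by blast
    \<comment> \<open>The lift \<open>z\<close> satisfies the relations of C only modulo boundaries.
      As the boundaries are Ext-acyclic, the tuple \<open>q\<close> of boundaries repairs this
      without changing the coordinates.\<close>
    have uz: "up (obj Q j) 0 z l \<in> bnd Q j" if l: "l < n (Suc 0)" for l
    proof -
      have ucyc: "up (obj Q j) 0 z l \<in> cyc Q j" using z(1) by (intro cyc_lc[OF Q_cplx]) auto
      have "\<pi> j k (up (obj Q j) 0 z l) = \<zero>\<^bsub>?N\<^esub>" if k: "k < b j" for k
      proof -
        have "\<pi> j k (up (obj Q j) 0 z l) = up ?N 0 (\<lambda>i. \<pi> j k (z i)) l"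
          using z(1) by (intro coords_lc[OF Q_cplx N \<pi> k]) auto
        also have "\<dots> = \<zero>\<^bsub>?N\<^esub>" using z(2) k m fup l by simp
        finally show ?thesis .
      qed
      then show ?thesis using cz[OF ucyc] by blast
    qed
    have "up (obj Q j) (Suc 0) (up (obj Q j) 0 z) l = \<zero>\<^bsub>obj Q j\<^esub>" if "l < n (Suc (Suc 0))" for l
      by (rule up_up[OF Q(1) zO that])
    from ext_exact_onD[where x = "up (obj Q j) 0 z" and k = 0, OF Q_ext_exact(1)[of j] uz this]
    obtain q where q: "\<And>i. q i \<in> bnd Q j" "\<And>l. l < n (Suc 0) \<Longrightarrow> up (obj Q j) 0 z l = up (obj Q j) 0 q l" by blast
    have qZ: "q i \<in> cyc Q j" for i using bnd_cyc[OF Q_cplx q(1)] .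
    have qO: "q i \<in> carrier (obj Q j)" for i using cycD[OF Q_cplx qZ] .
    have "\<exists>p\<in>carrier ?O. \<forall>l<n 0. z l \<ominus>\<^bsub>obj Q j\<^esub> q l = ?e p (c l)"
    proof (rule esurj)
      fix l assume l: "l < n 1"
      have "up (obj Q j) 0 (\<lambda>l. z l \<ominus>\<^bsub>obj Q j\<^esub> q l) l = up (obj Q j) 0 z l \<ominus>\<^bsub>obj Q j\<^esub> up (obj Q j) 0 q l"
        using zO qO by (intro Q.lc_minus) auto
      moreover have "up (obj Q j) 0 q l \<in> carrier (obj Q j)" using qO by auto
      ultimately show "up (obj Q j) 0 (\<lambda>l. z l \<ominus>\<^bsub>obj Q j\<^esub> q l) l = \<zero>\<^bsub>obj Q j\<^esub>"
        using q(2)[of l] l by (simp add: Q.minus_eq_zero_iff)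
    qed (use zO qO in auto)
    then obtain p where p: "p \<in> carrier ?O" "\<forall>l<n 0. z l \<ominus>\<^bsub>obj Q j\<^esub> q l = ?e p (c l)" by blast
    note dP = cplx_diff[OF P, of j]
    \<comment> \<open>By injectivity of P -> Hom(C, P \<otimes> C) one degree lower, being a cycle
      can be tested after tensoring with the \<open>c l\<close>.\<close>
    have "diff P j p = \<zero>\<^bsub>obj P (j - 1)\<^esub>"
    proof (rule einj[OF mod_hom_closed[OF dP p(1)]])
      fix l assume l: "l < n 0"
      have "tensor_elt R (obj P (j - 1)) C (diff P j p) (c l) = diff Q j (z l \<ominus>\<^bsub>obj Q j\<^esub> q l)"
        using Q_diff_elt[OF p(1) c_closed, of l] p(2) l by simp
      also have "\<dots> = \<zero>\<^bsub>obj Q (j - 1)\<^esub>"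
        using cyc_minus[OF Q_cplx z(1)[rule_format] qZ] by (simp add: cyc_def)
      finally show "tensor_elt R (obj P (j - 1)) C (diff P j p) (c l) = \<zero>\<^bsub>obj Q (j - 1)\<^esub>" .
    qed
    then have pZ: "p \<in> cyc P j" using p(1) by (simp add: cyc_def)
    have "\<pi> j k (?e p (c i)) = ?f (c i) (m k)" if k: "k < b j" and i: "i < n 0" for k i
    proof -
      have "\<pi> j k (?e p (c i)) = \<pi> j k (z i) \<ominus>\<^bsub>?N\<^esub> \<pi> j k (q i)"
        using p(2) i coords_minus[OF Q_cplx N \<pi> k z(1)[rule_format] qZ] by metis
      also have "\<pi> j k (q i) = \<zero>\<^bsub>?N\<^esub>" using cz[OF qZ[of i]] q(1)[of i] k by blast
      also have "\<pi> j k (z i) \<ominus>\<^bsub>?N\<^esub> \<zero>\<^bsub>?N\<^esub> = ?f (c i) (m k)"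
        using z(2) k mod_hom_closed[OF fh] m by (simp add: CM.T.minus_zero)
      finally show ?thesis .
    qed
    then have "\<rho> p m" unfolding \<rho>_def using pZ m by blast
    then show "\<exists>z m'. \<rho> z m' \<and> (\<forall>k<b j. m' k = m k)" by blast
  qed
qed

end

end

end

section \<open>Quasi-projective dimensions\<close>

lemma isomorphic_zero_mod_iff:
  assumes "module R A" "module R B" "isomorphic_mod R A B"
  shows "zero_mod A \<longleftrightarrow> zero_mod B"
proof -
  interpret A: module R A by fact
  interpret B: module R B by fact
  obtain f where f: "f \<in> mod_hom R A B" "bij_betw f (carrier A) (carrier B)"
    using assms(3) by (auto simp: isomorphic_mod_def mod_iso_def)
  have f0: "f \<zero>\<^bsub>A\<^esub> = \<zero>\<^bsub>B\<^esub>" by (rule mod_hom_zero[OF assms(1,2) f(1)])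
  have im: "f ` carrier A = carrier B" and inj: "inj_on f (carrier A)" using f(2) by (auto simp: bij_betw_def)
  show ?thesis
  proof
    assume "zero_mod A"
    then show "zero_mod B" using im f0 by (simp add: zero_mod_def)
  next
    assume B: "zero_mod B"
    have "x = \<zero>\<^bsub>A\<^esub>" if "x \<in> carrier A" for x
      using inj_onD[OF inj _ that A.zero_closed] f0 im that B by (auto simp: zero_mod_def)
    then show "zero_mod A" by (auto simp: zero_mod_def)
  qed
qed

lemma zero_mod_power_iff:
  assumes "module R A" "\<not> zero_mod A"
  shows "zero_mod (mod_power A k) \<longleftrightarrow> k = 0"
proof -
  interpret A: module R A by fact
  obtain x where x: "x \<in> carrier A" "x \<noteq> \<zero>\<^bsub>A\<^esub>" using assms(2) A.zero_closed by (auto simp: zero_mod_def)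
  show ?thesis
  proof
    assume z: "zero_mod (mod_power A k)"
    show "k = 0"
    proof (rule ccontr)
      assume "k \<noteq> 0"
      let ?f = "\<lambda>i. if i < k then x else undefined"
      have "?f \<in> carrier (mod_power A k)" using x by (simp add: A.mod_power_mem_iff)
      then have "?f = \<zero>\<^bsub>mod_power A k\<^esub>" using z by (auto simp: zero_mod_def)
      from fun_cong[OF this, of 0] show False using x \<open>k \<noteq> 0\<close> by (simp add: A.mod_power_apply)
    qed
  next
    assume "k = 0"
    then show "zero_mod (mod_power A k)"
      by (auto simp: zero_mod_def A.mod_power_mem_iff fun_eq_iff A.mod_power_apply)
  qed
qed

lemma zero_mods_isomorphic:
  assumes "module R A" "module R B" "zero_mod A" "zero_mod B"
  shows "isomorphic_mod R A B"
proof -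
  interpret A: module R A by fact
  interpret B: module R B by fact
  show ?thesis
    using assms(3,4)
    by (intro isomorphic_mod_relI[OF assms(1,2), where \<rho> = "\<lambda>x y. x = \<zero>\<^bsub>A\<^esub> \<and> y = \<zero>\<^bsub>B\<^esub>"])
      (auto simp: zero_mod_def)
qed

text \<open>Below the infimum the terms and hence the homology are zero, so the exponents extend by
  0 to all degrees. Conversely, as \<open>L\<close> is not zero, a nonzero exponent means nonzero
  homology, which cannot occur below the infimum.\<close>

lemma quasi_proj_res_iff:
  assumes L: "module R L" "\<not> zero_mod L"
  shows "quasi_proj_res R L P \<longleftrightarrow> is_cplx R P \<and> (\<forall>i. projective_mod R (obj P i)) \<and> bounded_below_cplx P \<and>
    (\<exists>a. (\<exists>i. a i \<noteq> 0) \<and> (\<forall>i. isomorphic_mod R (homology P i) (mod_power L (a i))))"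
    (is "_ \<longleftrightarrow> ?C \<and> ?P \<and> ?B \<and> ?A")
proof -
  interpret L: module R L by fact
  note Lm = L.mod_power_module
  have inf: "cplx_inf P \<le> ereal (real_of_int i)" if "\<not> zero_mod (obj P i)" for i
    unfolding cplx_inf_def using that by (intro INF_lower) simp
  have "?A" if C: ?C and "\<exists>a. (\<exists>i. cplx_inf P \<le> ereal (real_of_int i) \<and> a i \<noteq> 0) \<and>
      (\<forall>i. cplx_inf P \<le> ereal (real_of_int i) \<longrightarrow> isomorphic_mod R (homology P i) (mod_power L (a i)))"
  proof -
    from that(2) obtain a i where a: "cplx_inf P \<le> ereal (real_of_int i)" "a i \<noteq> 0"
      "\<forall>i. cplx_inf P \<le> ereal (real_of_int i) \<longrightarrow> isomorphic_mod R (homology P i) (mod_power L (a i))" by blast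
    let ?a = "\<lambda>i. if cplx_inf P \<le> ereal (real_of_int i) then a i else 0"
    have "isomorphic_mod R (homology P i) (mod_power L (?a i))" for i
    proof (cases "cplx_inf P \<le> ereal (real_of_int i)")
      case True
      then show ?thesis using a(3) by simp
    next
      case False
      then have "zero_mod (obj P i)" using inf by blast
      from zero_mod_imp_homology[OF C this] False show ?thesis
        by (intro zero_mods_isomorphic homology_module[OF C] Lm) (simp_all add: zero_mod_power_iff[OF L])
    qed
    then show ?thesis using a(1,2) by (intro exI[of _ ?a] conjI exI[of _ i]) auto
  qed
  moreover have "\<exists>a. (\<exists>i. cplx_inf P \<le> ereal (real_of_int i) \<and> a i \<noteq> 0) \<and>
      (\<forall>i. cplx_inf P \<le> ereal (real_of_int i) \<longrightarrow> isomorphic_mod R (homology P i) (mod_power L (a i)))"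
    if C: ?C and "?A"
  proof -
    from that(2) obtain a i where a: "a i \<noteq> 0" "\<forall>i. isomorphic_mod R (homology P i) (mod_power L (a i))" by blast
    have "\<not> zero_mod (homology P i)"
      using isomorphic_zero_mod_iff[OF homology_module[OF C] Lm a(2)[rule_format]] a(1)
      by (simp add: zero_mod_power_iff[OF L])
    then have "cplx_inf P \<le> ereal (real_of_int i)" using inf zero_mod_imp_homology[OF C] by blast
    with a show ?thesis by (intro exI[of _ a] conjI exI[of _ i]) simp_all
  qed
  ultimately show ?thesis unfolding quasi_proj_res_def by (intro iffI conjI; elim conjE) simp_all
qed

text \<open>Gives both notions the same shape, a family of exponents that is not identically zero.
  For nonzero \<open>L\<close> some exponent is nonzero exactly when the tensored complex is not
  acyclic.\<close>

lemma C_quasi_proj_res_iff: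
  assumes L: "module R L" "\<not> zero_mod L" and Q: "is_cplx R P \<Longrightarrow> is_cplx R (tensor_cplx R P C)"
  shows "C_quasi_proj_res R C L P \<longleftrightarrow> is_cplx R P \<and> (\<forall>i. projective_mod R (obj P i)) \<and> bounded_cplx P \<and>
    (\<exists>a. (\<exists>i. a i \<noteq> 0) \<and> (\<forall>i. isomorphic_mod R (homology (tensor_cplx R P C) i) (mod_power L (a i))))"
    (is "_ \<longleftrightarrow> ?C \<and> ?P \<and> ?B \<and> ?A")
proof -
  interpret L: module R L by fact
  note Lm = L.mod_power_module
  let ?Q = "tensor_cplx R P C"
  have "?A \<longleftrightarrow> \<not> acyclic_cplx ?Q \<and> (\<forall>i. zero_mod (homology ?Q i) \<or> (\<exists>n. isomorphic_mod R (homology ?Q i) (mod_power L n)))"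
    if C: ?C
  proof -
    note Hm = homology_module[OF Q[OF C]]
    have z: "zero_mod (homology ?Q i) \<longleftrightarrow> k = 0" if "isomorphic_mod R (homology ?Q i) (mod_power L k)" for i k
      using isomorphic_zero_mod_iff[OF Hm Lm that] by (simp add: zero_mod_power_iff[OF L])
    show ?thesis
    proof
      assume ?A
      then obtain a i where a: "a i \<noteq> 0" "\<forall>i. isomorphic_mod R (homology ?Q i) (mod_power L (a i))" by blast
      then have "\<not> zero_mod (homology ?Q i)" using z[of i "a i"] by simp
      with a(2) show "\<not> acyclic_cplx ?Q \<and> (\<forall>i. zero_mod (homology ?Q i) \<or> (\<exists>n. isomorphic_mod R (homology ?Q i) (mod_power L n)))"
        unfolding acyclic_cplx_def by blast
    next
      assume r: "\<not> acyclic_cplx ?Q \<and> (\<forall>i. zero_mod (homology ?Q i) \<or> (\<exists>n. isomorphic_mod R (homology ?Q i) (mod_power L n)))"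
      have "\<forall>i. \<exists>k. isomorphic_mod R (homology ?Q i) (mod_power L k)"
      proof
        fix i
        show "\<exists>k. isomorphic_mod R (homology ?Q i) (mod_power L k)"
        proof (cases "zero_mod (homology ?Q i)")
          case True
          then show ?thesis
            by (intro exI[of _ 0] zero_mods_isomorphic Hm Lm) (simp_all add: zero_mod_power_iff[OF L])
        qed (use r in blast)
      qed
      from choice[OF this] obtain a where a: "\<forall>i. isomorphic_mod R (homology ?Q i) (mod_power L (a i))" ..
      moreover obtain i where "\<not> zero_mod (homology ?Q i)" using r unfolding acyclic_cplx_def by blast
      ultimately have "a i \<noteq> 0" using z[of i "a i"] by simp
      with a show ?A by (intro exI[of _ a] conjI exI[of _ i])
    qed
  qed
  then show ?thesis unfolding C_quasi_proj_res_def by (intro iffI conjI; elim conjE) simp_all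
qed

section \<open>Comparison of the resolutions and of the dimensions\<close>

lemma semidualizing_resolution_exists:
  fixes R :: "('a, 'r) ring_scheme" and C :: "('a, 'c) module"
  assumes "noetherian_ring R" "semidualizing R C"
  shows "\<exists>n D c. semidualizing_resolution R C n D c"
proof -
  have C: "module R C" and fg: "fin_gen_mod R C"
    and hom: "(\<lambda>r. \<lambda>x\<in>carrier C. r \<odot>\<^bsub>C\<^esub> x) \<in> mod_iso R (regular_mod R) (hom_mod R C C)"
    and ext: "\<forall>i>0. zero_mod (Ext_mod R i C C)"
    using assms(2) by (simp_all add: semidualizing_def)
  interpret C: module R C by (rule C)
  obtain n D c where "finite_resolution R C n D c"
    using finite_resolution_exists[OF C assms(1) fg] by blast
  then interpret G: finite_resolution R C n D c .
  let ?h = "\<lambda>r. \<lambda>x\<in>carrier C. r \<odot>\<^bsub>C\<^esub> x"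
  have im: "?h ` carrier R = carrier (hom_mod R C C)" and inj: "inj_on ?h (carrier R)"
    using hom by (auto simp: mod_iso_def bij_betw_def regular_mod_def)
  have "semidualizing_resolution R C n D c"
  proof (unfold_locales, goal_cases)
    case (1 f)
    \<comment> \<open>The homothety isomorphism concerns extensional functions, so \<open>f\<close>
      is replaced by its restriction, with the same values on C.\<close>
    have "restrict f (carrier C) \<in> carrier (hom_mod R C C)"
      using 1 by (auto simp: hom_mod_def intro!: mod_hom_cong[OF C 1])
    then obtain r where r: "r \<in> carrier R" "restrict f (carrier C) = ?h r" unfolding im[symmetric] by blast
    have "f x = r \<odot>\<^bsub>C\<^esub> x" if "x \<in> carrier C" for x using fun_cong[OF r(2), of x] that by simp
    with r(1) show ?case by blast
  next
    case (2 r)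
    have "?h r = ?h \<zero>\<^bsub>R\<^esub>" using 2 by (auto simp: fun_eq_iff)
    then show ?case using inj_onD[OF inj] 2(1) by blast
  next
    case 3
    show ?case by (rule G.ext_acyclicI[OF C]) (use ext in blast)
  qed
  then show ?thesis by blast
qed

theorem theorem4p11:
  fixes R :: "('a, 'r) ring_scheme"
    and C :: "('a, 'c) module"
    and M :: "('a, 'm) module"
  assumes "cring R" and "noetherian_ring R"
    and "semidualizing R C"
    and "M \<in> auslander_class R C"
  shows "(qpd TYPE('p) R M < \<infinity> \<longleftrightarrow> C_qpd TYPE('p) R C (tensor_mod R C M) < \<infinity>)
    \<and> qpd TYPE('p) R M = C_qpd TYPE('p) R C (tensor_mod R C M)
    \<and> (\<not> zero_mod M \<longrightarrow>
        (\<forall>P :: ('a, 'p) cplx.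
          bounded_cplx P \<and> quasi_proj_res R M P
            \<longleftrightarrow> C_quasi_proj_res R C (tensor_mod R C M) P))"
proof -
  let ?N = "tensor_mod R C M" and ?e = "tensor_elt R C M"
  obtain n D c where "semidualizing_resolution R C n D c"
    using semidualizing_resolution_exists[OF assms(2,3)] by blast
  then interpret S: semidualizing_resolution R C n D c .
  note C = S.module_axioms
  have M: "module R M"
    and hom: "(\<lambda>m. \<lambda>x\<in>carrier C. ?e x m) \<in> mod_iso R M (hom_mod R C ?N)"
    and TE: "\<forall>i>0. zero_mod (Tor_mod R i C M) \<and> zero_mod (Ext_mod R i C ?N)"
    using assms(4) by (simp_all add: auslander_class_def)
  interpret M: module R M by (rule M)
  interpret CM: tensor_product R C M using C M by (simp add: tensor_product_def)
  note N = CM.tensor_module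
  have torM: "S.tor_acyclic M" by (rule S.tor_acyclicI[OF M]) (use TE in blast)
  have extN: "S.ext_acyclic ?N" by (rule S.ext_acyclicI[OF N]) (use TE in blast)
  let ?h = "\<lambda>m. \<lambda>x\<in>carrier C. ?e x m"
  have im: "?h ` carrier M = carrier (hom_mod R C ?N)" and inj: "inj_on ?h (carrier M)"
    using hom by (auto simp: mod_iso_def bij_betw_def)
  \<comment> \<open>This and \<open>elt_surj\<close> express the isomorphism of M with Hom(C, C
    \<otimes> M) on the generators \<open>c i\<close>.\<close>
  have elt_inj: "m = \<zero>\<^bsub>M\<^esub>" if m: "m \<in> carrier M" and z: "\<And>i. i < n 0 \<Longrightarrow> ?e (c i) m = \<zero>\<^bsub>?N\<^esub>" for m
  proof -
    have "?e x m = ?e x \<zero>\<^bsub>M\<^esub>" if x: "x \<in> carrier C" for x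
    proof (rule S.hom_C_eqI[OF N CM.elt_hom_left[OF m] CM.elt_hom_left[OF M.zero_closed] _ x])
      show "?e (c i) m = ?e (c i) \<zero>\<^bsub>M\<^esub>" if "i < n 0" for i
        using z[OF that] mod_hom_zero[OF M N CM.elt_hom_right] by simp
    qed
    then have "?h m = ?h \<zero>\<^bsub>M\<^esub>" by (auto simp: fun_eq_iff)
    then show ?thesis using inj_onD[OF inj] m by blast
  qed
  have elt_surj: "\<exists>m\<in>carrier M. \<forall>i<n 0. y i = ?e (c i) m"
    if y: "\<And>i. i < n 0 \<Longrightarrow> y i \<in> carrier ?N"
      and z: "\<And>j. j < n 1 \<Longrightarrow> lc ?N {..<n 0} (\<lambda>i. D 0 i j) y = \<zero>\<^bsub>?N\<^esub>" for y
  proof -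
    obtain f where f: "f \<in> mod_hom R C ?N" "\<forall>i<n 0. f (c i) = y i" using S.hom_from_C[OF N y z] by blast
    have "restrict f (carrier C) \<in> carrier (hom_mod R C ?N)"
      using f(1) by (auto simp: hom_mod_def intro!: mod_hom_cong[OF C f(1)])
    then obtain m where m: "m \<in> carrier M" "restrict f (carrier C) = ?h m" unfolding im[symmetric] by blast
    have "f x = ?e x m" if "x \<in> carrier C" for x using fun_cong[OF m(2), of x] that by simp
    then show ?thesis using m(1) f(2) by (intro bexI[of _ m]) auto
  qed
  \<comment> \<open>Both dimensions are thus - \<infinity> at the same time; in the remaining case
    homology determines the vanishing of exponents on either side.\<close>
  have zero: "zero_mod ?N \<longleftrightarrow> zero_mod M"
  proof
    assume "zero_mod ?N"
    then have "m = \<zero>\<^bsub>M\<^esub>" if "m \<in> carrier M" for m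
      using CM.elt_closed[OF S.c_closed that] by (intro elt_inj[OF that]) (auto simp: zero_mod_def)
    then show "zero_mod M" by (auto simp: zero_mod_def)
  next
    assume z: "zero_mod M"
    have "t = \<zero>\<^bsub>?N\<^esub>" if t: "t \<in> carrier ?N" for t
    proof -
      obtain x where x: "x \<in> vec M" "t = S.csum M x" using S.csum_surj[OF M t] by blast
      have x0: "x i = \<zero>\<^bsub>M\<^esub>" for i using vecD[OF x(1), of i] z by (auto simp: zero_mod_def)
      have "lc M {..<n (Suc 0)} (D 0 i) (\<lambda>_. \<zero>\<^bsub>M\<^esub>) = \<zero>\<^bsub>M\<^esub>" for i by (rule M.lc_zero) auto
      then show ?thesis unfolding x(2)
        by (intro S.csum_zeroI[OF M, where y = "\<lambda>_. \<zero>\<^bsub>M\<^esub>"]) (simp_all add: x0)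
    qed
    then show "zero_mod ?N" by (auto simp: zero_mod_def)
  qed
  show ?thesis
  proof (cases "zero_mod M")
    case True
    then show ?thesis by (simp add: qpd_def C_qpd_def zero)
  next
    case nz: False
    then have nzN: "\<not> zero_mod ?N" by (simp add: zero)
    have transfer: "isomorphic_mod R (homology (tensor_cplx R P C) i) (mod_power ?N (a i))"
      if P: "is_cplx R P" "\<forall>i. projective_mod R (obj P i)" "bounded_below_cplx P"
        and a: "\<forall>i. isomorphic_mod R (homology P i) (mod_power M (a i))" for P :: "('a, 'p) cplx" and a i
    proof -
      have "\<forall>j. \<exists>\<pi>. homology_coords R P j M (a j) \<pi>"
        using homology_coords_exist[OF P(1) M] a by blast
      from choice[OF this] obtain \<pi> where "\<forall>j. homology_coords R P j M (a j) (\<pi> j)" ..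
      then show ?thesis
        using P by (intro S.tensor_homology_power[OF _ _ M torM]) auto
    qed
    have transfer': "isomorphic_mod R (homology P i) (mod_power M (a i))"
      if P: "is_cplx R P" "\<forall>i. projective_mod R (obj P i)" "bounded_cplx P"
        and a: "\<forall>i. isomorphic_mod R (homology (tensor_cplx R P C) i) (mod_power ?N (a i))"
      for P :: "('a, 'p) cplx" and a i
    proof -
      have "\<forall>j. \<exists>\<pi>. homology_coords R (tensor_cplx R P C) j ?N (a j) \<pi>"
        using homology_coords_exist[OF S.tensor_cplx_is_cplx[OF P(1)] N] a by blast
      from choice[OF this] obtain \<pi> where \<pi>: "\<forall>j. homology_coords R (tensor_cplx R P C) j ?N (a j) (\<pi> j)" ..
      \<comment> \<open>Zero terms stay zero after tensoring, which provides the degree where the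
        descending induction starts.\<close>
      have "\<exists>N. \<forall>i>N. zero_mod (obj (tensor_cplx R P C) i)"
        using P(3) S.projective_tensor_zero_iff[OF P(2)[rule_format]] by (auto simp: bounded_cplx_def tensor_cplx_def)
      then show ?thesis
        using P \<pi> by (intro S.homology_power_of_tensor[OF _ _ M extN elt_inj elt_surj]) auto
    qed
    have iff: "bounded_cplx P \<and> quasi_proj_res R M P \<longleftrightarrow> C_quasi_proj_res R C ?N P" for P :: "('a, 'p) cplx"
    proof -
      have CQ: "C_quasi_proj_res R C ?N P \<longleftrightarrow> is_cplx R P \<and> (\<forall>i. projective_mod R (obj P i)) \<and> bounded_cplx P \<and>
          (\<exists>a. (\<exists>i. a i \<noteq> 0) \<and> (\<forall>i. isomorphic_mod R (homology (tensor_cplx R P C) i) (mod_power ?N (a i))))"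
        by (rule C_quasi_proj_res_iff[OF N nzN]) (rule S.tensor_cplx_is_cplx)
      show ?thesis
      proof
        assume "bounded_cplx P \<and> quasi_proj_res R M P"
        then have b: "bounded_cplx P" and P: "is_cplx R P" "\<forall>i. projective_mod R (obj P i)" "bounded_below_cplx P"
          and "\<exists>a. (\<exists>i. a i \<noteq> 0) \<and> (\<forall>i. isomorphic_mod R (homology P i) (mod_power M (a i)))"
          unfolding quasi_proj_res_iff[OF M nz] by blast+
        then obtain a where "\<exists>i. a i \<noteq> 0" "\<forall>i. isomorphic_mod R (homology P i) (mod_power M (a i))" by blast
        with transfer[OF P, of a] show "C_quasi_proj_res R C ?N P" unfolding CQ using P b by blast
      next
        assume "C_quasi_proj_res R C ?N P"
        then obtain a where P: "is_cplx R P" "\<forall>i. projective_mod R (obj P i)" "bounded_cplx P"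
          and "\<exists>i. a i \<noteq> 0" "\<forall>i. isomorphic_mod R (homology (tensor_cplx R P C) i) (mod_power ?N (a i))"
          unfolding CQ by blast
        with transfer'[OF P, of a] show "bounded_cplx P \<and> quasi_proj_res R M P"
          unfolding quasi_proj_res_iff[OF M nz] bounded_cplx_def by blast
      qed
    qed
    \<comment> \<open>Terms vanish in the same degrees because they are projective, and homology
      does because the exponents agree and neither module is zero. So the two differences agree for
      each resolution, and both infima run over the same set.\<close>
    have val: "cplx_sup P - cplx_hsup P = cplx_sup (tensor_cplx R P C) - cplx_hsup (tensor_cplx R P C)"
      if "bounded_cplx P \<and> quasi_proj_res R M P" for P :: "('a, 'p) cplx"
    proof -
      have P: "is_cplx R P" "\<forall>i. projective_mod R (obj P i)" "bounded_below_cplx P"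
        and "\<exists>a. (\<exists>i. a i \<noteq> 0) \<and> (\<forall>i. isomorphic_mod R (homology P i) (mod_power M (a i)))"
        using that unfolding quasi_proj_res_iff[OF M nz] by blast+
      then obtain a where a: "\<forall>i. isomorphic_mod R (homology P i) (mod_power M (a i))" by blast
      have "zero_mod (obj (tensor_cplx R P C) i) \<longleftrightarrow> zero_mod (obj P i)" for i
        using S.projective_tensor_zero_iff[OF P(2)[rule_format]] by (simp add: tensor_cplx_def)
      moreover have "zero_mod (homology (tensor_cplx R P C) i) \<longleftrightarrow> zero_mod (homology P i)" for i
      proof -
        have "zero_mod (homology P i) \<longleftrightarrow> a i = 0"
          using isomorphic_zero_mod_iff[OF homology_module[OF P(1)] M.mod_power_module a[rule_format]]
          by (simp add: zero_mod_power_iff[OF M nz])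
        moreover have "zero_mod (homology (tensor_cplx R P C) i) \<longleftrightarrow> a i = 0"
          using isomorphic_zero_mod_iff[OF homology_module[OF S.tensor_cplx_is_cplx[OF P(1)]]
              CM.T.mod_power_module transfer[OF P a]]
          by (simp add: zero_mod_power_iff[OF N nzN])
        ultimately show ?thesis by simp
      qed
      ultimately show ?thesis by (simp add: cplx_sup_def cplx_hsup_def)
    qed
    have sets: "{P :: ('a, 'p) cplx. C_quasi_proj_res R C ?N P} = {P. bounded_cplx P \<and> quasi_proj_res R M P}"
      using iff by simp
    have "qpd TYPE('p) R M = (INF P\<in>{P :: ('a, 'p) cplx. bounded_cplx P \<and> quasi_proj_res R M P}.
        cplx_sup (tensor_cplx R P C) - cplx_hsup (tensor_cplx R P C))"
      unfolding qpd_def using nz val by (simp cong: INF_cong_simp)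
    also have "\<dots> = C_qpd TYPE('p) R C ?N" unfolding C_qpd_def sets using nzN by simp
    finally have "qpd TYPE('p) R M = C_qpd TYPE('p) R C ?N" .
    then show ?thesis using iff by simp
  qed
qed

end
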